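(* For the star graph problem there is an efficient polynomial-time approximation scheme: for any $\epsilon>0$ there is an algorithm running in time $O\!\left(\left(\frac{1}{\epsilon^2}\right)^{O(1/\epsilon)}\cdot\mathrm{poly}(n,|\mathcal{A}|)\right)$ that outputs a policy $(\boldsymbol e,\boldsymbol a)$ with $\mathrm{val}_{r,q}(\boldsymbol e,\boldsymbol a)\ge(1-7\epsilon)\cdot\mathrm{OPT}$.
   Context: Star graph problem: there are $n$ edges $e\in[n]$, a finite action set $\mathcal{A}$, and for each edge $e$ and action $a$ a reward $r_e(a)\ge0$ and a probability $q_e(a)\in[0,1]$ (querying $e$ via $a$ succeeds with probability $q_e(a)$, yielding reward $r_e(a)$), together with a budget (patience) $\ell\le n$. A policy is a pair $(\boldsymbol e,\boldsymbol a)$ where $\boldsymbol e=(e_1,\dots,e_k)$, $k\le\ell$, is a sequence of distinct edges (the query order) and $\boldsymbol a=(a_1,\dots,a_k)\in\mathcal{A}^k$; edges are queried in order via the given actions and the process stops at the first success. Its expected reward is $\mathrm{val}_{r,q}(\boldsymbol e,\boldsymbol a)=\sum_{i=1}^k r_{e_i}(a_i)q_{e_i}(a_i)\prod_{j<i}(1-q_{e_j}(a_j))$. $\mathrm{OPT}$ is the maximum of $\mathrm{val}_{r,q}$ over all policies. *)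

theory Defs
  imports Complex_Main
begin

section \<open>The star graph problem\<close>

type_synonym ('e, 'a) policy = "'e list \<times> 'a list"

definition policies :: "'e set \<Rightarrow> 'a set \<Rightarrow> nat \<Rightarrow> ('e, 'a) policy set" where
  "policies E A l = {(es, acts). distinct es \<and> set es \<subseteq> E \<and> length es \<le> l \<and>
                                 length acts = length es \<and> set acts \<subseteq> A}"

definition policy_val ::
  "('e \<Rightarrow> 'a \<Rightarrow> real) \<Rightarrow> ('e \<Rightarrow> 'a \<Rightarrow> real) \<Rightarrow> ('e, 'a) policy \<Rightarrow> real" where
  "policy_val r q = (\<lambda>(es, acts). \<Sum>i<length es.
     r (es ! i) (acts ! i) * q (es ! i) (acts ! i) * (\<Prod>j<i. 1 - q (es ! j) (acts ! j)))"

definition OPT ::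
  "'e set \<Rightarrow> 'a set \<Rightarrow> nat \<Rightarrow> ('e \<Rightarrow> 'a \<Rightarrow> real) \<Rightarrow> ('e \<Rightarrow> 'a \<Rightarrow> real) \<Rightarrow> real" where
  "OPT E A l r q = Max (policy_val r q ` policies E A l)"

text \<open>The maximum is over a finite nonempty set, so \<^const>\<open>Max\<close> is the genuine maximum.\<close>

lemma finite_policies:
  assumes "finite E" "finite A"
  shows "finite (policies E A l)"
proof (rule finite_subset)
  show "policies E A l \<subseteq> {es. set es \<subseteq> E \<and> length es \<le> l} \<times> {acts. set acts \<subseteq> A \<and> length acts \<le> l}"
    by (auto simp: policies_def)
  show "finite ({es. set es \<subseteq> E \<and> length es \<le> l} \<times> {acts. set acts \<subseteq> A \<and> length acts \<le> l})"
    using assms by (intro finite_cartesian_product finite_lists_length_le)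
qed

lemma empty_policy: "([], []) \<in> policies E A l"
  by (simp add: policies_def)

text \<open>As inputs of an algorithm, the \<open>n\<close> edges are numbered \<open>0, \<dots>, n - 1\<close> and the actions
  \<open>0, \<dots>, m - 1\<close>, where \<open>m\<close> is the number of actions.\<close>

definition star_instance ::
  "nat \<Rightarrow> nat \<Rightarrow> nat \<Rightarrow> (nat \<Rightarrow> nat \<Rightarrow> real) \<Rightarrow> (nat \<Rightarrow> nat \<Rightarrow> real) \<Rightarrow> bool" where
  "star_instance n m l r q \<longleftrightarrow> l \<le> n \<and>
     (\<forall>e<n. \<forall>a<m. 0 \<le> r e a \<and> 0 \<le> q e a \<and> q e a \<le> 1)"

section \<open>Algorithms and running time\<close>

text \<open>
  Rewards and probabilities are real numbers and the running time depends only on \<open>n\<close> and the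
  number of actions, so the machine model is the real RAM: exact unit-cost arithmetic and
  comparison of reals, and natural numbers for control and addressing. Programs are
  structured programs over named one-dimensional arrays of naturals and of reals; a scalar is
  cell 0 of an array.

  Two restrictions keep the unit-cost model honest. There is no rounding, no conversion from
  reals to naturals, and no multiplication or division of naturals (these operations at unit
  cost would allow exponentially much bit-level computation per step). The constants of a
  program are natural numbers, so no real number can be built into it.
\<close>

datatype nexp =
    N nat
  | NGet string nexp
  | NAdd nexp nexp
  | NSub nexp nexp

datatype rexp =
    ROfNat nexp
  | RGet string nexp
  | RAdd rexp rexp
  | RSub rexp rexp
  | RMul rexp rexp
  | RDiv rexp rexp

datatype bexp =
    NLess nexp nexp
  | RLess rexp rexp
  | BNot bexp
  | BAnd bexp bexp

datatype com =
    Skip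
  | NSet string nexp nexp
  | RSet string nexp rexp
  | Seq com com
  | Cond bexp com com
  | While bexp com

record state =
  nmem :: "string \<Rightarrow> nat \<Rightarrow> nat"
  rmem :: "string \<Rightarrow> nat \<Rightarrow> real"

text \<open>Subtraction of naturals is truncated and division of reals by zero yields zero.\<close>

primrec nval :: "state \<Rightarrow> nexp \<Rightarrow> nat" where
  "nval s (N k) = k"
| "nval s (NGet x i) = nmem s x (nval s i)"
| "nval s (NAdd a b) = nval s a + nval s b"
| "nval s (NSub a b) = nval s a - nval s b"

primrec rval :: "state \<Rightarrow> rexp \<Rightarrow> real" where
  "rval s (ROfNat a) = real (nval s a)"
| "rval s (RGet x i) = rmem s x (nval s i)"
| "rval s (RAdd a b) = rval s a + rval s b"
| "rval s (RSub a b) = rval s a - rval s b"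
| "rval s (RMul a b) = rval s a * rval s b"
| "rval s (RDiv a b) = rval s a / rval s b"

primrec bval :: "state \<Rightarrow> bexp \<Rightarrow> bool" where
  "bval s (NLess a b) \<longleftrightarrow> nval s a < nval s b"
| "bval s (RLess a b) \<longleftrightarrow> rval s a < rval s b"
| "bval s (BNot b) \<longleftrightarrow> \<not> bval s b"
| "bval s (BAnd b b') \<longleftrightarrow> bval s b \<and> bval s b'"

text \<open>The cost of evaluating an expression is its number of operations, memory accesses and
  constants; expressions are not evaluated in unit time irrespective of their size.\<close>

primrec ncost :: "nexp \<Rightarrow> nat" where
  "ncost (N k) = 1"
| "ncost (NGet x i) = 1 + ncost i"
| "ncost (NAdd a b) = 1 + ncost a + ncost b"
| "ncost (NSub a b) = 1 + ncost a + ncost b"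

primrec rcost :: "rexp \<Rightarrow> nat" where
  "rcost (ROfNat a) = 1 + ncost a"
| "rcost (RGet x i) = 1 + ncost i"
| "rcost (RAdd a b) = 1 + rcost a + rcost b"
| "rcost (RSub a b) = 1 + rcost a + rcost b"
| "rcost (RMul a b) = 1 + rcost a + rcost b"
| "rcost (RDiv a b) = 1 + rcost a + rcost b"

primrec bcost :: "bexp \<Rightarrow> nat" where
  "bcost (NLess a b) = 1 + ncost a + ncost b"
| "bcost (RLess a b) = 1 + rcost a + rcost b"
| "bcost (BNot b) = 1 + bcost b"
| "bcost (BAnd b b') = 1 + bcost b + bcost b'"

text \<open>\<open>exec c s t s'\<close>: started in \<open>s\<close>, the program \<open>c\<close> halts in \<open>s'\<close> after exactly \<open>t\<close> steps.\<close>

inductive exec :: "com \<Rightarrow> state \<Rightarrow> nat \<Rightarrow> state \<Rightarrow> bool" where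
  Skip: "exec Skip s 1 s"
| NSet: "exec (NSet x i a) s (1 + ncost i + ncost a)
           (s\<lparr>nmem := (nmem s)(x := (nmem s x)(nval s i := nval s a))\<rparr>)"
| RSet: "exec (RSet x i a) s (1 + ncost i + rcost a)
           (s\<lparr>rmem := (rmem s)(x := (rmem s x)(nval s i := rval s a))\<rparr>)"
| Seq: "exec c1 s t1 s1 \<Longrightarrow> exec c2 s1 t2 s2 \<Longrightarrow> exec (Seq c1 c2) s (t1 + t2) s2"
| CondTrue: "bval s b \<Longrightarrow> exec c1 s t s' \<Longrightarrow> exec (Cond b c1 c2) s (1 + bcost b + t) s'"
| CondFalse: "\<not> bval s b \<Longrightarrow> exec c2 s t s' \<Longrightarrow> exec (Cond b c1 c2) s (1 + bcost b + t) s'"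
| WhileFalse: "\<not> bval s b \<Longrightarrow> exec (While b c) s (1 + bcost b) s"
| WhileTrue: "bval s b \<Longrightarrow> exec c s t1 s1 \<Longrightarrow> exec (While b c) s1 t2 s2 \<Longrightarrow>
                exec (While b c) s (1 + bcost b + t1 + t2) s2"

inductive_cases exec_SkipE: "exec Skip s t s'"
inductive_cases exec_NSetE: "exec (NSet x i a) s t s'"
inductive_cases exec_RSetE: "exec (RSet x i a) s t s'"
inductive_cases exec_SeqE: "exec (Seq c1 c2) s t s'"
inductive_cases exec_CondE: "exec (Cond b c1 c2) s t s'"
inductive_cases exec_WhileE: "exec (While b c) s t s'"

lemma exec_deterministic:
  "exec c s t s' \<Longrightarrow> exec c s t' s'' \<Longrightarrow> t' = t \<and> s'' = s'"
proof (induction arbitrary: t' s'' rule: exec.induct)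
  case (Skip s)
  then show ?case by (rule exec_SkipE) simp
next
  case (NSet x i a s)
  then show ?case by (rule exec_NSetE) simp
next
  case (RSet x i a s)
  then show ?case by (rule exec_RSetE) simp
next
  case (Seq c1 s t1 s1 c2 t2 s2)
  from Seq.prems show ?case
  proof (rule exec_SeqE)
    fix u1 v1 u2
    assume *: "t' = u1 + u2" "exec c1 s u1 v1" "exec c2 v1 u2 s''"
    from Seq.IH(1)[OF *(2)] have "u1 = t1" "v1 = s1" by simp_all
    with Seq.IH(2)[of u2 s''] * show ?thesis by simp
  qed
next
  case (CondTrue s b c1 t s' c2)
  from CondTrue.prems show ?case
  proof (rule exec_CondE)
    fix u
    assume "t' = Suc (bcost b + u)" "exec c1 s u s''"
    with CondTrue.IH[of u s''] show ?thesis by simp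
  qed (use CondTrue.hyps in simp)
next
  case (CondFalse s b c2 t s' c1)
  from CondFalse.prems show ?case
  proof (rule exec_CondE)
    fix u
    assume "t' = Suc (bcost b + u)" "exec c2 s u s''"
    with CondFalse.IH[of u s''] show ?thesis by simp
  qed (use CondFalse.hyps in simp)
next
  case (WhileFalse s b c)
  from WhileFalse.prems show ?case
    by (rule exec_WhileE) (use WhileFalse.hyps in simp_all)
next
  case (WhileTrue s b c t1 s1 t2 s2)
  from WhileTrue.prems show ?case
  proof (rule exec_WhileE)
    fix u1 v1 u2
    assume *: "t' = Suc (bcost b + u1 + u2)" "exec c s u1 v1" "exec (While b c) v1 u2 s''"
    from WhileTrue.IH(1)[OF *(2)] have "u1 = t1" "v1 = s1" by simp_all
    with WhileTrue.IH(2)[of u2 s''] * show ?thesis by simp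
  qed (use WhileTrue.hyps in simp)
qed

section \<open>Input and output\<close>

text \<open>\<open>r\<close> and \<open>q\<close> are given as matrices in row-major order: \<open>r e a\<close> is in cell \<open>e * m + a\<close>. All
  remaining memory is initially zero.\<close>

definition input_state ::
  "nat \<Rightarrow> nat \<Rightarrow> nat \<Rightarrow> (nat \<Rightarrow> nat \<Rightarrow> real) \<Rightarrow> (nat \<Rightarrow> nat \<Rightarrow> real) \<Rightarrow> state" where
  "input_state n m l r q =
     \<lparr>nmem = (\<lambda>x i. if x = ''n'' \<and> i = 0 then n
                   else if x = ''m'' \<and> i = 0 then m
                   else if x = ''l'' \<and> i = 0 then l
                   else 0),
      rmem = (\<lambda>x i. if x = ''r'' \<and> i < n * m then r (i div m) (i mod m)
                   else if x = ''q'' \<and> i < n * m then q (i div m) (i mod m)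
                   else 0)\<rparr>"

text \<open>The output policy has length \<open>k\<close>, its \<open>i\<close>-th query being edge \<open>e[i]\<close> via action \<open>a[i]\<close>.\<close>

definition output_policy :: "state \<Rightarrow> (nat, nat) policy" where
  "output_policy s = (map (nmem s ''e'') [0..<nmem s ''k'' 0], map (nmem s ''a'') [0..<nmem s ''k'' 0])"

end

theory Submission
  imports Defs "HOL-Analysis.Analysis"
begin

text \<open>The value of a sequence of queries is obtained by composing the maps \<open>V \<mapsto> V + gain e V\<close>, from the
  last query to the first, where \<open>gain e V = max 0 (max\<^sub>a q e a * (r e a - V))\<close>. Guess \<open>OPT\<close> up to a
  factor 2 and cut its range into \<open>O(1/\<epsilon>)\<close> levels. Up to a factor \<open>1 - O(\<epsilon>)\<close>, all that matters about a
  policy is which edges are queried while the value lies in a given level, and of those only the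
  sum of their gains at the bottom of the level.

  Only \<open>poly(1/\<epsilon>)\<close> edges gain more than \<open>\<epsilon>\<^sup>5 OPT\<close>. They are placed by a dynamic program over vectors of
  rounded totals. The other edges are first distributed fractionally: edge \<open>e\<close> goes to level \<open>j\<close> in
  proportion to \<open>\<Lambda>\<^sub>j * gain\<^sup>P\<close> with \<open>P\<close> of order \<open>log n / \<epsilon>\<close>. The optimality conditions of a minimisation of
  \<open>P\<close>-norms yield multipliers \<open>\<Lambda>\<^sub>j\<close> for which every level receives its share, and because of the large
  exponent \<open>\<Lambda>\<^sub>j\<close> may be restricted to a geometric grid of \<open>poly(1/\<epsilon>) * (log n)\<^sup>2\<close> values. So guessing all
  multipliers costs \<open>(log n) ^ O(1/\<epsilon>)\<close>, which is at most \<open>n\<close> times a function of \<open>\<epsilon>\<close>. A derandomised rounding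
  makes the distribution integral. Finally the edges are ordered by level and an exact dynamic
  program selects at most \<open>l\<close> of them and their actions.\<close>

section \<open>Programs with bounded loops\<close>

text \<open>With the multipliers fixed, the share of an edge depends on its own gains only. So
  multipliers chosen for the edges that an unknown optimal policy leaves to the small gains can be
  tried without knowing these edges. The code selecting the large edges also records their shares:
  exchanging them for others with the same code hardly changes what is left for the rest. The
  obstacle is the budget. Rounding may add about \<open>pr ^ 2\<close> edges besides a factor
  \<open>1 + O(1/pr)\<close>. If \<open>16 * pr ^ 3 \<le> l\<close>, both are an O(1/pr) fraction of
  \<open>l\<close>, and deleting surplus queries costs no larger fraction of the value
  (\<open>opt_trim\<close>). For smaller \<open>l\<close> the small gains total at most
  \<open>l * tau pr * W\<close>, an O(1/pr) fraction of \<open>W\<close>, and are given up. There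
  are O(pr) levels, so the errors not proportional to their gains must be O(1/pr^2) on each.
  Rounding small gains costs about \<open>pr ^ 2 * tau pr\<close> per level and the digits about
  \<open>hmax pr / dres pr\<close>; \<open>tau pr = 1 / pr ^ 5\<close> and
  \<open>dres pr = pr ^ 8\<close> make both O(1/pr^3).\<close>

text \<open>Only bounded loops: every program denotes a total function on states, so correctness and
  running time can be treated separately. \<open>FFor x b c\<close> runs \<open>c\<close> with \<open>x[0] = 0, \<dots>, b - 1\<close>; its semantics
  evaluates \<open>b\<close> once, the compiled loop on every iteration, hence the side conditions of
  \<open>exec_to_com\<close>.\<close>

datatype fcom =
    FSkip
  | FN string nexp nexp
  | FR string nexp rexp
  | FSeq fcom fcom  (infixr ";;" 60)
  | FIf bexp fcom fcom
  | FFor string nexp fcom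

primrec to_com :: "fcom \<Rightarrow> com" where
  "to_com FSkip = Skip"
| "to_com (FN x i a) = NSet x i a"
| "to_com (FR x i a) = RSet x i a"
| "to_com (c ;; d) = Seq (to_com c) (to_com d)"
| "to_com (FIf b c d) = Cond b (to_com c) (to_com d)"
| "to_com (FFor x b c) = Seq (NSet x (N 0) (N 0))
     (While (NLess (NGet x (N 0)) b) (Seq (to_com c) (NSet x (N 0) (NAdd (NGet x (N 0)) (N 1)))))"

definition nset :: "string \<Rightarrow> nat \<Rightarrow> nat \<Rightarrow> state \<Rightarrow> state" where
  "nset x i v s = s\<lparr>nmem := (nmem s)(x := (nmem s x)(i := v))\<rparr>"

definition rset :: "string \<Rightarrow> nat \<Rightarrow> real \<Rightarrow> state \<Rightarrow> state" where
  "rset x i v s = s\<lparr>rmem := (rmem s)(x := (rmem s x)(i := v))\<rparr>"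

lemma nmem_nset [simp]: "nmem (nset x i v s) y k = (if y = x \<and> k = i then v else nmem s y k)"
  by (simp add: nset_def)

lemma nmem_rset [simp]: "nmem (rset x i v s) = nmem s"
  by (simp add: rset_def)

lemma rmem_rset [simp]: "rmem (rset x i v s) y k = (if y = x \<and> k = i then v else rmem s y k)"
  by (simp add: rset_def)

lemma rmem_nset [simp]: "rmem (nset x i v s) = rmem s"
  by (simp add: nset_def)

primrec den :: "fcom \<Rightarrow> state \<Rightarrow> state" where
  "den FSkip s = s"
| "den (FN x i a) s = nset x (nval s i) (nval s a) s"
| "den (FR x i a) s = rset x (nval s i) (rval s a) s"
| "den (c ;; d) s = den d (den c s)"
| "den (FIf b c d) s = (if bval s b then den c s else den d s)"
| "den (FFor x b c) s =
     ((\<lambda>s'. let s'' = den c s' in nset x 0 (nmem s'' x 0 + 1) s'') ^^ nval s b) (nset x 0 0 s)"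

section \<open>Arrays that a program may write, and the loop rule\<close>

primrec nw :: "fcom \<Rightarrow> string set" where
  "nw FSkip = {}"
| "nw (FN x i a) = {x}"
| "nw (FR x i a) = {}"
| "nw (c ;; d) = nw c \<union> nw d"
| "nw (FIf b c d) = nw c \<union> nw d"
| "nw (FFor x b c) = insert x (nw c)"

primrec rw :: "fcom \<Rightarrow> string set" where
  "rw FSkip = {}"
| "rw (FN x i a) = {}"
| "rw (FR x i a) = {x}"
| "rw (c ;; d) = rw c \<union> rw d"
| "rw (FIf b c d) = rw c \<union> rw d"
| "rw (FFor x b c) = rw c"

primrec nvars :: "nexp \<Rightarrow> string set" where
  "nvars (N k) = {}"
| "nvars (NGet x i) = insert x (nvars i)"
| "nvars (NAdd a b) = nvars a \<union> nvars b"
| "nvars (NSub a b) = nvars a \<union> nvars b"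

lemma nval_cong: "(\<And>x. x \<in> nvars a \<Longrightarrow> nmem s x = nmem s' x) \<Longrightarrow> nval s a = nval s' a"
  by (induction a) auto

lemma nmem_nset_other: "x \<noteq> y \<Longrightarrow> nmem (nset y i v s) x = nmem s x"
  by (auto simp: nset_def)

lemma rmem_rset_other: "x \<noteq> y \<Longrightarrow> rmem (rset y i v s) x = rmem s x"
  by (auto simp: rset_def)

lemma nmem_den: "x \<notin> nw c \<Longrightarrow> nmem (den c s) x = nmem s x"
proof (induction c arbitrary: s)
  case (FFor y b c)
  have "nmem (((\<lambda>s'. let s'' = den c s' in nset y 0 (nmem s'' y 0 + 1) s'') ^^ k) (nset y 0 0 s)) x
      = nmem s x" for k
    using FFor by (induction k) (simp_all add: Let_def nmem_nset_other)
  then show ?case by simp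
qed (simp_all add: nmem_nset_other)

lemma rmem_den: "x \<notin> rw c \<Longrightarrow> rmem (den c s) x = rmem s x"
proof (induction c arbitrary: s)
  case (FFor y b c)
  have "rmem (((\<lambda>s'. let s'' = den c s' in nset y 0 (nmem s'' y 0 + 1) s'') ^^ k) (nset y 0 0 s)) x
      = rmem s x" for k
    using FFor by (induction k) (simp_all add: Let_def)
  then show ?case by simp
qed (simp_all add: rmem_rset_other)

text \<open>Besides the invariant, the step may use the value of the counter and the fact that
  arrays outside the write set of the body still agree with the state before the loop. Frame
  conditions thus need not be part of \<open>I\<close>.\<close>

lemma den_For:
  assumes "x \<notin> nw c" "nval s b = k"
    and "I 0 (nset x 0 0 s)"
    and "\<And>i s'. i < k \<Longrightarrow> I i s' \<Longrightarrow> nmem s' x 0 = i \<Longrightarrow>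
      (\<And>y. y \<noteq> x \<Longrightarrow> y \<notin> nw c \<Longrightarrow> nmem s' y = nmem s y) \<Longrightarrow>
      (\<And>y. y \<notin> rw c \<Longrightarrow> rmem s' y = rmem s y) \<Longrightarrow> I (Suc i) (nset x 0 (Suc i) (den c s'))"
  shows "I k (den (FFor x b c) s)"
proof -
  let ?f = "\<lambda>s'. let s'' = den c s' in nset x 0 (nmem s'' x 0 + 1) s''"
  have "I j ((?f ^^ j) (nset x 0 0 s)) \<and> nmem ((?f ^^ j) (nset x 0 0 s)) x 0 = j \<and>
     (\<forall>y. y \<noteq> x \<longrightarrow> y \<notin> nw c \<longrightarrow> nmem ((?f ^^ j) (nset x 0 0 s)) y = nmem s y) \<and>
     (\<forall>y. y \<notin> rw c \<longrightarrow> rmem ((?f ^^ j) (nset x 0 0 s)) y = rmem s y)" if "j \<le> k" for j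
    using that
  proof (induction j)
    case 0
    then show ?case using assms(3) by (simp add: nmem_nset_other)
  next
    case (Suc j)
    then have IH: "I j ((?f ^^ j) (nset x 0 0 s))" "nmem ((?f ^^ j) (nset x 0 0 s)) x 0 = j"
      "\<And>y. y \<noteq> x \<Longrightarrow> y \<notin> nw c \<Longrightarrow> nmem ((?f ^^ j) (nset x 0 0 s)) y = nmem s y"
      "\<And>y. y \<notin> rw c \<Longrightarrow> rmem ((?f ^^ j) (nset x 0 0 s)) y = rmem s y"
      by auto
    from assms(4)[of j, OF _ IH] Suc.prems IH assms(1) show ?case
      by (simp add: Let_def nmem_den rmem_den nmem_nset_other)
  qed
  from this[of k] show ?thesis using assms(2) by simp
qed

section \<open>Time bound of the compiled program\<close>

primrec bnds :: "fcom \<Rightarrow> nexp set" where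
  "bnds FSkip = {}"
| "bnds (FN x i a) = {}"
| "bnds (FR x i a) = {}"
| "bnds (c ;; d) = bnds c \<union> bnds d"
| "bnds (FIf b c d) = bnds c \<union> bnds d"
| "bnds (FFor x b c) = insert b (bnds c)"

primrec no_clash :: "fcom \<Rightarrow> bool" where
  "no_clash FSkip = True"
| "no_clash (FN x i a) = True"
| "no_clash (FR x i a) = True"
| "no_clash (c ;; d) = (no_clash c \<and> no_clash d)"
| "no_clash (FIf b c d) = (no_clash c \<and> no_clash d)"
| "no_clash (FFor x b c) = (x \<notin> nw c \<and> no_clash c)"

text \<open>\<open>w b\<close> bounds the value of the loop bound \<open>b\<close>. The loop
  constants are the costs of the compiled code: 3 for resetting the counter,
  \<open>4 + ncost b\<close> for each test including the last one that fails, and 6 for the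
  increment. Both branches of a conditional are charged.\<close>

primrec tb :: "(nexp \<Rightarrow> nat) \<Rightarrow> fcom \<Rightarrow> nat" where
  "tb w FSkip = 1"
| "tb w (FN x i a) = 1 + ncost i + ncost a"
| "tb w (FR x i a) = 1 + ncost i + rcost a"
| "tb w (c ;; d) = tb w c + tb w d"
| "tb w (FIf b c d) = 1 + bcost b + tb w c + tb w d"
| "tb w (FFor x b c) = 7 + ncost b + w b * (10 + ncost b + tb w c)"

lemma exec_NSet': "exec (NSet x i a) s (1 + ncost i + ncost a) (nset x (nval s i) (nval s a) s)"
  unfolding nset_def by (rule exec.NSet)

lemma exec_RSet': "exec (RSet x i a) s (1 + ncost i + rcost a) (rset x (nval s i) (rval s a) s)"
  unfolding rset_def by (rule exec.RSet)

lemma exec_to_com: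
  assumes "no_clash c" "\<And>b. b \<in> bnds c \<Longrightarrow> nvars b \<inter> nw c = {} \<and> nval s b \<le> w b"
  shows "\<exists>t. t \<le> tb w c \<and> exec (to_com c) s t (den c s)"
  using assms
proof (induction c arbitrary: s)
  case FSkip
  show ?case using exec.Skip by (intro exI[of _ 1]) simp
next
  case (FN x i a)
  show ?case using exec_NSet'[of x i a s] by (intro exI[of _ "1 + ncost i + ncost a"]) simp
next
  case (FR x i a)
  show ?case using exec_RSet'[of x i a s] by (intro exI[of _ "1 + ncost i + rcost a"]) simp
next
  case (FSeq c d)
  have "\<exists>t. t \<le> tb w c \<and> exec (to_com c) s t (den c s)"
    using FSeq.prems by (intro FSeq.IH(1)) auto
  then obtain t1 where 1: "t1 \<le> tb w c" "exec (to_com c) s t1 (den c s)" by blast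
  have "\<exists>t. t \<le> tb w d \<and> exec (to_com d) (den c s) t (den d (den c s))"
  proof (rule FSeq.IH(2))
    fix b assume "b \<in> bnds d"
    then have b: "nvars b \<inter> (nw c \<union> nw d) = {}" "nval s b \<le> w b" using FSeq.prems(2)[of b] by auto
    have "nval (den c s) b = nval s b" using b by (intro nval_cong nmem_den) auto
    then show "nvars b \<inter> nw d = {} \<and> nval (den c s) b \<le> w b" using b by auto
  qed (use FSeq.prems in simp)
  then obtain t2 where 2: "t2 \<le> tb w d" "exec (to_com d) (den c s) t2 (den d (den c s))" by blast
  show ?case using exec.Seq[OF 1(2) 2(2)] 1(1) 2(1) by (intro exI[of _ "t1 + t2"]) simp
next
  case (FIf b c d)
  show ?case
  proof (cases "bval s b")
    case True
    have "\<exists>t. t \<le> tb w c \<and> exec (to_com c) s t (den c s)"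
      using FIf.prems by (intro FIf.IH(1)) auto
    then obtain t where t: "t \<le> tb w c" "exec (to_com c) s t (den c s)" by blast
    then show ?thesis using exec.CondTrue[OF True t(2)] True
      by (intro exI[of _ "1 + bcost b + t"]) simp
  next
    case False
    have "\<exists>t. t \<le> tb w d \<and> exec (to_com d) s t (den d s)"
      using FIf.prems by (intro FIf.IH(2)) auto
    then obtain t where t: "t \<le> tb w d" "exec (to_com d) s t (den d s)" by blast
    then show ?thesis using exec.CondFalse[OF False t(2)] False
      by (intro exI[of _ "1 + bcost b + t"]) simp
  qed
next
  case (FFor x b c)
  let ?b = "NLess (NGet x (N 0)) b"
  let ?step = "NSet x (N 0) (NAdd (NGet x (N 0)) (N 1))"
  let ?c = "Seq (to_com c) ?step"
  let ?f = "\<lambda>s'. let s'' = den c s' in nset x 0 (nmem s'' x 0 + 1) s''"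
  let ?k = "nval s b"
  have bv: "nvars b \<inter> insert x (nw c) = {}" "?k \<le> w b" using FFor.prems(2)[of b] by auto
  have body: "\<exists>t. t \<le> tb w c + 6 \<and> exec ?c s' t (?f s')"
    if "\<And>y. y \<notin> insert x (nw c) \<Longrightarrow> nmem s' y = nmem s y" for s'
  proof -
    have "\<exists>t. t \<le> tb w c \<and> exec (to_com c) s' t (den c s')"
    proof (rule FFor.IH)
      fix a assume "a \<in> bnds c"
      then have a: "nvars a \<inter> insert x (nw c) = {}" "nval s a \<le> w a" using FFor.prems(2)[of a] by auto
      have "nval s' a = nval s a" using a that by (intro nval_cong) blast
      then show "nvars a \<inter> nw c = {} \<and> nval s' a \<le> w a" using a by auto
    qed (use FFor.prems in simp)
    then obtain t where t: "t \<le> tb w c" "exec (to_com c) s' t (den c s')" by blast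
    show ?thesis
      using exec.Seq[OF t(2) exec_NSet'[of x "N 0" "NAdd (NGet x (N 0)) (N 1)" "den c s'"]] t(1)
      by (intro exI[of _ "t + (1 + ncost (N 0) + ncost (NAdd (NGet x (N 0)) (N 1)))"]) (simp add: Let_def)
  qed
  \<comment> \<open>Induction on the number \<open>j\<close> of iterations still to run. The bound
    is evaluated anew each time, but it keeps the value \<open>?k\<close> since its variables are
    disjoint from what the loop writes.\<close>
  have loop: "\<exists>t. t \<le> (4 + ncost b) + j * (10 + ncost b + tb w c) \<and>
      exec (While ?b ?c) s' t ((?f ^^ j) s')"
    if "\<And>y. y \<notin> insert x (nw c) \<Longrightarrow> nmem s' y = nmem s y" "nmem s' x 0 + j = ?k" for j s'
    using that
  proof (induction j arbitrary: s')
    case 0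
    have "nval s' b = ?k" using 0 bv by (intro nval_cong) blast
    then have "\<not> bval s' ?b" using 0 by simp
    from exec.WhileFalse[OF this, of ?c] show ?case
      by (intro exI[of _ "1 + bcost ?b"]) simp
  next
    case (Suc j)
    have "nval s' b = ?k" using Suc.prems(1) bv by (intro nval_cong) blast
    then have b: "bval s' ?b" using Suc.prems by simp
    obtain t1 where t1: "t1 \<le> tb w c + 6" "exec ?c s' t1 (?f s')" using body[OF Suc.prems(1)] by blast
    have f: "nmem (?f s') y = nmem s y" if "y \<notin> insert x (nw c)" for y
      using that Suc.prems(1)[of y] by (simp add: Let_def nmem_nset_other nmem_den)
    have "nmem (?f s') x 0 + j = ?k"
      using Suc.prems FFor.prems(1) by (simp add: Let_def nmem_den)
    from Suc.IH[OF f this] obtain t2 where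
      t2: "t2 \<le> (4 + ncost b) + j * (10 + ncost b + tb w c)"
      "exec (While ?b ?c) (?f s') t2 ((?f ^^ j) (?f s'))" by blast
    have eq: "(?f ^^ Suc j) s' = (?f ^^ j) (?f s')" by (simp only: funpow_Suc_right o_apply)
    show ?case unfolding eq using exec.WhileTrue[OF b t1(2) t2(2)] t1(1) t2(1)
      by (intro exI[of _ "1 + bcost ?b + t1 + t2"]) simp
  qed
  have "\<exists>t. t \<le> (4 + ncost b) + ?k * (10 + ncost b + tb w c) \<and>
      exec (While ?b ?c) (nset x 0 0 s) t ((?f ^^ ?k) (nset x 0 0 s))"
    by (rule loop) (auto simp: nmem_nset_other)
  then obtain t where t: "t \<le> (4 + ncost b) + ?k * (10 + ncost b + tb w c)"
      "exec (While ?b ?c) (nset x 0 0 s) t ((?f ^^ ?k) (nset x 0 0 s))" by blast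
  have m: "?k * (10 + ncost b + tb w c) \<le> w b * (10 + ncost b + tb w c)"
    using bv(2) by (rule mult_le_mono1)
have m': "t \<le> 4 + ncost b + w b * (10 + ncost b + tb w c)" using t(1) m by linarith
  show ?case
    using exec.Seq[OF exec_NSet'[of x "N 0" "N 0" s], of "While ?b ?c" t "(?f ^^ ?k) (nset x 0 0 s)"] t(2) m'
    by (intro exI[of _ "1 + ncost (N 0) + ncost (N 0) + t"]) simp
qed

section \<open>Optimal policies\<close>

text \<open>\<open>V\<close> is the value of the queries after \<open>e\<close>; prepending \<open>e\<close> with its best action, or not at all,
  raises the value by \<open>gain r q m e V\<close>.\<close>

definition gain :: "(nat \<Rightarrow> nat \<Rightarrow> real) \<Rightarrow> (nat \<Rightarrow> nat \<Rightarrow> real) \<Rightarrow> nat \<Rightarrow> nat \<Rightarrow> real \<Rightarrow> real" where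
  "gain r q m e V = Max (insert 0 ((\<lambda>a. q e a * (r e a - V)) ` {..<m}))"

primrec opt :: "(nat \<Rightarrow> nat \<Rightarrow> real) \<Rightarrow> (nat \<Rightarrow> nat \<Rightarrow> real) \<Rightarrow> nat \<Rightarrow> nat list \<Rightarrow> nat \<Rightarrow> real" where
  "opt r q m [] k = 0"
| "opt r q m (e # es) k = (case k of 0 \<Rightarrow> 0
     | Suc k' \<Rightarrow> max (opt r q m es (Suc k')) (opt r q m es k' + gain r q m e (opt r q m es k')))"

definition comp_val :: "(nat \<Rightarrow> nat \<Rightarrow> real) \<Rightarrow> (nat \<Rightarrow> nat \<Rightarrow> real) \<Rightarrow> nat \<Rightarrow> nat list \<Rightarrow> real \<Rightarrow> real" where
  "comp_val r q m es V = foldr (\<lambda>e V. V + gain r q m e V) es V"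

lemma gain_nonneg [simp]: "0 \<le> gain r q m e V"
  unfolding gain_def by (rule Max_ge) auto

lemma gain_ge: "a < m \<Longrightarrow> q e a * (r e a - V) \<le> gain r q m e V"
  unfolding gain_def by (rule Max_ge) auto

lemma gain_cases: "gain r q m e V = 0 \<or> (\<exists>a<m. gain r q m e V = q e a * (r e a - V))"
proof -
  have "gain r q m e V \<in> insert 0 ((\<lambda>a. q e a * (r e a - V)) ` {..<m})"
    unfolding gain_def by (rule Max_in) auto
  then show ?thesis by auto
qed

lemma gain_le: "0 \<le> c \<Longrightarrow> (\<And>a. a < m \<Longrightarrow> q e a * (r e a - V) \<le> c) \<Longrightarrow> gain r q m e V \<le> c"
  using gain_cases[of r q m e V] by auto

lemma policy_val_Nil [simp]: "policy_val r q ([], as) = 0"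
  by (simp add: policy_val_def)

lemma policy_val_Cons: "policy_val r q (e # es, a # as) = r e a * q e a + (1 - q e a) * policy_val r q (es, as)"
proof -
  have "policy_val r q (e # es, a # as) = r e a * q e a +
     (\<Sum>i<length es. r (es ! i) (as ! i) * q (es ! i) (as ! i) *
        (\<Prod>j<Suc i. 1 - q ((e # es) ! j) ((a # as) ! j)))"
    unfolding policy_val_def by (simp add: sum.lessThan_Suc_shift del: prod.lessThan_Suc sum.lessThan_Suc)
  also have "\<dots> = r e a * q e a + (1 - q e a) * policy_val r q (es, as)"
    unfolding policy_val_def prod.lessThan_Suc_shift by (simp add: sum_distrib_left mult_ac)
  finally show ?thesis .
qed

locale rewards =
  fixes n m :: nat and r q :: "nat \<Rightarrow> nat \<Rightarrow> real"
  assumes q01: "\<And>e a. e < n \<Longrightarrow> a < m \<Longrightarrow> 0 \<le> q e a \<and> q e a \<le> 1"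
    and r0: "\<And>e a. e < n \<Longrightarrow> a < m \<Longrightarrow> 0 \<le> r e a"
begin

lemma gain_antimono: "e < n \<Longrightarrow> V \<le> V' \<Longrightarrow> gain r q m e V' \<le> gain r q m e V"
proof (rule gain_le[OF gain_nonneg])
  fix a assume "e < n" "V \<le> V'" "a < m"
  then have "q e a * (r e a - V') \<le> q e a * (r e a - V)" using q01 by (intro mult_left_mono) auto
  also have "\<dots> \<le> gain r q m e V" using \<open>a < m\<close> by (rule gain_ge)
  finally show "q e a * (r e a - V') \<le> gain r q m e V" .
qed

text \<open>A query via \<open>a\<close> turns the value \<open>V\<close> into
  \<open>q * r + (1 - q) * V\<close>, nondecreasing in \<open>V\<close> because
  \<open>q \<le> 1\<close>, and the maximum over the actions inherits this. It is what lets a lower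
  bound on the continuation be carried through further queries.\<close>

lemma add_gain_mono: "e < n \<Longrightarrow> V \<le> V' \<Longrightarrow> V + gain r q m e V \<le> V' + gain r q m e V'"
proof -
  assume e: "e < n" and V: "V \<le> V'"
  have "gain r q m e V \<le> V' - V + gain r q m e V'"
  proof (rule gain_le)
    show "0 \<le> V' - V + gain r q m e V'" using V gain_nonneg[of r q m e V'] by simp
    fix a assume a: "a < m"
    have "q e a * (V' - V) \<le> 1 * (V' - V)" using q01[OF e a] V by (intro mult_right_mono) auto
    then show "q e a * (r e a - V) \<le> V' - V + gain r q m e V'"
      using gain_ge[OF a, of q e r V'] by (simp add: algebra_simps)
  qed
  then show ?thesis by simp
qed

lemma opt_nonneg: "0 \<le> opt r q m es k"
  by (induction es arbitrary: k) (auto split: nat.split simp: gain_nonneg add_nonneg_nonneg le_max_iff_disj)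

lemma opt_Suc: "opt r q m es k \<le> opt r q m es (Suc k)" if "set es \<subseteq> {..<n}"
  using that
proof (induction es arbitrary: k)
  case (Cons e es)
  show ?case
  proof (cases k)
    case 0
    then show ?thesis using opt_nonneg[of "e # es" 1] by simp
  next
    case (Suc k')
    have "opt r q m es k' + gain r q m e (opt r q m es k') \<le> opt r q m es k + gain r q m e (opt r q m es k)"
      using Cons Suc by (intro add_gain_mono) auto
    then show ?thesis using Cons Suc by (auto simp: le_max_iff_disj)
  qed
qed simp

text \<open>There are \<open>k + 1\<close> ways to delete one query from an optimal selection of
  \<open>k + 1\<close>, and on average a deletion costs at most the fraction
  \<open>1 / (k + 1)\<close> of the value. In the induction, one of the deletions removes the first
  query \<open>e\<close> and leaves \<open>v\<close>; the other \<open>k\<close> keep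
  \<open>e\<close> and delete a later query, which is the induction hypothesis.\<close>

lemma opt_trim_Suc: "real k * opt r q m es (Suc k) \<le> real (Suc k) * opt r q m es k" if "set es \<subseteq> {..<n}"
  using that
proof (induction es arbitrary: k)
  case (Cons e es)
  show ?case
  proof (cases k)
    case (Suc k')
    define v where "v = opt r q m es k"
    define v' where "v' = opt r q m es k'"
    have e: "e < n" using Cons.prems by simp
    have v0: "0 \<le> v" "0 \<le> v'" by (simp_all add: v_def v'_def opt_nonneg)
    have IH1: "real k * opt r q m es (Suc k) \<le> real (Suc k) * v"
      and IH2: "real k' * v \<le> real k * v'"
      using Cons.IH[of k] Cons.IH[of k'] Cons.prems by (simp_all add: v_def v'_def Suc)
    have L: "opt r q m (e # es) k = max v (v' + gain r q m e v')" by (simp add: Suc v_def v'_def)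
    have R: "opt r q m (e # es) (Suc k) = max (opt r q m es (Suc k)) (v + gain r q m e v)"
      by (simp add: v_def)
    have 1: "real k * opt r q m es (Suc k) \<le> real (Suc k) * opt r q m (e # es) k"
      using IH1 unfolding L by (rule order_trans) (intro mult_left_mono, auto)
    have 2: "real k * (v + gain r q m e v) \<le> real (Suc k) * max v (v' + gain r q m e v')"
    proof (cases "gain r q m e v = 0")
      case True
      have "real k * v \<le> real (Suc k) * v" using v0 by (intro mult_right_mono) auto
      also have "\<dots> \<le> real (Suc k) * max v (v' + gain r q m e v')" by (intro mult_left_mono) auto
      finally show ?thesis using True by simp
    next
      case False
      then obtain a where a: "a < m" "gain r q m e v = q e a * (r e a - v)"
        using gain_cases[of r q m e v] by auto
      define p where "p = q e a"
      have p: "0 \<le> p" "p \<le> 1" using q01[OF e a(1)] by (auto simp: p_def)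
      have g: "p * (r e a - v') \<le> gain r q m e v'" using gain_ge[OF a(1)] by (simp add: p_def)
      have "real k * (v + gain r q m e v) = real k * p * r e a + real k * (1 - p) * v"
        by (simp add: a(2) p_def algebra_simps)
      \<comment> \<open>Of the \<open>k\<close> copies of \<open>v\<close>, one pays for the
        deletion of \<open>e\<close>; by the hypothesis the remaining \<open>k'\<close> are at most
        \<open>k\<close> copies of \<open>v'\<close>.\<close>
      also have "\<dots> = v * (1 - p) + (1 - p) * (real k' * v) + real k * (p * r e a)"
        by (simp add: Suc algebra_simps)
      also have "\<dots> \<le> v * 1 + (1 - p) * (real k * v') + real k * (p * r e a)"
        using p v0 IH2 by (intro add_mono mult_left_mono) auto
      also have "\<dots> = v + real k * (v' + p * (r e a - v'))" by (simp add: algebra_simps)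
      also have "\<dots> \<le> v + real k * (v' + gain r q m e v')"
        using g by (intro add_left_mono mult_left_mono) auto
      also have "\<dots> \<le> max v (v' + gain r q m e v') + real k * max v (v' + gain r q m e v')"
        by (intro add_mono mult_left_mono) auto
      finally show ?thesis by (simp add: algebra_simps)
    qed
    show ?thesis unfolding R using 1 2 unfolding L[symmetric]
      by (cases "opt r q m es (Suc k) \<le> v + gain r q m e v") (simp_all only: max_def if_True if_False)
  qed simp
qed simp

lemma opt_trim: "l \<le> k \<Longrightarrow> set es \<subseteq> {..<n} \<Longrightarrow> real l * opt r q m es k \<le> real k * opt r q m es l"
proof (induction k rule: dec_induct)
  case (step k)
  show ?case
  proof (cases "k = 0")
    case False
    have "real k * (real l * opt r q m es (Suc k)) = real l * (real k * opt r q m es (Suc k))" by simp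
    also have "\<dots> \<le> real l * (real (Suc k) * opt r q m es k)"
      using step by (intro mult_left_mono opt_trim_Suc) auto
    also have "\<dots> = real (Suc k) * (real l * opt r q m es k)" by simp
    also have "\<dots> \<le> real (Suc k) * (real k * opt r q m es l)"
      using step by (intro mult_left_mono) auto
    finally have "real k * (real l * opt r q m es (Suc k)) \<le> real k * (real (Suc k) * opt r q m es l)"
      by (simp add: mult_ac)
    then show ?thesis using False by simp
  qed (use step opt_nonneg in simp)
qed simp

lemma opt_eq_comp_val: "length es \<le> k \<Longrightarrow> opt r q m es k = comp_val r q m es 0"
  by (induction es arbitrary: k)
    (auto simp: comp_val_def gain_nonneg split: nat.split)

text \<open>A gain of 0 need not be realised by any action. In that case \<open>e\<close> is
  dropped, which loses nothing because the later queries may then use one selection more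
  (\<open>opt_Suc\<close>).\<close>

lemma opt_policy:
  assumes "distinct es" "set es \<subseteq> {..<n}"
  shows "\<exists>es' as. distinct es' \<and> set es' \<subseteq> set es \<and> length es' \<le> k \<and> length as = length es' \<and>
           set as \<subseteq> {..<m} \<and> policy_val r q (es', as) = opt r q m es k"
  using assms
proof (induction es arbitrary: k)
  case Nil
  show ?case by (intro exI[of _ "[]"]) simp
next
  case (Cons e es)
  show ?case
  proof (cases k)
    case 0
    then show ?thesis by (intro exI[of _ "[]"]) simp
  next
    case (Suc k')
    define v where "v = opt r q m es k'"
    have ex: "\<exists>es' as. distinct es' \<and> set es' \<subseteq> set es \<and> length es' \<le> k \<and> length as = length es' \<and>
           set as \<subseteq> {..<m} \<and> policy_val r q (es', as) = opt r q m es k" for k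
      using Cons by simp
    have le: "v \<le> opt r q m es k" using Cons.prems Suc by (simp add: v_def opt_Suc)
    consider "opt r q m (e # es) k = opt r q m es k"
      | a where "a < m" "opt r q m (e # es) k = v + q e a * (r e a - v)"
    proof -
      have R: "opt r q m (e # es) k = max (opt r q m es k) (v + gain r q m e v)"
        by (simp add: Suc v_def)
      show ?thesis
      proof (cases "v + gain r q m e v \<le> opt r q m es k")
        case True
        then show ?thesis using R that(1) by (simp add: max_def)
      next
        case False
        then have "gain r q m e v \<noteq> 0" using le by auto
        then obtain a where "a < m" "gain r q m e v = q e a * (r e a - v)"
          using gain_cases[of r q m e v] by auto
        then show ?thesis using that(2)[of a] R False by (simp add: max_def)
      qed
    qed
    then show ?thesis
    proof cases
      case 1
      with ex[of k] show ?thesis by (metis set_subset_Cons order_trans)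
    next
      case 2
      from ex[of k'] obtain es' as where *: "distinct es'" "set es' \<subseteq> set es" "length es' \<le> k'"
        "length as = length es'" "set as \<subseteq> {..<m}" "policy_val r q (es', as) = v"
        by (auto simp: v_def)
      show ?thesis
        using * 2 Cons.prems Suc
        by (intro exI[of _ "e # es'"] exI[of _ "a # as"]) (auto simp: policy_val_Cons algebra_simps)
    qed
  qed
qed

lemma policy_val_le_comp_val:
  assumes "length as = length es" "set es \<subseteq> {..<n}" "set as \<subseteq> {..<m}"
  shows "policy_val r q (es, as) \<le> comp_val r q m es 0"
  using assms
proof (induction es as rule: list_induct2')
  case (4 e es a as)
  define v where "v = policy_val r q (es, as)"
  have "r e a * q e a + (1 - q e a) * v = v + q e a * (r e a - v)" by (simp add: algebra_simps)
  also have "\<dots> \<le> v + gain r q m e v" using 4 by (intro add_left_mono gain_ge) auto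
  also have "\<dots> \<le> comp_val r q m es 0 + gain r q m e (comp_val r q m es 0)"
    using 4 by (intro add_gain_mono) (auto simp: v_def)
  finally show ?case by (simp add: policy_val_Cons v_def comp_val_def)
qed (auto simp: comp_val_def)

lemma opt_le_OPT:
  assumes "distinct es" "set es \<subseteq> {..<n}"
  shows "opt r q m es l \<le> OPT {..<n} {..<m} l r q"
proof -
  from opt_policy[OF assms, of l] obtain es' as where *: "distinct es'" "set es' \<subseteq> set es" "length es' \<le> l"
    "length as = length es'" "set as \<subseteq> {..<m}" "policy_val r q (es', as) = opt r q m es l" by auto
  then have "(es', as) \<in> policies {..<n} {..<m} l" using assms by (auto simp: policies_def)
  then show ?thesis unfolding OPT_def *(6)[symmetric] by (intro Max_ge finite_imageI finite_policies) auto
qed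

text \<open>Greedy actions cannot beat an optimal policy, as \<open>opt_policy\<close> turns the
  greedy value back into a policy. So an optimal policy may be represented by its list of edges
  alone.\<close>

lemma OPT_comp_val:
  "\<exists>es. distinct es \<and> set es \<subseteq> {..<n} \<and> length es \<le> l \<and> comp_val r q m es 0 = OPT {..<n} {..<m} l r q"
proof -
  have "OPT {..<n} {..<m} l r q \<in> policy_val r q ` policies {..<n} {..<m} l"
    unfolding OPT_def using empty_policy by (intro Max_in finite_imageI finite_policies) auto
  then obtain es as where *: "(es, as) \<in> policies {..<n} {..<m} l"
    "policy_val r q (es, as) = OPT {..<n} {..<m} l r q" by auto
  then have d: "distinct es" "set es \<subseteq> {..<n}" "length es \<le> l" "length as = length es" "set as \<subseteq> {..<m}"
    by (auto simp: policies_def)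
  have "comp_val r q m es 0 = opt r q m es l" using d by (simp add: opt_eq_comp_val)
  also have "\<dots> \<le> OPT {..<n} {..<m} l r q" using d by (intro opt_le_OPT)
  finally show ?thesis using policy_val_le_comp_val[OF d(4,2,5)] *(2) d by (intro exI[of _ es]) auto
qed

end

section \<open>Fractional assignment of small gains\<close>

lemma continuous_on_coordinate: "continuous_on A (\<lambda>x :: nat \<Rightarrow> real. x i)"
  by (rule continuous_on_subset[OF continuous_on_product_coordinates]) auto

text \<open>Points are total functions on \<open>nat\<close>. Compactness comes from a product of
  compact sets over all indices, which is why the coordinates outside \<open>I\<close> are pinned to
  0, cut by a closed hyperplane.\<close>

lemma compact_simplex:
  fixes \<eta> :: real
  assumes "finite I"
  shows "compact {y :: nat \<Rightarrow> real. (\<forall>i\<in>I. \<eta> \<le> y i \<and> y i \<le> 1) \<and> (\<forall>i. i \<notin> I \<longrightarrow> y i = 0) \<and> (\<Sum>i\<in>I. y i) = 1}"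
    (is "compact ?Y")
proof -
  have eq: "?Y = PiE UNIV (\<lambda>i. if i \<in> I then {\<eta>..1} else {0}) \<inter> {y. (\<Sum>i\<in>I. y i) = 1}"
    by (auto simp: PiE_UNIV_domain Pi_def split: if_splits)
  have "compactin (product_topology (\<lambda>_. euclidean) UNIV)
      (PiE (UNIV :: nat set) (\<lambda>i. if i \<in> I then {\<eta>..1} else {0}))"
    by (subst compactin_PiE) auto
  then have "compact (PiE (UNIV :: nat set) (\<lambda>i. if i \<in> I then {\<eta>..1} else {0}))"
    by (simp add: euclidean_product_topology)
  moreover have "closed {y :: nat \<Rightarrow> real. (\<Sum>i\<in>I. y i) = 1}"
    by (intro closed_Collect_eq continuous_intros continuous_on_coordinate)
  ultimately show ?thesis unfolding eq by (rule compact_Int_closed)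
qed

text \<open>Write \<open>la i = y i / D i\<close>. The point \<open>y\<close> minimises the sum of the \<open>p\<close>-norms \<open>\<nu> e\<close> of
  \<open>(la i * c e i)\<^sub>i\<close> over the simplex \<open>\<Sum>y = 1, y \<ge> \<eta>\<close>. The assignment \<open>\<sigma>\<close> shows that the minimum is at
  least 1, and the last conclusion is stationarity in the direction of the \<open>j\<close>-th vertex.\<close>

lemma kkt_pnorm:
  fixes c :: "'e \<Rightarrow> nat \<Rightarrow> real" and D :: "nat \<Rightarrow> real" and p :: nat and \<eta> :: real
  assumes fin: "finite E" "finite I" and i0: "i0 \<in> I" "\<And>e. e \<in> E \<Longrightarrow> 0 < c e i0"
    and c0: "\<And>e i. e \<in> E \<Longrightarrow> i \<in> I \<Longrightarrow> 0 \<le> c e i"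
    and D0: "\<And>i. i \<in> I \<Longrightarrow> 0 < D i" and p: "p > 0"
    and \<sigma>: "\<And>e. e \<in> E \<Longrightarrow> \<sigma> e \<in> I"
    and D: "\<And>i. i \<in> I \<Longrightarrow> D i \<le> (\<Sum>e\<in>{e\<in>E. \<sigma> e = i}. c e i)"
    and \<eta>: "0 < \<eta>" "real (card I) * \<eta> \<le> 1"
  shows "\<exists>la \<nu>. (\<forall>i\<in>I. \<eta> / D i \<le> la i \<and> la i \<le> 1 / D i) \<and>
     (\<forall>e\<in>E. 0 < \<nu> e \<and> (\<Sum>i\<in>I. (la i * c e i / \<nu> e) ^ p) = 1) \<and>
     (\<forall>j\<in>I. 1 \<le> (\<Sum>e\<in>E. c e j * (la j * c e j / \<nu> e) ^ (p - 1)) / D j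
           + \<eta> * (\<Sum>i\<in>I. (\<Sum>e\<in>E. c e i * (la i * c e i / \<nu> e) ^ (p - 1)) / D i))"
proof -
  \<comment> \<open>The lower bound \<open>\<eta>\<close> keeps the norms positive on
    \<open>Y\<close>, where the root is differentiable, and later bounds the multipliers away from
    0.\<close>
  define Y where "Y = {y :: nat \<Rightarrow> real. (\<forall>i\<in>I. \<eta> \<le> y i \<and> y i \<le> 1) \<and> (\<forall>i. i \<notin> I \<longrightarrow> y i = 0) \<and> (\<Sum>i\<in>I. y i) = 1}"
  define S where "S y e = (\<Sum>i\<in>I. (y i / D i * c e i) ^ p)" for y e
  define Nu where "Nu y e = root p (S y e)" for y e
  define F where "F y = (\<Sum>e\<in>E. Nu y e)" for y
  have cI: "card I > 0" using fin i0 by (auto simp: card_gt_0_iff)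
  have \<eta>c: "\<eta> \<le> 1 / real (card I)" using \<eta>(2) cI by (simp add: field_simps)
  have Yne: "(\<lambda>i. if i \<in> I then 1 / real (card I) else 0) \<in> Y"
    using cI \<eta>c by (auto simp: Y_def)
  have Ycomp: "compact Y" unfolding Y_def by (rule compact_simplex[OF fin(2)])
  have contF: "continuous_on Y F"
    unfolding F_def Nu_def S_def by (intro continuous_intros continuous_on_coordinate) (use D0 in force)
  obtain y where y: "y \<in> Y" "\<And>z. z \<in> Y \<Longrightarrow> F y \<le> F z"
    using continuous_attains_inf[OF Ycomp _ contF] Yne by blast
  have y\<eta>: "\<eta> \<le> y i" "y i \<le> 1" "0 < y i" if "i \<in> I" for i
    using y(1) that \<eta>(1) by (force simp: Y_def)+
  have y1: "(\<Sum>i\<in>I. y i) = 1" using y(1) by (simp add: Y_def)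
  have yc0: "0 \<le> y i / D i * c e i" if "e \<in> E" "i \<in> I" for e i
    using c0[OF that] D0[OF that(2)] y\<eta>(3)[OF that(2)] by simp
  have S_ge: "(y i / D i * c e i) ^ p \<le> S y e" if "e \<in> E" "i \<in> I" for e i
    unfolding S_def using that(2) fin(2) zero_le_power[OF yc0[OF that(1)]]
    by (intro member_le_sum[of i I "\<lambda>i. (y i / D i * c e i) ^ p"]) (auto simp del: zero_le_power_eq)
  have Spos: "0 < S y e" if "e \<in> E" for e
  proof -
    have "0 < (y i0 / D i0 * c e i0) ^ p" using that i0 y\<eta> D0 by simp
    also have "\<dots> \<le> S y e" using S_ge[OF that i0(1)] .
    finally show ?thesis .
  qed
  define \<nu> where "\<nu> = Nu y"
  have \<nu>0: "0 < \<nu> e" if "e \<in> E" for e using Spos[OF that] p by (simp add: \<nu>_def Nu_def)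
  have \<nu>p: "\<nu> e ^ p = S y e" if "e \<in> E" for e
    using Spos[OF that] p by (simp add: \<nu>_def Nu_def)
  define l where "l i = y i / D i" for i
  define t where "t e i = l i * c e i / \<nu> e" for e i
  have t0: "0 \<le> t e i" if "e \<in> E" "i \<in> I" for e i
    unfolding t_def l_def by (rule divide_nonneg_pos[OF yc0[OF that] \<nu>0[OF that(1)]])
  have t1: "(\<Sum>i\<in>I. t e i ^ p) = 1" if "e \<in> E" for e
  proof -
    have "(\<Sum>i\<in>I. t e i ^ p) = S y e / \<nu> e ^ p"
      unfolding S_def t_def l_def by (simp add: power_divide power_mult_distrib sum_divide_distrib)
    then show ?thesis using \<nu>p[OF that] Spos[OF that] by simp
  qed
  \<comment> \<open>\<open>R i\<close> is the partial derivative of \<open>F\<close> with respect to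
    \<open>y i\<close>.\<close>
  define R where "R i = (\<Sum>e\<in>E. c e i * t e i ^ (p - 1)) / D i" for i
  have R0: "0 \<le> R i" if "i \<in> I" for i
    using that c0 D0 t0 by (auto simp: R_def intro!: divide_nonneg_pos sum_nonneg)
  \<comment> \<open>Euler's identity: \<open>F\<close> is homogeneous of degree 1, so pairing
    \<open>y\<close> with the gradient returns \<open>F y\<close>.\<close>
  have Euler: "(\<Sum>i\<in>I. y i * R i) = F y"
  proof -
    have "(\<Sum>i\<in>I. y i * R i) = (\<Sum>i\<in>I. \<Sum>e\<in>E. l i * c e i * t e i ^ (p - 1))"
      unfolding R_def l_def by (simp add: sum_distrib_left sum_divide_distrib mult_ac)
    also have "\<dots> = (\<Sum>e\<in>E. \<Sum>i\<in>I. l i * c e i * t e i ^ (p - 1))" by (rule sum.swap)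
    also have "\<dots> = (\<Sum>e\<in>E. \<nu> e * (\<Sum>i\<in>I. t e i ^ p))"
    proof (rule sum.cong[OF refl])
      fix e assume e: "e \<in> E"
      have "l i * c e i * t e i ^ (p - 1) = \<nu> e * t e i ^ p" for i
      proof -
        have "l i * c e i = \<nu> e * t e i" using \<nu>0[OF e] by (simp add: t_def)
        then show ?thesis using p by (simp add: power_eq_if)
      qed
      then show "(\<Sum>i\<in>I. l i * c e i * t e i ^ (p - 1)) = \<nu> e * (\<Sum>i\<in>I. t e i ^ p)"
        by (simp add: sum_distrib_left)
    qed
    also have "\<dots> = F y" using t1 by (simp add: F_def \<nu>_def)
    finally show ?thesis .
  qed
  \<comment> \<open>Each norm is at least its entry at the bin \<open>\<sigma> e\<close>. Grouped by
    bins, these entries sum to at least the total of \<open>y\<close> because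
    \<open>\<sigma>\<close> meets the demands \<open>D\<close>.\<close>
  have F1: "1 \<le> F y"
  proof -
    have "1 = (\<Sum>i\<in>I. y i)" by (simp add: y1)
    also have "\<dots> \<le> (\<Sum>i\<in>I. l i * (\<Sum>e\<in>{e\<in>E. \<sigma> e = i}. c e i))"
    proof (rule sum_mono)
      fix i assume i: "i \<in> I"
      have "y i = l i * D i" using D0[OF i] by (simp add: l_def)
      also have "\<dots> \<le> l i * (\<Sum>e\<in>{e\<in>E. \<sigma> e = i}. c e i)"
        using D[OF i] y\<eta>(3)[OF i] D0[OF i] by (intro mult_left_mono) (auto simp: l_def)
      finally show "y i \<le> l i * (\<Sum>e\<in>{e\<in>E. \<sigma> e = i}. c e i)" .
    qed
    also have "\<dots> = (\<Sum>i\<in>I. \<Sum>e\<in>{e\<in>E. \<sigma> e = i}. l (\<sigma> e) * c e (\<sigma> e))"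
      by (auto simp: sum_distrib_left intro!: sum.cong)
    also have "\<dots> = (\<Sum>e\<in>E. l (\<sigma> e) * c e (\<sigma> e))"
      using fin \<sigma> by (intro sum.group) auto
    also have "\<dots> \<le> F y" unfolding F_def
    proof (rule sum_mono)
      fix e assume e: "e \<in> E"
      have n: "0 \<le> l (\<sigma> e) * c e (\<sigma> e)"
        unfolding l_def by (rule yc0[OF e \<sigma>[OF e]])
      have "(l (\<sigma> e) * c e (\<sigma> e)) ^ p \<le> S y e"
        unfolding l_def using S_ge[OF e \<sigma>[OF e]] .
      then have "root p ((l (\<sigma> e) * c e (\<sigma> e)) ^ p) \<le> Nu y e"
        unfolding Nu_def using p by simp
      then show "l (\<sigma> e) * c e (\<sigma> e) \<le> Nu y e" using n p by (simp add: real_root_power_cancel)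
    qed
    finally show ?thesis .
  qed
  \<comment> \<open>First-order optimality: if the derivative from \<open>y\<close> towards
    \<open>v\<close> were negative, a short step along the segment, which stays in the convex set
    \<open>Y\<close>, would decrease \<open>F\<close>.\<close>
  have dir: "(\<Sum>i\<in>I. y i * R i) \<le> (\<Sum>i\<in>I. v i * R i)" if v: "v \<in> Y" for v
  proof (rule ccontr)
    define z where "z s i = y i + s * (v i - y i)" for s :: real and i
    assume neg: "\<not> ?thesis"
    define G' where "G' = (\<Sum>e\<in>E. \<Sum>i\<in>I. (v i - y i) / D i * c e i * t e i ^ (p - 1))"
    have "G' = (\<Sum>i\<in>I. \<Sum>e\<in>E. (v i - y i) / D i * c e i * t e i ^ (p - 1))"
      unfolding G'_def by (rule sum.swap)
    also have "\<dots> = (\<Sum>i\<in>I. (v i - y i) * R i)"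
      unfolding R_def by (simp add: sum_distrib_left sum_divide_distrib mult_ac)
    also have "\<dots> < 0" using neg by (simp add: left_diff_distrib sum_subtractf)
    finally have G'neg: "G' < 0" .
    have derN: "((\<lambda>s. Nu (z s) e) has_real_derivative (\<Sum>i\<in>I. (v i - y i) / D i * c e i * t e i ^ (p - 1))) (at 0)"
      if e: "e \<in> E" for e
    proof -
      have z0: "z 0 = y" by (rule ext) (simp add: z_def)
      have dS: "((\<lambda>s. S (z s) e) has_real_derivative
          (\<Sum>i\<in>I. real p * ((v i - y i) / D i * c e i) * (y i / D i * c e i) ^ (p - 1))) (at 0)"
        unfolding S_def
      proof (rule DERIV_sum)
        fix i assume i: "i \<in> I"
        have "((\<lambda>s. z s i / D i * c e i) has_real_derivative (v i - y i) / D i * c e i) (at 0)"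
          unfolding z_def using D0[OF i] by (auto intro!: derivative_eq_intros)
        from DERIV_power[OF this, of p]
        show "((\<lambda>s. (z s i / D i * c e i) ^ p) has_real_derivative
            real p * ((v i - y i) / D i * c e i) * (y i / D i * c e i) ^ (p - 1)) (at 0)"
          by (simp add: z0 mult_ac)
      qed
      have "((\<lambda>s. root p (S (z s) e)) has_real_derivative
          inverse (real p * root p (S (z 0) e) ^ (p - Suc 0)) *
          (\<Sum>i\<in>I. real p * ((v i - y i) / D i * c e i) * (y i / D i * c e i) ^ (p - 1))) (at 0)"
        by (rule DERIV_chain2[OF DERIV_real_root dS]) (use p Spos[OF e] z0 in auto)
      moreover have "inverse (real p * root p (S (z 0) e) ^ (p - Suc 0)) *
          (\<Sum>i\<in>I. real p * ((v i - y i) / D i * c e i) * (y i / D i * c e i) ^ (p - 1))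
        = (\<Sum>i\<in>I. (v i - y i) / D i * c e i * t e i ^ (p - 1))"
      proof -
        have "root p (S (z 0) e) = \<nu> e" by (simp add: z0 \<nu>_def Nu_def)
        moreover have "inverse (real p * \<nu> e ^ k) * (real p * a * X ^ k) = a * (X / \<nu> e) ^ k" for a X k
          using p \<nu>0[OF e] by (simp add: power_divide field_simps)
        ultimately show ?thesis by (simp only: sum_distrib_left t_def l_def One_nat_def)
      qed
      ultimately show ?thesis by (simp add: Nu_def)
    qed
    have "((\<lambda>s. F (z s)) has_real_derivative G') (at 0)"
      unfolding F_def G'_def by (rule DERIV_sum) (use derN in auto)
    from DERIV_neg_dec_right[OF this G'neg] obtain d where d: "d > 0"
      "\<And>h. 0 < h \<Longrightarrow> h < d \<Longrightarrow> F (z (0 + h)) < F (z 0)" by auto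
    define h where "h = min (d / 2) 1"
    have h: "0 < h" "h < d" "h \<le> 1" using d(1) by (auto simp: h_def)
    have zY: "z h \<in> Y"
    proof -
      have zz: "z h i = (1 - h) * y i + h * v i" for i by (simp add: z_def algebra_simps)
      have "\<eta> \<le> z h i \<and> z h i \<le> 1" if i: "i \<in> I" for i
      proof -
        have v': "\<eta> \<le> v i" "v i \<le> 1" using v i by (auto simp: Y_def)
        have "(1 - h) * \<eta> + h * \<eta> \<le> z h i" unfolding zz
          using h v' y\<eta>[OF i] by (intro add_mono mult_left_mono) auto
        moreover have "z h i \<le> (1 - h) * 1 + h * 1" unfolding zz
          using h v' y\<eta>[OF i] by (intro add_mono mult_left_mono) auto
        ultimately show ?thesis by (simp add: algebra_simps)
      qed
      moreover have "z h i = 0" if "i \<notin> I" for i using that v y(1) by (simp add: zz Y_def)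
      moreover have "(\<Sum>i\<in>I. z h i) = 1"
        unfolding zz sum.distrib sum_distrib_left[symmetric] using v y1 by (simp add: Y_def)
      ultimately show ?thesis by (simp add: Y_def)
    qed
    have "F (z h) < F (z 0)" using d(2)[of h] h by simp
    moreover have "z 0 = y" by (rule ext) (simp add: z_def)
    ultimately show False using y(2)[OF zY] by simp
  qed
  have main: "1 \<le> R j + \<eta> * (\<Sum>i\<in>I. R i)" if j: "j \<in> I" for j
  proof -
    \<comment> \<open>The vertex of the truncated simplex at \<open>j\<close>: mass
      \<open>\<eta>\<close> on every bin and all that remains on bin \<open>j\<close>.\<close>
    define v where "v i = (if i \<in> I then \<eta> + (if i = j then 1 - real (card I) * \<eta> else 0) else 0)" for i
    have "v \<in> Y"
    proof -
      have "(\<Sum>i\<in>I. v i) = (\<Sum>i\<in>I. \<eta> + (if i = j then 1 - real (card I) * \<eta> else 0))"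
        by (intro sum.cong) (auto simp: v_def)
      also have "\<dots> = 1" using fin j by (simp add: sum.distrib)
      finally have s: "(\<Sum>i\<in>I. v i) = 1" .
      have "1 * \<eta> \<le> real (card I) * \<eta>" using cI \<eta> by (intro mult_right_mono) auto
      then have "\<eta> \<le> 1" using \<eta>(2) by linarith
      then show ?thesis using s \<eta> cI by (auto simp: Y_def v_def)
    qed
    from dir[OF this] have "1 \<le> (\<Sum>i\<in>I. v i * R i)" using Euler F1 by simp
    also have "\<dots> = (\<Sum>i\<in>I. \<eta> * R i + (if i = j then (1 - real (card I) * \<eta>) * R i else 0))"
      by (intro sum.cong) (auto simp: v_def algebra_simps)
    also have "\<dots> = \<eta> * (\<Sum>i\<in>I. R i) + (1 - real (card I) * \<eta>) * R j"
      using fin j by (simp add: sum.distrib sum_distrib_left)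
    also have "\<dots> \<le> \<eta> * (\<Sum>i\<in>I. R i) + 1 * R j"
      using \<eta> R0[OF j] by (intro add_left_mono mult_right_mono) auto
    finally show ?thesis by simp
  qed
  have "\<forall>i\<in>I. \<eta> / D i \<le> l i \<and> l i \<le> 1 / D i"
    using y\<eta> D0 by (auto simp: l_def divide_right_mono less_imp_le)
  with \<nu>0 t1 main show ?thesis
    unfolding t_def R_def by (intro exI[of _ l] exI[of _ \<nu>]) auto
qed

section \<open>Multipliers on a geometric grid\<close>

definition grid :: "nat \<Rightarrow> nat \<Rightarrow> real set" where
  "grid pr K = insert 0 ((\<lambda>k. (1 + 1 / real pr) ^ k) ` {..<K})"

text \<open>Bin \<open>J\<close> enters without a power of \<open>g\<close> because leaving an edge
  out counts as gain 1. If all multipliers are 0, the quotient 0/0 is 0 and nothing is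
  assigned.\<close>

definition share :: "nat \<Rightarrow> nat \<Rightarrow> (nat \<Rightarrow> real) \<Rightarrow> ('e \<Rightarrow> nat \<Rightarrow> real) \<Rightarrow> 'e \<Rightarrow> nat \<Rightarrow> real" where
  "share J P \<Lambda> g e j = \<Lambda> j * g e j ^ P / (\<Lambda> J + (\<Sum>k<J. \<Lambda> k * g e k ^ P))"

lemma two_le_power: "pr > 0 \<Longrightarrow> 2 \<le> (1 + 1 / real pr) ^ pr"
proof -
  assume "pr > 0"
  moreover have "- 1 \<le> 1 / real pr" by (rule order_trans[of _ 0]) auto
  ultimately show ?thesis using Bernoulli_inequality[of "1 / real pr" pr] by simp
qed

text \<open>\<open>(1 - x) * (1 + x) \<le> 1\<close> turns the Bernoulli bound
  \<open>two_le_power\<close> into a bound on the reciprocal.\<close>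

lemma power_le_half: "pr \<ge> 2 \<Longrightarrow> (1 - 1 / real pr) ^ pr \<le> 1 / 2"
proof -
  assume pr: "pr \<ge> 2"
  have "2 \<le> (1 + 1 / real pr) ^ pr" using pr by (intro two_le_power) auto
  moreover have "((1 - 1 / real pr) * (1 + 1 / real pr)) ^ pr \<le> 1 ^ pr"
  proof (rule power_mono)
    have "(1 - x) * (1 + x) \<le> 1" for x :: real by (simp add: algebra_simps)
    then show "(1 - 1 / real pr) * (1 + 1 / real pr) \<le> 1" .
  qed (use pr in simp)
  moreover have "0 \<le> (1 - 1 / real pr) ^ pr" using pr by (intro zero_le_power) auto
  ultimately have "(1 - 1 / real pr) ^ pr * 2 \<le> 1"
    using mult_left_mono[of 2 "(1 + 1 / real pr) ^ pr" "(1 - 1 / real pr) ^ pr"]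
    unfolding power_mult_distrib power_one by linarith
  then show ?thesis by simp
qed

text \<open>The least sufficient power is chosen; its predecessor lies below \<open>a\<close>, so at
  most one factor of the ratio is lost. The power 0 has no predecessor, and there
  \<open>1 \<le> a\<close> is used.\<close>

lemma grid_point:
  fixes a :: real
  assumes "pr > 0" "1 \<le> a" "a \<le> (1 + 1 / real pr) ^ K"
  shows "\<exists>k\<le>K. a \<le> (1 + 1 / real pr) ^ k \<and> (1 + 1 / real pr) ^ k \<le> (1 + 1 / real pr) * a"
proof -
  define \<beta> where "\<beta> = 1 + 1 / real pr"
  define k where "k = (LEAST k. a \<le> \<beta> ^ k)"
  have k: "a \<le> \<beta> ^ k" "k \<le> K" unfolding k_def
    using assms(3) by (auto simp: \<beta>_def intro: LeastI Least_le)
  have "\<beta> ^ k \<le> \<beta> * a"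
  proof (cases k)
    case 0
    have "1 * 1 \<le> \<beta> * a" using assms by (intro mult_mono) (auto simp: \<beta>_def)
    then show ?thesis by (simp add: 0)
  next
    case (Suc k')
    have "\<not> a \<le> \<beta> ^ k'" using not_less_Least[of k' "\<lambda>k. a \<le> \<beta> ^ k"] Suc by (simp add: k_def)
    then show ?thesis using Suc by (simp add: \<beta>_def mult_left_mono)
  qed
  with k show ?thesis by (auto simp: \<beta>_def)
qed

text \<open>Splitting at \<open>t = \<theta>\<close> compares sums of \<open>P\<close>-th and \<open>(P+1)\<close>-st powers.\<close>

lemma sum_power_le:
  fixes t :: "'i \<Rightarrow> real"
  assumes "finite A" "0 < \<theta>" "\<And>i. i \<in> A \<Longrightarrow> 0 \<le> t i"
  shows "(\<Sum>i\<in>A. t i ^ P) \<le> (\<Sum>i\<in>A. t i ^ Suc P) / \<theta> + real (card A) * \<theta> ^ P"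
proof -
  have "(\<Sum>i\<in>A. t i ^ P) \<le> (\<Sum>i\<in>A. t i ^ Suc P / \<theta> + \<theta> ^ P)"
  proof (rule sum_mono)
    fix i assume i: "i \<in> A"
    show "t i ^ P \<le> t i ^ Suc P / \<theta> + \<theta> ^ P"
    proof (cases "t i \<le> \<theta>")
      case True
      have "t i ^ P \<le> \<theta> ^ P" using True assms(3)[OF i] by (rule power_mono)
      moreover have "0 \<le> t i ^ Suc P / \<theta>" using assms(2,3) i by simp
      ultimately show ?thesis by simp
    next
      case False
      have "\<theta> * t i ^ P \<le> t i * t i ^ P" using False assms(3)[OF i] by (intro mult_right_mono) auto
      then have "t i ^ P \<le> t i ^ Suc P / \<theta>" using assms(2) by (simp add: field_simps)
      moreover have "0 \<le> \<theta> ^ P" using assms(2) by simp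
      ultimately show ?thesis by linarith
    qed
  qed
  then show ?thesis by (simp add: sum.distrib sum_divide_distrib)
qed

text \<open>\<open>1 - t ^ P\<close> is the sum of the \<open>P\<close> terms
  \<open>t ^ i * (1 - t)\<close>, none of them smaller than \<open>t ^ P * (1 - t)\<close>, the term
  added in \<open>1 - t ^ Suc P\<close>.\<close>

lemma one_minus_power_Suc_le:
  fixes t :: real
  assumes "0 \<le> t" "t \<le> 1" "P > 0"
  shows "1 - t ^ Suc P \<le> (1 + 1 / real P) * (1 - t ^ P)"
proof -
  have "real P * (t ^ P * (1 - t)) = (\<Sum>i<P. t ^ P * (1 - t))" by simp
  also have "\<dots> \<le> (\<Sum>i<P. t ^ i * (1 - t))"
    using assms by (intro sum_mono mult_right_mono power_decreasing) auto
  also have "\<dots> = 1 - t ^ P" by (simp add: one_diff_power_eq sum_distrib_left mult.commute)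
  finally have "t ^ P * (1 - t) \<le> (1 - t ^ P) / real P" using assms by (simp add: field_simps)
  then show ?thesis by (simp add: algebra_simps diff_divide_distrib)
qed

text \<open>Bin \<open>J\<close> stands for not querying the edge, with gain 1 for each edge. A dummy edge \<open>None\<close>, usable
  only there, keeps its demand positive.\<close>

lemma soft_assignment_exists:
  fixes g :: "'e \<Rightarrow> nat \<Rightarrow> real" and d :: "nat \<Rightarrow> real"
  assumes pr: "pr \<ge> 2" and E: "finite E" "card E \<le> n" and \<tau>: "0 < \<tau>"
    and g: "\<And>e j. e \<in> E \<Longrightarrow> j < J \<Longrightarrow> 0 \<le> g e j \<and> g e j \<le> \<tau>"
    and A: "A \<subseteq> E" and \<sigma>: "\<And>e. e \<in> A \<Longrightarrow> \<sigma> e < J"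
    and d: "\<And>j. j < J \<Longrightarrow> d j \<le> (\<Sum>e\<in>{e\<in>A. \<sigma> e = j}. g e j)" "\<And>j. j < J \<Longrightarrow> 0 \<le> d j \<and> d j \<le> 2"
    and lg: "lg \<ge> 1" "2 * real pr * (real J + 1) * (real n + 1) \<le> 2 ^ lg" "1 / \<tau> \<le> 2 ^ lg"
    and P: "P = pr * lg"
  shows "\<exists>\<Lambda>. (\<forall>j\<le>J. \<Lambda> j \<in> grid pr (6 * pr\<^sup>2 * lg\<^sup>2 + 1)) \<and>
     (\<forall>j<J. (1 - 5 / real pr) * d j - \<tau> \<le> (\<Sum>e\<in>E. share J P \<Lambda> g e j * g e j)) \<and>
     (\<Sum>e\<in>E. \<Sum>j<J. share J P \<Lambda> g e j) \<le> (1 + 7 / real pr) * real (card A) + 5"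
proof -
  define X :: real where "X = 2 ^ lg"
  \<comment> \<open>Levels with demand below \<open>\<tau>\<close> are switched off, as the
    conclusion forgives \<open>\<tau>\<close> per level. On the others \<open>1 / D\<close> is
    bounded, and with it the multipliers.\<close>
  define Act where "Act = {j. j < J \<and> \<tau> \<le> d j}"
  define I where "I = insert J Act"
  define A' where "A' = {e \<in> A. \<sigma> e \<in> Act}"
  define E' where "E' = insert None (Some ` E)"
  define c where "c = (\<lambda>e' i. case e' of None \<Rightarrow> (if i = J then 1 else 0) | Some e \<Rightarrow> if i = J then 1 else g e i)"
  define D where "D i = (if i = J then real (card E) + 1 - real (card A') else d i)" for i
  define \<sigma>' where "\<sigma>' = (\<lambda>e'. case e' of None \<Rightarrow> J | Some e \<Rightarrow> if e \<in> A' then \<sigma> e else J)"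
  \<comment> \<open>The correction term of \<open>kkt_pnorm\<close> is \<open>\<eta>\<close> times
    at most \<open>J + 1\<close> quotients, each at most \<open>n + 1\<close>. This choice makes it
    at most \<open>1 / (pr * (n + 1))\<close>, small even after multiplication by the demand of bin
    \<open>J\<close>.\<close>
  define \<eta> where "\<eta> = 1 / ((real J + 1) * (real n + 1)\<^sup>2 * real pr)"
  \<comment> \<open>The norm with exponent \<open>P + 1\<close> has derivatives with exponent
    \<open>P\<close>, the exponent in \<open>share\<close>.\<close>
  define p where "p = Suc P"
  have X0: "0 < X" by (simp add: X_def)
  have nz: "real J + 1 \<noteq> 0" "real n + 1 \<noteq> 0" "real pr \<noteq> 0"
    using pr by auto
  have X2: "2 * real pr * (real J + 1) * (real n + 1) \<le> X" "1 / \<tau> \<le> X" using lg by (auto simp: X_def)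
  have finI: "finite I" "finite Act" "J \<in> I" "J \<notin> Act" by (auto simp: I_def Act_def)
  have "card Act \<le> card {..<J}" by (intro card_mono) (auto simp: Act_def)
  then have cAct: "card Act \<le> J" by simp
  then have cI: "real (card I) \<le> real J + 1" using finI by (simp add: I_def)
  have fA: "finite A" "finite A'" using finite_subset[OF A E(1)] by (auto simp: A'_def)
  have A'E: "A' \<subseteq> E" "card A' \<le> card A" "card A' \<le> card E"
    using A fA E by (auto simp: A'_def intro!: card_mono)
  have DJ: "1 \<le> D J" "D J \<le> real n + 1" using A'E E by (auto simp: D_def)
  have DAct: "\<tau> \<le> D j" "D j \<le> 2" "D j = d j" if "j \<in> Act" for j
    using that d(2) by (auto simp: D_def Act_def)
  have D0: "0 < D i" if "i \<in> I" for i
    using that DJ DAct \<tau> by (force simp: I_def)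
  have \<eta>0: "0 < \<eta>" using pr by (simp add: \<eta>_def)
  have c0: "0 \<le> c e i" if "e \<in> E'" "i \<in> I" for e i
    using that g by (auto simp: c_def E'_def I_def Act_def)
  have "\<exists>la \<nu>. (\<forall>i\<in>I. \<eta> / D i \<le> la i \<and> la i \<le> 1 / D i) \<and>
     (\<forall>e\<in>E'. 0 < \<nu> e \<and> (\<Sum>i\<in>I. (la i * c e i / \<nu> e) ^ p) = 1) \<and>
     (\<forall>j\<in>I. 1 \<le> (\<Sum>e\<in>E'. c e j * (la j * c e j / \<nu> e) ^ (p - 1)) / D j
           + \<eta> * (\<Sum>i\<in>I. (\<Sum>e\<in>E'. c e i * (la i * c e i / \<nu> e) ^ (p - 1)) / D i))"
  proof (rule kkt_pnorm[where \<sigma> = \<sigma>' and ?i0.0 = J])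
    show "finite E'" using E by (simp add: E'_def)
    show "0 < c e J" if "e \<in> E'" for e using that by (auto simp: c_def E'_def)
    show "\<sigma>' e \<in> I" if "e \<in> E'" for e using that by (auto simp: \<sigma>'_def E'_def I_def A'_def)
    show "D i \<le> (\<Sum>e\<in>{e \<in> E'. \<sigma>' e = i}. c e i)" if i: "i \<in> I" for i
    proof (cases "i = J")
      case True
      have eq: "{e \<in> E'. \<sigma>' e = J} = insert None (Some ` (E - A'))"
        using finI(4) by (auto simp: E'_def \<sigma>'_def A'_def split: if_splits)
      have "(\<Sum>e\<in>{e \<in> E'. \<sigma>' e = J}. c e J) = (\<Sum>e\<in>{e \<in> E'. \<sigma>' e = J}. 1)"
        by (intro sum.cong) (auto simp: c_def split: option.split)
      also have "\<dots> = real (card (insert None (Some ` (E - A'))))" by (simp add: eq)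
      also have "\<dots> = real (card (E - A')) + 1" using E by (simp add: card_image)
      also have "\<dots> = D J" using A'E fA by (simp add: D_def card_Diff_subset)
      finally show ?thesis using True by simp
    next
      case False
      then have iA: "i \<in> Act" using i by (simp add: I_def)
      have eq: "{e \<in> E'. \<sigma>' e = i} = Some ` {e \<in> A. \<sigma> e = i}"
        using False iA A by (auto simp: E'_def \<sigma>'_def A'_def split: if_splits)
      have "(\<Sum>e\<in>{e \<in> E'. \<sigma>' e = i}. c e i) = (\<Sum>e\<in>{e \<in> A. \<sigma> e = i}. g e i)"
        unfolding eq using False by (subst sum.reindex) (auto simp: c_def)
      then show ?thesis using DAct[OF iA] d(1)[of i] iA by (simp add: Act_def)
    qed
    show "real (card I) * \<eta> \<le> 1"
    proof -
      have "real (card I) * \<eta> \<le> (real J + 1) * \<eta>" using cI \<eta>0 by (intro mult_right_mono) auto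
      also have "\<dots> = 1 / ((real n + 1)\<^sup>2 * real pr)" using nz by (simp add: \<eta>_def mult.assoc)
      also have "\<dots> \<le> 1"
      proof -
        have "1 * 1 \<le> (real n + 1)\<^sup>2 * real pr" using pr by (intro mult_mono one_le_power) auto
        then show ?thesis by simp
      qed
      finally show ?thesis .
    qed
  qed (use finI c0 D0 \<eta>0 in \<open>auto simp: p_def\<close>)
  then obtain la \<nu> where K: "(\<forall>i\<in>I. \<eta> / D i \<le> la i \<and> la i \<le> 1 / D i) \<and>
     (\<forall>e\<in>E'. 0 < \<nu> e \<and> (\<Sum>i\<in>I. (la i * c e i / \<nu> e) ^ p) = 1) \<and>
     (\<forall>j\<in>I. 1 \<le> (\<Sum>e\<in>E'. c e j * (la j * c e j / \<nu> e) ^ (p - 1)) / D j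
           + \<eta> * (\<Sum>i\<in>I. (\<Sum>e\<in>E'. c e i * (la i * c e i / \<nu> e) ^ (p - 1)) / D i))"
    by blast
  have la: "\<And>i. i \<in> I \<Longrightarrow> \<eta> / D i \<le> la i \<and> la i \<le> 1 / D i"
    and \<nu>: "\<And>e. e \<in> E' \<Longrightarrow> 0 < \<nu> e" "\<And>e. e \<in> E' \<Longrightarrow> (\<Sum>i\<in>I. (la i * c e i / \<nu> e) ^ p) = 1"
    and R: "\<And>j. j \<in> I \<Longrightarrow> 1 \<le> (\<Sum>e\<in>E'. c e j * (la j * c e j / \<nu> e) ^ (p - 1)) / D j
           + \<eta> * (\<Sum>i\<in>I. (\<Sum>e\<in>E'. c e i * (la i * c e i / \<nu> e) ^ (p - 1)) / D i)"
    using K by blast+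
  define t where "t e i = la i * c e i / \<nu> e" for e i
  have la0: "0 < la i" if "i \<in> I" for i
    using la[OF that] D0[OF that] \<eta>0 by (meson divide_pos_pos less_le_trans)
  have t0: "0 \<le> t e i" if "e \<in> E'" "i \<in> I" for e i
    unfolding t_def using la0[OF that(2)] c0[OF that] \<nu>(1)[OF that(1)] by simp
  have tp: "(\<Sum>i\<in>I. t e i ^ Suc P) = 1" if "e \<in> E'" for e
    using \<nu>(2)[OF that] by (simp add: t_def p_def)
  have t1: "t e i \<le> 1" if "e \<in> E'" "i \<in> I" for e i
  proof -
    have "t e i ^ Suc P \<le> (\<Sum>i\<in>I. t e i ^ Suc P)"
      using that finI t0 by (intro member_le_sum[of i I "\<lambda>i. t e i ^ Suc P"]) (auto simp del: power_Suc)
    then have "t e i ^ Suc P \<le> 1 ^ Suc P" using tp[OF that(1)] by simp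
    then show ?thesis by (rule power_le_imp_le_base) simp
  qed
  define x where "x e i = t e i ^ P" for e i
  have x01: "0 \<le> x e i" "x e i \<le> 1" if "e \<in> E'" "i \<in> I" for e i
    using t0[OF that] t1[OF that] by (auto simp: x_def power_le_one)
  define L where "L i = (\<Sum>e\<in>E'. c e i * x e i)" for i
  have L: "1 \<le> L j / D j + \<eta> * (\<Sum>i\<in>I. L i / D i)" if "j \<in> I" for j
    using R[OF that] by (simp add: L_def x_def t_def p_def)
  have E'c: "finite E'" "real (card E') \<le> real n + 1"
    using E by (simp_all add: E'_def card_image)
  have LD: "L i / D i \<le> real n + 1" if i: "i \<in> I" for i
  proof -
    have "L i \<le> (\<Sum>e\<in>E'. D i)" unfolding L_def
    proof (rule sum_mono)
      fix e assume e: "e \<in> E'"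
      have "c e i \<le> D i"
        using e i g DJ DAct(1)[of i] \<tau> finI(4)
        by (auto simp: c_def E'_def I_def Act_def intro: order_trans split: option.split)
      then have "c e i * x e i \<le> D i * 1"
        using x01[OF e i] D0[OF i] by (intro mult_mono) auto
      then show "c e i * x e i \<le> D i" by simp
    qed
    also have "\<dots> \<le> (real n + 1) * D i" using E'c D0[OF i] by (simp add: mult_right_mono)
    finally show ?thesis using D0[OF i] by (simp add: field_simps)
  qed
  have \<eta>sum: "\<eta> * (\<Sum>i\<in>I. L i / D i) \<le> 1 / (real pr * (real n + 1))"
  proof -
    have "(\<Sum>i\<in>I. L i / D i) \<le> (\<Sum>i\<in>I. real n + 1)" using LD by (rule sum_mono)
    also have "\<dots> \<le> (real J + 1) * (real n + 1)" using cI by (simp add: mult_right_mono)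
    finally have "\<eta> * (\<Sum>i\<in>I. L i / D i) \<le> \<eta> * ((real J + 1) * (real n + 1))"
      using \<eta>0 by (intro mult_left_mono) auto
    also have "\<dots> = 1 / (real pr * (real n + 1))"
      using nz by (simp add: \<eta>_def power2_eq_square mult.assoc)
    finally show ?thesis .
  qed
  have \<eta>sum': "1 / (real pr * (real n + 1)) \<le> 1 / real pr"
    using pr mult_left_mono[of 1 "real n + 1" "real pr"] by (intro divide_left_mono) auto
  have LAct: "(1 - 1 / real pr) * d j \<le> (\<Sum>e\<in>E. g e j * x (Some e) j)" if j: "j \<in> Act" for j
  proof -
    have jI: "j \<in> I" "j \<noteq> J" using j finI by (auto simp: I_def)
    have "1 - 1 / real pr \<le> L j / D j" using L[OF jI(1)] \<eta>sum \<eta>sum' by linarith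
    then have "(1 - 1 / real pr) * d j \<le> L j"
      using D0[OF jI(1)] DAct(3)[OF j] by (simp add: field_simps)
    also have "L j = (\<Sum>e\<in>E. g e j * x (Some e) j)"
      unfolding L_def E'_def using E jI by (simp add: c_def sum.reindex)
    finally show ?thesis .
  qed
  \<comment> \<open>Bin \<open>J\<close> receives almost its whole demand, so little more than
    \<open>card A\<close> is left for the levels. This controls the number of queries.\<close>
  have LJ: "(\<Sum>e\<in>E. 1 - x (Some e) J) \<le> real (card A) + 1 / real pr"
  proof -
    have "1 - 1 / (real pr * (real n + 1)) \<le> L J / D J" using L[OF finI(3)] \<eta>sum by linarith
    then have "D J - D J / (real pr * (real n + 1)) \<le> L J"
      using DJ by (simp add: field_simps)
    moreover have "D J / (real pr * (real n + 1)) \<le> (real n + 1) / (real pr * (real n + 1))"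
      using DJ pr by (intro divide_right_mono) auto
    moreover have "(real n + 1) / (real pr * (real n + 1)) = 1 / real pr" using nz by simp
    moreover have "L J = x None J + (\<Sum>e\<in>E. x (Some e) J)"
      unfolding L_def E'_def using E by (simp add: c_def sum.reindex)
    moreover have "x None J \<le> 1" using x01[of None J] finI by (simp add: E'_def)
    ultimately have "D J - 1 / real pr \<le> 1 + (\<Sum>e\<in>E. x (Some e) J)" by linarith
    then show ?thesis using A'E by (simp add: D_def sum_subtractf)
  qed
  define \<beta> where "\<beta> = 1 + 1 / real pr"
  \<comment> \<open>Every \<open>la i\<close> lies between \<open>1 / \<Gamma>\<close> and
    \<open>\<Gamma>\<close>. A common factor of all multipliers does not change a share, so
    \<open>la\<close> is scaled by \<open>\<Gamma>\<close> to reach at least 1, where the powers of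
    the grid begin.\<close>
  define \<Gamma> where "\<Gamma> = X ^ 3"
  have \<beta>1: "1 \<le> \<beta>" by (simp add: \<beta>_def)
  have \<Gamma>0: "0 < \<Gamma>" using X0 by (simp add: \<Gamma>_def)
  have Y: "1 \<le> real pr" "1 \<le> real J + 1" "1 \<le> real n + 1" using pr by auto
  have X1: "1 \<le> X" by (simp add: X_def)
  have XG: "X \<le> \<Gamma>" unfolding \<Gamma>_def using X1 self_le_power[of X 3] by simp
  have big: "(real n + 1) / \<eta> \<le> \<Gamma>" "2 / \<eta> \<le> \<Gamma>"
  proof -
    define B where "B = real pr * (real J + 1) * (real n + 1)"
    have "1 * 1 * 1 \<le> B" unfolding B_def using Y by (intro mult_mono) auto
    then have B1: "1 \<le> B" by simp
    have "2 * B \<le> X" using X2(1) by (simp add: B_def mult.assoc)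
    then have "(2 * B) ^ 3 \<le> \<Gamma>" unfolding \<Gamma>_def using B1 by (intro power_mono) auto
    then have c: "8 * (B * B * B) \<le> \<Gamma>" by (simp add: power3_eq_cube)
    have e1: "(real n + 1) / \<eta> = B * (real n + 1) * (real n + 1)"
      by (simp add: \<eta>_def B_def power2_eq_square)
    have e2: "2 / \<eta> = 2 * B * (real n + 1)"
      by (simp add: \<eta>_def B_def power2_eq_square)
    have nB: "real n + 1 \<le> B"
    proof -
      have "1 * 1 * (real n + 1) \<le> B" unfolding B_def using Y by (intro mult_mono) auto
      then show ?thesis by simp
    qed
    have b1: "B * (real n + 1) * (real n + 1) \<le> B * B * B"
      using nB B1 by (intro mult_mono) auto
    have b2: "2 * B * (real n + 1) * 1 \<le> 2 * B * B * B"
      using nB B1 by (intro mult_mono) auto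
    have b0: "0 \<le> B * B * B" using B1 by simp
    show "(real n + 1) / \<eta> \<le> \<Gamma>" unfolding e1 using b1 c b0 by linarith
    show "2 / \<eta> \<le> \<Gamma>" unfolding e2 using b2 c b0 by linarith
  qed
  have la\<Gamma>: "1 / \<Gamma> \<le> la i" "la i \<le> \<Gamma>" if i: "i \<in> I" for i
  proof -
    have DX: "D i / \<eta> \<le> \<Gamma> \<and> 1 / D i \<le> \<Gamma>"
    proof (cases "i = J")
      case True
      have "D J / \<eta> \<le> (real n + 1) / \<eta>" using DJ \<eta>0 by (intro divide_right_mono) auto
      moreover have "1 / D J \<le> 1" using DJ by simp
      ultimately show ?thesis using True big X1 XG by simp
    next
      case False
      then have iA: "i \<in> Act" using i by (simp add: I_def)
      have "D i / \<eta> \<le> 2 / \<eta>" using DAct[OF iA] \<eta>0 by (intro divide_right_mono) auto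
      moreover have "1 / D i \<le> 1 / \<tau>" using DAct[OF iA] \<tau> by (intro divide_left_mono) auto
      ultimately show ?thesis using big X2 XG by simp
    qed
    have "1 / \<Gamma> \<le> \<eta> / D i" using DX D0[OF i] \<eta>0 \<Gamma>0 by (simp add: field_simps)
    then show "1 / \<Gamma> \<le> la i" using la[OF i] by simp
    show "la i \<le> \<Gamma>" using la[OF i] DX by simp
  qed
  \<comment> \<open>The origin of the grid size: \<open>(\<Gamma> * \<Gamma>) ^ P\<close> is
    \<open>2 ^ (6 * lg * P)\<close>, each doubling takes at most \<open>pr\<close> grid steps, and
    \<open>P = pr * lg\<close>.\<close>
  have ex: "\<exists>k\<le>6 * pr\<^sup>2 * lg\<^sup>2. (la i * \<Gamma>) ^ P \<le> \<beta> ^ k \<and> \<beta> ^ k \<le> \<beta> * (la i * \<Gamma>) ^ P"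
    if i: "i \<in> I" for i
    unfolding \<beta>_def
  proof (rule grid_point)
    have "1 \<le> la i * \<Gamma>" using la\<Gamma>(1)[OF i] \<Gamma>0 by (simp add: field_simps)
    then show "1 \<le> (la i * \<Gamma>) ^ P" by (rule one_le_power)
    have "(la i * \<Gamma>) ^ P \<le> (\<Gamma> * \<Gamma>) ^ P"
      using la\<Gamma>[OF i] \<Gamma>0 la0[OF i] by (intro power_mono mult_right_mono) auto
    also have "\<dots> = 2 ^ (6 * lg * P)"
      by (simp add: \<Gamma>_def X_def power_mult[symmetric] power_add[symmetric] algebra_simps)
    also have "\<dots> \<le> ((1 + 1 / real pr) ^ pr) ^ (6 * lg * P)"
      using two_le_power[of pr] pr by (intro power_mono) auto
    also have "\<dots> = (1 + 1 / real pr) ^ (6 * pr\<^sup>2 * lg\<^sup>2)"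
      by (simp add: P power_mult[symmetric] power2_eq_square mult_ac)
    finally show "(la i * \<Gamma>) ^ P \<le> (1 + 1 / real pr) ^ (6 * pr\<^sup>2 * lg\<^sup>2)" .
  qed (use pr in auto)
  then obtain k where k: "\<And>i. i \<in> I \<Longrightarrow> k i \<le> 6 * pr\<^sup>2 * lg\<^sup>2 \<and> (la i * \<Gamma>) ^ P \<le> \<beta> ^ k i \<and> \<beta> ^ k i \<le> \<beta> * (la i * \<Gamma>) ^ P"
    by metis
  define \<Lambda> where "\<Lambda> i = (if i \<in> I then \<beta> ^ k i else 0)" for i
  have "\<forall>j\<le>J. \<Lambda> j \<in> grid pr (6 * pr\<^sup>2 * lg\<^sup>2 + 1)"
    using k by (auto simp: \<Lambda>_def grid_def \<beta>_def less_Suc_eq_le)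
  moreover
  define th where "th = 1 - 1 / real pr"
  have th: "0 < th" "1 / th \<le> 1 + 2 / real pr" using pr by (auto simp: th_def field_simps)
  \<comment> \<open>The reason for \<open>P = pr * lg\<close>: bins with \<open>t\<close> below
    \<open>th\<close> contribute at most \<open>1 / X\<close> each to a sum of \<open>P\<close>-th
    powers.\<close>
  have thP: "th ^ P \<le> 1 / X"
  proof -
    have "th ^ P = (th ^ pr) ^ lg" by (simp add: P power_mult)
    also have "\<dots> \<le> (1 / 2) ^ lg" using power_le_half[OF pr] th by (intro power_mono) (auto simp: th_def)
    finally show ?thesis by (simp add: X_def power_one_over)
  qed
  \<comment> \<open>The optimality conditions normalise the powers with exponent
    \<open>P + 1\<close>, but \<open>share\<close> those with exponent \<open>P\<close>. The
    discrepancy \<open>\<xi>\<close> is at most \<open>1 + 3 / pr\<close>.\<close>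
  define \<xi> where "\<xi> e = (\<Sum>i\<in>I. x e i)" for e
  have \<xi>: "1 \<le> \<xi> e" "\<xi> e \<le> 1 + 3 / real pr" if e: "e \<in> E'" for e
  proof -
    have "1 = (\<Sum>i\<in>I. t e i ^ Suc P)" using tp[OF e] by simp
    also have "\<dots> \<le> \<xi> e" unfolding \<xi>_def x_def
      using t0[OF e] t1[OF e] by (intro sum_mono power_decreasing) auto
    finally show "1 \<le> \<xi> e" .
    have "\<xi> e \<le> (\<Sum>i\<in>I. t e i ^ Suc P) / th + real (card I) * th ^ P"
      unfolding \<xi>_def x_def using finI th t0[OF e] by (intro sum_power_le) auto
    also have "\<dots> \<le> (1 + 2 / real pr) + (real J + 1) * (1 / X)"
      using th thP cI tp[OF e] by (intro add_mono mult_mono) auto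
    also have "(real J + 1) * (1 / X) \<le> 1 / real pr"
    proof -
      have "real pr * (real J + 1) * 1 \<le> (2 * real pr * (real J + 1)) * (real n + 1)"
        using pr by (intro mult_mono) auto
      then have "real pr * (real J + 1) \<le> X" using X2 by simp
      then show ?thesis using pr X0 by (simp add: field_simps)
    qed
    finally show "\<xi> e \<le> 1 + 3 / real pr" by simp
  qed
  \<comment> \<open>Up to the grid ratio, the weights in \<open>share\<close> are \<open>s e\<close>
    times \<open>x\<close>. This factor is the same for all bins of an edge and cancels in the
    quotient.\<close>
  define s where "s e = (\<Gamma> * \<nu> (Some e)) ^ P" for e
  have s0: "0 < s e" if "e \<in> E" for e using \<Gamma>0 \<nu>(1)[of "Some e"] that by (simp add: s_def E'_def)
  define w where "w e i = \<Lambda> i * c (Some e) i ^ P" for e i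
  have w: "s e * x (Some e) i \<le> w e i" "w e i \<le> \<beta> * (s e * x (Some e) i)" if e: "e \<in> E" and i: "i \<in> I" for e i
  proof -
    have eE: "Some e \<in> E'" using e by (simp add: E'_def)
    have eq: "s e * x (Some e) i = (la i * \<Gamma>) ^ P * c (Some e) i ^ P"
      using \<nu>(1)[OF eE] by (simp add: s_def x_def t_def power_mult_distrib[symmetric])
        (simp add: mult_ac)
    show "s e * x (Some e) i \<le> w e i" unfolding eq w_def
      using k[OF i] c0[OF eE i] i by (intro mult_right_mono) (auto simp: \<Lambda>_def)
    have "w e i \<le> \<beta> * (la i * \<Gamma>) ^ P * c (Some e) i ^ P" unfolding w_def
      using k[OF i] c0[OF eE i] i by (intro mult_right_mono) (auto simp: \<Lambda>_def)
    then show "w e i \<le> \<beta> * (s e * x (Some e) i)" unfolding eq by simp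
  qed
  define W where "W e = (\<Sum>i\<in>I. w e i)" for e
  have Weq: "\<Lambda> J + (\<Sum>k<J. \<Lambda> k * g e k ^ P) = W e" for e
  proof -
    have "(\<Sum>k<J. \<Lambda> k * g e k ^ P) = (\<Sum>k\<in>Act. w e k)"
      by (rule sum.mono_neutral_cong_right) (auto simp: Act_def \<Lambda>_def I_def w_def c_def)
    then show ?thesis unfolding W_def I_def using finI by (simp add: w_def c_def)
  qed
  have W: "s e * \<xi> (Some e) \<le> W e" "W e \<le> \<beta> * (s e * \<xi> (Some e))" if e: "e \<in> E" for e
    unfolding W_def \<xi>_def sum_distrib_left using w[OF e] by (auto intro!: sum_mono)
  have sh_eq: "share J P \<Lambda> g e j = (if j \<in> Act then w e j / W e else 0)" if "j < J" for e j
    unfolding share_def Weq using that by (auto simp: w_def c_def \<Lambda>_def I_def)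
  have W0: "0 < W e" if e: "e \<in> E" for e
  proof -
    have "0 < s e * \<xi> (Some e)" using s0[OF e] \<xi>(1)[of "Some e"] e by (simp add: E'_def)
    then show ?thesis using W(1)[OF e] by linarith
  qed
  have loads: "(1 - 5 / real pr) * d j - \<tau> \<le> (\<Sum>e\<in>E. share J P \<Lambda> g e j * g e j)" if j: "j < J" for j
  proof (cases "j \<in> Act")
    case False
    have "(1 - 5 / real pr) * d j - \<tau> \<le> 0"
    proof -
      have "(1 - 5 / real pr) * d j \<le> 1 * d j" using d(2)[OF j] by (intro mult_right_mono) auto
      moreover have "d j < \<tau>" using \<open>j \<notin> Act\<close> j by (simp add: Act_def)
      ultimately show ?thesis by simp
    qed
    then show ?thesis using sh_eq[OF j] False by simp
  next
    case True
    have jI: "j \<in> I" using True by (simp add: I_def)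
    have q: "0 \<le> 1 - 1 / real pr" "1 - 5 / real pr \<le> (1 - 1 / real pr) / (\<beta> * (1 + 3 / real pr))"
    proof -
      show "0 \<le> 1 - 1 / real pr" using pr by simp
      have "(1 - 5 / real pr) * (\<beta> * (1 + 3 / real pr)) \<le> 1 - 1 / real pr"
        using pr by (simp add: \<beta>_def field_simps)
      then show "1 - 5 / real pr \<le> (1 - 1 / real pr) / (\<beta> * (1 + 3 / real pr))"
        using \<beta>1 by (subst pos_le_divide_eq) (auto intro!: mult_pos_pos add_pos_nonneg)
    qed
    have d0: "0 \<le> d j" using True \<tau> by (simp add: Act_def)
    have "(1 - 5 / real pr) * d j \<le> (1 - 1 / real pr) * d j / (\<beta> * (1 + 3 / real pr))"
      using mult_right_mono[OF q(2) d0] by simp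
    also have "\<dots> \<le> (\<Sum>e\<in>E. g e j * x (Some e) j) / (\<beta> * (1 + 3 / real pr))"
      using LAct[OF True] \<beta>1 by (intro divide_right_mono) auto
    also have "\<dots> = (\<Sum>e\<in>E. x (Some e) j / (\<beta> * (1 + 3 / real pr)) * g e j)"
      by (simp add: sum_divide_distrib mult_ac)
    also have "\<dots> \<le> (\<Sum>e\<in>E. share J P \<Lambda> g e j * g e j)"
    proof (intro sum_mono mult_right_mono)
      fix e assume e: "e \<in> E"
      then have eE: "Some e \<in> E'" by (simp add: E'_def)
      show "0 \<le> g e j" using g e j by simp
      have "x (Some e) j / (\<beta> * (1 + 3 / real pr)) \<le> x (Some e) j / (\<beta> * \<xi> (Some e))"
        using \<xi>[OF eE] x01[OF eE jI] \<beta>1 by (intro divide_left_mono mult_left_mono mult_pos_pos) auto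
      also have "\<dots> = s e * x (Some e) j / (\<beta> * (s e * \<xi> (Some e)))" using s0[OF e] by simp
      also have "\<dots> \<le> w e j / (\<beta> * (s e * \<xi> (Some e)))"
        using w(1)[OF e jI] s0[OF e] \<xi>[OF eE] \<beta>1 by (intro divide_right_mono) auto
      also have "\<dots> \<le> w e j / W e"
      proof (rule divide_left_mono[OF W(2)[OF e]])
        show "0 \<le> w e j" using w(1)[OF e jI] s0[OF e] x01[OF eE jI]
          by (meson less_imp_le mult_nonneg_nonneg order_trans)
        show "0 < \<beta> * (s e * \<xi> (Some e)) * W e"
          using W0[OF e] s0[OF e] \<xi>[OF eE] \<beta>1 by (intro mult_pos_pos) auto
      qed
      finally show "x (Some e) j / (\<beta> * (1 + 3 / real pr)) \<le> share J P \<Lambda> g e j"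
        using sh_eq[OF j] True by simp
    qed
    finally show ?thesis using \<tau> by simp
  qed
  \<comment> \<open>Over \<open>Act\<close> the powers of \<open>t\<close> with exponent
    \<open>P + 1\<close> sum to exactly one minus the power at \<open>J\<close>.
    \<open>one_minus_power_Suc_le\<close> compares this with \<open>1 - x (Some e) J\<close>, whose
    total is bounded by \<open>LJ\<close>.\<close>
  moreover have "(\<Sum>e\<in>E. \<Sum>j<J. share J P \<Lambda> g e j) \<le> (1 + 7 / real pr) * real (card A) + 5"
  proof -
    have P0: "0 < P" "real pr \<le> real P" using lg pr by (auto simp: P)
    have "(\<Sum>e\<in>E. \<Sum>j<J. share J P \<Lambda> g e j) \<le>
      (\<Sum>e\<in>E. \<beta> * ((1 + 2 / real pr) * ((1 + 1 / real pr) * (1 - x (Some e) J)) + real J / X))"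
    proof (rule sum_mono)
      fix e assume e: "e \<in> E"
      then have eE: "Some e \<in> E'" by (simp add: E'_def)
      have "(\<Sum>j<J. share J P \<Lambda> g e j) = (\<Sum>j\<in>Act. w e j / W e)"
        by (rule sum.mono_neutral_cong_right) (auto simp: Act_def sh_eq)
      also have "\<dots> \<le> (\<Sum>j\<in>Act. \<beta> * x (Some e) j)"
      proof (rule sum_mono)
        fix j assume "j \<in> Act"
        then have jI: "j \<in> I" by (simp add: I_def)
        have "s e \<le> W e"
        proof -
          have "s e * 1 \<le> s e * \<xi> (Some e)"
            by (rule mult_left_mono[OF \<xi>(1)[OF eE]]) (use s0[OF e] in simp)
          then show ?thesis using W(1)[OF e] by simp
        qed
        then have "\<beta> * (s e * x (Some e) j) \<le> \<beta> * (W e * x (Some e) j)"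
          using x01[OF eE jI] \<beta>1 by (intro mult_left_mono mult_right_mono) auto
        then show "w e j / W e \<le> \<beta> * x (Some e) j"
          using w(2)[OF e jI] W0[OF e] by (simp add: field_simps)
      qed
      also have "\<dots> = \<beta> * (\<Sum>j\<in>Act. x (Some e) j)" by (simp add: sum_distrib_left)
      also have "\<dots> \<le> \<beta> * ((1 + 2 / real pr) * ((1 + 1 / real pr) * (1 - x (Some e) J)) + real J / X)"
      proof (rule mult_left_mono)
        have "(\<Sum>j\<in>Act. x (Some e) j) \<le> (\<Sum>i\<in>Act. t (Some e) i ^ Suc P) / th + real (card Act) * th ^ P"
          unfolding x_def using finI th t0[OF eE] by (intro sum_power_le) (auto simp: I_def)
        also have "(\<Sum>i\<in>Act. t (Some e) i ^ Suc P) = 1 - t (Some e) J ^ Suc P"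
          using tp[OF eE] finI by (simp add: I_def)
        also have "(1 - t (Some e) J ^ Suc P) / th \<le> (1 + 2 / real pr) * ((1 + 1 / real pr) * (1 - x (Some e) J))"
        proof -
          have "1 - t (Some e) J ^ Suc P \<le> (1 + 1 / real P) * (1 - x (Some e) J)"
            unfolding x_def using t0[OF eE finI(3)] t1[OF eE finI(3)] P0 by (intro one_minus_power_Suc_le) auto
          also have "\<dots> \<le> (1 + 1 / real pr) * (1 - x (Some e) J)"
            using P0 pr x01[OF eE finI(3)] by (intro mult_right_mono add_left_mono divide_left_mono) auto
          finally have "(1 - t (Some e) J ^ Suc P) * (1 / th) \<le> ((1 + 1 / real pr) * (1 - x (Some e) J)) * (1 + 2 / real pr)"
            using th x01[OF eE finI(3)] by (intro mult_mono) auto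
          then show ?thesis by (simp add: mult_ac)
        qed
        also have "real (card Act) * th ^ P \<le> real J * (1 / X)"
          using cAct thP th by (intro mult_mono) auto
        finally show "(\<Sum>j\<in>Act. x (Some e) j) \<le> (1 + 2 / real pr) * ((1 + 1 / real pr) * (1 - x (Some e) J)) + real J / X"
          by simp
      qed (use \<beta>1 in simp)
      finally show "(\<Sum>j<J. share J P \<Lambda> g e j) \<le> \<beta> * ((1 + 2 / real pr) * ((1 + 1 / real pr) * (1 - x (Some e) J)) + real J / X)" .
    qed
    also have "\<dots> = \<beta> * ((1 + 2 / real pr) * (1 + 1 / real pr)) * (\<Sum>e\<in>E. 1 - x (Some e) J) + \<beta> * (real (card E) * (real J / X))"
    proof -
      have "(\<Sum>e\<in>E. \<beta> * (a * (b * h e) + r)) = \<beta> * (a * b) * (\<Sum>e\<in>E. h e) + \<beta> * (real (card E) * r)"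
        for a b r and h :: "'e \<Rightarrow> real"
        by (simp add: sum_distrib_left sum.distrib algebra_simps)
      then show ?thesis .
    qed
    also have "\<dots> \<le> \<beta> * ((1 + 2 / real pr) * (1 + 1 / real pr)) * (real (card A) + 1 / real pr) + 2 * 1"
    proof (intro add_mono mult_mono mult_left_mono LJ)
      show "\<beta> \<le> 2" using pr by (simp add: \<beta>_def)
      have "real (card E) * real J \<le> (real n + 1) * (real J + 1)" using E by (intro mult_mono) auto
      also have "\<dots> \<le> (2 * real pr) * ((real n + 1) * (real J + 1))"
        using pr mult_right_mono[of 1 "2 * real pr" "(real n + 1) * (real J + 1)"] by simp
      also have "\<dots> \<le> X" using X2(1) by (simp only: mult_ac)
      finally have "real (card E) * real J \<le> X" .
      then show "real (card E) * (real J / X) \<le> 1" using X0 by (simp add: field_simps)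
      show "0 \<le> (\<Sum>e\<in>E. 1 - x (Some e) J)"
        using x01 finI by (intro sum_nonneg) (simp add: E'_def)
    qed (use \<beta>1 X0 in auto)
    also have "\<dots> \<le> (1 + 7 / real pr) * (real (card A) + 1 / real pr) + 2"
    proof -
      have "\<beta> * ((1 + 2 / real pr) * (1 + 1 / real pr)) \<le> 1 + 7 / real pr"
      proof -
        define u where "u = 1 / real pr"
        have u: "0 \<le> u" "u \<le> 1/2" using pr by (auto simp: u_def field_simps)
        have "u * u \<le> u * (1/2)" using u by (intro mult_left_mono) auto
        moreover have "u * u * u \<le> u * (1/2) * (1/2)" using u by (intro mult_mono) auto
        moreover have "(1 + u) * ((1 + 2 * u) * (1 + u)) = 1 + 4 * u + 5 * (u * u) + 2 * (u * u * u)"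
          by (simp add: algebra_simps)
        ultimately have "(1 + u) * ((1 + 2 * u) * (1 + u)) \<le> 1 + 7 * u" by linarith
        then show ?thesis by (simp add: u_def \<beta>_def)
      qed
      then show ?thesis by (intro add_mono mult_right_mono) auto
    qed
    also have "\<dots> \<le> (1 + 7 / real pr) * real (card A) + 5"
    proof -
      have "(1 + 7 / real pr) * (1 / real pr) \<le> (1 + 7 / 2) * (1 / 2)"
        using pr by (intro mult_mono add_left_mono divide_left_mono) auto
      then show ?thesis by (simp add: algebra_simps)
    qed
    finally show ?thesis .
  qed
  ultimately show ?thesis by (intro exI[of _ \<Lambda>]) blast
qed

section \<open>Derandomised rounding\<close>

text \<open>\<open>R\<close> is the excess of what has been placed over what the fractional
  assignment \<open>y\<close> prescribes: in gains for each level, and in the number of placed edges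
  at index \<open>J\<close>. The prescribed amounts are subtracted here, and \<open>radd\<close>
  adds the choice made.\<close>

definition rsub :: "nat \<Rightarrow> (nat \<Rightarrow> nat \<Rightarrow> real) \<Rightarrow> (nat \<Rightarrow> nat \<Rightarrow> real) \<Rightarrow> (nat \<Rightarrow> real) \<Rightarrow> nat \<Rightarrow> nat \<Rightarrow> real" where
  "rsub J y g R e j = (if j < J then R j - y e j * g e j else R j - (\<Sum>k<J. y e k))"

definition rgain :: "nat \<Rightarrow> (nat \<Rightarrow> nat \<Rightarrow> real) \<Rightarrow> real \<Rightarrow> (nat \<Rightarrow> real) \<Rightarrow> (nat \<Rightarrow> real) \<Rightarrow> nat \<Rightarrow> nat \<Rightarrow> real" where
  "rgain J g \<kappa> L R e j = (2 * R j * g e j + g e j * g e j) / L j + \<kappa> * (2 * R J + 1) / L J"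

text \<open>A minimum together with its index. The start value \<open>(0, J)\<close> stands for
  leaving the edge out, and the strict comparison keeps it unless some entry is negative.\<close>

primrec scan :: "nat \<Rightarrow> (nat \<Rightarrow> real) \<Rightarrow> nat \<Rightarrow> real \<times> nat" where
  "scan J v 0 = (0, J)"
| "scan J v (Suc k) = (if v k < fst (scan J v k) then (v k, k) else scan J v k)"

definition rpick where
  "rpick J y g \<kappa> L R e = snd (scan J (rgain J g \<kappa> L (rsub J y g R e) e) J)"

definition radd :: "nat \<Rightarrow> (nat \<Rightarrow> nat \<Rightarrow> real) \<Rightarrow> (nat \<Rightarrow> real) \<Rightarrow> nat \<Rightarrow> nat \<Rightarrow> nat \<Rightarrow> real" where
  "radd J g R e p j = (if p < J then (if j = p then R j + g e j else if j = J then R j + 1 else R j) else R j)"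

primrec rres where
  "rres J y g \<kappa> L F 0 = (\<lambda>_. 0 :: real)"
| "rres J y g \<kappa> L F (Suc e) = (if F e then
     radd J g (rsub J y g (rres J y g \<kappa> L F e) e) e (rpick J y g \<kappa> L (rres J y g \<kappa> L F e) e)
   else rres J y g \<kappa> L F e)"

definition rchoice where
  "rchoice J y g \<kappa> L F e = rpick J y g \<kappa> L (rres J y g \<kappa> L F e) e"

lemma scan_le: "fst (scan J v k) \<le> 0" "j < k \<Longrightarrow> fst (scan J v k) \<le> v j"
proof -
  show "fst (scan J v k) \<le> 0" by (induction k) auto
  show "j < k \<Longrightarrow> fst (scan J v k) \<le> v j" by (induction k) (auto simp: less_Suc_eq)
qed

lemma scan_snd: "(snd (scan J v k) = J \<and> fst (scan J v k) = 0) \<or> (snd (scan J v k) < k \<and> v (snd (scan J v k)) = fst (scan J v k))"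
  by (induction k) auto

text \<open>Squared excesses relative to their expected size: under independent rounding the
  variance is at most \<open>\<tau> * L j\<close> for a level and at most \<open>L J\<close> for the
  count. The weight \<open>\<kappa>\<close>, later \<open>\<tau>\<close>, puts the count on the same
  scale as the levels.\<close>

definition rpot where
  "rpot J \<kappa> L R = (\<Sum>j<J. R j * R j / L j) + \<kappa> * (R J * R J) / (L J :: real)"

lemma rpot_radd:
  assumes "p < J"
  shows "rpot J \<kappa> L (radd J g R e p) = rpot J \<kappa> L R + rgain J g \<kappa> L R e p"
proof -
  have "(\<Sum>j<J. radd J g R e p j * radd J g R e p j / L j)
      = (\<Sum>j<J. R j * R j / L j + (if j = p then (2 * R j * g e j + g e j * g e j) / L j else 0))"
    using assms by (intro sum.cong) (auto simp: radd_def algebra_simps add_divide_distrib)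
  also have "\<dots> = (\<Sum>j<J. R j * R j / L j) + (2 * R p * g e p + g e p * g e p) / L p"
    using assms by (simp add: sum.distrib)
  finally show ?thesis using assms
    by (simp add: rpot_def rgain_def radd_def algebra_simps add_divide_distrib)
qed

lemma rpot_step:
  assumes y: "\<And>j. j < J \<Longrightarrow> 0 \<le> y e j" "(\<Sum>j<J. y e j) \<le> 1" and \<kappa>: "0 \<le> \<kappa>" and L: "\<And>j. j \<le> J \<Longrightarrow> 0 \<le> L j"
  shows "rpot J \<kappa> L (radd J g (rsub J y g R e) e (rpick J y g \<kappa> L R e))
    \<le> rpot J \<kappa> L R + ((\<Sum>j<J. y e j * (g e j * g e j) / L j) + \<kappa> * (\<Sum>j<J. y e j) / L J)"
proof -
  define R' where "R' = rsub J y g R e"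
  define v where "v = rgain J g \<kappa> L R' e"
  define p where "p = rpick J y g \<kappa> L R e"
  define b where "b = fst (scan J v J)"
  have p: "p = snd (scan J v J)" by (simp add: p_def rpick_def v_def R'_def)
  have eq: "rpot J \<kappa> L (radd J g R' e p) = rpot J \<kappa> L R' + b"
    using scan_snd[of J v J]
  proof
    assume "snd (scan J v J) = J \<and> fst (scan J v J) = 0"
    then have "radd J g R' e p = R'" "b = 0" by (auto simp: radd_def p b_def)
    then show ?thesis by simp
  next
    assume "snd (scan J v J) < J \<and> v (snd (scan J v J)) = fst (scan J v J)"
    then show ?thesis using rpot_radd[of p J \<kappa> L g R' e] by (simp add: p b_def v_def)
  qed
  have b0: "b \<le> 0" "\<And>j. j < J \<Longrightarrow> b \<le> v j" by (auto simp: b_def scan_le)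
  \<comment> \<open>The best choice is no worse than the average under \<open>y\<close>, where
    leaving the edge out, with increase 0, takes the probability missing to 1.\<close>
  have "b \<le> (\<Sum>j<J. y e j) * b" using mult_right_mono_neg[OF y(2) b0(1)] by simp
  also have "\<dots> = (\<Sum>j<J. y e j * b)" by (simp add: sum_distrib_right)
  also have "\<dots> \<le> (\<Sum>j<J. y e j * v j)" using b0 y by (intro sum_mono mult_left_mono) auto
  also have "\<dots> = (\<Sum>j<J. y e j * (2 * R' j * g e j + g e j * g e j) / L j) + (\<Sum>j<J. y e j) * (\<kappa> * (2 * R' J + 1) / L J)"
  proof -
    have "(\<Sum>j<J. y e j * (X j + K)) = (\<Sum>j<J. y e j * X j) + (\<Sum>j<J. y e j) * K" for X K
      by (simp add: distrib_left sum.distrib sum_distrib_right)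
    from this[of "\<lambda>j. (2 * R' j * g e j + g e j * g e j) / L j" "\<kappa> * (2 * R' J + 1) / L J"]
    show ?thesis by (simp add: v_def rgain_def)
  qed
  finally have b: "b \<le> \<dots>" .
  have "(\<Sum>j<J. R' j * R' j / L j) + (\<Sum>j<J. y e j * (2 * R' j * g e j + g e j * g e j) / L j)
      = (\<Sum>j<J. (R' j * R' j + y e j * (2 * R' j * g e j + g e j * g e j)) / L j)"
    by (simp add: sum.distrib add_divide_distrib)
  also have "\<dots> \<le> (\<Sum>j<J. (R j * R j + y e j * (g e j * g e j)) / L j)"
  proof (intro sum_mono divide_right_mono)
    fix j assume j: "j \<in> {..<J}"
    have R'j: "R' j = R j - y e j * g e j" using j by (simp add: R'_def rsub_def)
    have "R' j * R' j + y e j * (2 * R' j * g e j + g e j * g e j)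
        = R j * R j + y e j * (g e j * g e j) - (y e j * g e j) * (y e j * g e j)"
      unfolding R'j by (simp add: algebra_simps)
    moreover have "0 \<le> (y e j * g e j) * (y e j * g e j)" by simp
    ultimately show "R' j * R' j + y e j * (2 * R' j * g e j + g e j * g e j) \<le> R j * R j + y e j * (g e j * g e j)"
      by linarith
  qed (use L in auto)
  also have "\<dots> = (\<Sum>j<J. R j * R j / L j) + (\<Sum>j<J. y e j * (g e j * g e j) / L j)"
    by (simp add: sum.distrib add_divide_distrib)
  finally have 1: "(\<Sum>j<J. R' j * R' j / L j) + (\<Sum>j<J. y e j * (2 * R' j * g e j + g e j * g e j) / L j) \<le> \<dots>" .
  define c where "c = (\<Sum>j<J. y e j)"
  have "\<kappa> * (R' J * R' J) / L J + c * (\<kappa> * (2 * R' J + 1) / L J) = \<kappa> * (R J * R J + c - c * c) / L J"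
  proof -
    have R'J: "R' J = R J - c" by (simp add: R'_def rsub_def c_def)
    show ?thesis unfolding R'J by (simp add: algebra_simps add_divide_distrib diff_divide_distrib)
  qed
  also have "\<dots> \<le> \<kappa> * (R J * R J + c) / L J"
    using \<kappa> L[of J] by (intro divide_right_mono mult_left_mono) auto
  also have "\<dots> = \<kappa> * (R J * R J) / L J + \<kappa> * c / L J" by (simp add: algebra_simps add_divide_distrib)
  finally have 2: "\<kappa> * (R' J * R' J) / L J + c * (\<kappa> * (2 * R' J + 1) / L J) \<le> \<dots>" .
  have "rpot J \<kappa> L (radd J g R' e p) \<le> rpot J \<kappa> L R + ((\<Sum>j<J. y e j * (g e j * g e j) / L j) + \<kappa> * c / L J)"
    using eq b 1 2 unfolding rpot_def c_def[symmetric] by linarith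
  then show ?thesis by (simp add: R'_def p_def c_def)
qed

text \<open>Derandomisation by the method of conditional expectations, with the variance as potential:
  choosing bin \<open>j\<close> with probability \<open>y e j\<close> would increase the potential by at most the stated
  amount in expectation.\<close>

lemma greedy_rounding:
  fixes y g :: "nat \<Rightarrow> nat \<Rightarrow> real" and F :: "nat \<Rightarrow> bool" and L :: "nat \<Rightarrow> real" and J n :: nat and \<tau> :: real
  defines "Fs \<equiv> {e. e < n \<and> F e}"
  assumes y: "\<And>e j. e < n \<Longrightarrow> j < J \<Longrightarrow> 0 \<le> y e j" "\<And>e. e < n \<Longrightarrow> (\<Sum>j<J. y e j) \<le> 1"
    and g: "\<And>e j. e < n \<Longrightarrow> j < J \<Longrightarrow> 0 \<le> g e j \<and> g e j \<le> \<tau>" and \<tau>: "0 < \<tau>" and pr: "pr > 0"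
    and L: "\<And>j. j < J \<Longrightarrow> L j = (\<Sum>e\<in>Fs. y e j * g e j)" "L J = (\<Sum>e\<in>Fs. \<Sum>j<J. y e j)"
  defines "ch \<equiv> rchoice J y g \<tau> L F"
  shows "L J = 0 \<Longrightarrow> ch e = J"
    and "\<And>j. j < J \<Longrightarrow> L j - L j / real pr - real pr * ((real J + 1) * \<tau>) \<le> (\<Sum>e\<in>{e\<in>Fs. ch e = j}. g e j)"
    and "real (card {e\<in>Fs. ch e < J}) \<le> L J + L J / real pr + real pr * (real J + 1)"
proof -
  define R where "R = rres J y g \<tau> L F"
  have finF: "finite Fs" by (simp add: Fs_def)
  have L0: "0 \<le> L j" if "j \<le> J" for j
    using that y g by (cases "j = J") (auto simp: L Fs_def intro!: sum_nonneg mult_nonneg_nonneg)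
  have res: "(\<forall>j<J. R k j = (\<Sum>e\<in>{e\<in>Fs. e < k \<and> ch e = j}. g e j) - (\<Sum>e\<in>{e\<in>Fs. e < k}. y e j * g e j)) \<and>
     R k J = real (card {e\<in>Fs. e < k \<and> ch e < J}) - (\<Sum>e\<in>{e\<in>Fs. e < k}. \<Sum>j<J. y e j)"
    if "k \<le> n" for k
    using that
  proof (induction k)
    case 0
    then show ?case by (simp add: R_def)
  next
    case (Suc k)
    show ?case
    proof (cases "F k")
      case False
      then have "{e\<in>Fs. e < Suc k \<and> Q e} = {e\<in>Fs. e < k \<and> Q e}" for Q by (auto simp: Fs_def less_Suc_eq)
      from this[of "\<lambda>_. True"] this Suc False show ?thesis by (simp add: R_def)
    next
      case True
      have kF: "k \<in> Fs" using True Suc.prems by (simp add: Fs_def)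
      have s1: "{e\<in>Fs. e < Suc k \<and> Q e} = (if Q k then insert k {e\<in>Fs. e < k \<and> Q e} else {e\<in>Fs. e < k \<and> Q e})" for Q
        using kF by (auto simp: less_Suc_eq)
      have s2: "{e\<in>Fs. e < Suc k} = insert k {e\<in>Fs. e < k}" using s1[of "\<lambda>_. True"] by simp
      have RS: "R (Suc k) = radd J g (rsub J y g (R k) k) k (ch k)"
        using True by (simp add: R_def ch_def rchoice_def)
      show ?thesis using Suc finF
        by (auto simp: RS s1 s2 radd_def rsub_def)
    qed
  qed
  have pot: "rpot J \<tau> L (R k) \<le> (\<Sum>e\<in>{e\<in>Fs. e < k}. (\<Sum>j<J. y e j * (g e j * g e j) / L j) + \<tau> * (\<Sum>j<J. y e j) / L J)"
    if "k \<le> n" for k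
    using that
  proof (induction k)
    case 0
    then show ?case by (simp add: R_def rpot_def)
  next
    case (Suc k)
    show ?case
    proof (cases "F k")
      case False
      then have "{e\<in>Fs. e < Suc k} = {e\<in>Fs. e < k}" by (auto simp: Fs_def less_Suc_eq)
      then show ?thesis using Suc False by (simp add: R_def)
    next
      case True
      have kF: "k \<in> Fs" using True Suc.prems by (simp add: Fs_def)
      have s2: "{e\<in>Fs. e < Suc k} = insert k {e\<in>Fs. e < k}" using kF by (auto simp: less_Suc_eq)
      have RS: "R (Suc k) = radd J g (rsub J y g (R k) k) k (rpick J y g \<tau> L (R k) k)"
        using True by (simp add: R_def)
      have "rpot J \<tau> L (R (Suc k)) \<le> rpot J \<tau> L (R k) + ((\<Sum>j<J. y k j * (g k j * g k j) / L j) + \<tau> * (\<Sum>j<J. y k j) / L J)"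
        unfolding RS using Suc.prems y \<tau> L0 by (intro rpot_step) auto
      then show ?thesis using Suc finF by (simp add: s2)
    qed
  qed
  \<comment> \<open>Each level contributes at most \<open>\<tau> * (L j / L j)\<close> because
    \<open>g * g \<le> \<tau> * g\<close>, and the count contributes at most \<open>\<tau>\<close>:
    \<open>J + 1\<close> terms in all.\<close>
  have tot: "(\<Sum>e\<in>Fs. (\<Sum>j<J. y e j * (g e j * g e j) / L j) + \<tau> * (\<Sum>j<J. y e j) / L J) \<le> (real J + 1) * \<tau>"
  proof -
    have "(\<Sum>e\<in>Fs. \<Sum>j<J. y e j * (g e j * g e j) / L j) = (\<Sum>j<J. \<Sum>e\<in>Fs. y e j * (g e j * g e j) / L j)"
      by (rule sum.swap)
    also have "\<dots> \<le> (\<Sum>j<J. \<tau>)"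
    proof (rule sum_mono)
      fix j assume j: "j \<in> {..<J}"
      have "(\<Sum>e\<in>Fs. y e j * (g e j * g e j) / L j) \<le> (\<Sum>e\<in>Fs. \<tau> * (y e j * g e j) / L j)"
      proof (intro sum_mono divide_right_mono)
        fix e assume "e \<in> Fs"
        then have e: "e < n" by (simp add: Fs_def)
        have "(y e j * g e j) * g e j \<le> (y e j * g e j) * \<tau>"
          using y(1)[OF e] g[OF e] j by (intro mult_left_mono mult_nonneg_nonneg) auto
        then show "y e j * (g e j * g e j) \<le> \<tau> * (y e j * g e j)" by (simp add: mult_ac)
      qed (use L0 j in auto)
      also have "\<dots> = \<tau> * ((\<Sum>e\<in>Fs. y e j * g e j) / L j)" by (simp add: sum_distrib_left sum_divide_distrib)
      also have "\<dots> = \<tau> * (L j / L j)" using L(1)[of j] j by simp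
      also have "\<dots> \<le> \<tau>" using \<tau> by (cases "L j = 0") auto
      finally show "(\<Sum>e\<in>Fs. y e j * (g e j * g e j) / L j) \<le> \<tau>" .
    qed
    finally have 1: "(\<Sum>e\<in>Fs. \<Sum>j<J. y e j * (g e j * g e j) / L j) \<le> real J * \<tau>" by simp
    have "(\<Sum>e\<in>Fs. \<tau> * h e / c) = \<tau> * ((\<Sum>e\<in>Fs. h e) / c)" for h :: "nat \<Rightarrow> real" and c
      by (simp add: sum_distrib_left sum_divide_distrib)
    then have "(\<Sum>e\<in>Fs. \<tau> * (\<Sum>j<J. y e j) / L J) = \<tau> * ((\<Sum>e\<in>Fs. \<Sum>j<J. y e j) / L J)" .
    also have "\<dots> = \<tau> * (L J / L J)" by (simp only: L(2)[symmetric])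
    also have "\<dots> \<le> \<tau>" using \<tau> by (cases "L J = 0") auto
    finally show ?thesis using 1 by (simp add: sum.distrib algebra_simps)
  qed
  have "{e\<in>Fs. e < n} = Fs" by (auto simp: Fs_def)
  with pot[of n] tot have pot': "rpot J \<tau> L (R n) \<le> (real J + 1) * \<tau>" by simp
  define B where "B = real J + 1"
  have B0: "0 \<le> B" by (simp add: B_def)
  have term0: "0 \<le> R n j * R n j / L j" if "j \<le> J" for j using L0[OF that] by simp
  \<comment> \<open>The geometric mean of \<open>l\<close> and \<open>b\<close> is split into a
    small multiple of \<open>l\<close> and a large multiple of \<open>b\<close>: an error relative
    to the load plus an additive one.\<close>
  have am: "\<bar>x\<bar> \<le> l / real pr + real pr * b" if "x * x \<le> l * b" "0 \<le> l" "0 \<le> b" for x l b :: real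
  proof (rule abs_le_square_iff[THEN iffD2, THEN order_trans])
    have "(l / real pr + real pr * b)\<^sup>2 - l * b = (l / real pr)\<^sup>2 + (real pr * b)\<^sup>2 + l * b"
      using pr by (simp add: power2_eq_square field_simps)
    then have "l * b \<le> (l / real pr + real pr * b)\<^sup>2" using that by (smt (verit) zero_le_power2 mult_nonneg_nonneg)
    then show "x\<^sup>2 \<le> (l / real pr + real pr * b)\<^sup>2" using that(1) by (simp add: power2_eq_square)
    show "\<bar>l / real pr + real pr * b\<bar> \<le> l / real pr + real pr * b" using that by simp
  qed
  \<comment> \<open>Without any mass all \<open>L j\<close> vanish, division by zero makes every
    \<open>rgain\<close> zero, and the strict comparison in \<open>scan\<close> never leaves
    \<open>J\<close>.\<close>
  have ch_J: "ch e = J" if True: "L J = 0" for e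
  proof -
    have "y e j = 0" if "e \<in> Fs" "j < J" for e j
    proof -
      have "\<forall>e\<in>Fs. (\<Sum>j<J. y e j) = 0" using True finF y(1) unfolding L(2)
        by (subst (asm) sum_nonneg_eq_0_iff) (auto simp: Fs_def intro: sum_nonneg)
      with that have "(\<Sum>j<J. y e j) = 0" by blast
      then show ?thesis using that y(1)[of e]
        by (subst (asm) sum_nonneg_eq_0_iff) (auto simp: Fs_def)
    qed
    then have Lz: "L j = 0" if "j \<le> J" for j using that True L(1)[of j] by (cases "j = J") auto
    have "scan J v J = (0, J)" if "\<And>j. j < J \<Longrightarrow> v j = 0" for v
    proof -
      have "scan J v k = (0, J)" if "k \<le> J" for k using that \<open>\<And>j. j < J \<Longrightarrow> v j = 0\<close> by (induction k) auto
      then show ?thesis by simp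
    qed
    then show ?thesis unfolding ch_def rchoice_def rpick_def by (simp add: rgain_def Lz)
  qed
  show "L J = 0 \<Longrightarrow> ch e = J" by (rule ch_J)
  show "L j - L j / real pr - real pr * ((real J + 1) * \<tau>) \<le> (\<Sum>e\<in>{e\<in>Fs. ch e = j}. g e j)" if j: "j < J" for j
  proof -
    have s: "{e\<in>Fs. e < n \<and> ch e = j} = {e\<in>Fs. ch e = j}" "{e\<in>Fs. e < n} = Fs" by (auto simp: Fs_def)
    have Rj: "R n j = (\<Sum>e\<in>{e\<in>Fs. ch e = j}. g e j) - L j" using res[of n] j by (simp add: s L)
    have ld: "0 \<le> (\<Sum>e\<in>{e\<in>Fs. ch e = j}. g e j)" using g j by (intro sum_nonneg) (auto simp: Fs_def)
    show ?thesis
    proof (cases "L j = 0")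
      case True
      moreover have "0 \<le> real pr * ((real J + 1) * \<tau>)" using \<tau> by simp
      ultimately show ?thesis using ld by simp
    next
      case False
      then have Lj: "0 < L j" using L0[of j] j by simp
      have "R n j * R n j / L j \<le> (\<Sum>j<J. R n j * R n j / L j)"
        using j term0 by (intro member_le_sum[of j "{..<J}" "\<lambda>j. R n j * R n j / L j"]) auto
      also have "\<dots> \<le> rpot J \<tau> L (R n)" unfolding rpot_def using \<tau> L0[of J] by simp
      also have "\<dots> \<le> B * \<tau>" using pot' by (simp add: B_def)
      finally have "R n j * R n j \<le> L j * (B * \<tau>)" using Lj by (simp add: field_simps)
      from am[OF this] have "\<bar>R n j\<bar> \<le> L j / real pr + real pr * (B * \<tau>)" using Lj B0 \<tau> by simp
      then show ?thesis using Rj by (simp add: B_def)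
    qed
  qed
  show "real (card {e\<in>Fs. ch e < J}) \<le> L J + L J / real pr + real pr * (real J + 1)"
  proof -
    have s: "{e\<in>Fs. e < n \<and> ch e < J} = {e\<in>Fs. ch e < J}" "{e\<in>Fs. e < n} = Fs" by (auto simp: Fs_def)
    have RJ: "R n J = real (card {e\<in>Fs. ch e < J}) - L J" using res[of n] by (simp add: s L)
    show ?thesis
    proof (cases "L J = 0")
      case True
      then have "ch e = J" for e by (rule ch_J)
      then show ?thesis using True by simp
    next
      case False
      then have LJ: "0 < L J" using L0[of J] by simp
      have "\<tau> * (R n J * R n J) / L J \<le> rpot J \<tau> L (R n)"
        unfolding rpot_def using sum_nonneg[of "{..<J}" "\<lambda>j. R n j * R n j / L j"] term0 by auto
      also have "\<dots> \<le> B * \<tau>" using pot' by (simp add: B_def)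
      finally have "R n J * R n J \<le> L J * B" using LJ \<tau> by (simp add: field_simps)
      from am[OF this] have "\<bar>R n J\<bar> \<le> L J / real pr + real pr * B" using LJ B0 by simp
      then show ?thesis using RJ by (simp add: B_def)
    qed
  qed
qed

section \<open>Large gains\<close>

text \<open>\<open>tab w B e s\<close> is 0 if \<open>s\<close> is not a sum of weights of the edges below \<open>e\<close>, each put into at most
  one of \<open>B\<close> bins; otherwise it records the choice for the last edge: 1 for no bin, \<open>b + 2\<close> for bin
  \<open>b\<close>. The weight of an edge may depend on its bin. In \<open>lasg\<close>, 0 is no bin and \<open>b + 1\<close> is bin \<open>b\<close>.\<close>

primrec tsel :: "(nat \<Rightarrow> nat) \<Rightarrow> (nat \<Rightarrow> nat) \<Rightarrow> nat \<Rightarrow> nat \<Rightarrow> nat" where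
  "tsel w f s 0 = (if 0 < f s then 1 else 0)"
| "tsel w f s (Suc b) = (if w b \<le> s \<and> 0 < f (s - w b) then b + 2 else tsel w f s b)"

primrec tab :: "(nat \<Rightarrow> nat \<Rightarrow> nat) \<Rightarrow> nat \<Rightarrow> nat \<Rightarrow> nat \<Rightarrow> nat" where
  "tab w B 0 s = (if s = 0 then 1 else 0)"
| "tab w B (Suc e) s = tsel (w e) (tab w B e) s B"

text \<open>Backtracking through the table: what is left of the sum \<open>s\<close> after the
  recorded choices of the last \<open>i\<close> edges have been removed.\<close>

primrec cur :: "(nat \<Rightarrow> nat \<Rightarrow> nat) \<Rightarrow> nat \<Rightarrow> nat \<Rightarrow> nat \<Rightarrow> nat \<Rightarrow> nat" where
  "cur w B n s 0 = s"
| "cur w B n s (Suc i) = (let p = tab w B (n - i) (cur w B n s i) in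
     if 1 < p then cur w B n s i - w (n - Suc i) (p - 2) else cur w B n s i)"

definition lasg :: "(nat \<Rightarrow> nat \<Rightarrow> nat) \<Rightarrow> nat \<Rightarrow> nat \<Rightarrow> nat \<Rightarrow> nat \<Rightarrow> nat" where
  "lasg w B n s e = tab w B (Suc e) (cur w B n s (n - Suc e)) - 1"

lemma tsel_cases:
  "tsel w f s B = 0 \<and> f s = 0 \<or> tsel w f s B = 1 \<and> 0 < f s \<or>
   (\<exists>b<B. tsel w f s B = b + 2 \<and> w b \<le> s \<and> 0 < f (s - w b))"
  by (induction B) (auto simp: less_Suc_eq)

lemma tsel_pos: "0 < f s \<Longrightarrow> 0 < tsel w f s B" "b < B \<Longrightarrow> w b \<le> s \<Longrightarrow> 0 < f (s - w b) \<Longrightarrow> 0 < tsel w f s B"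
  by (induction B) (auto simp: less_Suc_eq)

lemma tab_complete:
  assumes "\<And>e. e < n \<Longrightarrow> x e \<le> B"
  shows "0 < tab w B n (\<Sum>e\<in>{e. e < n \<and> 0 < x e}. w e (x e - 1))"
  using assms
proof (induction n)
  case (Suc n)
  define s where "s = (\<Sum>e\<in>{e. e < n \<and> 0 < x e}. w e (x e - 1))"
  have IH: "0 < tab w B n s" using Suc by (simp add: s_def)
  show ?case
  proof (cases "0 < x n")
    case True
    then have "{e. e < Suc n \<and> 0 < x e} = insert n {e. e < n \<and> 0 < x e}" by (auto simp: less_Suc_eq)
    then have "(\<Sum>e\<in>{e. e < Suc n \<and> 0 < x e}. w e (x e - 1)) = w n (x n - 1) + s" by (simp add: s_def)
    moreover have "x n - 1 < B" using True Suc.prems[of n] by simp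
    ultimately show ?thesis using IH by (auto intro!: tsel_pos(2)[of "x n - 1"])
  next
    case False
    then have "{e. e < Suc n \<and> 0 < x e} = {e. e < n \<and> 0 < x e}" by (auto simp: less_Suc_eq)
    then show ?thesis using IH by (auto simp: s_def intro!: tsel_pos(1))
  qed
qed simp

lemma tab_le: "tab w B e s \<le> B + 1"
  using tsel_cases[of "w (e - 1)" "tab w B (e - 1)" s B] by (cases e) auto

lemma lasg_le: "lasg w B n s e \<le> B"
  using tab_le[of w B "Suc e"] by (simp add: lasg_def le_diff_conv)

text \<open>Along the backtracking the visited entries stay positive, and the removed weights plus
  the remaining sum give \<open>s\<close>. Row 0 is positive at 0 only, so nothing remains at the
  end.\<close>

lemma tab_sound:
  assumes "0 < tab w B n s"
  shows "(\<Sum>e\<in>{e. e < n \<and> 0 < lasg w B n s e}. w e (lasg w B n s e - 1)) = s"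
proof -
  let ?x = "lasg w B n s"
  have "0 < tab w B (n - i) (cur w B n s i) \<and>
     (\<Sum>e\<in>{e. n - i \<le> e \<and> e < n \<and> 0 < ?x e}. w e (?x e - 1)) + cur w B n s i = s" if "i \<le> n" for i
    using that
  proof (induction i)
    case 0
    then show ?case using assms by simp
  next
    case (Suc i)
    define e where "e = n - Suc i"
    define c where "c = cur w B n s i"
    have e: "n - i = Suc e" "n - Suc i = e" "e < n" "n - Suc e = i" using Suc.prems by (auto simp: e_def)
    have t: "0 < tab w B (Suc e) c" using Suc e by (simp add: c_def)
    have xe: "?x e = tab w B (Suc e) c - 1" by (simp add: lasg_def e c_def)
    have nx: "cur w B n s (Suc i) = (if 1 < tab w B (Suc e) c then c - w e (tab w B (Suc e) c - 2) else c)"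
      by (simp add: c_def e Let_def)
    have sum: "(\<Sum>a\<in>{a. Suc e \<le> a \<and> a < n \<and> 0 < ?x a}. w a (?x a - 1)) + c = s"
      using Suc e by (simp add: c_def)
    have set: "{a. e \<le> a \<and> a < n \<and> 0 < ?x a} =
      (if 0 < ?x e then insert e {a. Suc e \<le> a \<and> a < n \<and> 0 < ?x a} else {a. Suc e \<le> a \<and> a < n \<and> 0 < ?x a})"
      using e(3) by (auto simp: Suc_le_eq le_less)
    consider "tab w B (Suc e) c = 1" "0 < tab w B e c"
      | b where "b < B" "tab w B (Suc e) c = b + 2" "w e b \<le> c" "0 < tab w B e (c - w e b)"
      using tsel_cases[of "w e" "tab w B e" c B] t by auto
    then show ?case
    proof cases
      case 1
      then show ?thesis unfolding e(2) nx set using sum xe by simp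
    next
      case 2
      then show ?thesis unfolding e(2) nx set using sum xe by simp
    qed
  qed
  from this[of n] have "0 < tab w B 0 (cur w B n s n)"
    "(\<Sum>e\<in>{e. e < n \<and> 0 < ?x e}. w e (?x e - 1)) + cur w B n s n = s" by simp_all
  then show ?thesis by (simp split: if_splits)
qed

section \<open>Uniqueness of digits\<close>

lemma digits_unique:
  fixes v w :: "nat \<Rightarrow> nat"
  assumes "(\<Sum>i<k. v i * U ^ i) = (\<Sum>i<k. w i * U ^ i)" "\<And>i. i < k \<Longrightarrow> v i < U \<and> w i < U"
  shows "\<forall>i<k. v i = w i"
  using assms
proof (induction k arbitrary: v w)
  case (Suc k)
  have U: "0 < U" using Suc.prems(2)[of 0] by simp
  have eq: "(\<Sum>i<Suc k. v i * U ^ i) = v 0 + U * (\<Sum>i<k. v (Suc i) * U ^ i)" for v :: "nat \<Rightarrow> nat"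
    unfolding sum.lessThan_Suc_shift by (simp add: sum_distrib_left mult_ac)
  have e: "v 0 + U * (\<Sum>i<k. v (Suc i) * U ^ i) = w 0 + U * (\<Sum>i<k. w (Suc i) * U ^ i)"
    using Suc.prems(1) unfolding eq .
  have b: "v 0 < U" "w 0 < U" using Suc.prems(2)[of 0] by auto
  have "v 0 = w 0" using arg_cong[OF e, of "\<lambda>x. x mod U"] b by simp
  moreover have "(\<Sum>i<k. v (Suc i) * U ^ i) = (\<Sum>i<k. w (Suc i) * U ^ i)"
    using e \<open>v 0 = w 0\<close> U by simp
  ultimately show ?case using Suc.IH[of "v \<circ> Suc" "w \<circ> Suc"] Suc.prems(2)
    by (auto simp: less_Suc_eq_0_disj)
qed simp

lemma digits_less:
  fixes v :: "nat \<Rightarrow> nat"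
  assumes "\<And>i. i < k \<Longrightarrow> v i < U"
  shows "(\<Sum>i<k. v i * U ^ i) < U ^ k"
  using assms
proof (induction k)
  case (Suc k)
  then have "v k * U ^ k + U ^ k \<le> U * U ^ k"
    using mult_le_mono1[of "Suc (v k)" U "U ^ k"] by (simp add: Suc_le_eq)
  then show ?case using Suc by fastforce
qed simp

section \<open>Levels\<close>

text \<open>In contrast to \<open>comp_val\<close>, the list runs from the last query to the first,
  so the value increases along it and the levels are met from the bottom up.\<close>

definition run_val :: "(nat \<Rightarrow> nat \<Rightarrow> real) \<Rightarrow> (nat \<Rightarrow> nat \<Rightarrow> real) \<Rightarrow> nat \<Rightarrow> nat list \<Rightarrow> real \<Rightarrow> real" where
  "run_val r q m xs V = fold (\<lambda>e V. V + gain r q m e V) xs V"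

lemma run_val_simps [simp]:
  "run_val r q m [] V = V"
  "run_val r q m (e # xs) V = run_val r q m xs (V + gain r q m e V)"
  "run_val r q m (xs @ ys) V = run_val r q m ys (run_val r q m xs V)"
  by (simp_all add: run_val_def)

lemma comp_val_rev: "comp_val r q m (rev xs) V = run_val r q m xs V"
  by (simp add: comp_val_def run_val_def foldr_conv_fold)

lemma run_val_ge: "V \<le> run_val r q m xs V"
proof (induction xs arbitrary: V)
  case (Cons e xs)
  have "V \<le> V + gain r q m e V" by simp
  also have "\<dots> \<le> run_val r q m (e # xs) V" using Cons[of "V + gain r q m e V"] by simp
  finally show ?case .
qed simp

context rewards
begin

text \<open>While the value is below \<open>v\<close>, each edge gains at least what it gains at
  \<open>v\<close>; once the value has passed \<open>v\<close>, nothing is left to show. Hence a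
  level may be represented by a sum of gains, whatever the order of its edges.\<close>

lemma run_val_bulk:
  assumes "set xs \<subseteq> {..<n}" "distinct xs"
  shows "min v (V + (\<Sum>e\<in>set xs. gain r q m e v)) \<le> run_val r q m xs V"
  using assms
proof (induction xs arbitrary: V)
  case (Cons e xs)
  have S: "0 \<le> (\<Sum>e\<in>set xs. gain r q m e v)" by (intro sum_nonneg) auto
  have "min v (V + (\<Sum>e\<in>set (e # xs). gain r q m e v)) \<le>
      min v (V + gain r q m e V + (\<Sum>e\<in>set xs. gain r q m e v))"
  proof (cases "V \<le> v")
    case True
    then have "gain r q m e v \<le> gain r q m e V" using Cons.prems by (intro gain_antimono) auto
    then show ?thesis using Cons.prems by (auto simp: min_def)
  next
    case False
    then have "v \<le> V + gain r q m e V + (\<Sum>e\<in>set xs. gain r q m e v)"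
      using S gain_nonneg[of r q m e V] by linarith
    then show ?thesis by (simp add: min_absorb1)
  qed
  also have "\<dots> \<le> run_val r q m xs (V + gain r q m e V)" using Cons by auto
  finally show ?case by simp
qed simp

text \<open>A gain that leaves the level must not be cut off at \<open>v\<close>, as
  \<open>run_val_bulk\<close> would do. For a single edge it can be added on top, since
  \<open>V + gain r q m e V\<close> is monotone in \<open>V\<close>.\<close>

lemma run_val_single:
  assumes "set xs \<subseteq> {..<n}" "e \<in> set xs"
  shows "min v V + gain r q m e v \<le> run_val r q m xs V"
proof -
  from assms(2) obtain ys zs where xs: "xs = ys @ e # zs" by (meson split_list)
  define W where "W = run_val r q m ys V"
  have e: "e < n" using assms by auto
  have "V \<le> W" unfolding W_def by (rule run_val_ge)
  have "min v V + gain r q m e v \<le> min v V + gain r q m e (min v V)"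
    by (intro add_left_mono gain_antimono[OF e]) auto
  also have "\<dots> \<le> W + gain r q m e W" using \<open>V \<le> W\<close> by (intro add_gain_mono[OF e]) auto
  also have "\<dots> \<le> run_val r q m zs (W + gain r q m e W)" by (rule run_val_ge)
  also have "\<dots> = run_val r q m xs V" by (simp add: xs W_def)
  finally show ?thesis .
qed

text \<open>\<open>T i\<close> is the value after the last \<open>i\<close> queries of a policy. Edge \<open>i\<close> goes to bin \<open>2 j\<close> if
  \<open>T i\<close> lies on level \<open>j\<close>, except that a large gain leaving level \<open>j\<close> goes to bin \<open>2 j + 1\<close>.
  Any bin contents that match the gains of the policy, measured at the bottom of each level,
  recover its value up to one level.\<close>

lemma replay:
  fixes T :: "nat \<Rightarrow> real" and bin :: "nat \<Rightarrow> nat" and bl :: "nat \<Rightarrow> nat list" and \<delta> \<theta> :: real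
  assumes \<delta>: "0 < \<delta>" and \<theta>: "0 \<le> \<theta>"
    and T: "T 0 = 0" "\<And>i. i < k \<Longrightarrow> T i \<le> T (Suc i)"
    and cr: "\<And>i. cross i \<longleftrightarrow> \<theta> < T (Suc i) - T i \<and> (real (lv i) + 1) * \<delta> \<le> T (Suc i)"
    and lv: "\<And>i. i < k \<Longrightarrow> real (lv i) * \<delta> \<le> T i \<and> T i < (real (lv i) + 1) * \<delta>"
    and lvJ: "\<And>i. i < k \<Longrightarrow> lv i < J"
    and bin: "\<And>i. bin i = 2 * lv i + (if cross i then 1 else 0)"
    and bl: "\<And>b. set (bl b) \<subseteq> {..<n}" "\<And>b. distinct (bl b)"
    and err: "\<And>b. 0 \<le> err b"
    and even: "\<And>j. j < J \<Longrightarrow> (\<Sum>i\<in>{i. i < k \<and> bin i = 2 * j}. T (Suc i) - T i) - err (2 * j)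
        \<le> (\<Sum>e\<in>set (bl (2 * j)). gain r q m e (real j * \<delta>))"
    and odd: "\<And>i. i < k \<Longrightarrow> cross i \<Longrightarrow> \<exists>e\<in>set (bl (bin i)). T (Suc i) - T i - err (bin i)
        \<le> gain r q m e (real (lv i) * \<delta>)"
  shows "T k - \<delta> - \<theta> - (\<Sum>b<2*J. err b) \<le> run_val r q m (concat (map bl [0..<2*J])) 0"
proof -
  have Tmono: "T i \<le> T i'" if "i \<le> i'" "i' \<le> k" for i i'
    using that(1,2)
  proof (induction i' rule: dec_induct)
    case (step i')
    then show ?case using T(2)[of i'] by simp
  qed simp
  have lvmono: "lv i \<le> lv i'" if "i \<le> i'" "i' < k" for i i'
  proof -
    have "real (lv i) * \<delta> < (real (lv i') + 1) * \<delta>"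
      using lv[of i] lv[of i'] Tmono[of i i'] that by fastforce
    then have "real (lv i) < real (lv i') + 1" using \<delta> by simp
    then show ?thesis by simp
  qed
  \<comment> \<open>A crossing increment is the last one of its level. Giving it the number
    \<open>2 * lv i + 1\<close> therefore keeps the bins in order, and no odd bin contains two
    increments.\<close>
  have lvcross: "lv i < lv i'" if "i < i'" "i' < k" "cross i" for i i'
  proof -
    have "(real (lv i) + 1) * \<delta> < (real (lv i') + 1) * \<delta>"
      using lv[of i'] Tmono[of "Suc i" i'] that cr[of i] by fastforce
    then have "real (lv i) < real (lv i')" using \<delta> by simp
    then show ?thesis by simp
  qed
  have binmono: "bin i \<le> bin i'" if "i \<le> i'" "i' < k" for i i'
    using lvmono[OF that] lvcross[of i i'] that by (cases "i = i'") (auto simp: bin)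
  define V where "V b = run_val r q m (concat (map bl [0..<b])) 0" for b
  have V0: "V 0 = 0" and VS: "V (Suc b) = run_val r q m (bl b) (V b)" for b
    by (simp_all add: V_def)
  \<comment> \<open>\<open>c\<close> counts the increments in the bins below \<open>b\<close>. The
    loss \<open>\<delta> + \<theta>\<close> belongs to the level in progress and does not
    accumulate; only \<open>err\<close> does.\<close>
  have main: "\<exists>c\<le>k. (\<forall>i<k. bin i < b \<longleftrightarrow> i < c) \<and> T c - \<delta> - \<theta> - (\<Sum>b<b. err b) \<le> V b" if "b \<le> 2 * J" for b
    using that
  proof (induction b)
    case 0
    show ?case using T(1) \<delta> \<theta> by (intro exI[of _ 0]) (simp add: V0)
  next
    case (Suc b)
    then obtain c where c: "c \<le> k" "\<forall>i<k. bin i < b \<longleftrightarrow> i < c" "T c - \<delta> - \<theta> - (\<Sum>b<b. err b) \<le> V b"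
      by auto
    define Eb where "Eb = (\<Sum>b<b. err b)"
    have Eb: "0 \<le> Eb" "(\<Sum>b<Suc b. err b) = Eb + err b" using err by (auto simp: Eb_def sum_nonneg)
    have c3: "T c - \<delta> - \<theta> - Eb \<le> V b" using c by (simp add: Eb_def)
    define S where "S = {i. i < k \<and> bin i = b}"
    show ?case
    proof (cases "S = {}")
      case True
      have "V b \<le> V (Suc b)" unfolding VS by (rule run_val_ge)
      moreover have "bin i < Suc b \<longleftrightarrow> i < c" if "i < k" for i
        using c(2) True that by (auto simp: S_def less_Suc_eq)
      ultimately show ?thesis using c Eb err[of b] c3 by (intro exI[of _ c]) auto
    next
      case False
      have fS: "finite S" by (simp add: S_def)
      define i1 where "i1 = Max S"
      have i1: "i1 \<in> S" "\<And>i. i \<in> S \<Longrightarrow> i \<le> i1" using False fS by (auto simp: i1_def)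
      have i1': "i1 < k" "bin i1 = b" using i1(1) by (auto simp: S_def)
      have Seq: "S = {c..<Suc i1}"
      proof (intro equalityI subsetI)
        fix i assume "i \<in> S"
        then show "i \<in> {c..<Suc i1}" using i1(2)[of i] c(2) by (auto simp: S_def not_less[symmetric])
      next
        fix i assume i: "i \<in> {c..<Suc i1}"
        then have "i < k" using i1' by auto
        moreover have "bin i \<le> b" using i i1' binmono[of i i1] by auto
        moreover have "\<not> bin i < b" using i c(2) \<open>i < k\<close> by auto
        ultimately show "i \<in> S" by (auto simp: S_def)
      qed
      have ci: "c \<le> i1" using i1(1) Seq by auto
      have tele: "(\<Sum>i\<in>S. T (Suc i) - T i) = T (Suc i1) - T c"
        unfolding Seq using ci by (subst sum_Suc_diff') auto
      have new: "bin i < Suc b \<longleftrightarrow> i < Suc i1" if "i < k" for i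
      proof
        assume "bin i < Suc b"
        then consider "bin i < b" | "bin i = b" by linarith
        then show "i < Suc i1"
        proof cases
          case 1
          then show ?thesis using c(2) that ci by auto
        next
          case 2
          then show ?thesis using i1(2)[of i] that by (simp add: S_def)
        qed
      next
        assume "i < Suc i1"
        then show "bin i < Suc b" using binmono[of i i1] i1' by auto
      qed
      define j where "j = lv i1"
      have j: "j < J" using lvJ i1' by (simp add: j_def)
      have "T (Suc i1) - \<delta> - \<theta> - (Eb + err b) \<le> V (Suc b)"
      proof (cases "cross i1")
        case False
        then have b: "b = 2 * j" using i1' by (simp add: bin j_def)
        \<comment> \<open>The last increment of the bin either ends below the top of the level or is
          at most \<open>\<theta>\<close>. So it is enough to reach the bottom of the level.\<close>
        have up: "T (Suc i1) \<le> (real j + 1) * \<delta> + \<theta>"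
          using False cr[of i1] lv[of i1] i1' \<theta> by (auto simp: j_def not_less)
        have "T (Suc i1) - T c - err b \<le> (\<Sum>e\<in>set (bl b). gain r q m e (real j * \<delta>))"
          using even[OF j] tele by (simp add: b S_def)
        moreover have "min (real j * \<delta>) (V b + (\<Sum>e\<in>set (bl b). gain r q m e (real j * \<delta>))) \<le> V (Suc b)"
          unfolding VS by (rule run_val_bulk[OF bl])
        moreover have "T (Suc i1) - \<delta> - \<theta> \<le> real j * \<delta>" using up by (simp add: algebra_simps)
        ultimately show ?thesis using c3 Eb(1) err[of b] by (auto simp: min_def split: if_splits)
      next
        case True
        then have b: "b = 2 * j + 1" using i1' by (simp add: bin j_def)
        have single: "i = i1" if "i \<in> S" for i
        proof (rule ccontr)
          assume "i \<noteq> i1"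
          then have "i < i1" using i1(2)[OF that] by simp
          have bi: "bin i = b" "i < k" using that by (auto simp: S_def)
          have "odd (bin i)" using bi b by simp
          then have "cross i" "lv i = j" using bi b by (auto simp: bin split: if_splits)
          then show False using lvcross[of i i1] \<open>i < i1\<close> i1' by (simp add: j_def)
        qed
        have "c \<in> S" using Seq ci by simp
        from single[OF this] have ic: "i1 = c" ..
        obtain e where e: "e \<in> set (bl b)" "T (Suc c) - T c - err b \<le> gain r q m e (real j * \<delta>)"
          using odd[OF i1'(1) True] i1' ic by (auto simp: j_def)
        \<comment> \<open>The crossing gain is added to the current value or to the bottom of the
          level, whichever is smaller. Both are at least \<open>T c\<close> minus the permitted
          loss.\<close>
        have "min (real j * \<delta>) (V b) + gain r q m e (real j * \<delta>) \<le> V (Suc b)"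
          unfolding VS by (rule run_val_single[OF bl(1) e(1)])
        moreover have "T c - \<delta> - \<theta> \<le> real j * \<delta>"
          using lv[of i1] i1' \<theta> by (simp add: j_def ic algebra_simps)
        ultimately show ?thesis using e(2) c3 Eb(1) unfolding ic by (auto simp: min_def split: if_splits)
      qed
      then show ?thesis using new i1' Eb by (intro exI[of _ "Suc i1"]) auto
    qed
  qed
  from main[of "2 * J"] obtain c where c: "c \<le> k" "\<forall>i<k. bin i < 2 * J \<longleftrightarrow> i < c"
    "T c - \<delta> - \<theta> - (\<Sum>b<2*J. err b) \<le> V (2 * J)" by auto
  have "bin i < 2 * J" if "i < k" for i using lvJ[OF that] by (simp add: bin)
  then have "c = k" using c(1,2) by (metis le_eq_less_or_eq less_irrefl)
  then show ?thesis using c(3) by (simp add: V_def)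
qed

end

section \<open>The candidate policies\<close>

text \<open>\<open>pr\<close> is the precision, of order \<open>1 / \<epsilon>\<close>. At most \<open>hmax\<close> edges of an optimal policy gain more
  than the fraction \<open>tau\<close> of its value. Their data is rounded to multiples of \<open>1 / dres\<close> and
  encoded in base \<open>ubase\<close>, where a sum over \<open>hmax\<close> edges has no carry; \<open>qsize\<close> bounds the sums of codes.\<close>

definition lvls :: "nat \<Rightarrow> nat" where "lvls pr = 2 * pr + 1"
definition hmax :: "nat \<Rightarrow> nat" where "hmax pr = 2 * pr ^ 5"
definition dres :: "nat \<Rightarrow> nat" where "dres pr = pr ^ 8"
definition dpad :: "nat \<Rightarrow> nat" where "dpad pr = hmax pr * dres pr + 1"
definition ubase :: "nat \<Rightarrow> nat" where "ubase pr = hmax pr * (dres pr + dpad pr) + 1"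
definition qsize :: "nat \<Rightarrow> nat" where "qsize pr = (hmax pr + 1) * ubase pr ^ (3 * lvls pr + 1)"
definition tau :: "nat \<Rightarrow> real" where "tau pr = 1 / real pr ^ 5"

text \<open>The integer part of \<open>D * v\<close>, capped at the last argument. The machine
  cannot round, so it is obtained by comparing \<open>D * v\<close> with 1, 2, and so on.\<close>

primrec dig :: "nat \<Rightarrow> real \<Rightarrow> nat \<Rightarrow> nat" where
  "dig D v 0 = 0"
| "dig D v (Suc i) = dig D v i + (if real D * v < real (Suc i) then 0 else 1)"

lemma dig_eq: "0 \<le> v \<Longrightarrow> dig D v k = min k (nat \<lfloor>real D * v\<rfloor>)"
proof (induction k)
  case (Suc k)
  have "real D * v < real (Suc k) \<longleftrightarrow> nat \<lfloor>real D * v\<rfloor> < Suc k"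
    using Suc.prems by (simp add: nat_less_iff floor_less_iff)
  then show ?case using Suc by (auto simp: min_def)
qed simp

lemma dig_le: "dig D v k \<le> k"
  by (induction k) auto

lemma dig_bounds:
  assumes "0 \<le> v" "v \<le> 1" "D > 0"
  shows "real (dig D v D) / real D \<le> v" "v \<le> (real (dig D v D) + 1) / real D"
proof -
  have "real D * v \<le> real D * 1" using assms by (intro mult_left_mono) auto
  then have "nat \<lfloor>real D * v\<rfloor> \<le> D" by (simp add: nat_le_iff floor_le_iff)
  then have eq: "dig D v D = nat \<lfloor>real D * v\<rfloor>" using assms by (simp add: dig_eq)
  have "0 \<le> real D * v" using assms by simp
  then have "real (dig D v D) = of_int \<lfloor>real D * v\<rfloor>" unfolding eq by simp
  then have "real (dig D v D) \<le> real D * v" "real D * v \<le> real (dig D v D) + 1"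
    by linarith+
  then show "real (dig D v D) / real D \<le> v" "v \<le> (real (dig D v D) + 1) / real D"
    using assms by (simp_all add: field_simps)
qed

text \<open>Digits round down: replacing values by digits costs at most \<open>1 / D\<close> per
  element of \<open>X\<close>, and going back on \<open>Z\<close> costs nothing.\<close>

lemma sum_dig_transfer:
  fixes v :: "'e \<Rightarrow> real"
  assumes "(\<Sum>e\<in>Z. dig D (v e) D) = (\<Sum>e\<in>X. dig D (v e) D)" "D > 0"
    "\<And>e. e \<in> Z \<union> X \<Longrightarrow> 0 \<le> v e \<and> v e \<le> 1"
  shows "(\<Sum>e\<in>X. v e) - real (card X) / real D \<le> (\<Sum>e\<in>Z. v e)"
proof -
  have "(\<Sum>e\<in>X. v e) \<le> (\<Sum>e\<in>X. (real (dig D (v e) D) + 1) / real D)"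
    using assms by (intro sum_mono dig_bounds) auto
  also have "\<dots> = real (\<Sum>e\<in>X. dig D (v e) D) / real D + real (card X) / real D"
    by (simp add: sum_divide_distrib[symmetric] sum.distrib add_divide_distrib)
  also have "real (\<Sum>e\<in>X. dig D (v e) D) / real D = (\<Sum>e\<in>Z. real (dig D (v e) D) / real D)"
    unfolding assms(1)[symmetric] by (simp add: sum_divide_distrib)
  also have "\<dots> \<le> (\<Sum>e\<in>Z. v e)" using assms by (intro sum_mono dig_bounds) auto
  finally show ?thesis by simp
qed

lemma sum_lessThan_add: "(\<Sum>i<a + b. f i) = (\<Sum>i<a. f i) + (\<Sum>i<b. f (a + i))" for f :: "nat \<Rightarrow> 'a :: comm_monoid_add"
  by (induction b) (auto simp: add.assoc)

text \<open>Bin \<open>b\<close> is stored as \<open>b + 1\<close>, since 0 marks an edge left out.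
  The list is ordered as for \<open>run_val\<close>; a policy queries it backwards.\<close>

definition bin_order :: "nat \<Rightarrow> nat \<Rightarrow> (nat \<Rightarrow> nat) \<Rightarrow> nat list" where
  "bin_order n B z = concat (map (\<lambda>b. filter (\<lambda>e. z e = Suc b) [0..<n]) [0..<B])"

lemma set_bin_order: "set (bin_order n B z) = {e. e < n \<and> 0 < z e \<and> z e \<le> B}"
  by (auto simp: bin_order_def gr0_conv_Suc Suc_le_eq)

lemma distinct_bin_order: "distinct (bin_order n B z)"
proof (induction B)
  case (Suc B)
  have "bin_order n (Suc B) z = bin_order n B z @ filter (\<lambda>e. z e = Suc B) [0..<n]"
    by (simp add: bin_order_def)
  then show ?case using Suc by (auto simp: set_bin_order)
qed (simp add: bin_order_def)

locale star = rewards n m r q for n m :: nat and r q :: "nat \<Rightarrow> nat \<Rightarrow> real" +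
  fixes l pr :: nat
  assumes l_le: "l \<le> n" and N2: "pr \<ge> 2"
begin

definition lev :: "real \<Rightarrow> nat \<Rightarrow> nat \<Rightarrow> real" where
  "lev W e j = gain r q m e (real j * W / real pr) / W"

text \<open>Truncation makes every edge eligible for the rounding of small gains, whichever edges an
  optimal policy uses as large ones. The true gain is never smaller.\<close>

definition sg :: "real \<Rightarrow> nat \<Rightarrow> nat \<Rightarrow> real" where
  "sg W e j = min (lev W e j) (tau pr)"

definition shr :: "real \<Rightarrow> nat \<Rightarrow> (nat \<Rightarrow> real) \<Rightarrow> nat \<Rightarrow> nat \<Rightarrow> real" where
  "shr W P \<Lambda> e j = share (lvls pr) P \<Lambda> (sg W) e j"

text \<open>The top digit counts edges. Digit \<open>b < 2 * lvls pr\<close> carries the gain in bin \<open>b\<close>, padded by \<open>dpad\<close> so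
  that it also counts the edges in bin \<open>b\<close>. The remaining digits carry the fractional load that
  is withdrawn from the small-gain bins when \<open>e\<close> is treated as large.\<close>

definition code :: "real \<Rightarrow> nat \<Rightarrow> (nat \<Rightarrow> real) \<Rightarrow> nat \<Rightarrow> nat \<Rightarrow> nat" where
  "code W P \<Lambda> e b = ubase pr ^ (3 * lvls pr + 1) + ubase pr ^ b * (dpad pr + dig (dres pr) (lev W e (b div 2)) (dres pr))
     + (\<Sum>j<lvls pr. ubase pr ^ (2 * lvls pr + j) * dig (dres pr) (shr W P \<Lambda> e j * sg W e j) (dres pr))
     + ubase pr ^ (3 * lvls pr) * dig (dres pr) (\<Sum>j<lvls pr. shr W P \<Lambda> e j) (dres pr)"

definition lrg :: "real \<Rightarrow> nat \<Rightarrow> (nat \<Rightarrow> real) \<Rightarrow> nat \<Rightarrow> nat \<Rightarrow> nat" where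
  "lrg W P \<Lambda> s = lasg (code W P \<Lambda>) (2 * lvls pr) n s"

definition load :: "real \<Rightarrow> nat \<Rightarrow> (nat \<Rightarrow> real) \<Rightarrow> nat \<Rightarrow> nat \<Rightarrow> real" where
  "load W P \<Lambda> s j = (\<Sum>e\<in>{e. e < n \<and> lrg W P \<Lambda> s e = 0}.
     if j < lvls pr then shr W P \<Lambda> e j * sg W e j else (\<Sum>k<lvls pr. shr W P \<Lambda> e k))"

definition sch :: "real \<Rightarrow> nat \<Rightarrow> (nat \<Rightarrow> real) \<Rightarrow> nat \<Rightarrow> nat \<Rightarrow> nat" where
  "sch W P \<Lambda> s = rchoice (lvls pr) (shr W P \<Lambda>) (sg W) (tau pr) (load W P \<Lambda> s) (\<lambda>e. lrg W P \<Lambda> s e = 0)"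

text \<open>Small gains of level \<open>j\<close> belong to the even bin \<open>2 * j\<close>, whose
  stored number is \<open>2 * j + 1\<close>.\<close>

definition asg :: "real \<Rightarrow> nat \<Rightarrow> (nat \<Rightarrow> real) \<Rightarrow> nat \<Rightarrow> nat \<Rightarrow> nat" where
  "asg W P \<Lambda> s e = (if 0 < lrg W P \<Lambda> s e then lrg W P \<Lambda> s e
     else if sch W P \<Lambda> s e < lvls pr then 2 * sch W P \<Lambda> s e + 1 else 0)"

definition cand :: "real \<Rightarrow> nat \<Rightarrow> (nat \<Rightarrow> real) \<Rightarrow> nat \<Rightarrow> real" where
  "cand W P \<Lambda> s = opt r q m (rev (bin_order n (2 * lvls pr) (asg W P \<Lambda> s))) l"

lemma tau_bounds: "0 < tau pr" "tau pr \<le> 1"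
  using N2 by (auto simp: tau_def)

lemma lev_nonneg: "0 < W \<Longrightarrow> 0 \<le> lev W e j"
  by (simp add: lev_def)

lemma sg_bounds: "0 < W \<Longrightarrow> 0 \<le> sg W e j" "0 < W \<Longrightarrow> sg W e j \<le> tau pr"
  using tau_bounds by (auto simp: sg_def lev_nonneg)

lemma share_bounds:
  assumes "0 < W" "\<forall>j. 0 \<le> \<Lambda> j"
  shows "0 \<le> shr W P \<Lambda> e j" "(\<Sum>j<lvls pr. shr W P \<Lambda> e j) \<le> 1"
proof -
  have S: "0 \<le> (\<Sum>k<lvls pr. \<Lambda> k * sg W e k ^ P)" using assms sg_bounds[OF assms(1)] by (intro sum_nonneg) auto
  show "0 \<le> shr W P \<Lambda> e j" unfolding shr_def share_def
    using assms sg_bounds[OF assms(1)] S by (intro divide_nonneg_nonneg mult_nonneg_nonneg add_nonneg_nonneg) auto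
  have "(\<Sum>j<lvls pr. shr W P \<Lambda> e j) = (\<Sum>k<lvls pr. \<Lambda> k * sg W e k ^ P) / (\<Lambda> (lvls pr) + (\<Sum>k<lvls pr. \<Lambda> k * sg W e k ^ P))"
    by (simp add: shr_def share_def sum_divide_distrib)
  also have "\<dots> \<le> 1" using S spec[OF assms(2), of "lvls pr"]
    by (cases "\<Lambda> (lvls pr) + (\<Sum>k<lvls pr. \<Lambda> k * sg W e k ^ P) = 0") (auto simp: divide_le_eq_1)
  finally show "(\<Sum>j<lvls pr. shr W P \<Lambda> e j) \<le> 1" .
qed

lemma share_le_1:
  assumes "0 < W" "\<forall>j. 0 \<le> \<Lambda> j" "j < lvls pr"
  shows "shr W P \<Lambda> e j \<le> 1"
proof -
  have "shr W P \<Lambda> e j \<le> (\<Sum>j<lvls pr. shr W P \<Lambda> e j)"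
    using assms share_bounds[OF assms(1,2)] by (intro member_le_sum[of j "{..<lvls pr}" "shr W P \<Lambda> e"]) auto
  moreover have "(\<Sum>j<lvls pr. shr W P \<Lambda> e j) \<le> 1"
    by (rule share_bounds(2)) (use assms in auto)
  ultimately show ?thesis by linarith
qed

text \<open>The digits in base \<open>ubase pr\<close> of a sum of codes: \<open>code_sum\<close>
  gives the expansion, and \<open>code_match\<close> shows that no digit overflows.\<close>

definition dvec :: "real \<Rightarrow> nat \<Rightarrow> (nat \<Rightarrow> real) \<Rightarrow> (nat \<Rightarrow> nat) \<Rightarrow> nat \<Rightarrow> nat" where
  "dvec W P \<Lambda> z i =
     (if i < 2 * lvls pr then (\<Sum>e\<in>{e. e < n \<and> z e = Suc i}. dpad pr + dig (dres pr) (lev W e (i div 2)) (dres pr))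
      else if i < 3 * lvls pr then (\<Sum>e\<in>{e. e < n \<and> 0 < z e}.
          dig (dres pr) (shr W P \<Lambda> e (i - 2 * lvls pr) * sg W e (i - 2 * lvls pr)) (dres pr))
      else if i = 3 * lvls pr then (\<Sum>e\<in>{e. e < n \<and> 0 < z e}. dig (dres pr) (\<Sum>j<lvls pr. shr W P \<Lambda> e j) (dres pr))
      else card {e. e < n \<and> 0 < z e})"

lemma code_sum:
  assumes "\<And>e. e < n \<Longrightarrow> z e \<le> 2 * lvls pr"
  shows "(\<Sum>e\<in>{e. e < n \<and> 0 < z e}. code W P \<Lambda> e (z e - 1)) = (\<Sum>i<3 * lvls pr + 2. dvec W P \<Lambda> z i * ubase pr ^ i)"
proof -
  define J where "J = lvls pr"
  define U where "U = ubase pr"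
  define Z where "Z = {e. e < n \<and> 0 < z e}"
  have fin: "finite Z" by (simp add: Z_def)
  have split: "(\<Sum>i<3 * J + 2. f i) = (\<Sum>i<2 * J. f i) + (\<Sum>i<J. f (2 * J + i)) + f (3 * J) + f (3 * J + 1)"
    for f :: "nat \<Rightarrow> nat"
  proof -
    have "(\<Sum>i<3 * J + 2. f i) = (\<Sum>i<2 * J + J. f i) + f (3 * J) + f (3 * J + 1)"
      by (simp add: numeral_2_eq_2 algebra_simps numeral_3_eq_3)
    then show ?thesis by (simp only: sum_lessThan_add)
  qed
  have A: "(\<Sum>e\<in>Z. U ^ (z e - 1) * (dpad pr + dig (dres pr) (lev W e ((z e - 1) div 2)) (dres pr)))
     = (\<Sum>i<2 * J. dvec W P \<Lambda> z i * U ^ i)"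
  proof -
    have "(\<Sum>i<2 * J. dvec W P \<Lambda> z i * U ^ i) =
        (\<Sum>i<2 * J. \<Sum>e\<in>{e\<in>Z. z e - 1 = i}. U ^ (z e - 1) * (dpad pr + dig (dres pr) (lev W e ((z e - 1) div 2)) (dres pr)))"
    proof (rule sum.cong[OF refl])
      fix i assume i: "i \<in> {..<2 * J}"
      have "{e\<in>Z. z e - 1 = i} = {e. e < n \<and> z e = Suc i}" by (auto simp: Z_def)
      then show "dvec W P \<Lambda> z i * U ^ i = (\<Sum>e\<in>{e\<in>Z. z e - 1 = i}. U ^ (z e - 1) * (dpad pr + dig (dres pr) (lev W e ((z e - 1) div 2)) (dres pr)))"
        using i by (auto simp: dvec_def J_def sum_distrib_left mult.commute intro!: sum.cong)
    qed
    also have "\<dots> = (\<Sum>e\<in>Z. U ^ (z e - 1) * (dpad pr + dig (dres pr) (lev W e ((z e - 1) div 2)) (dres pr)))"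
      using assms fin by (intro sum.group) (force simp: Z_def J_def)+
    finally show ?thesis by simp
  qed
  have B: "(\<Sum>e\<in>Z. \<Sum>j<J. U ^ (2 * J + j) * dig (dres pr) (shr W P \<Lambda> e j * sg W e j) (dres pr))
     = (\<Sum>i<J. dvec W P \<Lambda> z (2 * J + i) * U ^ (2 * J + i))"
    by (subst sum.swap) (auto simp: dvec_def Z_def J_def sum_distrib_left mult.commute intro!: sum.cong)
  show ?thesis
    unfolding code_def J_def[symmetric] U_def[symmetric] Z_def[symmetric] split sum.distrib A B
    by (simp add: dvec_def J_def[symmetric] Z_def[symmetric] sum_distrib_left mult.commute)
qed

text \<open>With at most \<open>hmax pr\<close> edges no digit reaches the base, so equal sums of
  codes have equal digits. The number of edges in \<open>z\<close> is not known beforehand;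
  comparing the sum with the place of the top digit bounds it first. Equal digits mean exactly equal
  counts, and gains and shares that agree up to rounding.\<close>

lemma code_match:
  assumes W: "0 < W" and \<Lambda>: "\<forall>j. 0 \<le> \<Lambda> j" and lev: "\<forall>e<n. \<forall>j. lev W e j \<le> 1"
    and xz: "\<forall>e<n. x e \<le> 2 * lvls pr" "\<forall>e<n. z e \<le> 2 * lvls pr"
    and eq: "(\<Sum>e\<in>{e. e < n \<and> 0 < z e}. code W P \<Lambda> e (z e - 1)) = (\<Sum>e\<in>{e. e < n \<and> 0 < x e}. code W P \<Lambda> e (x e - 1))"
    and h: "card {e. e < n \<and> 0 < x e} \<le> hmax pr"
  defines "h \<equiv> card {e. e < n \<and> 0 < x e}"
  shows "(\<Sum>e\<in>{e. e < n \<and> 0 < x e}. code W P \<Lambda> e (x e - 1)) < qsize pr"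
    and "card {e. e < n \<and> 0 < z e} = h"
    and "\<And>b. b < 2 * lvls pr \<Longrightarrow> card {e. e < n \<and> z e = Suc b} = card {e. e < n \<and> x e = Suc b}"
    and "\<And>b. b < 2 * lvls pr \<Longrightarrow> (\<Sum>e\<in>{e. e < n \<and> x e = Suc b}. lev W e (b div 2)) - real h / real (dres pr)
        \<le> (\<Sum>e\<in>{e. e < n \<and> z e = Suc b}. lev W e (b div 2))"
    and "\<And>j. j < lvls pr \<Longrightarrow> (\<Sum>e\<in>{e. e < n \<and> 0 < z e}. shr W P \<Lambda> e j * sg W e j)
        \<le> (\<Sum>e\<in>{e. e < n \<and> 0 < x e}. shr W P \<Lambda> e j * sg W e j) + real h / real (dres pr)"
    and "(\<Sum>e\<in>{e. e < n \<and> 0 < x e}. \<Sum>j<lvls pr. shr W P \<Lambda> e j) - real h / real (dres pr)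
        \<le> (\<Sum>e\<in>{e. e < n \<and> 0 < z e}. \<Sum>j<lvls pr. shr W P \<Lambda> e j)"
    and "\<And>b. b < 2 * lvls pr \<Longrightarrow> (\<Sum>e\<in>{e. e < n \<and> z e = Suc b}. dig (dres pr) (lev W e (b div 2)) (dres pr))
        = (\<Sum>e\<in>{e. e < n \<and> x e = Suc b}. dig (dres pr) (lev W e (b div 2)) (dres pr))"
proof -
  define J where "J = lvls pr"
  define U where "U = ubase pr"
  define D where "D = dres pr"
  have lev1: "\<And>e j. e < n \<Longrightarrow> lev W e j \<le> 1"
    and x: "\<And>e. e < n \<Longrightarrow> x e \<le> 2 * lvls pr" and z: "\<And>e. e < n \<Longrightarrow> z e \<le> 2 * lvls pr"
    using lev xz by auto
  define H where "H = hmax pr"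
  let ?X = "{e. e < n \<and> 0 < x e}" and ?Z = "{e. e < n \<and> 0 < z e}"
  have D0: "0 < D" using N2 by (simp add: D_def dres_def)
  have H1: "1 \<le> H" using N2 by (simp add: H_def hmax_def)
  have digs: "dvec W P \<Lambda> y i < U" if "card {e. e < n \<and> 0 < y e} \<le> H" for y i
  proof -
    have le: "(\<Sum>e\<in>S. f e) < U" if "S \<subseteq> {e. e < n \<and> 0 < y e}" "\<And>e. f e \<le> dpad pr + D" for S and f :: "nat \<Rightarrow> nat"
    proof -
      have "(\<Sum>e\<in>S. f e) \<le> (\<Sum>e\<in>S. dpad pr + D)" using that(2) by (rule sum_mono)
      also have "\<dots> = card S * (dpad pr + D)" by simp
      also have "\<dots> \<le> H * (dpad pr + D)"
        using card_mono[OF _ that(1)] \<open>card _ \<le> H\<close> by (intro mult_le_mono1) (simp add: le_trans)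
      also have "\<dots> < U" by (simp add: U_def ubase_def H_def D_def add.commute)
      finally show ?thesis .
    qed
    have "card {e. e < n \<and> 0 < y e} = (\<Sum>e\<in>{e. e < n \<and> 0 < y e}. 1)" by simp
    also have "\<dots> < U" by (rule le) (auto simp: dpad_def)
    finally have c: "card {e. e < n \<and> 0 < y e} < U" .
    show ?thesis unfolding dvec_def
      by (auto simp: c D_def dig_le trans_le_add2[OF dig_le] intro!: le)
  qed
  have dx: "dvec W P \<Lambda> x i < U" for i using digs[of x] h by (simp add: H_def)
  have top: "(\<Sum>i<3 * J + 2. dvec W P \<Lambda> y i * U ^ i) = (\<Sum>i<3 * J + 1. dvec W P \<Lambda> y i * U ^ i) + card {e. e < n \<and> 0 < y e} * U ^ (3 * J + 1)" for y
    by (simp add: dvec_def J_def)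
  have sx: "(\<Sum>e\<in>?X. code W P \<Lambda> e (x e - 1)) = (\<Sum>i<3 * J + 2. dvec W P \<Lambda> x i * U ^ i)"
    unfolding J_def U_def by (rule code_sum[OF x])
  have sz: "(\<Sum>e\<in>?Z. code W P \<Lambda> e (z e - 1)) = (\<Sum>i<3 * J + 2. dvec W P \<Lambda> z i * U ^ i)"
    unfolding J_def U_def by (rule code_sum[OF z])
  have "(\<Sum>i<3 * J + 1. dvec W P \<Lambda> x i * U ^ i) < U ^ (3 * J + 1)"
    using dx by (intro digits_less) auto
  moreover have "card ?X * U ^ (3 * J + 1) \<le> H * U ^ (3 * J + 1)" using h by (simp add: H_def)
  ultimately have "(\<Sum>e\<in>?X. code W P \<Lambda> e (x e - 1)) < (H + 1) * U ^ (3 * J + 1)"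
    unfolding sx top by (simp only: add_mult_distrib mult_1)
  then show q: "(\<Sum>e\<in>?X. code W P \<Lambda> e (x e - 1)) < qsize pr"
    by (simp add: qsize_def H_def U_def J_def)
  have "card ?Z * U ^ (3 * J + 1) \<le> (\<Sum>e\<in>?Z. code W P \<Lambda> e (z e - 1))" unfolding sz top by simp
  also have "\<dots> < (H + 1) * U ^ (3 * J + 1)" using q eq by (simp add: qsize_def H_def U_def J_def)
  finally have "card ?Z < H + 1" by (rule mult_less_cancel2[THEN iffD1, THEN conjunct2])
  then have dz: "dvec W P \<Lambda> z i < U" for i using digs[of z] by simp
  have "(\<Sum>i<3 * J + 2. dvec W P \<Lambda> z i * U ^ i) = (\<Sum>i<3 * J + 2. dvec W P \<Lambda> x i * U ^ i)"
    using eq unfolding sx sz .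
  from digits_unique[OF this] dx dz have same: "dvec W P \<Lambda> z i = dvec W P \<Lambda> x i" if "i < 3 * J + 2" for i
    using that by blast
  show hz: "card ?Z = h" using same[of "3 * J + 1"] by (simp add: dvec_def J_def h_def)
  \<comment> \<open>\<open>dpad pr\<close> exceeds every sum of \<open>hmax pr\<close> digits, so
    division with remainder by it separates the number of edges from the sum of their
    digits.\<close>
  have pad: "(\<Sum>e\<in>S. dpad pr + f e) div dpad pr = card S \<and> (\<Sum>e\<in>S. dpad pr + f e) mod dpad pr = (\<Sum>e\<in>S. f e)"
    if "card S \<le> H" "\<And>e. f e \<le> D" for S and f :: "nat \<Rightarrow> nat"
  proof -
    have "(\<Sum>e\<in>S. f e) \<le> (\<Sum>e\<in>S. D)" using that(2) by (rule sum_mono)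
    also have "\<dots> \<le> H * D" using that(1) by simp
    also have "\<dots> < dpad pr" by (simp add: dpad_def H_def D_def)
    finally show ?thesis by (simp add: sum.distrib)
  qed
  have cS: "card {e. e < n \<and> y e = Suc b} \<le> card {e. e < n \<and> 0 < y e}" for y b
    by (intro card_mono) auto
  have bins: "card {e. e < n \<and> z e = Suc b} = card {e. e < n \<and> x e = Suc b} \<and>
     (\<Sum>e\<in>{e. e < n \<and> z e = Suc b}. dig D (lev W e (b div 2)) D) = (\<Sum>e\<in>{e. e < n \<and> x e = Suc b}. dig D (lev W e (b div 2)) D)"
    if "b < 2 * lvls pr" for b
  proof -
    have "(\<Sum>e\<in>{e. e < n \<and> z e = Suc b}. dpad pr + dig D (lev W e (b div 2)) D) = (\<Sum>e\<in>{e. e < n \<and> x e = Suc b}. dpad pr + dig D (lev W e (b div 2)) D)"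
      using same[of b] that by (simp add: dvec_def J_def D_def)
    moreover have "card {e. e < n \<and> z e = Suc b} \<le> H" "card {e. e < n \<and> x e = Suc b} \<le> H"
      using cS[of z b] cS[of x b] h hz by (auto simp: h_def H_def)
    ultimately show ?thesis
      using pad[of "{e. e < n \<and> z e = Suc b}" "\<lambda>e. dig D (lev W e (b div 2)) D"]
        pad[of "{e. e < n \<and> x e = Suc b}" "\<lambda>e. dig D (lev W e (b div 2)) D"] dig_le
      by simp
  qed
  show "card {e. e < n \<and> z e = Suc b} = card {e. e < n \<and> x e = Suc b}" if "b < 2 * lvls pr" for b
    using bins[OF that] by simp
  show "(\<Sum>e\<in>{e. e < n \<and> z e = Suc b}. dig (dres pr) (lev W e (b div 2)) (dres pr))
        = (\<Sum>e\<in>{e. e < n \<and> x e = Suc b}. dig (dres pr) (lev W e (b div 2)) (dres pr))" if "b < 2 * lvls pr" for b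
    using bins[OF that] by (simp add: D_def)
  show "(\<Sum>e\<in>{e. e < n \<and> x e = Suc b}. lev W e (b div 2)) - real h / real (dres pr)
        \<le> (\<Sum>e\<in>{e. e < n \<and> z e = Suc b}. lev W e (b div 2))" if "b < 2 * lvls pr" for b
  proof -
    have "(\<Sum>e\<in>{e. e < n \<and> x e = Suc b}. lev W e (b div 2)) - real (card {e. e < n \<and> x e = Suc b}) / real D
        \<le> (\<Sum>e\<in>{e. e < n \<and> z e = Suc b}. lev W e (b div 2))"
      using bins[OF that] D0 lev1 lev_nonneg[OF W] by (intro sum_dig_transfer) auto
    moreover have "real (card {e. e < n \<and> x e = Suc b}) / real D \<le> real h / real D"
      using cS[of x b] by (intro divide_right_mono) (auto simp: h_def)
    ultimately show ?thesis by (simp add: D_def)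
  qed
  have ys: "0 \<le> shr W P \<Lambda> e j * sg W e j \<and> shr W P \<Lambda> e j * sg W e j \<le> 1" if "j < lvls pr" for e j
    using share_bounds(1)[OF W \<Lambda>] share_le_1[OF W \<Lambda> that] sg_bounds[OF W, of e j] sg_bounds(2)[OF W, of e j] tau_bounds
    by (auto intro!: mult_nonneg_nonneg mult_le_one)
  show "(\<Sum>e\<in>?Z. shr W P \<Lambda> e j * sg W e j) \<le> (\<Sum>e\<in>?X. shr W P \<Lambda> e j * sg W e j) + real h / real (dres pr)"
    if "j < lvls pr" for j
  proof -
    have "(\<Sum>e\<in>?X. dig D (shr W P \<Lambda> e j * sg W e j) D) = (\<Sum>e\<in>?Z. dig D (shr W P \<Lambda> e j * sg W e j) D)"
      using same[of "2 * J + j"] that by (simp add: dvec_def J_def D_def)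
    from sum_dig_transfer[OF this D0] ys[OF that] show ?thesis by (simp add: hz D_def)
  qed
  have "(\<Sum>e\<in>?Z. dig D (\<Sum>j<lvls pr. shr W P \<Lambda> e j) D) = (\<Sum>e\<in>?X. dig D (\<Sum>j<lvls pr. shr W P \<Lambda> e j) D)"
    using same[of "3 * J"] by (simp add: dvec_def J_def D_def)
  from sum_dig_transfer[OF this D0] share_bounds[OF W \<Lambda>]
  show "(\<Sum>e\<in>?X. \<Sum>j<lvls pr. shr W P \<Lambda> e j) - real h / real (dres pr)
        \<le> (\<Sum>e\<in>?Z. \<Sum>j<lvls pr. shr W P \<Lambda> e j)"
    by (simp add: h_def D_def sum_nonneg)
qed

end

section \<open>Existence of a good candidate\<close>

context star
begin

lemma run_val_take: "i < length fs \<Longrightarrow> run_val r q m (take (Suc i) fs) V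
    = run_val r q m (take i fs) V + gain r q m (fs ! i) (run_val r q m (take i fs) V)"
  by (simp add: take_Suc_conv_app_nth)

lemma grid_nonneg: "x \<in> grid pr k \<Longrightarrow> 0 \<le> x"
  by (auto simp: grid_def)

text \<open>If \<open>l\<close> is large, the multipliers come from
  \<open>soft_assignment_exists\<close>. Otherwise the whole demand, at most
  \<open>l * tau pr\<close>, is declared an error; with all multipliers 0 no small edge is placed,
  and so the budget is not at risk.\<close>

lemma soft_small:
  assumes E: "E \<subseteq> {..<n}" and W: "0 < W"
    and A: "A \<subseteq> E" and \<sigma>: "\<And>e. e \<in> A \<Longrightarrow> \<sigma> e < lvls pr"
    and d: "\<And>j. j < lvls pr \<Longrightarrow> d j \<le> (\<Sum>e\<in>{e\<in>A. \<sigma> e = j}. sg W e j)"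
      "\<And>j. j < lvls pr \<Longrightarrow> 0 \<le> d j" "(\<Sum>j<lvls pr. d j) \<le> 2" "(\<Sum>j<lvls pr. d j) \<le> real l * tau pr"
    and lg: "lg \<ge> 1" "2 * real pr * (real (lvls pr) + 1) * (real n + 1) \<le> 2 ^ lg" "real pr ^ 5 \<le> 2 ^ lg"
  shows "\<exists>\<Lambda>. ((\<forall>j. \<Lambda> j \<in> grid pr (6 * pr\<^sup>2 * lg\<^sup>2 + 1)) \<and> (\<forall>j>lvls pr. \<Lambda> j = 0)) \<and>
     (\<exists>er. (\<forall>j<lvls pr. 0 \<le> er j \<and> d j - er j \<le> (\<Sum>e\<in>E. shr W (pr * lg) \<Lambda> e j * sg W e j)) \<and>
           (\<Sum>j<lvls pr. er j) \<le> 16 / real pr) \<and>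
     ((\<forall>e j. shr W (pr * lg) \<Lambda> e j = 0) \<or>
      16 * real pr ^ 3 \<le> real l \<and> (\<Sum>e\<in>E. \<Sum>j<lvls pr. shr W (pr * lg) \<Lambda> e j) \<le> (1 + 7 / real pr) * real (card A) + 5)"
proof (cases "real l < 16 * real pr ^ 3")
  case True
  have p: "0 < real pr" "1 \<le> real pr" using N2 by auto
  have "(\<Sum>j<lvls pr. d j) \<le> 16 * real pr ^ 3 * tau pr"
    using d(4) True tau_bounds by (meson less_imp_le mult_right_mono order_trans)
  also have "\<dots> = 16 / real pr / real pr" using p by (simp add: tau_def field_simps eval_nat_numeral)
  also have "\<dots> \<le> 16 / real pr / 1" using p by (intro divide_left_mono) auto
  finally have "(\<Sum>j<lvls pr. d j) \<le> 16 / real pr" by simp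
  then show ?thesis using d(2)
    by (intro exI[of _ "\<lambda>_. 0"] conjI exI[of _ d]) (auto simp: shr_def share_def grid_def)
next
  case False
  have p: "0 < real pr" "1 \<le> real pr" using N2 by auto
  have fE: "finite E" using E finite_subset by blast
  have "card E \<le> n" using card_mono[OF _ E] by simp
  have d2: "d j \<le> 2" if "j < lvls pr" for j
    using d(3) member_le_sum[of j "{..<lvls pr}" d] d(2) that by (auto intro: order_trans)
  have "\<exists>\<Lambda>. (\<forall>j\<le>lvls pr. \<Lambda> j \<in> grid pr (6 * pr\<^sup>2 * lg\<^sup>2 + 1)) \<and>
     (\<forall>j<lvls pr. (1 - 5 / real pr) * d j - tau pr \<le> (\<Sum>e\<in>E. share (lvls pr) (pr * lg) \<Lambda> (sg W) e j * sg W e j)) \<and>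
     (\<Sum>e\<in>E. \<Sum>j<lvls pr. share (lvls pr) (pr * lg) \<Lambda> (sg W) e j) \<le> (1 + 7 / real pr) * real (card A) + 5"
    by (rule soft_assignment_exists[where \<tau> = "tau pr" and \<sigma> = \<sigma> and n = n])
      (use N2 fE \<open>card E \<le> n\<close> tau_bounds sg_bounds[OF W] A \<sigma> d d2 lg in \<open>auto simp: tau_def\<close>)
  then obtain \<Lambda> where \<Lambda>: "\<forall>j\<le>lvls pr. \<Lambda> j \<in> grid pr (6 * pr\<^sup>2 * lg\<^sup>2 + 1)"
    "\<forall>j<lvls pr. (1 - 5 / real pr) * d j - tau pr \<le> (\<Sum>e\<in>E. share (lvls pr) (pr * lg) \<Lambda> (sg W) e j * sg W e j)"
    "(\<Sum>e\<in>E. \<Sum>j<lvls pr. share (lvls pr) (pr * lg) \<Lambda> (sg W) e j) \<le> (1 + 7 / real pr) * real (card A) + 5"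
    by blast
  define \<Lambda>' where "\<Lambda>' j = (if j \<le> lvls pr then \<Lambda> j else 0)" for j
  have sh: "shr W (pr * lg) \<Lambda>' e j = share (lvls pr) (pr * lg) \<Lambda> (sg W) e j" if "j < lvls pr" for e j
    using that by (simp add: shr_def share_def \<Lambda>'_def)
  define er where "er j = 5 / real pr * d j + tau pr" for j
  have "(\<Sum>j<lvls pr. er j) = 5 / real pr * (\<Sum>j<lvls pr. d j) + real (lvls pr) * tau pr"
    by (simp add: er_def sum.distrib sum_distrib_left)
  also have "\<dots> \<le> 5 / real pr * 2 + 3 / real pr"
  proof (intro add_mono mult_left_mono d)
    have "real (lvls pr) \<le> 3 * real pr ^ 4"
    proof -
      have "real pr \<le> real pr ^ 4" by (rule self_le_power) (use p in auto)
      moreover have "real (lvls pr) = 2 * real pr + 1" by (simp add: lvls_def)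
      ultimately show ?thesis using p by linarith
    qed
    then have "real (lvls pr) * tau pr \<le> 3 * real pr ^ 4 * tau pr" using tau_bounds by (intro mult_right_mono) auto
    also have "\<dots> = 3 / real pr" using p by (simp add: tau_def field_simps eval_nat_numeral)
    finally show "real (lvls pr) * tau pr \<le> 3 / real pr" .
  qed (use p in simp)
  also have "\<dots> \<le> 16 / real pr" by (simp add: divide_right_mono)
  finally have "(\<Sum>j<lvls pr. er j) \<le> 16 / real pr" .
  moreover have "0 \<le> er j \<and> d j - er j \<le> (\<Sum>e\<in>E. shr W (pr * lg) \<Lambda>' e j * sg W e j)" if "j < lvls pr" for j
  proof -
    have eq: "(\<Sum>e\<in>E. shr W (pr * lg) \<Lambda>' e j * sg W e j)
        = (\<Sum>e\<in>E. share (lvls pr) (pr * lg) \<Lambda> (sg W) e j * sg W e j)"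
      by (simp add: sh[OF that])
    have dj: "d j - er j = (1 - 5 / real pr) * d j - tau pr" by (simp add: er_def algebra_simps)
    have "0 \<le> er j" using d(2)[OF that] tau_bounds by (simp add: er_def)
    then show ?thesis unfolding eq dj using \<Lambda>(2) that by blast
  qed
  moreover have "(\<forall>j. \<Lambda>' j \<in> grid pr (6 * pr\<^sup>2 * lg\<^sup>2 + 1)) \<and> (\<forall>j>lvls pr. \<Lambda>' j = 0)" using \<Lambda>(1) by (auto simp: \<Lambda>'_def grid_def)
  moreover have "16 * real pr ^ 3 \<le> real l \<and> (\<Sum>e\<in>E. \<Sum>j<lvls pr. shr W (pr * lg) \<Lambda>' e j) \<le> (1 + 7 / real pr) * real (card A) + 5"
  proof -
    have "(\<Sum>e\<in>E. \<Sum>j<lvls pr. shr W (pr * lg) \<Lambda>' e j)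
        = (\<Sum>e\<in>E. \<Sum>j<lvls pr. share (lvls pr) (pr * lg) \<Lambda> (sg W) e j)"
      by (intro sum.cong refl) (simp add: sh)
    then show ?thesis using \<Lambda>(3) False by simp
  qed
  ultimately show ?thesis by blast
qed

text \<open>Both witnesses are read off an optimal policy: \<open>s\<close> is the sum of the codes
  of its large increments, and \<open>\<Lambda>\<close> solves the fractional assignment for its
  small ones. The table may return other large edges with the same sum of codes, and the analysis
  uses nothing about them but \<open>code_match\<close>. The bound on single gains puts
  \<open>lev\<close> into the range of the digits.\<close>

lemma candidate_good:
  assumes W: "0 < W" "W \<le> OPT {..<n} {..<m} l r q" "OPT {..<n} {..<m} l r q \<le> 2 * W"
    and M: "\<And>e. e < n \<Longrightarrow> gain r q m e 0 \<le> W"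
    and lg: "lg \<ge> 1" "2 * real pr * (real (lvls pr) + 1) * (real n + 1) \<le> 2 ^ lg" "real pr ^ 5 \<le> 2 ^ lg"
  shows "\<exists>\<Lambda> s. (\<forall>j. \<Lambda> j \<in> grid pr (6 * pr\<^sup>2 * lg\<^sup>2 + 1)) \<and> (\<forall>j>lvls pr. \<Lambda> j = 0) \<and> s < qsize pr \<and>
    (1 - 100 / real pr) * OPT {..<n} {..<m} l r q \<le> cand W (pr * lg) \<Lambda> s"
proof -
  define Op where "Op = OPT {..<n} {..<m} l r q"
  define P where "P = pr * lg"
  define J where "J = lvls pr"
  define \<tau> where "\<tau> = tau pr"
  have p: "0 < real pr" "1 \<le> real pr" using N2 by auto
  have J: "J = 2 * pr + 1" by (simp add: J_def lvls_def)
  have \<tau>: "0 < \<tau>" "\<tau> \<le> 1" using tau_bounds by (simp_all add: \<tau>_def)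
  obtain es where es: "distinct es" "set es \<subseteq> {..<n}" "length es \<le> l" "comp_val r q m es 0 = Op"
    using OPT_comp_val unfolding Op_def by blast
  define fs where "fs = rev es"
  define k where "k = length fs"
  have fs: "distinct fs" "set fs \<subseteq> {..<n}" "k \<le> l" using es by (auto simp: fs_def k_def)
  have fsn: "fs ! i < n" if "i < k" for i using fs(2) that nth_mem unfolding k_def by blast
  have inj: "inj_on (\<lambda>i. fs ! i) {..<k}" using fs(1) by (auto simp: k_def inj_on_def nth_eq_iff_index_eq)
  define T where "T i = run_val r q m (take i fs) 0" for i
  have T0: "T 0 = 0" by (simp add: T_def)
  have TS: "T (Suc i) = T i + gain r q m (fs ! i) (T i)" if "i < k" for i
    using run_val_take[of i fs 0] that by (simp add: T_def k_def)
  have Tk: "T k = Op" using es(4) comp_val_rev[of r q m fs 0] by (simp add: T_def k_def fs_def)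
  have Tle: "T i \<le> T (Suc i)" if "i < k" for i using TS[OF that] by simp
  have Tmono: "T i \<le> T i'" if "i \<le> i'" "i' \<le> k" for i i'
    using that(1,2)
  proof (induction i' rule: dec_induct)
    case (step i')
    then show ?case using Tle[of i'] by simp
  qed simp
  have Tnn: "0 \<le> T i" "T i \<le> 2 * W" if "i \<le> k" for i
    using Tmono[of 0 i] Tmono[of i k] that T0 Tk W by (auto simp: Op_def)
  define \<delta> where "\<delta> = W / real pr"
  define \<theta> where "\<theta> = \<tau> * W"
  have \<delta>0: "0 < \<delta>" using W p by (simp add: \<delta>_def)
  have \<theta>0: "0 < \<theta>" using W \<tau> by (simp add: \<theta>_def)
  define lv where "lv i = nat \<lfloor>T i / \<delta>\<rfloor>" for i
  have lv: "real (lv i) * \<delta> \<le> T i \<and> T i < (real (lv i) + 1) * \<delta>" if "i < k" for i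
  proof -
    have "0 \<le> T i / \<delta>" using Tnn[of i] that \<delta>0 by simp
    then have "real (lv i) = of_int \<lfloor>T i / \<delta>\<rfloor>" by (simp add: lv_def)
    then have "real (lv i) \<le> T i / \<delta>" "T i / \<delta> < real (lv i) + 1" by linarith+
    then show ?thesis using \<delta>0 by (simp add: field_simps)
  qed
  have lvJ: "lv i < J" if "i < k" for i
  proof -
    have "real (lv i) * \<delta> \<le> 2 * W" using lv[OF that] Tnn[of i] that by linarith
    then have "real (lv i) \<le> 2 * real pr" using W p by (simp add: \<delta>_def field_simps)
    then show ?thesis by (simp add: J)
  qed
  define cross where "cross i \<longleftrightarrow> \<theta> < T (Suc i) - T i \<and> (real (lv i) + 1) * \<delta> \<le> T (Suc i)" for i
  define bin where "bin i = 2 * lv i + (if cross i then 1 else 0)" for i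
  have bin_div: "bin i div 2 = lv i" for i by (simp add: bin_def)
  have binJ: "bin i < 2 * J" if "i < k" for i using lvJ[OF that] by (simp add: bin_def)
  define LS where "LS = {i. i < k \<and> \<theta> < T (Suc i) - T i}"
  define SS where "SS = {i. i < k \<and> \<not> \<theta> < T (Suc i) - T i}"
  have fin: "finite LS" "finite SS" by (auto simp: LS_def SS_def)
  \<comment> \<open>The bin, stored plus one, of each edge with a large increment in the optimal
    policy.\<close>
  define x where "x e = (if \<exists>i\<in>LS. fs ! i = e then Suc (bin (THE i. i \<in> LS \<and> fs ! i = e)) else 0)" for e
  have xfs: "x (fs ! i) = (if i \<in> LS then Suc (bin i) else 0)" if "i < k" for i
  proof -
    have "i' = i" if "i' \<in> LS" "fs ! i' = fs ! i" for i'
      using inj that \<open>i < k\<close> by (auto simp: LS_def inj_on_def)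
    then have "(\<exists>i'\<in>LS. fs ! i' = fs ! i) \<longleftrightarrow> i \<in> LS" "i \<in> LS \<Longrightarrow> (THE i'. i' \<in> LS \<and> fs ! i' = fs ! i) = i"
      by auto
    then show ?thesis by (simp add: x_def)
  qed
  have Xset: "{e. e < n \<and> 0 < x e} = (\<lambda>i. fs ! i) ` LS"
    using fsn by (auto simp: x_def LS_def)
  have Xb: "{e. e < n \<and> x e = Suc b} = (\<lambda>i. fs ! i) ` {i\<in>LS. bin i = b}" for b
  proof -
    have "{e. e < n \<and> x e = Suc b} = {e \<in> (\<lambda>i. fs ! i) ` LS. x e = Suc b}" using Xset by auto
    also have "\<dots> = (\<lambda>i. fs ! i) ` {i\<in>LS. bin i = b}" using xfs by (auto simp: LS_def)
    finally show ?thesis .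
  qed
  have injS: "inj_on (\<lambda>i. fs ! i) A" if "A \<subseteq> {..<k}" for A using inj that by (rule inj_on_subset)
  define h where "h = card {e. e < n \<and> 0 < x e}"
  have h: "h = card LS" unfolding h_def Xset by (rule card_image[OF injS]) (auto simp: LS_def)
  have x2J: "x e \<le> 2 * J" for e
  proof (cases "\<exists>i\<in>LS. fs ! i = e")
    case True
    then obtain i where i: "i \<in> LS" "i < k" "e = fs ! i" by (auto simp: LS_def)
    have "x e = Suc (bin i)" using xfs[OF i(2)] i(1) unfolding i(3) by simp
    then show ?thesis using binJ[OF i(2)] by simp
  qed (simp add: x_def)
  have tele: "(\<Sum>i<k. T (Suc i) - T i) = Op"
    using sum_lessThan_telescope[of T k] T0 Tk by simp
  have h5: "real h \<le> 2 * real pr ^ 5"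
  proof -
    have "real h * \<theta> = (\<Sum>i\<in>LS. \<theta>)" by (simp add: h)
    also have "\<dots> \<le> (\<Sum>i\<in>LS. T (Suc i) - T i)" by (intro sum_mono) (auto simp: LS_def)
    also have "\<dots> \<le> (\<Sum>i<k. T (Suc i) - T i)" using Tle by (intro sum_mono2) (auto simp: LS_def)
    also have "\<dots> \<le> 2 * W" using tele W by (simp add: Op_def)
    finally show ?thesis using W p by (simp add: \<theta>_def \<tau>_def tau_def field_simps)
  qed
  have hH: "h \<le> hmax pr"
  proof -
    have "real h \<le> real (hmax pr)" using h5 by (simp add: hmax_def)
    then show ?thesis by simp
  qed
  have lev1: "lev W e j \<le> 1" if "e < n" for e j
  proof -
    have "gain r q m e (real j * W / real pr) \<le> gain r q m e 0"
      using that W p by (intro gain_antimono) auto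
    then show ?thesis using M[OF that] W(1) by (simp add: lev_def)
  qed
  have glev: "gain r q m e (real j * \<delta>) = W * lev W e j" for e j
    using W(1) by (simp add: lev_def \<delta>_def)
  have inc_le: "T (Suc i) - T i \<le> W * lev W (fs ! i) (lv i)" if "i < k" for i
  proof -
    have "gain r q m (fs ! i) (T i) \<le> gain r q m (fs ! i) (real (lv i) * \<delta>)"
      using lv[OF that] by (intro gain_antimono fsn that) auto
    then show ?thesis using TS[OF that] glev by simp
  qed
  \<comment> \<open>The edges that are not large in the optimal policy, whether queried or not. The
    multipliers are chosen for these, with the small edges \<open>A\<close> of the policy as the
    witness that the demands can be met.\<close>
  define E where "E = {e. e < n \<and> x e = 0}"
  define A where "A = (\<lambda>i. fs ! i) ` SS"
  define idx where "idx e = (THE i. i < k \<and> fs ! i = e)" for e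
  have idx: "idx (fs ! i) = i" if "i < k" for i
    unfolding idx_def using inj that by (intro the_equality) (auto simp: inj_on_def)
  define \<sigma> where "\<sigma> e = lv (idx e)" for e
  define d where "d j = (\<Sum>i\<in>{i\<in>SS. lv i = j}. T (Suc i) - T i) / W" for j
  have cA: "card A = card SS" unfolding A_def by (rule card_image[OF injS]) (auto simp: SS_def)
  have kk: "h + card A = k"
  proof -
    have "LS \<union> SS = {..<k}" "LS \<inter> SS = {}" by (auto simp: LS_def SS_def)
    then show ?thesis using card_Un_disjoint[OF fin] by (simp add: h cA)
  qed
  have dsum: "(\<Sum>j<J. d j) = (\<Sum>i\<in>SS. T (Suc i) - T i) / W"
  proof -
    have "(\<Sum>j<J. \<Sum>i\<in>{i\<in>SS. lv i = j}. T (Suc i) - T i) = (\<Sum>i\<in>SS. T (Suc i) - T i)"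
      using lvJ fin by (intro sum.group) (auto simp: SS_def)
    then show ?thesis by (simp add: d_def sum_divide_distrib[symmetric])
  qed
  have d0: "0 \<le> d j" for j
    unfolding d_def using Tle W by (intro divide_nonneg_pos sum_nonneg) (auto simp: SS_def)
  have dsum2: "(\<Sum>j<J. d j) \<le> 2"
  proof -
    have "(\<Sum>i\<in>SS. T (Suc i) - T i) \<le> (\<Sum>i<k. T (Suc i) - T i)"
      using Tle by (intro sum_mono2) (auto simp: SS_def)
    then show ?thesis using tele W unfolding dsum by (simp add: Op_def divide_le_eq)
  qed
  have dsuml: "(\<Sum>j<J. d j) \<le> real l * \<tau>"
  proof -
    have "(\<Sum>i\<in>SS. T (Suc i) - T i) \<le> (\<Sum>i\<in>SS. \<theta>)" by (intro sum_mono) (auto simp: SS_def)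
    also have "\<dots> \<le> real l * \<theta>"
    proof -
      have "card SS \<le> l" using kk cA fs(3) by linarith
      then show ?thesis using \<theta>0 by (simp add: mult_right_mono)
    qed
    finally show ?thesis unfolding dsum using W(1) by (simp add: \<theta>_def divide_le_eq mult_ac)
  qed
  have dle: "d j \<le> (\<Sum>e\<in>{e\<in>A. \<sigma> e = j}. sg W e j)" for j
  proof -
    have eq: "{e\<in>A. \<sigma> e = j} = (\<lambda>i. fs ! i) ` {i\<in>SS. lv i = j}"
      by (auto simp: A_def \<sigma>_def SS_def idx)
    have "(\<Sum>e\<in>{e\<in>A. \<sigma> e = j}. sg W e j) = (\<Sum>i\<in>{i\<in>SS. lv i = j}. sg W (fs ! i) j)"
      unfolding eq by (subst sum.reindex[OF injS]) (auto simp: SS_def)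
    moreover have "d j \<le> (\<Sum>i\<in>{i\<in>SS. lv i = j}. sg W (fs ! i) j)"
      unfolding d_def sum_divide_distrib
    proof (rule sum_mono)
      fix i assume "i \<in> {i\<in>SS. lv i = j}"
      then have i: "i < k" "T (Suc i) - T i \<le> \<theta>" "lv i = j" by (auto simp: SS_def)
      have "(T (Suc i) - T i) / W \<le> lev W (fs ! i) j" using inc_le[OF i(1)] W(1) i(3) by (simp add: divide_le_eq mult_ac)
      moreover have "(T (Suc i) - T i) / W \<le> tau pr" using i(2) W(1) by (simp add: \<theta>_def \<tau>_def divide_le_eq)
      ultimately show "(T (Suc i) - T i) / W \<le> sg W (fs ! i) j" by (simp add: sg_def)
    qed
    ultimately show ?thesis by simp
  qed
  have AE: "A \<subseteq> E" unfolding A_def E_def using fsn xfs by (auto simp: SS_def LS_def)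
  have "\<exists>\<Lambda>. ((\<forall>j. \<Lambda> j \<in> grid pr (6 * pr\<^sup>2 * lg\<^sup>2 + 1)) \<and> (\<forall>j>lvls pr. \<Lambda> j = 0)) \<and>
     (\<exists>er. (\<forall>j<lvls pr. 0 \<le> er j \<and> d j - er j \<le> (\<Sum>e\<in>E. shr W (pr * lg) \<Lambda> e j * sg W e j)) \<and>
           (\<Sum>j<lvls pr. er j) \<le> 16 / real pr) \<and>
     ((\<forall>e j. shr W (pr * lg) \<Lambda> e j = 0) \<or>
      16 * real pr ^ 3 \<le> real l \<and> (\<Sum>e\<in>E. \<Sum>j<lvls pr. shr W (pr * lg) \<Lambda> e j) \<le> (1 + 7 / real pr) * real (card A) + 5)"
    by (rule soft_small[where \<sigma> = \<sigma>])
      (use W(1) AE dle d0 dsum2 dsuml lg lvJ in \<open>auto simp: E_def A_def \<sigma>_def idx SS_def J_def \<tau>_def\<close>)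
  then obtain \<Lambda> er where \<Lambda>g: "\<forall>j. \<Lambda> j \<in> grid pr (6 * pr\<^sup>2 * lg\<^sup>2 + 1)" "\<forall>j>lvls pr. \<Lambda> j = 0"
    and er: "\<And>j. j < J \<Longrightarrow> 0 \<le> er j \<and> d j - er j \<le> (\<Sum>e\<in>E. shr W P \<Lambda> e j * sg W e j)" "(\<Sum>j<J. er j) \<le> 16 / real pr"
    and cnt: "(\<forall>e j. shr W P \<Lambda> e j = 0) \<or>
      16 * real pr ^ 3 \<le> real l \<and> (\<Sum>e\<in>E. \<Sum>j<J. shr W P \<Lambda> e j) \<le> (1 + 7 / real pr) * real (card A) + 5"
    unfolding P_def J_def by blast
  have \<Lambda>0: "\<forall>j. 0 \<le> \<Lambda> j" using \<Lambda>g grid_nonneg by blast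
  define s where "s = (\<Sum>e\<in>{e. e < n \<and> 0 < x e}. code W P \<Lambda> e (x e - 1))"
  define z where "z = lrg W P \<Lambda> s"
  have "0 < tab (code W P \<Lambda>) (2 * J) n s" unfolding s_def by (rule tab_complete) (use x2J in auto)
  from tab_sound[OF this] have zs: "(\<Sum>e\<in>{e. e < n \<and> 0 < z e}. code W P \<Lambda> e (z e - 1)) = s"
    by (simp add: z_def lrg_def J_def)
  have z2J: "z e \<le> 2 * J" for e unfolding z_def lrg_def J_def by (rule lasg_le)
  have pre: "\<forall>e<n. \<forall>j. lev W e j \<le> 1" "\<forall>e<n. x e \<le> 2 * J" "\<forall>e<n. z e \<le> 2 * J"
    using lev1 x2J z2J by auto
  note match = code_match[where W = W and \<Lambda> = \<Lambda> and x = x and z = z and P = P, folded h_def J_def,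
      OF W(1) \<Lambda>0 pre zs[unfolded s_def] hH]
  define D where "D = real (dres pr)"
  have D: "D = real pr ^ 8" by (simp add: D_def dres_def)
  have hD: "real h / D \<le> 2 / real pr ^ 3"
    using h5 p by (simp add: D field_simps eval_nat_numeral)
  have D1: "1 / D \<le> 1 / real pr ^ 3"
    unfolding D using p by (intro divide_left_mono power_increasing) auto
  define F where "F = {e. e < n \<and> z e = 0}"
  define ch where "ch = sch W P \<Lambda> s"
  have ch_eq: "ch = rchoice J (shr W P \<Lambda>) (sg W) \<tau> (load W P \<Lambda> s) (\<lambda>e. z e = 0)"
    by (simp add: ch_def sch_def J_def \<tau>_def z_def)
  have loadJ: "load W P \<Lambda> s j = (\<Sum>e\<in>F. shr W P \<Lambda> e j * sg W e j)" if "j < J" for j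
    using that by (simp add: load_def F_def z_def J_def)
  have loadC: "load W P \<Lambda> s J = (\<Sum>e\<in>F. \<Sum>k<J. shr W P \<Lambda> e k)"
    by (simp add: load_def F_def z_def J_def)
  have g1: "load W P \<Lambda> s J = 0 \<Longrightarrow> ch e = J" for e
    unfolding ch_eq using share_bounds[OF W(1) \<Lambda>0] sg_bounds[OF W(1)] \<tau> p loadJ loadC
    by (intro greedy_rounding(1)[where n = n and pr = pr]) (auto simp: J_def \<tau>_def F_def)
  have g2: "load W P \<Lambda> s j - load W P \<Lambda> s j / real pr - real pr * ((real J + 1) * \<tau>) \<le> (\<Sum>e\<in>{e\<in>F. ch e = j}. sg W e j)" if "j < J" for j
    unfolding ch_eq F_def using share_bounds[OF W(1) \<Lambda>0] sg_bounds[OF W(1)] \<tau> p loadJ loadC that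
    by (intro greedy_rounding(2)) (auto simp: J_def \<tau>_def F_def)
  have g3: "real (card {e\<in>F. ch e < J}) \<le> load W P \<Lambda> s J + load W P \<Lambda> s J / real pr + real pr * (real J + 1)"
    unfolding ch_eq F_def using share_bounds[OF W(1) \<Lambda>0] sg_bounds[OF W(1)] \<tau> p loadJ loadC
    by (intro greedy_rounding(3)) (auto simp: J_def \<tau>_def F_def)
  define as where "as = asg W P \<Lambda> s"
  have as: "as e = (if 0 < z e then z e else if ch e < J then 2 * ch e + 1 else 0)" for e
    by (simp add: as_def asg_def z_def ch_def J_def)
  \<comment> \<open>Small gains are placed on \<open>F\<close> by the algorithm but were planned on
    \<open>E\<close>. The two differ by the edges withdrawn for \<open>z\<close> and for
    \<open>x\<close>, and the recorded digits say that both withdraw the same amounts up to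
    \<open>h / D\<close>.\<close>
  have split: "(\<Sum>e\<in>F. f e) + (\<Sum>e\<in>{e. e < n \<and> 0 < z e}. f e) = (\<Sum>e\<in>E. f e) + (\<Sum>e\<in>{e. e < n \<and> 0 < x e}. f e)"
    for f :: "nat \<Rightarrow> real"
  proof -
    have "(\<Sum>e\<in>{e. e < n \<and> y e = 0}. f e) + (\<Sum>e\<in>{e. e < n \<and> 0 < y e}. f e) = (\<Sum>e<n. f e)" for y :: "nat \<Rightarrow> nat"
      by (subst sum.union_disjoint[symmetric]) (auto intro!: sum.cong)
    then show ?thesis unfolding F_def E_def by metis
  qed
  have Lj: "d j - er j - real h / D \<le> load W P \<Lambda> s j" if "j < J" for j
    using split[of "\<lambda>e. shr W P \<Lambda> e j * sg W e j"] match(5)[OF that] er(1)[OF that] loadJ[OF that] by (simp add: D_def)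
  have Lc: "load W P \<Lambda> s J \<le> (\<Sum>e\<in>E. \<Sum>k<J. shr W P \<Lambda> e k) + real h / D"
    using split[of "\<lambda>e. \<Sum>k<J. shr W P \<Lambda> e k"] match(6) loadC by (simp add: D_def)
  \<comment> \<open>An even bin loses \<open>d / pr\<close> and \<open>pr * (J + 1) * \<tau>\<close>
    in the rounding, \<open>er\<close> in the fractional assignment, and \<open>h / D\<close> twice:
    for the large gains and for the withdrawn shares. An odd bin holds one large edge and loses one
    unit of its digit.\<close>
  define err where "err b = W * (if even b then d (b div 2) / real pr + er (b div 2) + 2 * (real h / D) + real pr * ((real J + 1) * \<tau>) else 1 / D)" for b
  define bl where "bl b = (if b < 2 * J then filter (\<lambda>e. as e = Suc b) [0..<n] else [])" for b
  have blset: "set (bl b) = {e. e < n \<and> as e = Suc b}" if "b < 2 * J" for b using that by (auto simp: bl_def)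
  have zbl: "{e. e < n \<and> z e = Suc b} \<subseteq> set (bl b)" if "b < 2 * J" for b
    using that by (auto simp: blset as)
  have err0: "0 \<le> err b" if "b < 2 * J" for b
  proof -
    have "b div 2 < J" using that by auto
    then show ?thesis using W(1) d0[of "b div 2"] er(1)[of "b div 2"] \<tau> p
      by (auto simp: err_def D intro!: mult_nonneg_nonneg add_nonneg_nonneg)
  qed
  define err' where "err' b = (if b < 2 * J then err b else 0)" for b
  have even_case: "(\<Sum>i\<in>{i. i < k \<and> bin i = 2 * j}. T (Suc i) - T i) - err' (2 * j)
        \<le> (\<Sum>e\<in>set (bl (2 * j)). gain r q m e (real j * \<delta>))" if j: "j < J" for j
  proof -
    have b2: "2 * j < 2 * J" using j by simp
    let ?X = "{e. e < n \<and> x e = Suc (2 * j)}" and ?Z = "{e. e < n \<and> z e = Suc (2 * j)}"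
    have seteq: "{i. i < k \<and> bin i = 2 * j} = {i\<in>SS. lv i = j} \<union> {i\<in>LS. bin i = 2 * j}"
    proof -
      have "bin i = 2 * j \<longleftrightarrow> lv i = j" if "i \<in> SS" for i
        using that \<theta>0 by (auto simp: bin_def cross_def SS_def)
      then show ?thesis by (auto simp: SS_def LS_def)
    qed
    have "(\<Sum>i\<in>{i. i < k \<and> bin i = 2 * j}. T (Suc i) - T i)
       = (\<Sum>i\<in>{i\<in>SS. lv i = j}. T (Suc i) - T i) + (\<Sum>i\<in>{i\<in>LS. bin i = 2 * j}. T (Suc i) - T i)"
      unfolding seteq using fin by (intro sum.union_disjoint) (auto simp: SS_def LS_def)
    also have "(\<Sum>i\<in>{i\<in>SS. lv i = j}. T (Suc i) - T i) = W * d j" using W(1) by (simp add: d_def)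
    also have "(\<Sum>i\<in>{i\<in>LS. bin i = 2 * j}. T (Suc i) - T i) \<le> (\<Sum>i\<in>{i\<in>LS. bin i = 2 * j}. W * lev W (fs ! i) j)"
    proof (rule sum_mono)
      fix i assume "i \<in> {i\<in>LS. bin i = 2 * j}"
      then show "T (Suc i) - T i \<le> W * lev W (fs ! i) j" using inc_le[of i] bin_div[of i] by (simp add: LS_def)
    qed
    also have "\<dots> = W * (\<Sum>e\<in>?X. lev W e j)"
      unfolding Xb by (subst sum.reindex[OF injS]) (auto simp: LS_def sum_distrib_left)
    finally have 1: "(\<Sum>i\<in>{i. i < k \<and> bin i = 2 * j}. T (Suc i) - T i) \<le> W * (d j + (\<Sum>e\<in>?X. lev W e j))"
      by (simp add: distrib_left)
    have 2: "(\<Sum>e\<in>?X. lev W e j) - real h / D \<le> (\<Sum>e\<in>?Z. lev W e j)"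
      using match(4)[OF b2] by (simp add: D_def)
    have 3: "d j - (d j / real pr + er j + real h / D + real pr * ((real J + 1) * \<tau>)) \<le> (\<Sum>e\<in>{e\<in>F. ch e = j}. sg W e j)"
    proof -
      define c where "c = 1 - 1 / real pr"
      have q: "0 \<le> c" "c \<le> 1" using p by (auto simp: c_def)
      have "c * (d j - er j - real h / D) \<le> c * load W P \<Lambda> s j"
        using Lj[OF j] q by (intro mult_left_mono) auto
      moreover have "c * (er j + real h / D) \<le> 1 * (er j + real h / D)"
        using er(1)[OF j] q p by (intro mult_right_mono) (auto simp: D)
      moreover have "c * load W P \<Lambda> s j = load W P \<Lambda> s j - load W P \<Lambda> s j / real pr"
        by (simp add: c_def left_diff_distrib)
      moreover have "c * d j = d j - d j / real pr" by (simp add: c_def left_diff_distrib)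
      moreover have "c * (d j - er j - real h / D) = c * d j - c * (er j + real h / D)"
        by (simp add: algebra_simps)
      ultimately have "(d j - d j / real pr) - (er j + real h / D) \<le> load W P \<Lambda> s j - load W P \<Lambda> s j / real pr"
        by (metis (no_types, lifting) diff_left_mono mult_1 order_trans)
      then have "(d j - d j / real pr) - (er j + real h / D) - real pr * ((real J + 1) * \<tau>)
          \<le> (\<Sum>e\<in>{e\<in>F. ch e = j}. sg W e j)"
        using g2[OF j] by (meson diff_right_mono order_trans)
      then show ?thesis by (simp add: diff_diff_eq add.assoc)
    qed
    have un: "set (bl (2 * j)) = ?Z \<union> {e\<in>F. ch e = j}"
    proof -
      have "as e = Suc (2 * j) \<longleftrightarrow> z e = Suc (2 * j) \<or> (z e = 0 \<and> ch e = j)" for e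
        unfolding as using j by (cases "z e = 0") auto
      then show ?thesis unfolding blset[OF b2] F_def by blast
    qed
    have "(\<Sum>e\<in>set (bl (2 * j)). lev W e j) = (\<Sum>e\<in>?Z. lev W e j) + (\<Sum>e\<in>{e\<in>F. ch e = j}. lev W e j)"
      unfolding un by (intro sum.union_disjoint) (auto simp: F_def)
    moreover have "(\<Sum>e\<in>{e\<in>F. ch e = j}. sg W e j) \<le> (\<Sum>e\<in>{e\<in>F. ch e = j}. lev W e j)"
      by (intro sum_mono) (simp add: sg_def)
    ultimately have "d j + (\<Sum>e\<in>?X. lev W e j) - (d j / real pr + er j + 2 * (real h / D) + real pr * ((real J + 1) * \<tau>))
        \<le> (\<Sum>e\<in>set (bl (2 * j)). lev W e j)"
      using 2 3 by linarith
    then have "W * (d j + (\<Sum>e\<in>?X. lev W e j) - (d j / real pr + er j + 2 * (real h / D) + real pr * ((real J + 1) * \<tau>)))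
        \<le> W * (\<Sum>e\<in>set (bl (2 * j)). lev W e j)"
      using W(1) by (intro mult_left_mono) auto
    moreover have "err' (2 * j) = W * (d j / real pr + er j + 2 * (real h / D) + real pr * ((real J + 1) * \<tau>))"
      using b2 by (simp add: err'_def err_def)
    moreover have "(\<Sum>e\<in>set (bl (2 * j)). gain r q m e (real j * \<delta>)) = W * (\<Sum>e\<in>set (bl (2 * j)). lev W e j)"
      by (simp add: glev sum_distrib_left)
    ultimately show ?thesis using 1 by (simp only: right_diff_distrib)
  qed
  have odd_case: "\<exists>e\<in>set (bl (bin i)). T (Suc i) - T i - err' (bin i) \<le> gain r q m e (real (lv i) * \<delta>)"
    if i: "i < k" "cross i" for i
  proof -
    have b: "bin i < 2 * J" "odd (bin i)" "i \<in> LS"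
      using binJ[OF i(1)] i by (simp, simp add: bin_def, simp add: LS_def cross_def)
    \<comment> \<open>Two crossing increments cannot start on one level. So the odd bin has one edge
      both in \<open>x\<close> and in \<open>z\<close>, and equal sums of digits are equal single
      digits.\<close>
    have uniq: "i' = i" if "i' \<in> LS" "bin i' = bin i" for i'
    proof -
      have i': "i' < k" "cross i'" "lv i' = lv i"
        using that b(2) i by (auto simp: bin_def LS_def split: if_splits) presburger+
      have "\<not> a < a'" if "a < k" "a' < k" "cross a" "lv a = lv a'" for a a'
        using lv[OF that(2)] Tmono[of "Suc a" a'] that by (auto simp: cross_def)
      then show ?thesis using i i' by (metis linorder_neqE_nat)
    qed
    have "{i'\<in>LS. bin i' = bin i} = {i}" using uniq b(3) by auto
    then have X1: "{e. e < n \<and> x e = Suc (bin i)} = {fs ! i}" unfolding Xb by simp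
    then have "card {e. e < n \<and> z e = Suc (bin i)} = 1" using match(3)[OF b(1)] by simp
    then obtain e where e: "{e. e < n \<and> z e = Suc (bin i)} = {e}" 
      using card_1_singletonE[of "{e. e < n \<and> z e = Suc (bin i)}"] by blast
    then have eb: "e \<in> set (bl (bin i))" using zbl[OF b(1)] by blast
    have dg: "dig (dres pr) (lev W e (lv i)) (dres pr) = dig (dres pr) (lev W (fs ! i) (lv i)) (dres pr)"
      using match(7)[OF b(1)] unfolding X1 e by (simp add: bin_div)
    have "0 < dres pr" using N2 by (simp add: dres_def)
    have "e < n" using e by blast
    have "lev W (fs ! i) (lv i) \<le> (real (dig (dres pr) (lev W e (lv i)) (dres pr)) + 1) / D"
      unfolding dg D_def using lev1[OF fsn[OF i(1)]] lev_nonneg[OF W(1)] \<open>0 < dres pr\<close> by (intro dig_bounds) auto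
    moreover have "real (dig (dres pr) (lev W e (lv i)) (dres pr)) / D \<le> lev W e (lv i)"
      unfolding D_def using lev1[OF \<open>e < n\<close>] lev_nonneg[OF W(1)] \<open>0 < dres pr\<close> by (intro dig_bounds) auto
    ultimately have "lev W (fs ! i) (lv i) - 1 / D \<le> lev W e (lv i)" by (simp add: add_divide_distrib)
    then have "W * (lev W (fs ! i) (lv i) - 1 / D) \<le> W * lev W e (lv i)" using W(1) by (intro mult_left_mono) auto
    moreover have "err' (bin i) = W * (1 / D)" using b by (simp add: err'_def err_def)
    ultimately have "T (Suc i) - T i - err' (bin i) \<le> W * lev W e (lv i)"
      using inc_le[OF i(1)] by (simp add: right_diff_distrib)
    then show ?thesis using eb glev by auto
  qed
  have "T k - \<delta> - \<theta> - (\<Sum>b<2*J. err' b) \<le> run_val r q m (concat (map bl [0..<2*J])) 0"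
  proof (rule replay[where cross = cross and lv = lv and bin = bin])
    show "set (bl b) \<subseteq> {..<n}" "distinct (bl b)" for b by (auto simp: bl_def)
    show "0 \<le> err' b" for b using err0 by (simp add: err'_def)
  qed (use \<delta>0 \<theta>0 T0 Tle lv lvJ even_case odd_case in \<open>auto simp: cross_def bin_def\<close>)
  moreover define od where "od = bin_order n (2 * J) as"
  moreover have "concat (map bl [0..<2*J]) = od"
    unfolding od_def bin_order_def by (intro arg_cong[where f = concat] map_cong) (auto simp: bl_def)
  ultimately have run: "Op - \<delta> - \<theta> - (\<Sum>b<2*J. err' b) \<le> run_val r q m od 0" using Tk by simp
  have errsum: "(\<Sum>b<2*J. err' b) \<le> W * (60 / real pr)"
  proof -
    have pairs: "(\<Sum>b<2*J. f b) = (\<Sum>j<J. f (2 * j) + f (2 * j + 1))" for f :: "nat \<Rightarrow> real" and J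
      by (induction J) auto
    define c1 where "c1 = 2 * (real h / D) + real pr * ((real J + 1) * \<tau>) + 1 / D"
    have "(\<Sum>b<2*J. err' b) = (\<Sum>j<J. err' (2 * j) + err' (2 * j + 1))" by (rule pairs)
    also have "\<dots> = (\<Sum>j<J. W * (d j / real pr + er j + c1))"
      by (intro sum.cong) (auto simp: err'_def err_def c1_def algebra_simps)
    also have "\<dots> = W * ((\<Sum>j<J. d j) / real pr + (\<Sum>j<J. er j) + real J * c1)"
      by (simp add: sum_distrib_left[symmetric] sum.distrib sum_divide_distrib)
    also have "\<dots> \<le> W * (2 / real pr + 16 / real pr + 42 / real pr)"
    proof (intro mult_left_mono add_mono divide_right_mono dsum2 er(2))
      have "c1 \<le> 2 * (2 / real pr ^ 3) + 5 / real pr ^ 3 + 1 / real pr ^ 3"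
        unfolding c1_def
      proof (intro add_mono mult_left_mono hD D1)
        have "real pr * ((real J + 1) * \<tau>) \<le> real pr * (4 * real pr * \<tau>)"
          using p \<tau> by (intro mult_left_mono mult_right_mono) (auto simp: J)
        also have "\<dots> = 4 / real pr ^ 3" using p by (simp add: \<tau>_def tau_def field_simps eval_nat_numeral)
        also have "\<dots> \<le> 5 / real pr ^ 3" by (intro divide_right_mono) auto
        finally show "real pr * ((real J + 1) * \<tau>) \<le> 5 / real pr ^ 3" .
      qed auto
      then have c1: "c1 \<le> 10 / real pr ^ 3" by simp
      have c10: "0 \<le> c1" unfolding c1_def using p \<tau> by (auto simp: D intro!: add_nonneg_nonneg mult_nonneg_nonneg)
      have "real J * c1 \<le> (3 * real pr) * (10 / real pr ^ 3)"
        using c1 c10 p by (intro mult_mono) (auto simp: J)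
      also have "\<dots> = 30 / real pr / real pr" using p by (simp add: field_simps eval_nat_numeral)
      also have "\<dots> \<le> 42 / real pr / 1" using p by (intro frac_le divide_right_mono) auto
      finally show "real J * c1 \<le> 42 / real pr" by simp
    qed (use W p in auto)
    also have "\<dots> = W * (60 / real pr)" by simp
    finally show ?thesis .
  qed
  have \<delta>\<theta>: "\<delta> + \<theta> \<le> W * (2 / real pr)"
  proof -
    have "\<tau> \<le> 1 / real pr" unfolding \<tau>_def tau_def
      using p self_le_power[of "real pr" 5] by (intro divide_left_mono) auto
    then have "\<theta> \<le> 1 / real pr * W" unfolding \<theta>_def using W(1) by (intro mult_right_mono) auto
    moreover have "W * (2 / real pr) = \<delta> + 1 / real pr * W" by (simp add: \<delta>_def)
    ultimately show ?thesis by linarith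
  qed
  have run2: "(1 - 62 / real pr) * Op \<le> run_val r q m od 0"
  proof -
    have "W * (62 / real pr) \<le> Op * (62 / real pr)" using W(2) p by (intro mult_right_mono) (auto simp: Op_def)
    moreover have "W * (2 / real pr) + W * (60 / real pr) = W * (62 / real pr)" by (simp add: add_divide_distrib[symmetric])
    moreover have "(1 - 62 / real pr) * Op = Op - Op * (62 / real pr)" by (simp add: left_diff_distrib)
    moreover have "t \<le> R" if "a \<le> b" "c + f = a" "t = O' - b" "O' - x - y - z \<le> R" "z \<le> f" "x + y \<le> c"
      for t R a b c f O' x y z :: real using that by linarith
    ultimately show ?thesis using run errsum \<delta>\<theta> by blast
  qed
  have od: "distinct od" "set od \<subseteq> {..<n}" by (auto simp: od_def distinct_bin_order set_bin_order)
  have candeq: "cand W P \<Lambda> s = opt r q m (rev od) l" by (simp add: cand_def od_def as_def J_def)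
  have full: "opt r q m (rev od) (length od) = run_val r q m od 0"
    using opt_eq_comp_val[of "rev od" "length od"] by (simp add: comp_val_rev)
  have run0: "0 \<le> run_val r q m od 0" using run_val_ge[of 0] by simp
  have Op0: "0 < Op" using W by (simp add: Op_def)
  have lenod: "length od = h + card {e\<in>F. ch e < J}"
  proof -
    have "length od = card (set od)" using od(1) by (simp add: distinct_card)
    also have "set od = {e. e < n \<and> 0 < z e} \<union> {e\<in>F. ch e < J}"
      unfolding od_def set_bin_order using z2J by (auto simp: as F_def)
    also have "card \<dots> = card {e. e < n \<and> 0 < z e} + card {e\<in>F. ch e < J}"
      by (intro card_Un_disjoint) (auto simp: F_def)
    finally show ?thesis using match(2) by simp
  qed
  have "(1 - 100 / real pr) * Op \<le> cand W P \<Lambda> s"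
  proof (cases "\<forall>e j. shr W P \<Lambda> e j = 0")
    case True
    \<comment> \<open>Without shares no small edge is placed, and the large edges are exactly as
      many as in the optimal policy. The budget is respected without trimming.\<close>
    then have "ch e = J" for e using g1 loadC by simp
    then have "length od \<le> l" using lenod kk fs(3) by simp
    then have "cand W P \<Lambda> s = run_val r q m od 0" unfolding candeq
      using opt_eq_comp_val[of "rev od" l] by (simp add: comp_val_rev)
    moreover have "(1 - 100 / real pr) * Op \<le> (1 - 62 / real pr) * Op"
      using Op0 p by (intro mult_right_mono) (auto simp: divide_right_mono)
    ultimately show ?thesis using run2 by simp
  next
    case False
    \<comment> \<open>With \<open>16 * pr ^ 3 \<le> l\<close>, the additive surplus of at most
      \<open>14 + 4 * pr ^ 2\<close> edges is at most \<open>l / pr\<close>.\<close>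
    with cnt have l16: "16 * real pr ^ 3 \<le> real l"
      and C: "(\<Sum>e\<in>E. \<Sum>j<J. shr W P \<Lambda> e j) \<le> (1 + 7 / real pr) * real (card A) + 5" by auto
    have pr3: "1 \<le> real pr ^ 3" by (rule one_le_power[OF p(2)])
    have l0: "0 < real l" using l16 pr3 by linarith
    have "load W P \<Lambda> s J \<le> (1 + 7 / real pr) * real (card A) + 7"
    proof -
      have "2 / real pr ^ 3 \<le> 2 / 1" using pr3 p by (intro divide_left_mono) auto
      then show ?thesis using Lc C hD by linarith
    qed
    then have "load W P \<Lambda> s J * (1 + 1 / real pr) \<le> ((1 + 7 / real pr) * real (card A) + 7) * (1 + 1 / real pr)"
      using p by (intro mult_right_mono) auto
    then have "real (length od) \<le> real h + ((1 + 7 / real pr) * real (card A) + 7) * (1 + 1 / real pr) + real pr * (real J + 1)"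
      using g3 lenod by (simp add: distrib_left)
    also have "((1 + 7 / real pr) * real (card A) + 7) * (1 + 1 / real pr) \<le> (1 + 15 / real pr) * real (card A) + 14"
    proof -
      define u where "u = 1 / real pr"
      have u: "0 \<le> u" "u \<le> 1" using p by (auto simp: u_def)
      have "u * u \<le> u * 1" using u by (intro mult_left_mono) auto
      then have "(1 + 7 * u) * (1 + u) \<le> 1 + 15 * u" by (simp add: algebra_simps)
      then have "(1 + 7 * u) * (1 + u) * real (card A) \<le> (1 + 15 * u) * real (card A)" by (intro mult_right_mono) auto
      moreover have "7 * (1 + u) \<le> 14" using u by simp
      ultimately have "((1 + 7 * u) * real (card A) + 7) * (1 + u) \<le> (1 + 15 * u) * real (card A) + 14"
        by (simp add: algebra_simps)
      then show ?thesis by (simp add: u_def)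
    qed
    also have "real pr * (real J + 1) \<le> 4 * real pr ^ 2"
      using p mult_left_mono[of 1 "real pr" "real pr"] by (simp add: J power2_eq_square algebra_simps)
    finally have "real (length od) \<le> real h + ((1 + 15 / real pr) * real (card A) + 14) + 4 * real pr ^ 2" by simp
    moreover have "real h \<le> (1 + 15 / real pr) * real h" using p by (simp add: algebra_simps)
    moreover have "(1 + 15 / real pr) * real h + (1 + 15 / real pr) * real (card A) \<le> (1 + 15 / real pr) * real l"
    proof -
      have "real h + real (card A) \<le> real l" using kk fs(3) by linarith
      then show ?thesis unfolding distrib_left[symmetric] using p by (intro mult_left_mono) auto
    qed
    moreover have "14 + 4 * real pr ^ 2 \<le> 1 / real pr * real l"
    proof -
      have "16 * real pr ^ 2 = 1 / real pr * (16 * real pr ^ 3)" using p by (simp add: eval_nat_numeral)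
      also have "\<dots> \<le> 1 / real pr * real l" using l16 p by (intro mult_left_mono) auto
      finally have "16 * real pr ^ 2 \<le> 1 / real pr * real l" .
      moreover have "4 \<le> real pr ^ 2" using N2 power_mono[of 2 "real pr" 2] by simp
      ultimately show ?thesis by linarith
    qed
    moreover have "(1 + 16 / real pr) * real l = (1 + 15 / real pr) * real l + 1 / real pr * real l"
      by (simp add: algebra_simps add_divide_distrib[symmetric])
    ultimately have len: "real (length od) \<le> (1 + 16 / real pr) * real l" by linarith
    \<comment> \<open>Trimming a list of at most \<open>(1 + 16 / pr) * l\<close> edges to
      \<open>l\<close> queries keeps at least the fraction \<open>1 / (1 + 16 / pr)\<close>, and
      \<open>(1 - u) * (1 + u) \<le> 1\<close>.\<close>
    have "(1 - 16 / real pr) * run_val r q m od 0 \<le> cand W P \<Lambda> s"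
    proof (cases "l \<le> length od")
      case True
      have "real l * run_val r q m od 0 \<le> real (length od) * cand W P \<Lambda> s"
        using opt_trim[OF True, of "rev od"] od full by (simp add: candeq)
      also have "\<dots> \<le> (1 + 16 / real pr) * real l * cand W P \<Lambda> s"
        using len opt_nonneg by (intro mult_right_mono) (auto simp: candeq)
      finally have 1: "run_val r q m od 0 \<le> (1 + 16 / real pr) * cand W P \<Lambda> s" using l0 by (simp add: mult_ac)
      have c0: "0 \<le> cand W P \<Lambda> s" unfolding candeq by (rule opt_nonneg)
      show ?thesis
      proof (cases "16 / real pr \<le> 1")
        case True
        have "(1 - 16 / real pr) * run_val r q m od 0 \<le> (1 - 16 / real pr) * ((1 + 16 / real pr) * cand W P \<Lambda> s)"
          using 1 True by (intro mult_left_mono) auto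
        also have "\<dots> = (1 - (16 / real pr) * (16 / real pr)) * cand W P \<Lambda> s"
        proof -
          have "(1 - u) * ((1 + u) * c) = (1 - u * u) * c" for u c :: real by (simp add: algebra_simps)
          then show ?thesis .
        qed
        also have "\<dots> \<le> 1 * cand W P \<Lambda> s" using c0 by (intro mult_right_mono) auto
        finally show ?thesis by simp
      next
        case False
        then have "(1 - 16 / real pr) * run_val r q m od 0 \<le> 0" using run0 by (intro mult_nonpos_nonneg) auto
        then show ?thesis using c0 by simp
      qed
    next
      case False
      then have "cand W P \<Lambda> s = run_val r q m od 0" unfolding candeq
        using opt_eq_comp_val[of "rev od" l] by (simp add: comp_val_rev)
      moreover have "(1 - 16 / real pr) * run_val r q m od 0 \<le> 1 * run_val r q m od 0"
        using run0 p by (intro mult_right_mono) auto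
      ultimately show ?thesis by simp
    qed
    moreover have "(1 - 100 / real pr) * Op \<le> (1 - 16 / real pr) * run_val r q m od 0 \<or> (1 - 100 / real pr) * Op \<le> 0"
    proof (cases "16 / real pr \<le> 1")
      case True
      have "(1 - 16 / real pr) * ((1 - 62 / real pr) * Op) \<le> (1 - 16 / real pr) * run_val r q m od 0"
        using run2 True by (intro mult_left_mono) auto
      moreover have "(1 - 100 / real pr) * Op \<le> ((1 - 16 / real pr) * (1 - 62 / real pr)) * Op"
      proof (rule mult_right_mono)
        define u where "u = 1 / real pr"
        have "0 \<le> u" using p by (simp add: u_def)
        then have "1 - 100 * u \<le> (1 - 16 * u) * (1 - 62 * u)" by (simp add: algebra_simps)
        then show "1 - 100 / real pr \<le> (1 - 16 / real pr) * (1 - 62 / real pr)" by (simp add: u_def)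
      qed (use Op0 in simp)
      ultimately show ?thesis by (simp add: mult.assoc)
    next
      case False
      then have "1 < 100 / real pr" using p by (simp add: field_simps)
      then show ?thesis using Op0 by (intro disjI2 mult_nonpos_nonneg) auto
    qed
    moreover have "0 \<le> cand W P \<Lambda> s" unfolding candeq by (rule opt_nonneg)
    ultimately show ?thesis by linarith
  qed
  then show ?thesis using \<Lambda>g match(1) unfolding Op_def P_def s_def by blast
qed

end

section \<open>The program\<close>

abbreviation "nV x \<equiv> NGet x (N 0)"
abbreviation "rV x \<equiv> RGet x (N 0)"
abbreviation "nS x a \<equiv> FN x (N 0) a"
abbreviation "rS x a \<equiv> FR x (N 0) a"

text \<open>Naturals cannot be multiplied by the machine, so a constant factor is unrolled into
  additions.\<close>

primrec nmulc :: "nat \<Rightarrow> nexp \<Rightarrow> nexp" where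
  "nmulc 0 a = N 0"
| "nmulc (Suc k) a = NAdd a (nmulc k a)"

primrec rsum :: "(nat \<Rightarrow> rexp) \<Rightarrow> nat \<Rightarrow> rexp" where
  "rsum f 0 = ROfNat (N 0)"
| "rsum f (Suc k) = RAdd (rsum f k) (f k)"

primrec fseq :: "(nat \<Rightarrow> fcom) \<Rightarrow> nat \<Rightarrow> fcom" where
  "fseq f 0 = FSkip"
| "fseq f (Suc k) = fseq f k ;; f k"

lemma nval_nmulc [simp]: "nval s (nmulc k a) = k * nval s a"
  by (induction k) auto

lemma rval_rsum [simp]: "rval s (rsum f k) = (\<Sum>j<k. rval s (f j))"
  by (induction k) auto

lemma nw_fseq: "nw (fseq f k) = (\<Union>j<k. nw (f j))"
  by (induction k) (auto simp: less_Suc_eq)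

lemma rw_fseq: "rw (fseq f k) = (\<Union>j<k. rw (f j))"
  by (induction k) (auto simp: less_Suc_eq)

lemma den_fseq:
  assumes "I 0 s" "\<And>j s'. j < k \<Longrightarrow> I j s' \<Longrightarrow> I (Suc j) (den (f j) s')"
  shows "I k (den (fseq f k) s)"
  using assms by (induction k) auto

text \<open>Two nested loops as one row-major scan: the end \<open>(i, w)\<close> of a row is
  identified with the start \<open>(Suc i, 0)\<close> of the next, so one invariant \<open>Q\<close>
  serves both loops.\<close>

lemma den_For2:
  assumes xy: "x \<notin> nw c" "y \<notin> nw c" "x \<noteq> y"
    and b: "nval s b1 = n"
      "\<And>s'. (\<And>z. z \<noteq> x \<Longrightarrow> z \<noteq> y \<Longrightarrow> z \<notin> nw c \<Longrightarrow> nmem s' z = nmem s z) \<Longrightarrow> nval s' b2 = w"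
    and Q: "\<And>i k v s'. Q i k (nset x 0 v s') = Q i k s'" "\<And>i k v s'. Q i k (nset y 0 v s') = Q i k s'"
    and init: "Q 0 0 s"
    and step: "\<And>i k s'. i < n \<Longrightarrow> k < w \<Longrightarrow> Q i k s' \<Longrightarrow> nmem s' x 0 = i \<Longrightarrow> nmem s' y 0 = k \<Longrightarrow>
      (\<And>z. z \<noteq> x \<Longrightarrow> z \<noteq> y \<Longrightarrow> z \<notin> nw c \<Longrightarrow> nmem s' z = nmem s z) \<Longrightarrow>
      (\<And>z. z \<notin> rw c \<Longrightarrow> rmem s' z = rmem s z) \<Longrightarrow> Q i (Suc k) (den c s')"
    and nxt: "\<And>i s'. i < n \<Longrightarrow> Q i w s' \<Longrightarrow> Q (Suc i) 0 s'"
  shows "Q n 0 (den (FFor x b1 (FFor y b2 c)) s)"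
proof (rule den_For[where I = "\<lambda>i s'. Q i 0 s'"])
  show "x \<notin> nw (FFor y b2 c)" using xy by simp
  show "nval s b1 = n" by (rule b(1))
  show "Q 0 0 (nset x 0 0 s)" using init by (simp only: Q)
  fix i s1 assume i: "i < n" and A: "Q i 0 s1" "nmem s1 x 0 = i"
    and frn: "\<And>z. z \<noteq> x \<Longrightarrow> z \<notin> nw (FFor y b2 c) \<Longrightarrow> nmem s1 z = nmem s z"
    and frr: "\<And>z. z \<notin> rw (FFor y b2 c) \<Longrightarrow> rmem s1 z = rmem s z"
  have "Q i w (den (FFor y b2 c) s1)"
  proof (rule den_For[where I = "\<lambda>k s'. Q i k s'"])
    show "y \<notin> nw c" by (rule xy)
    show "nval s1 b2 = w" using frn by (intro b(2)) simp
    show "Q i 0 (nset y 0 0 s1)" using A by (simp only: Q)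
    fix k s2 assume k: "k < w" and B: "Q i k s2" "nmem s2 y 0 = k"
      and frn2: "\<And>z. z \<noteq> y \<Longrightarrow> z \<notin> nw c \<Longrightarrow> nmem s2 z = nmem s1 z"
      and frr2: "\<And>z. z \<notin> rw c \<Longrightarrow> rmem s2 z = rmem s1 z"
    have "nmem s2 x 0 = i" using frn2[of x] xy A(2) by simp
    then have "Q i (Suc k) (den c s2)"
      using i k B frn frn2 frr frr2 by (intro step) simp_all
    then show "Q i (Suc k) (nset y 0 (Suc k) (den c s2))" by (simp only: Q)
  qed
  from nxt[OF i this] show "Q (Suc i) 0 (nset x 0 (Suc i) (den (FFor y b2 c) s1))" by (simp only: Q)
qed

text \<open>There is no multiplication of naturals, so row offsets are tabulated.\<close>

definition mul_table :: "string \<Rightarrow> nexp \<Rightarrow> fcom" where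
  "mul_table x v = nS x (N 0) ;; FFor ''i'' (nV ''n'') (FN x (NAdd (nV ''i'') (N 1)) (NAdd (NGet x (nV ''i'')) v))"

lemma mul_table:
  assumes "x \<notin> {''i'', ''n''}" "nvars v \<inter> {x, ''i''} = {}" "i \<le> nmem s ''n'' 0"
  shows "nmem (den (mul_table x v) s) x i = i * nval s v"
proof -
  let ?s = "den (nS x (N 0)) s"
  let ?b = "FN x (NAdd (nV ''i'') (N 1)) (NAdd (NGet x (nV ''i'')) v)"
  let ?I = "\<lambda>k (s' :: state). \<forall>j\<le>k. nmem s' x j = j * nval s v"
  have "?I (nmem s ''n'' 0) (den (FFor ''i'' (nV ''n'') ?b) ?s)"
  proof (rule den_For[where I = ?I])
    show "nval ?s (nV ''n'') = nmem s ''n'' 0" using assms by auto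
    show "?I 0 (nset ''i'' 0 0 ?s)" using assms by auto
    fix k and s' :: state assume k: "\<forall>j\<le>k. nmem s' x j = j * nval s v" "nmem s' ''i'' 0 = k"
      "\<And>y. y \<noteq> ''i'' \<Longrightarrow> y \<notin> nw ?b \<Longrightarrow> nmem s' y = nmem ?s y"
    have "nval s' v = nval s v"
    proof (rule nval_cong)
      fix y assume "y \<in> nvars v"
      then have "y \<noteq> ''i''" "y \<noteq> x" using assms(2) by auto
      then show "nmem s' y = nmem s y" using k(3)[of y] by (simp add: nmem_nset_other)
    qed
    then show "?I (Suc k) (nset ''i'' 0 (Suc k) (den ?b s'))" using k(1,2) assms(1) by (auto simp: le_Suc_eq)
  qed (use assms in auto)
  then show ?thesis using assms(3) by (simp add: mul_table_def)
qed

text \<open>With \<open>n + 1 \<le> 2 ^ g\<close>, the number \<open>lg_off pr + g\<close> satisfies the requirements on \<open>lg\<close> in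
  \<open>candidate_good\<close>.\<close>

definition lg_off :: "nat \<Rightarrow> nat" where
  "lg_off pr = 2 * pr * (lvls pr + 1) + pr ^ 5"

text \<open>The square of \<open>lg\<close> is maintained by \<open>(x + 1)\<^sup>2 = x\<^sup>2 + 2 x + 1\<close>.\<close>

definition c_log :: "nat \<Rightarrow> fcom" where
  "c_log pr = nS ''x'' (N 1) ;; nS ''lg'' (N (lg_off pr)) ;; nS ''sq'' (N (lg_off pr * lg_off pr)) ;;
     FFor ''i'' (nV ''n'') (FIf (NLess (nV ''x'') (NAdd (nV ''n'') (N 1)))
       (nS ''x'' (NAdd (nV ''x'') (nV ''x'')) ;;
        nS ''sq'' (NAdd (nV ''sq'') (NAdd (nV ''lg'') (NAdd (nV ''lg'') (N 1)))) ;;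
        nS ''lg'' (NAdd (nV ''lg'') (N 1))) FSkip) ;;
     nS ''P'' (nmulc pr (nV ''lg'')) ;; nS ''K'' (NAdd (nmulc (6 * pr\<^sup>2) (nV ''sq'')) (N 2))"

lemma c_log:
  fixes s :: state and pr :: nat
  defines "s' \<equiv> den (c_log pr) s"
  shows "\<exists>g. nmem s ''n'' 0 + 1 \<le> 2 ^ g \<and> 2 ^ g \<le> 2 * (nmem s ''n'' 0 + 1) \<and>
    nmem s' ''P'' 0 = pr * (lg_off pr + g) \<and> nmem s' ''K'' 0 = 6 * pr\<^sup>2 * (lg_off pr + g)\<^sup>2 + 2"
proof -
  define n where "n = nmem s ''n'' 0"
  let ?s = "den (nS ''x'' (N 1) ;; nS ''lg'' (N (lg_off pr)) ;; nS ''sq'' (N (lg_off pr * lg_off pr))) s"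
  let ?b = "FIf (NLess (nV ''x'') (NAdd (nV ''n'') (N 1)))
       (nS ''x'' (NAdd (nV ''x'') (nV ''x'')) ;;
        nS ''sq'' (NAdd (nV ''sq'') (NAdd (nV ''lg'') (NAdd (nV ''lg'') (N 1)))) ;;
        nS ''lg'' (NAdd (nV ''lg'') (N 1))) FSkip"
  \<comment> \<open>Either the doubling has stopped, or every iteration so far has doubled. After
    \<open>n\<close> iterations the second case also gives \<open>n + 1 \<le> 2 ^ g\<close>.\<close>
  let ?I = "\<lambda>i (s' :: state). \<exists>g. nmem s' ''x'' 0 = 2 ^ g \<and> 2 ^ g \<le> 2 * (n + 1) \<and> (n + 1 \<le> 2 ^ g \<or> i \<le> g) \<and>
     nmem s' ''lg'' 0 = lg_off pr + g \<and> nmem s' ''sq'' 0 = (lg_off pr + g)\<^sup>2"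
  have "?I n (den (FFor ''i'' (nV ''n'') ?b) ?s)"
  proof (rule den_For[where I = ?I])
    show "nval ?s (nV ''n'') = n" by (simp add: n_def)
    show "?I 0 (nset ''i'' 0 0 ?s)" by (intro exI[of _ 0]) (simp add: power2_eq_square)
    fix i and s' :: state assume A: "?I i s'" and i: "nmem s' ''i'' 0 = i"
      and fr: "\<And>y. y \<noteq> ''i'' \<Longrightarrow> y \<notin> nw ?b \<Longrightarrow> nmem s' y = nmem ?s y"
    have n: "nmem s' ''n'' 0 = n" using fr[of "''n''"] by (simp add: n_def)
    from A obtain g where g: "nmem s' ''x'' 0 = 2 ^ g" "2 ^ g \<le> 2 * (n + 1)" "n + 1 \<le> 2 ^ g \<or> i \<le> g"
     "nmem s' ''lg'' 0 = lg_off pr + g" "nmem s' ''sq'' 0 = (lg_off pr + g)\<^sup>2" by blast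
    show "?I (Suc i) (nset ''i'' 0 (Suc i) (den ?b s'))"
    proof (cases "2 ^ g < n + 1")
      case True
      then show ?thesis using g n by (intro exI[of _ "Suc g"]) (auto simp: power2_eq_square algebra_simps)
    next
      case False
      then show ?thesis using g n by (intro exI[of _ g]) auto
    qed
  qed auto
  then obtain g where g: "2 ^ g \<le> 2 * (n + 1)" "n + 1 \<le> 2 ^ g \<or> n \<le> g"
     "nmem (den (FFor ''i'' (nV ''n'') ?b) ?s) ''lg'' 0 = lg_off pr + g"
     "nmem (den (FFor ''i'' (nV ''n'') ?b) ?s) ''sq'' 0 = (lg_off pr + g)\<^sup>2" by blast
  have "n + 1 \<le> 2 ^ g"
  proof (cases "n \<le> g")
    case True
    have "n < 2 ^ n" by (rule less_exp)
    also have "(2::nat) ^ n \<le> 2 ^ g" using True by simp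
    finally show ?thesis by simp
  qed (use g in auto)
  then show ?thesis using g(1,3,4) unfolding s'_def c_log_def n_def den.simps
    by (intro exI[of _ g]) (simp del: den.simps(6))
qed

definition RQ :: "string \<Rightarrow> string \<Rightarrow> string \<Rightarrow> rexp" where
  "RQ x i a = RGet x (NAdd (NGet ''rm'' (nV i)) (nV a))"

definition IX :: "nat \<Rightarrow> string \<Rightarrow> nexp \<Rightarrow> nexp" where
  "IX w i a = NAdd (nmulc w (nV i)) a"

lemma nval_IX [simp]: "nval s (IX w i a) = w * nmem s i 0 + nval s a"
  by (simp add: IX_def)

text \<open>A program contains no real constants, so \<open>tau pr\<close> is computed as a quotient
  of naturals.\<close>

definition TAU :: "nat \<Rightarrow> rexp" where
  "TAU pr = RDiv (ROfNat (N 1)) (ROfNat (N (pr ^ 5)))"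

lemma rval_TAU [simp]: "rval s (TAU pr) = tau pr"
  by (simp add: TAU_def tau_def)

text \<open>The largest expected reward of a single query. If \<open>OPT\<close> is positive, it
  lies between this number and \<open>n\<close> times it, so the multiples of \<open>M\<close> serve
  as the guesses \<open>W\<close>.\<close>

definition c_max :: fcom where
  "c_max = rS ''M'' (ROfNat (N 0)) ;; FFor ''i'' (nV ''n'') (FFor ''a1'' (nV ''m'')
     (rS ''u'' (RMul (RQ ''r'' ''i'' ''a1'') (RQ ''q'' ''i'' ''a1'')) ;;
      FIf (RLess (rV ''M'') (rV ''u'')) (rS ''M'' (rV ''u'')) FSkip))"

text \<open>Array \<open>g\<close> receives \<open>lev\<close> and array \<open>h\<close> the
  truncated \<open>sg\<close>, both in rows of length \<open>lvls pr\<close>.\<close>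

definition c_lev :: "nat \<Rightarrow> fcom" where
  "c_lev pr = FFor ''i'' (nV ''n'') (FFor ''j'' (N (lvls pr)) (
     rS ''t'' (ROfNat (N 0)) ;;
     FFor ''a1'' (nV ''m'')
       (rS ''u'' (RMul (RQ ''q'' ''i'' ''a1'')
          (RSub (RQ ''r'' ''i'' ''a1'') (RDiv (RMul (ROfNat (nV ''j'')) (rV ''W'')) (ROfNat (N pr))))) ;;
        FIf (RLess (rV ''t'') (rV ''u'')) (rS ''t'' (rV ''u'')) FSkip) ;;
     rS ''t'' (RDiv (rV ''t'') (rV ''W'')) ;;
     FR ''g'' (IX (lvls pr) ''i'' (nV ''j'')) (rV ''t'') ;;
     FIf (RLess (TAU pr) (rV ''t'')) (rS ''t'' (TAU pr)) FSkip ;;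
     FR ''h'' (IX (lvls pr) ''i'' (nV ''j'')) (rV ''t'')))"

lemma idx_eq: "j < w \<Longrightarrow> j' < w \<Longrightarrow> w * e + j = w * e' + j' \<longleftrightarrow> e = e' \<and> j = j'" for e e' j j' w :: nat
proof
  assume *: "j < w" "j' < w" "w * e + j = w * e' + j'"
  have "e = (w * e + j) div w" "e' = (w * e' + j') div w" using *(1,2) by auto
  then have "e = e'" using *(3) by metis
  then show "e = e' \<and> j = j'" using * by auto
qed auto

lemma gain_Suc: "gain r q (Suc k) e V = max (gain r q k e V) (q e k * (r e k - V))"
proof -
  have eq: "insert 0 ((\<lambda>a. q e a * (r e a - V)) ` {..<Suc k}) = insert (q e k * (r e k - V)) (insert 0 ((\<lambda>a. q e a * (r e a - V)) ` {..<k}))"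
    by (auto simp: less_Suc_eq)
  show ?thesis unfolding gain_def eq by (subst Max_insert) (auto simp: max.commute)
qed

context star
begin

definition inp :: "state \<Rightarrow> bool" where
  "inp s \<longleftrightarrow> nmem s ''n'' 0 = n \<and> nmem s ''m'' 0 = m \<and> nmem s ''l'' 0 = l \<and>
     (\<forall>i\<le>n. nmem s ''rm'' i = i * m \<and> nmem s ''rl'' i = i * (n + 1)) \<and>
     (\<forall>e<n. \<forall>a<m. rmem s ''r'' (e * m + a) = r e a \<and> rmem s ''q'' (e * m + a) = q e a)"

lemma inp_cong:
  assumes "\<And>x. x \<in> {''n'', ''m'', ''l'', ''rm'', ''rl''} \<Longrightarrow> nmem s' x = nmem s x"
    "\<And>x. x \<in> {''r'', ''q''} \<Longrightarrow> rmem s' x = rmem s x"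
  shows "inp s' \<longleftrightarrow> inp s"
  using assms by (simp add: inp_def)

lemma inp_den:
  assumes "{''n'', ''m'', ''l'', ''rm'', ''rl''} \<inter> nw c = {}" "{''r'', ''q''} \<inter> rw c = {}"
  shows "inp (den c s) \<longleftrightarrow> inp s"
  using assms by (intro inp_cong nmem_den rmem_den) auto

lemma c_max:
  assumes "inp s"
  defines "M \<equiv> rmem (den c_max s) ''M'' 0"
  shows "\<And>e a. e < n \<Longrightarrow> a < m \<Longrightarrow> r e a * q e a \<le> M"
    and "M = 0 \<or> (\<exists>e<n. \<exists>a<m. M = r e a * q e a)"
proof -
  let ?s = "den (rS ''M'' (ROfNat (N 0))) s"
  let ?bb = "rS ''u'' (RMul (RQ ''r'' ''i'' ''a1'') (RQ ''q'' ''i'' ''a1'')) ;;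
      FIf (RLess (rV ''M'') (rV ''u'')) (rS ''M'' (rV ''u'')) FSkip"
  let ?b = "FFor ''a1'' (nV ''m'') ?bb"
  let ?Q = "\<lambda>i k (s' :: state). (\<forall>e a. (e < i \<and> a < m \<or> e = i \<and> a < k) \<longrightarrow> r e a * q e a \<le> rmem s' ''M'' 0) \<and>
     (rmem s' ''M'' 0 = 0 \<or> (\<exists>e<n. \<exists>a<m. rmem s' ''M'' 0 = r e a * q e a))"
  let ?I = "\<lambda>i (s' :: state). ?Q i 0 s'"
  have "?I n (den (FFor ''i'' (nV ''n'') ?b) ?s)"
  proof (rule den_For[where I = ?I])
    show "nval ?s (nV ''n'') = n" using assms(1) by (simp add: inp_def)
    show "?I 0 (nset ''i'' 0 0 ?s)" by simp
    fix i and s' :: state assume i: "i < n" and A: "?I i s'" and ii: "nmem s' ''i'' 0 = i"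
      and frn: "\<And>y. y \<noteq> ''i'' \<Longrightarrow> y \<notin> nw ?b \<Longrightarrow> nmem s' y = nmem ?s y"
      and frr: "\<And>y. y \<notin> rw ?b \<Longrightarrow> rmem s' y = rmem ?s y"
    have inp: "inp s'" using assms(1) by (subst inp_cong[of s' s]) (auto simp: frn frr nmem_nset_other rmem_rset_other)
    have "?Q i m (den ?b s')"
    proof (rule den_For[where I = "\<lambda>k (s' :: state). ?Q i k s'"])
      show "nval s' (nV ''m'') = m" using inp by (simp add: inp_def)
      show "?Q i 0 (nset ''a1'' 0 0 s')" using A by simp
      fix k and s2 :: state assume k: "k < m" and B: "?Q i k s2" and kk: "nmem s2 ''a1'' 0 = k"
        and frn2: "\<And>y. y \<noteq> ''a1'' \<Longrightarrow> y \<notin> nw ?bb \<Longrightarrow> nmem s2 y = nmem s' y"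
        and frr2: "\<And>y. y \<notin> rw ?bb \<Longrightarrow> rmem s2 y = rmem s' y"
      have inp2: "inp s2" using inp by (subst inp_cong[of s2 s']) (auto simp: frn2 frr2)
      have ii2: "nmem s2 ''i'' 0 = i" using frn2 ii by simp
      have rq: "rval s2 (RQ ''r'' ''i'' ''a1'') = r i k" "rval s2 (RQ ''q'' ''i'' ''a1'') = q i k"
        using inp2 i k ii2 kk by (auto simp: RQ_def inp_def)
      show "?Q i (Suc k) (nset ''a1'' 0 (Suc k) (den ?bb s2))"
        using B rq i k by (auto simp: less_Suc_eq intro: order_trans less_imp_le)
    qed simp
    then show "?I (Suc i) (nset ''i'' 0 (Suc i) (den ?b s'))"
      by (auto simp: less_Suc_eq simp del: den.simps)
  qed simp
  then have "?I n (den c_max s)" by (simp add: c_max_def del: den.simps(6))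
  then show "\<And>e a. e < n \<Longrightarrow> a < m \<Longrightarrow> r e a * q e a \<le> M"
    "M = 0 \<or> (\<exists>e<n. \<exists>a<m. M = r e a * q e a)" by (auto simp: M_def)
qed

lemma c_lev:
  assumes "inp s" and W: "rmem s ''W'' 0 = W"
  defines "s' \<equiv> den (c_lev pr) s"
  shows "\<forall>e<n. \<forall>j<lvls pr. rmem s' ''g'' (lvls pr * e + j) = lev W e j \<and> rmem s' ''h'' (lvls pr * e + j) = sg W e j"
proof -
  let ?J = "lvls pr"
  let ?c = "rS ''u'' (RMul (RQ ''q'' ''i'' ''a1'')
          (RSub (RQ ''r'' ''i'' ''a1'') (RDiv (RMul (ROfNat (nV ''j'')) (rV ''W'')) (ROfNat (N pr))))) ;;
        FIf (RLess (rV ''t'') (rV ''u'')) (rS ''t'' (rV ''u'')) FSkip"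
  let ?b2 = "rS ''t'' (ROfNat (N 0)) ;;
     FFor ''a1'' (nV ''m'') ?c ;;
     rS ''t'' (RDiv (rV ''t'') (rV ''W'')) ;;
     FR ''g'' (IX ?J ''i'' (nV ''j'')) (rV ''t'') ;;
     FIf (RLess (TAU pr) (rV ''t'')) (rS ''t'' (TAU pr)) FSkip ;;
     FR ''h'' (IX ?J ''i'' (nV ''j'')) (rV ''t'')"
  let ?b = "FFor ''j'' (N ?J) ?b2"
  let ?Q = "\<lambda>i k (s' :: state). \<forall>e j. (e < i \<and> j < ?J \<or> e = i \<and> j < k) \<longrightarrow>
      rmem s' ''g'' (?J * e + j) = lev W e j \<and> rmem s' ''h'' (?J * e + j) = sg W e j"
  let ?I = "\<lambda>i (s' :: state). ?Q i 0 s'"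
  have "?I n (den (FFor ''i'' (nV ''n'') ?b) s)"
  proof (rule den_For[where I = ?I])
    show "nval s (nV ''n'') = n" using assms(1) by (simp add: inp_def)
    show "?I 0 (nset ''i'' 0 0 s)" by simp
    fix i and s' :: state assume i: "i < n" and A: "?I i s'" and ii: "nmem s' ''i'' 0 = i"
      and frn: "\<And>y. y \<noteq> ''i'' \<Longrightarrow> y \<notin> nw ?b \<Longrightarrow> nmem s' y = nmem s y"
      and frr: "\<And>y. y \<notin> rw ?b \<Longrightarrow> rmem s' y = rmem s y"
    have inp: "inp s'" using assms(1) by (subst inp_cong[of s' s]) (auto simp: frn frr)
    have W': "rmem s' ''W'' 0 = W" using frr W by simp
    have "?Q i ?J (den ?b s')"
    proof (rule den_For[where I = "\<lambda>k (s' :: state). ?Q i k s'"])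
      show "?Q i 0 (nset ''j'' 0 0 s')" using A by simp
      fix k and s2 :: state assume k: "k < ?J" and B: "?Q i k s2" and kk: "nmem s2 ''j'' 0 = k"
        and frn2: "\<And>y. y \<noteq> ''j'' \<Longrightarrow> y \<notin> nw ?b2 \<Longrightarrow> nmem s2 y = nmem s' y"
        and frr2: "\<And>y. y \<notin> rw ?b2 \<Longrightarrow> rmem s2 y = rmem s' y"
      have inp2: "inp s2" using inp by (subst inp_cong[of s2 s']) (auto simp: frn2 frr2)
      have ii2: "nmem s2 ''i'' 0 = i" "rmem s2 ''W'' 0 = W" using frn2 ii frr2 W' by simp_all
      define s3 where "s3 = den (rS ''t'' (ROfNat (N 0))) s2"
      define s4 where "s4 = den (FFor ''a1'' (nV ''m'') ?c) s3"
      define V where "V = real k * W / real pr"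
      have t: "rmem s4 ''t'' 0 = gain r q m i V"
        unfolding s4_def
      proof (rule den_For[where I = "\<lambda>a (s :: state). rmem s ''t'' 0 = gain r q a i V"])
        show "nval s3 (nV ''m'') = m" using inp2 by (simp add: inp_def s3_def)
        show "rmem (nset ''a1'' 0 0 s3) ''t'' 0 = gain r q 0 i V" by (simp add: s3_def gain_def)
        fix a and s5 :: state assume a: "a < m" and C: "rmem s5 ''t'' 0 = gain r q a i V" and aa: "nmem s5 ''a1'' 0 = a"
        and frn3: "\<And>y. y \<noteq> ''a1'' \<Longrightarrow> y \<notin> nw ?c \<Longrightarrow> nmem s5 y = nmem s3 y"
        and frr3: "\<And>y. y \<notin> rw ?c \<Longrightarrow> rmem s5 y = rmem s3 y"
        have inp3: "inp s5" using inp2 by (subst inp_cong[of s5 s2]) (auto simp: frn3 frr3 s3_def rmem_rset_other)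
        have ii3: "nmem s5 ''i'' 0 = i" "nmem s5 ''j'' 0 = k" "rmem s5 ''W'' 0 = W"
          using frn3 ii2 frr3 kk by (simp_all add: s3_def)
        have rq: "rval s5 (RQ ''r'' ''i'' ''a1'') = r i a" "rval s5 (RQ ''q'' ''i'' ''a1'') = q i a"
          using inp3 i a ii3 aa by (auto simp: RQ_def inp_def)
        show "rmem (nset ''a1'' 0 (Suc a) (den ?c s5)) ''t'' 0 = gain r q (Suc a) i V"
          using C rq ii3 by (simp add: gain_Suc V_def max_def)
      qed simp
      have s4n: "nmem s4 ''i'' 0 = i" "nmem s4 ''j'' 0 = k"
        unfolding s4_def s3_def using ii2 kk by (simp_all add: nmem_den del: den.simps(6))
      have s4r: "rmem s4 ''W'' 0 = W" "rmem s4 ''g'' = rmem s2 ''g''" "rmem s4 ''h'' = rmem s2 ''h''"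
        unfolding s4_def s3_def using ii2 by (simp_all add: rmem_den rmem_rset_other del: den.simps(6))
      have lev: "rmem s4 ''t'' 0 / W = lev W i k" using t by (simp add: lev_def V_def)
      have d: "den ?b2 s2 = den (rS ''t'' (RDiv (rV ''t'') (rV ''W'')) ;;
     FR ''g'' (IX ?J ''i'' (nV ''j'')) (rV ''t'') ;;
     FIf (RLess (TAU pr) (rV ''t'')) (rS ''t'' (TAU pr)) FSkip ;;
     FR ''h'' (IX ?J ''i'' (nV ''j'')) (rV ''t'')) s4"
        by (simp add: s4_def s3_def)
      show "?Q i (Suc k) (nset ''j'' 0 (Suc k) (den ?b2 s2))"
        unfolding d using B s4n s4r lev k
        by (auto simp: less_Suc_eq idx_eq sg_def min_def)
    qed simp_all
    then show "?I (Suc i) (nset ''i'' 0 (Suc i) (den ?b s'))"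
      by (auto simp: less_Suc_eq simp del: den.simps)
  qed simp
  then show ?thesis unfolding s'_def c_lev_def by auto
qed

end

section \<open>Computing shares, codes and the table of reachable sums\<close>

definition HX :: "nat \<Rightarrow> string \<Rightarrow> nexp \<Rightarrow> rexp" where
  "HX pr x a = RGet x (IX (lvls pr) ''i'' a)"

lemma rval_HX [simp]: "rval s (HX pr x a) = rmem s x (lvls pr * nmem s ''i'' 0 + nval s a)"
  by (simp add: HX_def)

definition c_weight :: "nat \<Rightarrow> fcom" where
  "c_weight pr = rS ''t'' (ROfNat (N 1)) ;;
     FFor ''p'' (nV ''P'') (rS ''t'' (RMul (rV ''t'') (HX pr ''h'' (nV ''j'')))) ;;
     FR ''w'' (nV ''j'') (RMul (RGet ''Lam'' (nV ''j'')) (rV ''t''))"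

definition c_share :: "nat \<Rightarrow> fcom" where
  "c_share pr = FFor ''i'' (nV ''n'') (
     FFor ''j'' (N (lvls pr)) (c_weight pr) ;;
     FFor ''j'' (N (lvls pr)) (FR ''y'' (IX (lvls pr) ''i'' (nV ''j''))
       (RDiv (RGet ''w'' (nV ''j'')) (RAdd (RGet ''Lam'' (N (lvls pr))) (rsum (\<lambda>k. RGet ''w'' (N k)) (lvls pr))))))"

text \<open>Adds \<open>u\<close> to \<open>c\<close> once for each of the thresholds 1 to
  \<open>D\<close> that \<open>D * v\<close> reaches. This replaces both the rounding and the
  product of the digit with its place value.\<close>

definition digit :: "nat \<Rightarrow> rexp \<Rightarrow> nat \<Rightarrow> fcom" where
  "digit D v u = FFor ''d'' (N D) (FIf (RLess (RMul (ROfNat (N D)) v) (ROfNat (NAdd (nV ''d'') (N 1))))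
     FSkip (nS ''c'' (NAdd (nV ''c'') (N u))))"

text \<open>Bins and levels are unrolled by \<open>fseq\<close> because the powers of
  \<open>ubase pr\<close> have to be literals of the program; they depend on \<open>pr\<close>
  only.\<close>

definition c_code :: "nat \<Rightarrow> fcom" where
  "c_code pr = FFor ''i'' (nV ''n'') (fseq (\<lambda>b.
     nS ''c'' (N (ubase pr ^ (3 * lvls pr + 1) + ubase pr ^ b * dpad pr)) ;;
     digit (dres pr) (HX pr ''g'' (N (b div 2))) (ubase pr ^ b) ;;
     fseq (\<lambda>j. digit (dres pr) (RMul (HX pr ''y'' (N j)) (HX pr ''h'' (N j))) (ubase pr ^ (2 * lvls pr + j))) (lvls pr) ;;
     digit (dres pr) (rsum (\<lambda>j. HX pr ''y'' (N j)) (lvls pr)) (ubase pr ^ (3 * lvls pr)) ;;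
     FN ''inc'' (IX (2 * lvls pr) ''i'' (N b)) (nV ''c'')) (2 * lvls pr))"

definition c_sel :: "nat \<Rightarrow> fcom" where
  "c_sel pr = nS ''z'' (NGet ''inc'' (IX (2 * lvls pr) ''i'' (nV ''b''))) ;;
     FIf (BAnd (BNot (NLess (nV ''s'') (nV ''z'')))
          (NLess (N 0) (NGet ''tab'' (IX (qsize pr) ''i'' (NSub (nV ''s'') (nV ''z''))))))
       (nS ''c'' (NAdd (nV ''b'') (N 2))) FSkip"

text \<open>A table restricted to sums below \<open>qsize pr\<close> is exact: the recursion only
  subtracts weights, so an entry never refers to a larger sum.\<close>

definition c_tab :: "nat \<Rightarrow> fcom" where
  "c_tab pr = FFor ''s'' (N (qsize pr)) (FN ''tab'' (nV ''s'') (N 0)) ;; FN ''tab'' (N 0) (N 1) ;;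
     FFor ''i'' (nV ''n'') (FFor ''s'' (N (qsize pr)) (
       FIf (NLess (N 0) (NGet ''tab'' (IX (qsize pr) ''i'' (nV ''s'')))) (nS ''c'' (N 1)) (nS ''c'' (N 0)) ;;
       FFor ''b'' (N (2 * lvls pr)) (c_sel pr) ;;
       FN ''tab'' (NAdd (N (qsize pr)) (IX (qsize pr) ''i'' (nV ''s''))) (nV ''c'')))"

lemma nw_digit [simp]: "nw (digit D v u) = {''d'', ''c''}"
  and rw_digit [simp]: "rw (digit D v u) = {}"
  by (auto simp: digit_def)

lemma digit:
  assumes "\<And>s'. (\<And>z. z \<notin> {''c'', ''d''} \<Longrightarrow> nmem s' z = nmem s z) \<Longrightarrow> rmem s' = rmem s \<Longrightarrow> rval s' v = x"
  shows "nmem (den (digit D v u) s) ''c'' 0 = nmem s ''c'' 0 + u * dig D x D"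
  unfolding digit_def
proof (rule den_For[where I = "\<lambda>i s'. nmem s' ''c'' 0 = nmem s ''c'' 0 + u * dig D x i"])
  fix i and s' :: state
  let ?b = "FIf (RLess (RMul (ROfNat (N D)) v) (ROfNat (NAdd (nV ''d'') (N 1))))
     FSkip (nS ''c'' (NAdd (nV ''c'') (N u)))"
  assume A: "nmem s' ''c'' 0 = nmem s ''c'' 0 + u * dig D x i" "nmem s' ''d'' 0 = i"
    and frn: "\<And>y. y \<noteq> ''d'' \<Longrightarrow> y \<notin> nw ?b \<Longrightarrow> nmem s' y = nmem s y"
    and frr: "\<And>y. y \<notin> rw ?b \<Longrightarrow> rmem s' y = rmem s y"
  have "rmem s' = rmem s" using frr by auto
  then have "rval s' v = x" using frn by (intro assms) auto
  then show "nmem (nset ''d'' 0 (Suc i) (den ?b s')) ''c'' 0 = nmem s ''c'' 0 + u * dig D x (Suc i)"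
    using A by simp
qed auto

context star
begin

definition lev_ok :: "real \<Rightarrow> state \<Rightarrow> bool" where
  "lev_ok W s \<longleftrightarrow> (\<forall>e<n. \<forall>j<lvls pr. rmem s ''g'' (lvls pr * e + j) = lev W e j \<and> rmem s ''h'' (lvls pr * e + j) = sg W e j)"

definition share_ok :: "real \<Rightarrow> nat \<Rightarrow> (nat \<Rightarrow> real) \<Rightarrow> state \<Rightarrow> bool" where
  "share_ok W P \<Lambda> s \<longleftrightarrow> (\<forall>e<n. \<forall>j<lvls pr. rmem s ''y'' (lvls pr * e + j) = shr W P \<Lambda> e j)"

definition code_ok :: "real \<Rightarrow> nat \<Rightarrow> (nat \<Rightarrow> real) \<Rightarrow> state \<Rightarrow> bool" where
  "code_ok W P \<Lambda> s \<longleftrightarrow> (\<forall>e<n. \<forall>b<2 * lvls pr. nmem s ''inc'' (2 * lvls pr * e + b) = code W P \<Lambda> e b)"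

definition tab_ok :: "real \<Rightarrow> nat \<Rightarrow> (nat \<Rightarrow> real) \<Rightarrow> state \<Rightarrow> bool" where
  "tab_ok W P \<Lambda> s \<longleftrightarrow> (\<forall>e\<le>n. \<forall>c<qsize pr. nmem s ''tab'' (qsize pr * e + c) = tab (code W P \<Lambda>) (2 * lvls pr) e c)"

lemma c_share:
  assumes n: "nmem s ''n'' 0 = n" and P: "nmem s ''P'' 0 = P" and lev: "lev_ok W s"
    and \<Lambda>: "rmem s ''Lam'' = \<Lambda>"
  shows "share_ok W P \<Lambda> (den (c_share pr) s)"
proof -
  let ?J = "lvls pr"
  let ?b2 = "FR ''y'' (IX ?J ''i'' (nV ''j''))
       (RDiv (RGet ''w'' (nV ''j'')) (RAdd (RGet ''Lam'' (N ?J)) (rsum (\<lambda>k. RGet ''w'' (N k)) ?J)))"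
  let ?b = "FFor ''j'' (N ?J) (c_weight pr) ;; FFor ''j'' (N ?J) ?b2"
  let ?I = "\<lambda>i (s' :: state). \<forall>e<i. \<forall>j<?J. rmem s' ''y'' (?J * e + j) = shr W P \<Lambda> e j"
  have "?I n (den (FFor ''i'' (nV ''n'') ?b) s)"
  proof (rule den_For[where I = ?I])
    show "nval s (nV ''n'') = n" using n by simp
    fix i and s' :: state assume i: "i < n" and A: "?I i s'" and ii: "nmem s' ''i'' 0 = i"
      and frn: "\<And>y. y \<noteq> ''i'' \<Longrightarrow> y \<notin> nw ?b \<Longrightarrow> nmem s' y = nmem s y"
      and frr: "\<And>y. y \<notin> rw ?b \<Longrightarrow> rmem s' y = rmem s y"
    have f1: "rmem s' ''h'' = rmem s ''h''" "rmem s' ''Lam'' = \<Lambda>" "nmem s' ''P'' 0 = P"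
      using frr frn \<Lambda> P by (simp_all add: c_weight_def)
    define s1 where "s1 = den (FFor ''j'' (N ?J) (c_weight pr)) s'"
    have w: "\<forall>j<?J. rmem s1 ''w'' j = \<Lambda> j * sg W i j ^ P"
      unfolding s1_def
    proof (rule den_For[where I = "\<lambda>k (s :: state). \<forall>j<k. rmem s ''w'' j = \<Lambda> j * sg W i j ^ P"])
      fix k and s2 :: state assume k: "k < ?J" and B: "\<forall>j<k. rmem s2 ''w'' j = \<Lambda> j * sg W i j ^ P"
        and kk: "nmem s2 ''j'' 0 = k"
        and frn2: "\<And>y. y \<noteq> ''j'' \<Longrightarrow> y \<notin> nw (c_weight pr) \<Longrightarrow> nmem s2 y = nmem s' y"
        and frr2: "\<And>y. y \<notin> rw (c_weight pr) \<Longrightarrow> rmem s2 y = rmem s' y"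
      have f2: "rmem s2 ''h'' = rmem s ''h''" "rmem s2 ''Lam'' = \<Lambda>" "nmem s2 ''P'' 0 = P" "nmem s2 ''i'' 0 = i"
        using frr2 frn2 f1 ii by (simp_all add: c_weight_def)
      have h: "rmem s ''h'' (?J * i + k) = sg W i k" using lev i k by (simp add: lev_ok_def)
      let ?c = "rS ''t'' (RMul (rV ''t'') (HX pr ''h'' (nV ''j'')))"
      define s3 where "s3 = den (rS ''t'' (ROfNat (N 1))) s2"
      define s4 where "s4 = den (FFor ''p'' (nV ''P'') ?c) s3"
      have t: "rmem s4 ''t'' 0 = sg W i k ^ P" unfolding s4_def
      proof (rule den_For[where I = "\<lambda>p (s :: state). rmem s ''t'' 0 = sg W i k ^ p"])
        fix p and s5 :: state assume C: "rmem s5 ''t'' 0 = sg W i k ^ p"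
          and frn3: "\<And>y. y \<noteq> ''p'' \<Longrightarrow> y \<notin> nw ?c \<Longrightarrow> nmem s5 y = nmem s3 y"
          and frr3: "\<And>y. y \<notin> rw ?c \<Longrightarrow> rmem s5 y = rmem s3 y"
        have "rmem s5 ''h'' = rmem s ''h''" "nmem s5 ''i'' 0 = i" "nmem s5 ''j'' 0 = k"
          using frn3 frr3 f2 kk by (simp_all add: s3_def rmem_rset_other)
        then show "rmem (nset ''p'' 0 (Suc p) (den ?c s5)) ''t'' 0 = sg W i k ^ Suc p"
          using C h by simp
      qed (use f2 in \<open>simp_all add: s3_def\<close>)
      have f4: "rmem s4 ''Lam'' = \<Lambda>" "rmem s4 ''w'' = rmem s2 ''w''" "nmem s4 ''j'' 0 = k"
        unfolding s4_def s3_def using f2 kk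
        by (simp_all add: rmem_den nmem_den rmem_rset_other HX_def del: den.simps(6))
      have d: "den (c_weight pr) s2 = den (FR ''w'' (nV ''j'') (RMul (RGet ''Lam'' (nV ''j'')) (rV ''t''))) s4"
        by (simp add: c_weight_def s4_def s3_def)
      show "\<forall>j<Suc k. rmem (nset ''j'' 0 (Suc k) (den (c_weight pr) s2)) ''w'' j = \<Lambda> j * sg W i j ^ P"
        unfolding d using B t f4 by (auto simp: less_Suc_eq)
    qed (auto simp: c_weight_def)
    have f5: "rmem s1 ''Lam'' = \<Lambda>" "nmem s1 ''i'' 0 = i" "rmem s1 ''y'' = rmem s' ''y''"
      unfolding s1_def using f1 ii by (simp_all add: rmem_den nmem_den c_weight_def del: den.simps(6))
    define s6 where "s6 = den (FFor ''j'' (N ?J) ?b2) s1"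
    have y: "(\<forall>e<i. \<forall>j<?J. rmem s6 ''y'' (?J * e + j) = shr W P \<Lambda> e j) \<and>
        (\<forall>j<?J. rmem s6 ''y'' (?J * i + j) = shr W P \<Lambda> i j)"
      unfolding s6_def
    proof (rule den_For[where I = "\<lambda>k (s6 :: state). (\<forall>e<i. \<forall>j<?J. rmem s6 ''y'' (?J * e + j) = shr W P \<Lambda> e j) \<and>
        (\<forall>j<k. rmem s6 ''y'' (?J * i + j) = shr W P \<Lambda> i j)"])
      fix k and s7 :: state
      assume k: "k < ?J" and B: "(\<forall>e<i. \<forall>j<?J. rmem s7 ''y'' (?J * e + j) = shr W P \<Lambda> e j) \<and>
        (\<forall>j<k. rmem s7 ''y'' (?J * i + j) = shr W P \<Lambda> i j)" and kk: "nmem s7 ''j'' 0 = k"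
        and frn2: "\<And>y. y \<noteq> ''j'' \<Longrightarrow> y \<notin> nw ?b2 \<Longrightarrow> nmem s7 y = nmem s1 y"
        and frr2: "\<And>y. y \<notin> rw ?b2 \<Longrightarrow> rmem s7 y = rmem s1 y"
      have "rmem s7 ''Lam'' = \<Lambda>" "nmem s7 ''i'' 0 = i" "rmem s7 ''w'' = rmem s1 ''w''"
        using frn2 frr2 f5 by simp_all
      moreover have "(\<Sum>j<?J. rmem s1 ''w'' j) = (\<Sum>j<?J. \<Lambda> j * sg W i j ^ P)" using w by simp
      ultimately show "(\<forall>e<i. \<forall>j<?J. rmem (nset ''j'' 0 (Suc k) (den ?b2 s7)) ''y'' (?J * e + j) = shr W P \<Lambda> e j) \<and>
        (\<forall>j<Suc k. rmem (nset ''j'' 0 (Suc k) (den ?b2 s7)) ''y'' (?J * i + j) = shr W P \<Lambda> i j)"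
        using B kk k w by (auto simp: less_Suc_eq idx_eq shr_def share_def)
    qed (use A f5 in auto)
    have "den ?b s' = s6" by (simp add: s6_def s1_def)
    then show "?I (Suc i) (nset ''i'' 0 (Suc i) (den ?b s'))"
      using y by (simp add: less_Suc_eq del: den.simps)
  qed (auto simp: c_weight_def)
  then show ?thesis by (simp add: share_ok_def c_share_def)
qed

lemma c_code:
  assumes n: "nmem s ''n'' 0 = n" and lev: "lev_ok W s" and y: "share_ok W P \<Lambda> s"
  shows "code_ok W P \<Lambda> (den (c_code pr) s)"
proof -
  let ?J = "lvls pr" and ?U = "ubase pr" and ?D = "dres pr"
  let ?f = "\<lambda>j. digit ?D (RMul (HX pr ''y'' (N j)) (HX pr ''h'' (N j))) (?U ^ (2 * ?J + j))"
  let ?bb = "\<lambda>b. nS ''c'' (N (?U ^ (3 * ?J + 1) + ?U ^ b * dpad pr)) ;;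
     digit ?D (HX pr ''g'' (N (b div 2))) (?U ^ b) ;;
     fseq ?f ?J ;;
     digit ?D (rsum (\<lambda>j. HX pr ''y'' (N j)) ?J) (?U ^ (3 * ?J)) ;;
     FN ''inc'' (IX (2 * ?J) ''i'' (N b)) (nV ''c'')"
  let ?b = "fseq ?bb (2 * ?J)"
  let ?I = "\<lambda>i (s' :: state). \<forall>e<i. \<forall>b<2 * ?J. nmem s' ''inc'' (2 * ?J * e + b) = code W P \<Lambda> e b"
  have nwb: "nw ?b \<subseteq> {''c'', ''d'', ''inc''}" "rw ?b = {}" by (auto simp: nw_fseq rw_fseq)
  have "?I n (den (FFor ''i'' (nV ''n'') ?b) s)"
  proof (rule den_For[where I = ?I])
    show "nval s (nV ''n'') = n" using n by simp
    show "''i'' \<notin> nw ?b" using nwb by auto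
    fix i and s' :: state assume i: "i < n" and A: "?I i s'" and ii: "nmem s' ''i'' 0 = i"
      and frr: "\<And>y. y \<notin> rw ?b \<Longrightarrow> rmem s' y = rmem s y"
    have r: "rmem s' = rmem s" using frr nwb(2) by auto
    let ?K = "\<lambda>k (s1 :: state). rmem s1 = rmem s \<and> nmem s1 ''i'' 0 = i \<and>
      (\<forall>e<i. \<forall>b<2 * ?J. nmem s1 ''inc'' (2 * ?J * e + b) = code W P \<Lambda> e b) \<and>
      (\<forall>b<k. nmem s1 ''inc'' (2 * ?J * i + b) = code W P \<Lambda> i b)"
    have "?K (2 * ?J) (den ?b s')"
    proof (rule den_fseq[where I = ?K])
      show "?K 0 s'" using A r ii by simp
      fix b and s1 :: state assume b: "b < 2 * ?J" and B: "?K b s1"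
      have g: "rmem s ''g'' (?J * i + b div 2) = lev W i (b div 2)" using lev i b by (auto simp: lev_ok_def)
      have yh: "rmem s ''y'' (?J * i + j) = shr W P \<Lambda> i j" "rmem s ''h'' (?J * i + j) = sg W i j" if "j < ?J" for j
        using lev y i that by (auto simp: lev_ok_def share_ok_def)
      define s2 where "s2 = den (nS ''c'' (N (?U ^ (3 * ?J + 1) + ?U ^ b * dpad pr))) s1"
      define s3 where "s3 = den (digit ?D (HX pr ''g'' (N (b div 2))) (?U ^ b)) s2"
      define s4 where "s4 = den (fseq ?f ?J) s3"
      define s5 where "s5 = den (digit ?D (rsum (\<lambda>j. HX pr ''y'' (N j)) ?J) (?U ^ (3 * ?J))) s4"
      have e2: "rmem s2 = rmem s" "nmem s2 ''i'' 0 = i" "nmem s2 ''inc'' = nmem s1 ''inc''"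
        using B by (auto simp: s2_def nmem_nset_other)
      have e3: "rmem s3 = rmem s" "nmem s3 ''i'' 0 = i" "nmem s3 ''inc'' = nmem s1 ''inc''"
        using e2 by (auto simp: s3_def nmem_den rmem_den)
      have c2: "nmem s2 ''c'' 0 = ?U ^ (3 * ?J + 1) + ?U ^ b * dpad pr" by (simp add: s2_def)
      have "nmem s3 ''c'' 0 = nmem s2 ''c'' 0 + ?U ^ b * dig ?D (lev W i (b div 2)) ?D"
        unfolding s3_def by (rule digit) (simp add: e2 g)
      then have c3: "nmem s3 ''c'' 0 = ?U ^ (3 * ?J + 1) + ?U ^ b * (dpad pr + dig ?D (lev W i (b div 2)) ?D)"
        using c2 by (simp add: algebra_simps)
      have s4: "rmem s4 = rmem s \<and> nmem s4 ''i'' 0 = i \<and> nmem s4 ''inc'' = nmem s1 ''inc'' \<and>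
        nmem s4 ''c'' 0 = nmem s3 ''c'' 0 + (\<Sum>j<?J. ?U ^ (2 * ?J + j) * dig ?D (shr W P \<Lambda> i j * sg W i j) ?D)"
        unfolding s4_def
      proof (rule den_fseq[where I = "\<lambda>k (s4 :: state). rmem s4 = rmem s \<and> nmem s4 ''i'' 0 = i \<and> nmem s4 ''inc'' = nmem s1 ''inc'' \<and>
        nmem s4 ''c'' 0 = nmem s3 ''c'' 0 + (\<Sum>j<k. ?U ^ (2 * ?J + j) * dig ?D (shr W P \<Lambda> i j * sg W i j) ?D)"])
        fix j and s6 :: state assume j: "j < ?J" and C: "rmem s6 = rmem s \<and> nmem s6 ''i'' 0 = i \<and> nmem s6 ''inc'' = nmem s1 ''inc'' \<and>
        nmem s6 ''c'' 0 = nmem s3 ''c'' 0 + (\<Sum>j<j. ?U ^ (2 * ?J + j) * dig ?D (shr W P \<Lambda> i j * sg W i j) ?D)"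
        have "nmem (den (?f j) s6) ''c'' 0 = nmem s6 ''c'' 0 + ?U ^ (2 * ?J + j) * dig ?D (shr W P \<Lambda> i j * sg W i j) ?D"
          using C j yh by (intro digit) simp
        then show "rmem (den (?f j) s6) = rmem s \<and> nmem (den (?f j) s6) ''i'' 0 = i \<and> nmem (den (?f j) s6) ''inc'' = nmem s1 ''inc'' \<and>
        nmem (den (?f j) s6) ''c'' 0 = nmem s3 ''c'' 0 + (\<Sum>j<Suc j. ?U ^ (2 * ?J + j) * dig ?D (shr W P \<Lambda> i j * sg W i j) ?D)"
          using C by (auto simp: nmem_den rmem_den)
      qed (use e3 in simp)
      have "nmem s5 ''c'' 0 = nmem s4 ''c'' 0 + ?U ^ (3 * ?J) * dig ?D (\<Sum>j<?J. shr W P \<Lambda> i j) ?D"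
        unfolding s5_def by (rule digit) (simp add: s4 yh)
      then have c5: "nmem s5 ''c'' 0 = code W P \<Lambda> i b" using c3 s4 by (simp add: code_def)
      have e5: "rmem s5 = rmem s" "nmem s5 ''i'' 0 = i" "nmem s5 ''inc'' = nmem s1 ''inc''"
        using s4 by (auto simp: s5_def nmem_den rmem_den)
      have d: "den (?bb b) s1 = den (FN ''inc'' (IX (2 * ?J) ''i'' (N b)) (nV ''c'')) s5"
        by (simp add: s5_def s4_def s3_def s2_def)
      show "?K (Suc b) (den (?bb b) s1)" unfolding d using B c5 e5 b
        by (auto simp: less_Suc_eq idx_eq)
    qed
    then show "?I (Suc i) (nset ''i'' 0 (Suc i) (den ?b s'))" by (auto simp: less_Suc_eq)
  qed simp
  then show ?thesis by (simp add: code_ok_def c_code_def)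
qed

lemma c_tab:
  assumes n: "nmem s ''n'' 0 = n" and code: "code_ok W P \<Lambda> s"
  shows "tab_ok W P \<Lambda> (den (c_tab pr) s)"
proof -
  let ?B = "2 * lvls pr" and ?Z = "qsize pr"
  let ?w = "code W P \<Lambda>"
  let ?t = "tab ?w ?B"
  define s1 where "s1 = den (FFor ''s'' (N ?Z) (FN ''tab'' (nV ''s'') (N 0)) ;; FN ''tab'' (N 0) (N 1)) s"
  have "\<forall>c<?Z. nmem (den (FFor ''s'' (N ?Z) (FN ''tab'' (nV ''s'') (N 0))) s) ''tab'' c = 0"
    by (rule den_For[where I = "\<lambda>k (s :: state). \<forall>c<k. nmem s ''tab'' c = 0"]) (auto simp: less_Suc_eq)
  then have t1: "\<forall>c<?Z. nmem s1 ''tab'' c = ?t 0 c" unfolding s1_def by (simp del: den.simps(6))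
  have n1: "nmem s1 ''n'' 0 = n" "nmem s1 ''inc'' = nmem s ''inc''"
    using n by (simp_all add: s1_def nmem_den nmem_nset_other del: den.simps(6))
  let ?c = "FIf (NLess (N 0) (NGet ''tab'' (IX ?Z ''i'' (nV ''s'')))) (nS ''c'' (N 1)) (nS ''c'' (N 0)) ;;
       FFor ''b'' (N ?B) (c_sel pr) ;;
       FN ''tab'' (NAdd (N ?Z) (IX ?Z ''i'' (nV ''s''))) (nV ''c'')"
  let ?Q = "\<lambda>i k (s' :: state). \<forall>e c. (e \<le> i \<and> c < ?Z \<or> e = Suc i \<and> c < k) \<longrightarrow> nmem s' ''tab'' (?Z * e + c) = ?t e c"
  have "?Q n 0 (den (FFor ''i'' (nV ''n'') (FFor ''s'' (N ?Z) ?c)) s1)"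
  proof (rule den_For2[where Q = ?Q])
    fix i k and s' :: state assume i: "i < n" and k: "k < ?Z" and A: "?Q i k s'"
      and ii: "nmem s' ''i'' 0 = i" and kk: "nmem s' ''s'' 0 = k"
      and frn: "\<And>z. z \<noteq> ''i'' \<Longrightarrow> z \<noteq> ''s'' \<Longrightarrow> z \<notin> nw ?c \<Longrightarrow> nmem s' z = nmem s1 z"
    have inc: "nmem s' ''inc'' = nmem s ''inc''" using frn n1 by (simp add: c_sel_def)
    define s2 where "s2 = den (FIf (NLess (N 0) (NGet ''tab'' (IX ?Z ''i'' (nV ''s'')))) (nS ''c'' (N 1)) (nS ''c'' (N 0))) s'"
    have c2: "nmem s2 ''c'' 0 = tsel (?w i) (?t i) k 0"
      using A ii kk k by (simp add: s2_def)
    have e2: "nmem s2 ''inc'' = nmem s ''inc''" "nmem s2 ''tab'' = nmem s' ''tab''" "nmem s2 ''i'' 0 = i" "nmem s2 ''s'' 0 = k"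
      using inc ii kk by (simp_all add: s2_def nmem_nset_other)
    define s3 where "s3 = den (FFor ''b'' (N ?B) (c_sel pr)) s2"
    have c3: "nmem s3 ''c'' 0 = tsel (?w i) (?t i) k ?B" unfolding s3_def
    proof (rule den_For[where I = "\<lambda>b (s :: state). nmem s ''c'' 0 = tsel (?w i) (?t i) k b"])
      fix b and s4 :: state assume b: "b < ?B" and C: "nmem s4 ''c'' 0 = tsel (?w i) (?t i) k b" and bb: "nmem s4 ''b'' 0 = b"
        and frn2: "\<And>z. z \<noteq> ''b'' \<Longrightarrow> z \<notin> nw (c_sel pr) \<Longrightarrow> nmem s4 z = nmem s2 z"
      have e4: "nmem s4 ''inc'' = nmem s ''inc''" "nmem s4 ''tab'' = nmem s' ''tab''" "nmem s4 ''i'' 0 = i" "nmem s4 ''s'' 0 = k"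
        using frn2 e2 by (simp_all add: c_sel_def)
      have w: "nmem s ''inc'' (?B * i + b) = ?w i b" using code i b by (simp add: code_ok_def)
      have t: "nmem s' ''tab'' (?Z * i + (k - ?w i b)) = ?t i (k - ?w i b)" using A k by simp
      show "nmem (nset ''b'' 0 (Suc b) (den (c_sel pr) s4)) ''c'' 0 = tsel (?w i) (?t i) k (Suc b)"
        using C bb e4 w t by (auto simp: c_sel_def nmem_nset_other)
    qed (auto simp: c_sel_def c2)
    have e3: "nmem s3 ''tab'' = nmem s' ''tab''" "nmem s3 ''i'' 0 = i" "nmem s3 ''s'' 0 = k"
      using e2 by (simp_all add: s3_def nmem_den c_sel_def del: den.simps(6))
    have d: "den ?c s' = den (FN ''tab'' (NAdd (N ?Z) (IX ?Z ''i'' (nV ''s''))) (nV ''c'')) s3"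
      by (simp add: s3_def s2_def)
    have idx: "?Z * e + c = ?Z + (?Z * i + k) \<longleftrightarrow> e = Suc i \<and> c = k" if "c < ?Z" for e c
      using idx_eq[OF that k, of e "Suc i"] by (simp add: algebra_simps)
    show "?Q i (Suc k) (den ?c s')"
    proof (intro allI impI)
      fix e c assume H: "e \<le> i \<and> c < ?Z \<or> e = Suc i \<and> c < Suc k"
      then have cZ: "c < ?Z" using k by auto
      show "nmem (den ?c s') ''tab'' (?Z * e + c) = ?t e c"
      proof (cases "e = Suc i \<and> c = k")
        case True
        then show ?thesis unfolding d using c3 e3 by (simp add: algebra_simps)
      next
        case False
        then have "nmem (den ?c s') ''tab'' (?Z * e + c) = nmem s' ''tab'' (?Z * e + c)"
          unfolding d using e3 idx[OF cZ] by auto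
        then show ?thesis using A H False by (auto simp: less_Suc_eq)
      qed
    qed
  next
    show "?Q 0 0 s1" using t1 by simp
    show "\<And>i s'. i < n \<Longrightarrow> ?Q i ?Z s' \<Longrightarrow> ?Q (Suc i) 0 s'" by (auto simp: le_Suc_eq)
  qed (use n1 in \<open>auto simp: c_sel_def nmem_nset_other\<close>)
  then have "?Q n 0 (den (c_tab pr) s)" by (simp add: c_tab_def s1_def)
  then show ?thesis unfolding tab_ok_def by auto
qed

end

section \<open>Backtracking, rounding and ordering by bins\<close>

definition c_back :: "nat \<Rightarrow> fcom" where
  "c_back pr = nS ''cur'' (nV ''s0'') ;; FFor ''i'' (nV ''n'') (
     nS ''e1'' (NSub (nV ''n'') (NAdd (nV ''i'') (N 1))) ;;
     nS ''o'' (NGet ''tab'' (NAdd (N (qsize pr)) (IX (qsize pr) ''e1'' (nV ''cur'')))) ;;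
     FIf (NLess (N 1) (nV ''o''))
       (FN ''asg'' (nV ''e1'') (NSub (nV ''o'') (N 1)) ;;
        nS ''cur'' (NSub (nV ''cur'') (NGet ''inc'' (IX (2 * lvls pr) ''e1'' (NSub (nV ''o'') (N 2))))))
       (FN ''asg'' (nV ''e1'') (N 0)))"

definition c_load :: "nat \<Rightarrow> fcom" where
  "c_load pr = FFor ''j'' (N (lvls pr + 1)) (FR ''L'' (nV ''j'') (ROfNat (N 0))) ;;
     FFor ''i'' (nV ''n'') (FIf (NLess (NGet ''asg'' (nV ''i'')) (N 1))
       (FFor ''j'' (N (lvls pr)) (FR ''L'' (nV ''j'')
          (RAdd (RGet ''L'' (nV ''j'')) (RMul (HX pr ''y'' (nV ''j'')) (HX pr ''h'' (nV ''j''))))) ;;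
        FR ''L'' (N (lvls pr)) (RAdd (RGet ''L'' (N (lvls pr))) (rsum (\<lambda>k. HX pr ''y'' (N k)) (lvls pr)))) FSkip)"

definition c_pick :: "nat \<Rightarrow> fcom" where
  "c_pick pr = rS ''b'' (ROfNat (N 0)) ;; nS ''o'' (N (lvls pr)) ;;
     FFor ''j'' (N (lvls pr)) (
       rS ''t'' (RAdd (RDiv (RAdd (RMul (RMul (ROfNat (N 2)) (RGet ''R'' (nV ''j''))) (HX pr ''h'' (nV ''j'')))
           (RMul (HX pr ''h'' (nV ''j'')) (HX pr ''h'' (nV ''j'')))) (RGet ''L'' (nV ''j'')))
         (RDiv (RMul (TAU pr) (RAdd (RMul (ROfNat (N 2)) (RGet ''R'' (N (lvls pr)))) (ROfNat (N 1)))) (RGet ''L'' (N (lvls pr))))) ;;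
       FIf (RLess (rV ''t'') (rV ''b'')) (rS ''b'' (rV ''t'') ;; nS ''o'' (nV ''j'')) FSkip)"

definition c_item :: "nat \<Rightarrow> fcom" where
  "c_item pr = FFor ''j'' (N (lvls pr)) (FR ''R'' (nV ''j'')
       (RSub (RGet ''R'' (nV ''j'')) (RMul (HX pr ''y'' (nV ''j'')) (HX pr ''h'' (nV ''j''))))) ;;
     FR ''R'' (N (lvls pr)) (RSub (RGet ''R'' (N (lvls pr))) (rsum (\<lambda>k. HX pr ''y'' (N k)) (lvls pr))) ;;
     c_pick pr ;;
     FIf (NLess (nV ''o'') (N (lvls pr)))
       (FR ''R'' (nV ''o'') (RAdd (RGet ''R'' (nV ''o'')) (HX pr ''h'' (nV ''o''))) ;;
        FR ''R'' (N (lvls pr)) (RAdd (RGet ''R'' (N (lvls pr))) (ROfNat (N 1))) ;;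
        FN ''asg'' (nV ''i'') (NAdd (NAdd (nV ''o'') (nV ''o'')) (N 1))) FSkip"

text \<open>\<open>asg\<close> is overwritten in place. An edge is tested before its own choice is
  stored, so the test still sees the assignment of the large edges.\<close>

definition c_greedy :: "nat \<Rightarrow> fcom" where
  "c_greedy pr = FFor ''j'' (N (lvls pr + 1)) (FR ''R'' (nV ''j'') (ROfNat (N 0))) ;;
     FFor ''i'' (nV ''n'') (FIf (NLess (NGet ''asg'' (nV ''i'')) (N 1)) (c_item pr) FSkip)"

text \<open>The two comparisons with \<open>b\<close> and \<open>b + 2\<close> express
  \<open>asg = b + 1\<close>, the stored form of bin \<open>b\<close>.\<close>

definition c_order :: "nat \<Rightarrow> fcom" where
  "c_order pr = nS ''cnt'' (N 0) ;; FFor ''b'' (N (2 * lvls pr)) (FFor ''i'' (nV ''n'')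
     (FIf (BAnd (NLess (nV ''b'') (NGet ''asg'' (nV ''i''))) (NLess (NGet ''asg'' (nV ''i'')) (NAdd (nV ''b'') (N 2))))
       (FN ''ord'' (nV ''cnt'') (nV ''i'') ;; nS ''cnt'' (NAdd (nV ''cnt'') (N 1))) FSkip))"

lemma cur_le: "cur w B n s i \<le> s"
  by (induction i) (auto simp: Let_def intro: le_trans)

context star
begin

lemma c_back:
  assumes n: "nmem s ''n'' 0 = n" and code: "code_ok W P \<Lambda> s" and tab: "tab_ok W P \<Lambda> s"
    and c: "nmem s ''s0'' 0 = c" "c < qsize pr"
  shows "\<forall>e<n. nmem (den (c_back pr) s) ''asg'' e = lrg W P \<Lambda> c e"
proof -
  let ?B = "2 * lvls pr" and ?Z = "qsize pr"
  let ?w = "code W P \<Lambda>"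
  let ?b = "nS ''e1'' (NSub (nV ''n'') (NAdd (nV ''i'') (N 1))) ;;
     nS ''o'' (NGet ''tab'' (NAdd (N (qsize pr)) (IX (qsize pr) ''e1'' (nV ''cur'')))) ;;
     FIf (NLess (N 1) (nV ''o''))
       (FN ''asg'' (nV ''e1'') (NSub (nV ''o'') (N 1)) ;;
        nS ''cur'' (NSub (nV ''cur'') (NGet ''inc'' (IX (2 * lvls pr) ''e1'' (NSub (nV ''o'') (N 2))))))
       (FN ''asg'' (nV ''e1'') (N 0))"
  let ?s = "den (nS ''cur'' (nV ''s0'')) s"
  let ?I = "\<lambda>i (s' :: state). nmem s' ''cur'' 0 = cur ?w ?B n c i \<and> (\<forall>e. n - i \<le> e \<and> e < n \<longrightarrow> nmem s' ''asg'' e = lrg W P \<Lambda> c e)"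
  have "?I n (den (FFor ''i'' (nV ''n'') ?b) ?s)"
  proof (rule den_For[where I = ?I])
    show "nval ?s (nV ''n'') = n" using n by simp
    show "?I 0 (nset ''i'' 0 0 ?s)" using c by simp
    fix i and s' :: state assume i: "i < n" and A: "?I i s'" and ii: "nmem s' ''i'' 0 = i"
      and frn: "\<And>y. y \<noteq> ''i'' \<Longrightarrow> y \<notin> nw ?b \<Longrightarrow> nmem s' y = nmem ?s y"
    define e where "e = n - Suc i"
    have e: "e < n" "n - i = Suc e" "n - Suc e = i" using i by (auto simp: e_def)
    have f: "nmem s' ''n'' 0 = n" "nmem s' ''tab'' = nmem s ''tab''" "nmem s' ''inc'' = nmem s ''inc''"
      using frn n by (simp_all add: nmem_nset_other)
    define d where "d = cur ?w ?B n c i"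
    have dZ: "d < ?Z" using cur_le[of ?w ?B n c i] c(2) by (simp add: d_def)
    define p where "p = tab ?w ?B (Suc e) d"
    have t: "nmem s ''tab'' (?Z + (?Z * e + d)) = p"
      using tab dZ e(1) unfolding tab_ok_def p_def by (metis Suc_leI add.assoc mult_Suc_right)
    have pB: "p \<le> ?B + 1" unfolding p_def by (rule tab_le)
    have inc: "nmem s ''inc'' (?B * e + (p - 2)) = ?w e (p - 2)" if "1 < p"
    proof -
      have "p - 2 < ?B" using that pB by linarith
      with code e(1) show ?thesis unfolding code_ok_def by blast
    qed
    have l: "lrg W P \<Lambda> c e = p - 1" by (simp add: lrg_def lasg_def e(3) p_def d_def)
    have nx: "cur ?w ?B n c (Suc i) = (if 1 < p then d - ?w e (p - 2) else d)"
      by (simp add: Let_def p_def d_def e(2) e_def[symmetric])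
    have cd: "nmem s' ''cur'' 0 = d" using A by (simp add: d_def)
    have es: "n - Suc i = e" by (simp add: e_def)
    have D: "nmem (den ?b s') ''cur'' 0 = cur ?w ?B n c (Suc i)"
      "nmem (den ?b s') ''asg'' = (nmem s' ''asg'')(e := p - 1)"
      unfolding nx using f ii cd t inc es by (auto simp: nmem_nset_other nset_def)
    have "nmem (den ?b s') ''asg'' a = lrg W P \<Lambda> c a" if "n - Suc i \<le> a" "a < n" for a
      using that A l e unfolding D(2) es by (cases "a = e") auto
    then show "?I (Suc i) (nset ''i'' 0 (Suc i) (den ?b s'))" using D(1) by (simp del: den.simps)
  qed simp
  then show ?thesis by (simp add: c_back_def)
qed

lemma c_load:
  assumes n: "nmem s ''n'' 0 = n" and lev: "lev_ok W s" and y: "share_ok W P \<Lambda> s"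
    and asg: "\<forall>e<n. nmem s ''asg'' e = lrg W P \<Lambda> c e"
  shows "\<forall>j\<le>lvls pr. rmem (den (c_load pr) s) ''L'' j = load W P \<Lambda> c j"
proof -
  let ?J = "lvls pr"
  define f where "f e j = (if j < ?J then shr W P \<Lambda> e j * sg W e j else (\<Sum>k<?J. shr W P \<Lambda> e k))" for e j
  define S where "S i j = (\<Sum>e\<in>{e. e < i \<and> lrg W P \<Lambda> c e = 0}. f e j)" for i j
  have SS: "S (Suc i) j = S i j + (if lrg W P \<Lambda> c i = 0 then f i j else 0)" for i j
  proof -
    have "{e. e < Suc i \<and> lrg W P \<Lambda> c e = 0} = (if lrg W P \<Lambda> c i = 0 then insert i {e. e < i \<and> lrg W P \<Lambda> c e = 0} else {e. e < i \<and> lrg W P \<Lambda> c e = 0})"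
      by (auto simp: less_Suc_eq)
    then show ?thesis by (simp add: S_def)
  qed
  define s1 where "s1 = den (FFor ''j'' (N (?J + 1)) (FR ''L'' (nV ''j'') (ROfNat (N 0)))) s"
  have "\<forall>j<?J + 1. rmem s1 ''L'' j = 0" unfolding s1_def
    by (rule den_For[where I = "\<lambda>k (s :: state). \<forall>j<k. rmem s ''L'' j = 0"]) (auto simp: less_Suc_eq)
  then have L1: "\<forall>j\<le>?J. rmem s1 ''L'' j = S 0 j" by (simp add: S_def)
  have f1: "nmem s1 ''n'' 0 = n" "nmem s1 ''asg'' = nmem s ''asg''" "rmem s1 ''y'' = rmem s ''y''" "rmem s1 ''h'' = rmem s ''h''"
    using n by (simp_all add: s1_def nmem_den rmem_den del: den.simps)
  let ?c = "FR ''L'' (nV ''j'') (RAdd (RGet ''L'' (nV ''j'')) (RMul (HX pr ''y'' (nV ''j'')) (HX pr ''h'' (nV ''j''))))"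
  let ?c2 = "FFor ''j'' (N ?J) ?c ;;
        FR ''L'' (N ?J) (RAdd (RGet ''L'' (N ?J)) (rsum (\<lambda>k. HX pr ''y'' (N k)) ?J))"
  let ?b = "FIf (NLess (NGet ''asg'' (nV ''i'')) (N 1)) ?c2 FSkip"
  let ?I = "\<lambda>i (s' :: state). \<forall>j\<le>?J. rmem s' ''L'' j = S i j"
  have "?I n (den (FFor ''i'' (nV ''n'') ?b) s1)"
  proof (rule den_For[where I = ?I])
    show "nval s1 (nV ''n'') = n" using f1 by simp
    show "?I 0 (nset ''i'' 0 0 s1)" using L1 by simp
    fix i and s' :: state assume i: "i < n" and A: "?I i s'" and ii: "nmem s' ''i'' 0 = i"
      and frn: "\<And>y. y \<noteq> ''i'' \<Longrightarrow> y \<notin> nw ?b \<Longrightarrow> nmem s' y = nmem s1 y"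
      and frr: "\<And>y. y \<notin> rw ?b \<Longrightarrow> rmem s' y = rmem s1 y"
    have f: "nmem s' ''asg'' = nmem s ''asg''" "rmem s' ''y'' = rmem s ''y''" "rmem s' ''h'' = rmem s ''h''"
      using frn frr f1 by simp_all
    have yh: "rmem s ''y'' (?J * i + j) = shr W P \<Lambda> i j" "rmem s ''h'' (?J * i + j) = sg W i j" if "j < ?J" for j
      using lev y i that by (auto simp: lev_ok_def share_ok_def)
    show "?I (Suc i) (nset ''i'' 0 (Suc i) (den ?b s'))"
    proof (cases "lrg W P \<Lambda> c i = 0")
      case False
      then show ?thesis using A asg f ii i by (simp add: SS del: den.simps(6))
    next
      case True
      define s2 where "s2 = den (FFor ''j'' (N ?J) ?c) s'"
      have L2: "\<forall>j\<le>?J. rmem s2 ''L'' j = S i j + (if j < ?J then f i j else 0)" unfolding s2_def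
      proof (rule den_For[where I = "\<lambda>k (s :: state). \<forall>j\<le>?J. rmem s ''L'' j = S i j + (if j < k then f i j else 0)"])
        fix k and s3 :: state assume k: "k < ?J" and B: "\<forall>j\<le>?J. rmem s3 ''L'' j = S i j + (if j < k then f i j else 0)"
          and kk: "nmem s3 ''j'' 0 = k"
          and frn2: "\<And>y. y \<noteq> ''j'' \<Longrightarrow> y \<notin> nw ?c \<Longrightarrow> nmem s3 y = nmem s' y"
          and frr2: "\<And>y. y \<notin> rw ?c \<Longrightarrow> rmem s3 y = rmem s' y"
        have "rmem s3 ''y'' = rmem s ''y''" "rmem s3 ''h'' = rmem s ''h''" "nmem s3 ''i'' 0 = i"
          using frn2 frr2 f ii by simp_all
        then show "\<forall>j\<le>?J. rmem (nset ''j'' 0 (Suc k) (den ?c s3)) ''L'' j = S i j + (if j < Suc k then f i j else 0)"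
          using B kk k yh[OF k] by (auto simp: f_def)
      qed (use A in auto)
      have f2: "rmem s2 ''y'' = rmem s ''y''" "nmem s2 ''i'' 0 = i"
        using f ii by (simp_all add: s2_def nmem_den rmem_den del: den.simps(6))
      have "den ?b s' = den (FR ''L'' (N ?J) (RAdd (RGet ''L'' (N ?J)) (rsum (\<lambda>k. HX pr ''y'' (N k)) ?J))) s2"
        using True asg f ii i by (simp add: s2_def)
      then show ?thesis using L2 f2 yh True by (auto simp: SS f_def)
    qed
  qed auto
  then have "\<forall>j\<le>?J. rmem (den (c_load pr) s) ''L'' j = S n j" by (simp add: c_load_def s1_def)
  then show ?thesis by (simp add: S_def f_def load_def)
qed

lemma c_item:
  assumes i: "nmem s ''i'' 0 = i" "i < n" and lev: "lev_ok W s" and y: "share_ok W P \<Lambda> s"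
    and L: "\<forall>j\<le>lvls pr. rmem s ''L'' j = L j"
    and R: "\<forall>j\<le>lvls pr. rmem s ''R'' j = R j"
  defines "p \<equiv> rpick (lvls pr) (shr W P \<Lambda>) (sg W) (tau pr) L R i"
  shows "\<forall>j\<le>lvls pr. rmem (den (c_item pr) s) ''R'' j =
      radd (lvls pr) (sg W) (rsub (lvls pr) (shr W P \<Lambda>) (sg W) R i) i p j"
    and "nmem (den (c_item pr) s) ''asg'' = (if p < lvls pr then (nmem s ''asg'')(i := 2 * p + 1) else nmem s ''asg'')"
proof -
  let ?J = "lvls pr"
  define R' where "R' = rsub ?J (shr W P \<Lambda>) (sg W) R i"
  define v where "v = rgain ?J (sg W) (tau pr) L R' i"
  have p: "p = snd (scan ?J v ?J)" by (simp add: p_def rpick_def v_def R'_def)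
  have yh: "rmem s ''y'' (?J * i + j) = shr W P \<Lambda> i j" "rmem s ''h'' (?J * i + j) = sg W i j" if "j < ?J" for j
    using lev y i that by (auto simp: lev_ok_def share_ok_def)
  let ?c = "FR ''R'' (nV ''j'') (RSub (RGet ''R'' (nV ''j'')) (RMul (HX pr ''y'' (nV ''j'')) (HX pr ''h'' (nV ''j''))))"
  define s2 where "s2 = den (FFor ''j'' (N ?J) ?c) s"
  have R2: "\<forall>j\<le>?J. rmem s2 ''R'' j = (if j < ?J then R' j else R j)" unfolding s2_def
  proof (rule den_For[where I = "\<lambda>k (s :: state). \<forall>j\<le>?J. rmem s ''R'' j = (if j < k then R' j else R j)"])
    fix k and s3 :: state assume k: "k < ?J" and B: "\<forall>j\<le>?J. rmem s3 ''R'' j = (if j < k then R' j else R j)"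
      and kk: "nmem s3 ''j'' 0 = k"
      and frn2: "\<And>y. y \<noteq> ''j'' \<Longrightarrow> y \<notin> nw ?c \<Longrightarrow> nmem s3 y = nmem s y"
      and frr2: "\<And>y. y \<notin> rw ?c \<Longrightarrow> rmem s3 y = rmem s y"
    have "rmem s3 ''y'' = rmem s ''y''" "rmem s3 ''h'' = rmem s ''h''" "nmem s3 ''i'' 0 = i"
      using frn2 frr2 i by simp_all
    then show "\<forall>j\<le>?J. rmem (nset ''j'' 0 (Suc k) (den ?c s3)) ''R'' j = (if j < Suc k then R' j else R j)"
      using B kk k yh[OF k] by (auto simp: R'_def rsub_def)
  qed (use R in auto)
  have f2: "rmem s2 ''y'' = rmem s ''y''" "rmem s2 ''h'' = rmem s ''h''" "rmem s2 ''L'' = rmem s ''L''"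
    "nmem s2 ''i'' 0 = i" "nmem s2 ''asg'' = nmem s ''asg''"
    using i by (simp_all add: s2_def nmem_den rmem_den del: den.simps(6))
  define s3 where "s3 = den (FR ''R'' (N ?J) (RSub (RGet ''R'' (N ?J)) (rsum (\<lambda>k. HX pr ''y'' (N k)) ?J)) ;;
     rS ''b'' (ROfNat (N 0)) ;; nS ''o'' (N ?J)) s2"
  have R3: "\<forall>j\<le>?J. rmem s3 ''R'' j = R' j"
    using R2 f2 yh by (auto simp: s3_def R'_def rsub_def)
  have f3: "rmem s3 ''h'' = rmem s ''h''" "rmem s3 ''L'' = rmem s ''L''"
    "nmem s3 ''i'' 0 = i" "nmem s3 ''asg'' = nmem s ''asg''" "nmem s3 ''o'' 0 = ?J" "rmem s3 ''b'' 0 = 0"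
    using f2 by (simp_all add: s3_def nmem_nset_other rmem_rset_other)
  let ?d = "rS ''t'' (RAdd (RDiv (RAdd (RMul (RMul (ROfNat (N 2)) (RGet ''R'' (nV ''j''))) (HX pr ''h'' (nV ''j'')))
           (RMul (HX pr ''h'' (nV ''j'')) (HX pr ''h'' (nV ''j'')))) (RGet ''L'' (nV ''j'')))
         (RDiv (RMul (TAU pr) (RAdd (RMul (ROfNat (N 2)) (RGet ''R'' (N (lvls pr)))) (ROfNat (N 1)))) (RGet ''L'' (N (lvls pr))))) ;;
       FIf (RLess (rV ''t'') (rV ''b'')) (rS ''b'' (rV ''t'') ;; nS ''o'' (nV ''j'')) FSkip"
  define s4 where "s4 = den (FFor ''j'' (N ?J) ?d) s3"
  have s4: "rmem s4 ''b'' 0 = fst (scan ?J v ?J) \<and> nmem s4 ''o'' 0 = snd (scan ?J v ?J)"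
    unfolding s4_def
  proof (rule den_For[where I = "\<lambda>k (s :: state). rmem s ''b'' 0 = fst (scan ?J v k) \<and> nmem s ''o'' 0 = snd (scan ?J v k)"])
    fix k and s5 :: state assume k: "k < ?J" and B: "rmem s5 ''b'' 0 = fst (scan ?J v k) \<and> nmem s5 ''o'' 0 = snd (scan ?J v k)"
      and kk: "nmem s5 ''j'' 0 = k"
      and frn2: "\<And>y. y \<noteq> ''j'' \<Longrightarrow> y \<notin> nw ?d \<Longrightarrow> nmem s5 y = nmem s3 y"
      and frr2: "\<And>y. y \<notin> rw ?d \<Longrightarrow> rmem s5 y = rmem s3 y"
    have f: "rmem s5 ''h'' = rmem s ''h''" "rmem s5 ''L'' = rmem s ''L''" "rmem s5 ''R'' = rmem s3 ''R''" "nmem s5 ''i'' 0 = i"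
      using frn2 frr2 f3 by simp_all
    have "v k = (2 * R' k * sg W i k + sg W i k * sg W i k) / L k + tau pr * (2 * R' ?J + 1) / L ?J"
      by (simp add: v_def rgain_def)
    then show "rmem (nset ''j'' 0 (Suc k) (den ?d s5)) ''b'' 0 = fst (scan ?J v (Suc k)) \<and>
        nmem (nset ''j'' 0 (Suc k) (den ?d s5)) ''o'' 0 = snd (scan ?J v (Suc k))"
      using B kk k yh[OF k] R3 L f by simp
  qed (use f3 in simp_all)
  have f4: "rmem s4 ''h'' = rmem s ''h''" "rmem s4 ''R'' = rmem s3 ''R''" "nmem s4 ''i'' 0 = i" "nmem s4 ''asg'' = nmem s ''asg''"
    using f3 by (simp_all add: s4_def nmem_den rmem_den del: den.simps(6))
  have o: "nmem s4 ''o'' 0 = p" using s4 p by simp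
  have d: "den (c_item pr) s = den (FIf (NLess (nV ''o'') (N ?J))
       (FR ''R'' (nV ''o'') (RAdd (RGet ''R'' (nV ''o'')) (HX pr ''h'' (nV ''o''))) ;;
        FR ''R'' (N ?J) (RAdd (RGet ''R'' (N ?J)) (ROfNat (N 1))) ;;
        FN ''asg'' (nV ''i'') (NAdd (NAdd (nV ''o'') (nV ''o'')) (N 1))) FSkip) s4"
    by (simp add: c_item_def c_pick_def s4_def s3_def s2_def)
  show "\<forall>j\<le>?J. rmem (den (c_item pr) s) ''R'' j = radd ?J (sg W) (rsub ?J (shr W P \<Lambda>) (sg W) R i) i p j"
    unfolding d R'_def[symmetric] using R3 f4 o yh by (auto simp: radd_def)
  show "nmem (den (c_item pr) s) ''asg'' = (if p < ?J then (nmem s ''asg'')(i := 2 * p + 1) else nmem s ''asg'')"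
    unfolding d using f4 o by (auto simp: nset_def rset_def)
qed

lemma nw_c_item: "nw (c_item pr) = {''j'', ''o'', ''asg''}" "rw (c_item pr) = {''R'', ''b'', ''t''}"
  by (auto simp: c_item_def c_pick_def)

lemma c_greedy:
  assumes n: "nmem s ''n'' 0 = n" and lev: "lev_ok W s" and y: "share_ok W P \<Lambda> s"
    and as: "\<forall>e<n. nmem s ''asg'' e = lrg W P \<Lambda> c e"
    and L: "\<forall>j\<le>lvls pr. rmem s ''L'' j = load W P \<Lambda> c j"
  shows "\<forall>e<n. nmem (den (c_greedy pr) s) ''asg'' e = asg W P \<Lambda> c e"
proof -
  let ?J = "lvls pr"
  define F where "F e \<longleftrightarrow> lrg W P \<Lambda> c e = 0" for e
  define R where "R = rres ?J (shr W P \<Lambda>) (sg W) (tau pr) (load W P \<Lambda> c) F"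
  define s1 where "s1 = den (FFor ''j'' (N (?J + 1)) (FR ''R'' (nV ''j'') (ROfNat (N 0)))) s"
  have "\<forall>j<?J + 1. rmem s1 ''R'' j = 0" unfolding s1_def
    by (rule den_For[where I = "\<lambda>k (s :: state). \<forall>j<k. rmem s ''R'' j = 0"]) (auto simp: less_Suc_eq)
  then have R1: "\<forall>j\<le>?J. rmem s1 ''R'' j = R 0 j" by (simp add: R_def)
  have f1: "nmem s1 ''n'' 0 = n" "nmem s1 ''asg'' = nmem s ''asg''" "rmem s1 ''y'' = rmem s ''y''" "rmem s1 ''h'' = rmem s ''h''"
    "rmem s1 ''g'' = rmem s ''g''" "rmem s1 ''L'' = rmem s ''L''"
    using n by (simp_all add: s1_def nmem_den rmem_den del: den.simps)
  let ?b = "FIf (NLess (NGet ''asg'' (nV ''i'')) (N 1)) (c_item pr) FSkip"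
  let ?I = "\<lambda>i (s' :: state). (\<forall>j\<le>?J. rmem s' ''R'' j = R i j) \<and>
     (\<forall>e<n. nmem s' ''asg'' e = (if e < i then asg W P \<Lambda> c e else lrg W P \<Lambda> c e))"
  have "?I n (den (FFor ''i'' (nV ''n'') ?b) s1)"
  proof (rule den_For[where I = ?I])
    show "nval s1 (nV ''n'') = n" using f1 by simp
    show "?I 0 (nset ''i'' 0 0 s1)" using R1 as f1 by simp
    fix i and s' :: state assume i: "i < n" and A: "?I i s'" and ii: "nmem s' ''i'' 0 = i"
      and frn: "\<And>y. y \<noteq> ''i'' \<Longrightarrow> y \<notin> nw ?b \<Longrightarrow> nmem s' y = nmem s1 y"
      and frr: "\<And>y. y \<notin> rw ?b \<Longrightarrow> rmem s' y = rmem s1 y"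
    have f: "rmem s' ''y'' = rmem s ''y''" "rmem s' ''h'' = rmem s ''h''" "rmem s' ''g'' = rmem s ''g''" "rmem s' ''L'' = rmem s ''L''"
      using frr f1 by (simp_all add: nw_c_item)
    have ok: "lev_ok W s'" "share_ok W P \<Lambda> s'" using lev y f by (simp_all add: lev_ok_def share_ok_def)
    have ai: "nmem s' ''asg'' i = lrg W P \<Lambda> c i" using A i by simp
    show "?I (Suc i) (nset ''i'' 0 (Suc i) (den ?b s'))"
    proof (cases "lrg W P \<Lambda> c i = 0")
      case False
      then have "den ?b s' = s'" using ai ii by simp
      moreover have "asg W P \<Lambda> c i = lrg W P \<Lambda> c i" using False by (simp add: asg_def)
      moreover have "R (Suc i) = R i" using False by (simp add: R_def F_def)
      ultimately show ?thesis using A by (auto simp: less_Suc_eq simp del: den.simps)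
    next
      case True
      define p where "p = rpick ?J (shr W P \<Lambda>) (sg W) (tau pr) (load W P \<Lambda> c) (R i) i"
      have sch: "sch W P \<Lambda> c i = p" by (simp add: sch_def rchoice_def p_def R_def F_def[abs_def])
      have ag: "asg W P \<Lambda> c i = (if p < ?J then 2 * p + 1 else 0)" using True by (simp add: asg_def sch)
      have RS: "R (Suc i) = radd ?J (sg W) (rsub ?J (shr W P \<Lambda>) (sg W) (R i) i) i p"
        using True by (simp add: R_def F_def p_def)
      have "den ?b s' = den (c_item pr) s'" using ai ii True by simp
      moreover note c_item[where s = s' and i = i and L = "load W P \<Lambda> c" and R = "R i", OF ii i ok, folded p_def, folded RS]
      ultimately show ?thesis using A L f ag True by (auto simp: less_Suc_eq simp del: den.simps)
    qed
  qed (simp_all add: nw_c_item)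
  then show ?thesis by (simp add: c_greedy_def s1_def)
qed

lemma c_order:
  assumes n: "nmem s ''n'' 0 = n" and z: "\<forall>e<n. nmem s ''asg'' e = z e"
  defines "s' \<equiv> den (c_order pr) s"
  shows "map (nmem s' ''ord'') [0..<nmem s' ''cnt'' 0] = bin_order n (2 * lvls pr) z"
proof -
  let ?s = "den (nS ''cnt'' (N 0)) s"
  let ?c = "FIf (BAnd (NLess (nV ''b'') (NGet ''asg'' (nV ''i''))) (NLess (NGet ''asg'' (nV ''i'')) (NAdd (nV ''b'') (N 2))))
       (FN ''ord'' (nV ''cnt'') (nV ''i'') ;; nS ''cnt'' (NAdd (nV ''cnt'') (N 1))) FSkip"
  let ?Q = "\<lambda>b i (s' :: state). map (nmem s' ''ord'') [0..<nmem s' ''cnt'' 0] = bin_order n b z @ filter (\<lambda>e. z e = Suc b) [0..<i]"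
  have "?Q (2 * lvls pr) 0 (den (FFor ''b'' (N (2 * lvls pr)) (FFor ''i'' (nV ''n'') ?c)) ?s)"
  proof (rule den_For2[where Q = ?Q])
    fix b i and s' :: state assume i: "i < n" and A: "?Q b i s'" and bb: "nmem s' ''b'' 0 = b" and ii: "nmem s' ''i'' 0 = i"
      and frn: "\<And>z. z \<noteq> ''b'' \<Longrightarrow> z \<noteq> ''i'' \<Longrightarrow> z \<notin> nw ?c \<Longrightarrow> nmem s' z = nmem ?s z"
    have a: "nmem s' ''asg'' i = z i" using frn z i by (simp add: nmem_nset_other)
    have upd: "map (f(k := v)) [0..<Suc k] = map f [0..<k] @ [v]" for f :: "nat \<Rightarrow> nat" and k v by simp
    show "?Q b (Suc i) (den ?c s')"
    proof (cases "z i = Suc b")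
      case True
      have "nmem (den ?c s') ''ord'' = (nmem s' ''ord'')(nmem s' ''cnt'' 0 := i)" "nmem (den ?c s') ''cnt'' 0 = Suc (nmem s' ''cnt'' 0)"
        using True a bb ii by (auto simp: nset_def)
      then show ?thesis using A True by (simp only: upd) simp
    next
      case False
      then have "den ?c s' = s'" using a bb ii by auto
      then show ?thesis using A False by (simp del: den.simps)
    qed
  next
    show "\<And>b s'. b < 2 * lvls pr \<Longrightarrow> ?Q b n s' \<Longrightarrow> ?Q (Suc b) 0 s'" by (simp add: bin_order_def)
    show "?Q 0 0 ?s" by (simp add: bin_order_def)
  qed (use n in \<open>auto simp: nmem_nset_other\<close>)
  then show ?thesis by (simp add: s'_def c_order_def)
qed

end

section \<open>Selecting queries and actions for a fixed order\<close>

definition FX :: "nexp \<Rightarrow> nexp \<Rightarrow> nexp" where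
  "FX t k = NAdd (NGet ''rl'' t) k"

lemma nval_FX [simp]: "nval s (FX t k) = nmem s ''rl'' (nval s t) + nval s k"
  by (simp add: FX_def)

text \<open>The entry for the first \<open>i + 1\<close> edges of \<open>ord\<close> and at most
  \<open>kk + 1\<close> queries. \<open>act\<close> is 0 if the new edge is skipped and otherwise
  the action plus one. The new edge is queried before the earlier ones of \<open>ord\<close>, so the
  earlier entry \<open>f\<close> is its continuation value.\<close>

definition c_cell :: fcom where
  "c_cell = rS ''f'' (RGet ''F'' (FX (nV ''i'') (nV ''kk''))) ;;
     rS ''u'' (RGet ''F'' (FX (nV ''i'') (NAdd (nV ''kk'') (N 1)))) ;; nS ''c'' (N 0) ;;
     FFor ''a1'' (nV ''m'') (
       rS ''t'' (RAdd (rV ''f'') (RMul (RQ ''q'' ''o'' ''a1'') (RSub (RQ ''r'' ''o'' ''a1'') (rV ''f'')))) ;;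
       FIf (RLess (rV ''u'') (rV ''t'')) (rS ''u'' (rV ''t'') ;; nS ''c'' (NAdd (nV ''a1'') (N 1))) FSkip) ;;
     FR ''F'' (FX (NAdd (nV ''i'') (N 1)) (NAdd (nV ''kk'') (N 1))) (rV ''u'') ;;
     FN ''act'' (FX (NAdd (nV ''i'') (N 1)) (NAdd (nV ''kk'') (N 1))) (nV ''c'')"

definition c_row :: fcom where
  "c_row = nS ''o'' (NGet ''ord'' (nV ''i'')) ;;
     FR ''F'' (FX (NAdd (nV ''i'') (N 1)) (N 0)) (ROfNat (N 0)) ;; FFor ''kk'' (nV ''l'') c_cell"

definition c_dp :: fcom where
  "c_dp = FR ''F'' (N 0) (ROfNat (N 0)) ;; FFor ''kk'' (nV ''l'') (FR ''F'' (NAdd (nV ''kk'') (N 1)) (ROfNat (N 0))) ;;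
     FFor ''i'' (nV ''n'') (FIf (NLess (nV ''i'') (nV ''cnt'')) c_row FSkip)"

text \<open>Backtracking goes from the last edge of \<open>ord\<close> to the first, which is the
  query order, so the output policy is written front to back.\<close>

definition c_step :: fcom where
  "c_step = nS ''z'' (NSub (nV ''cnt'') (NAdd (nV ''i'') (N 1))) ;;
     nS ''c'' (NGet ''act'' (FX (NAdd (nV ''z'') (N 1)) (nV ''kr''))) ;;
     FIf (BAnd (NLess (N 0) (nV ''kr'')) (NLess (N 0) (nV ''c'')))
       (FN ''e'' (nV ''k'') (NGet ''ord'' (nV ''z'')) ;; FN ''a'' (nV ''k'') (NSub (nV ''c'') (N 1)) ;;
        nS ''k'' (NAdd (nV ''k'') (N 1)) ;; nS ''kr'' (NSub (nV ''kr'') (N 1))) FSkip"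

definition c_out :: fcom where
  "c_out = FIf (RLess (rV ''best'') (RGet ''F'' (FX (nV ''cnt'') (nV ''l''))))
     (rS ''best'' (RGet ''F'' (FX (nV ''cnt'') (nV ''l''))) ;; nS ''k'' (N 0) ;; nS ''kr'' (nV ''l'') ;;
      FFor ''i'' (nV ''n'') (FIf (NLess (nV ''i'') (nV ''cnt'')) c_step FSkip)) FSkip"

definition c_cand :: "nat \<Rightarrow> fcom" where
  "c_cand pr = c_back pr ;; c_load pr ;; c_greedy pr ;; c_order pr ;; c_dp ;; c_out"

context star
begin

text \<open>The value of a policy whose continuation after the last query is worth \<open>v\<close>.
  During backtracking \<open>v\<close> is the table entry still to be unfolded, which makes the
  value an invariant.\<close>

definition ext_val :: "nat list \<Rightarrow> nat list \<Rightarrow> real \<Rightarrow> real" where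
  "ext_val es as v = foldr (\<lambda>(e, a) v. r e a * q e a + (1 - q e a) * v) (zip es as) v"

lemma ext_val_snoc: "length as = length es \<Longrightarrow> ext_val (es @ [e]) (as @ [a]) v = ext_val es as (r e a * q e a + (1 - q e a) * v)"
  by (simp add: ext_val_def)

lemma policy_val_ext: "length as = length es \<Longrightarrow> policy_val r q (es, as) = ext_val es as 0"
  by (induction as es rule: list_induct2) (simp_all add: ext_val_def policy_val_Cons)

definition cellix :: "nat \<Rightarrow> nat \<Rightarrow> nat" where
  "cellix t k = t * (n + 1) + k"

lemma cellix_inj: "k \<le> l \<Longrightarrow> k' \<le> l \<Longrightarrow> cellix t k = cellix t' k' \<longleftrightarrow> t = t' \<and> k = k'"
  using idx_eq[of k "n + 1" k' t t'] l_le by (simp add: cellix_def mult.commute)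

lemma inp_rl: "inp s \<Longrightarrow> t \<le> n \<Longrightarrow> nmem s ''rl'' t + k = cellix t k"
  by (simp add: inp_def cellix_def)

lemma opt_0 [simp]: "opt r q m xs 0 = 0"
  by (cases xs) auto

definition out_ok :: "state \<Rightarrow> bool" where
  "out_ok s \<longleftrightarrow> output_policy s \<in> policies {..<n} {..<m} l \<and> policy_val r q (output_policy s) = rmem s ''best'' 0"

definition dp_ok :: "nat list \<Rightarrow> state \<Rightarrow> bool" where
  "dp_ok od s \<longleftrightarrow> (\<forall>t\<le>length od. \<forall>k\<le>l. rmem s ''F'' (cellix t k) = opt r q m (rev (take t od)) k) \<and>
     (\<forall>t<length od. \<forall>k<l. let c = nmem s ''act'' (cellix (Suc t) (Suc k)); v = opt r q m (rev (take t od)) k;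
          v' = opt r q m (rev (take (Suc t) od)) (Suc k) in
        c = 0 \<and> v' = opt r q m (rev (take t od)) (Suc k) \<or>
        0 < c \<and> c \<le> m \<and> v' = v + q (od ! t) (c - 1) * (r (od ! t) (c - 1) - v))"

lemma c_dp:
  assumes inp: "inp s" and ord: "map (nmem s ''ord'') [0..<nmem s ''cnt'' 0] = od"
    and od: "set od \<subseteq> {..<n}" "length od \<le> n"
  shows "dp_ok od (den c_dp s)"
proof -
  define V where "V t k = opt r q m (rev (take t od)) k" for t k
  have V0: "V 0 k = 0" "V t 0 = 0" for t k
    by (simp_all add: V_def)
  have cnt: "nmem s ''cnt'' 0 = length od" using ord by (metis length_map length_upt diff_zero)
  have ordt: "nmem s ''ord'' t = od ! t" if "t < length od" for t
    using that ord cnt by (metis add_0 nth_map_upt diff_zero)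
  have VS: "V (Suc t) (Suc k) = max (V t (Suc k)) (V t k + gain r q m (od ! t) (V t k))" if "t < length od" for t k
    using that by (simp add: V_def take_Suc_conv_app_nth)
  have Vm: "V t k \<le> V t (Suc k)" for t k unfolding V_def
  proof (rule opt_Suc)
    show "set (rev (take t od)) \<subseteq> {..<n}" using od(1) set_take_subset[of t od] by auto
  qed
  define A where "A t k c \<longleftrightarrow> c = 0 \<and> V (Suc t) (Suc k) = V t (Suc k) \<or>
        0 < c \<and> c \<le> m \<and> V (Suc t) (Suc k) = V t k + q (od ! t) (c - 1) * (r (od ! t) (c - 1) - V t k)" for t k c
  let ?z = "FR ''F'' (NAdd (nV ''kk'') (N 1)) (ROfNat (N 0))"
  define s1 where "s1 = den (FR ''F'' (N 0) (ROfNat (N 0)) ;; FFor ''kk'' (nV ''l'') ?z) s"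
  have F1: "\<forall>k\<le>l. rmem s1 ''F'' (cellix 0 k) = 0" unfolding s1_def den.simps(4) cellix_def mult_0 add_0
    by (rule den_For[where I = "\<lambda>k (s :: state). \<forall>j\<le>k. rmem s ''F'' j = 0"])
      (use inp in \<open>auto simp: inp_def le_Suc_eq\<close>)
  have inp1: "inp s1" unfolding s1_def using inp by (simp add: inp_den del: den.simps)
  have f1: "nmem s1 ''cnt'' 0 = length od" "nmem s1 ''ord'' = nmem s ''ord''"
    using cnt by (simp_all add: s1_def nmem_den del: den.simps)
  let ?b = "FIf (NLess (nV ''i'') (nV ''cnt'')) c_row FSkip"
  let ?P = "\<lambda>t (s' :: state). (\<forall>t'\<le>t. \<forall>k\<le>l. rmem s' ''F'' (cellix t' k) = V t' k) \<and>
     (\<forall>t'<t. \<forall>k<l. A t' k (nmem s' ''act'' (cellix (Suc t') (Suc k))))"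
  let ?I = "\<lambda>i (s' :: state). ?P (min i (length od)) s'"
  have "?I n (den (FFor ''i'' (nV ''n'') ?b) s1)"
  proof (rule den_For[where I = ?I])
    show "nval s1 (nV ''n'') = n" using inp1 by (simp add: inp_def)
    show "?I 0 (nset ''i'' 0 0 s1)" using F1 by (simp add: V0)
    fix i and s' :: state assume i: "i < n" and A1: "?I i s'" and ii: "nmem s' ''i'' 0 = i"
      and frn: "\<And>y. y \<noteq> ''i'' \<Longrightarrow> y \<notin> nw ?b \<Longrightarrow> nmem s' y = nmem s1 y"
      and frr: "\<And>y. y \<notin> rw ?b \<Longrightarrow> rmem s' y = rmem s1 y"
    have inp2: "inp s'" using inp1 by (subst inp_cong[of s' s1]) (auto simp: frn frr c_row_def c_cell_def)
    have f2: "nmem s' ''cnt'' 0 = length od" "nmem s' ''ord'' = nmem s ''ord''"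
      using frn f1 by (simp_all add: c_row_def c_cell_def)
    show "?I (Suc i) (nset ''i'' 0 (Suc i) (den ?b s'))"
    proof (cases "i < length od")
      case False
      then have "den ?b s' = s'" "min (Suc i) (length od) = min i (length od)" using f2 ii by auto
      then show ?thesis using A1 by (simp del: den.simps)
    next
      case True
      have e: "od ! i < n" using True od(1) nth_mem by blast
      define s2 where "s2 = den (nS ''o'' (NGet ''ord'' (nV ''i'')) ;;
        FR ''F'' (FX (NAdd (nV ''i'') (N 1)) (N 0)) (ROfNat (N 0))) s'"
      have rl: "nmem s' ''rl'' (Suc i) = cellix (Suc i) 0" using inp_rl[OF inp2, of "Suc i" 0] i by simp
      have o2: "nmem s2 ''o'' 0 = od ! i" "nmem s2 ''i'' 0 = i" using True ii f2 ordt by (auto simp: s2_def)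
      have inp3: "inp s2" unfolding s2_def using inp2 by (simp add: inp_den del: den.simps)
      have act2: "nmem s2 ''act'' = nmem s' ''act''" by (simp add: s2_def nmem_nset_other)
      let ?K = "\<lambda>k (s' :: state). ?P i s' \<and> (\<forall>k'\<le>k. rmem s' ''F'' (cellix (Suc i) k') = V (Suc i) k') \<and>
          (\<forall>k'<k. A i k' (nmem s' ''act'' (cellix (Suc i) (Suc k'))))"
      have "?K l (den (FFor ''kk'' (nV ''l'') c_cell) s2)"
      proof (rule den_For[where I = ?K])
        show "nval s2 (nV ''l'') = l" using inp3 by (simp add: inp_def)
        have "rmem s2 ''F'' (cellix t' k) = (if t' = Suc i \<and> k = 0 then 0 else rmem s' ''F'' (cellix t' k))" if "k \<le> l" for t' k
          unfolding s2_def using ii rl cellix_inj[of k 0 t' "Suc i"] that by auto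
        then show "?K 0 (nset ''kk'' 0 0 s2)" using A1 True act2 by (simp add: V0)
        fix k and s3 :: state assume k: "k < l" and B: "?K k s3" and kk: "nmem s3 ''kk'' 0 = k"
          and frn3: "\<And>y. y \<noteq> ''kk'' \<Longrightarrow> y \<notin> nw c_cell \<Longrightarrow> nmem s3 y = nmem s2 y"
          and frr3: "\<And>y. y \<notin> rw c_cell \<Longrightarrow> rmem s3 y = rmem s2 y"
        have inp4: "inp s3" using inp3 by (subst inp_cong[of s3 s2]) (auto simp: frn3 frr3 c_cell_def)
        have o3: "nmem s3 ''o'' 0 = od ! i" "nmem s3 ''i'' 0 = i" using frn3 o2 by (simp_all add: c_cell_def)
        define v where "v = V i k"
        define s4 where "s4 = den (rS ''f'' (RGet ''F'' (FX (nV ''i'') (nV ''kk''))) ;;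
          rS ''u'' (RGet ''F'' (FX (nV ''i'') (NAdd (nV ''kk'') (N 1)))) ;; nS ''c'' (N 0)) s3"
        have rl3: "nmem s3 ''rl'' i + x = cellix i x" "nmem s3 ''rl'' (Suc i) + x = cellix (Suc i) x" for x
          using inp_rl[OF inp4] i by simp_all
        have BF: "rmem s3 ''F'' (cellix i k) = v" "rmem s3 ''F'' (cellix i (Suc k)) = V i (Suc k)"
          using B k unfolding v_def by auto
        have f4: "rmem s4 ''f'' 0 = v" "rmem s4 ''u'' 0 = V i (Suc k)" "nmem s4 ''c'' 0 = 0"
          "nmem s4 ''o'' 0 = od ! i" "nmem s4 ''i'' 0 = i" "nmem s4 ''kk'' 0 = k" "rmem s4 ''F'' = rmem s3 ''F''" "nmem s4 ''act'' = nmem s3 ''act''"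
          using BF kk o3 rl3(1)[of k] rl3(1)[of "Suc k"] by (auto simp: s4_def nmem_nset_other rmem_rset_other)
        have inp5: "inp s4" unfolding s4_def using inp4 by (simp add: inp_den del: den.simps)
        let ?d = "rS ''t'' (RAdd (rV ''f'') (RMul (RQ ''q'' ''o'' ''a1'') (RSub (RQ ''r'' ''o'' ''a1'') (rV ''f'')))) ;;
       FIf (RLess (rV ''u'') (rV ''t'')) (rS ''u'' (rV ''t'') ;; nS ''c'' (NAdd (nV ''a1'') (N 1))) FSkip"
        define s5 where "s5 = den (FFor ''a1'' (nV ''m'') ?d) s4"
        let ?M = "\<lambda>a. max (V i (Suc k)) (v + gain r q a (od ! i) v)"
        define Ok where "Ok a u c \<longleftrightarrow> u = ?M a \<and> (c = 0 \<and> u = V i (Suc k) \<or>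
            0 < c \<and> c \<le> a \<and> u = v + q (od ! i) (c - 1) * (r (od ! i) (c - 1) - v))" for a u and c :: nat
        \<comment> \<open>The loop over the actions starts from skipping the edge. By
          \<open>Vm\<close> this is worth at least \<open>v\<close>, the value for gain 0, so only
          actions that are actually chosen have to be recorded.\<close>
        have Ok0: "Ok 0 (V i (Suc k)) 0" using Vm[of i k] by (simp add: Ok_def v_def max_def gain_def)
        have OkS: "Ok (Suc a) (if u < x then x else u) (if u < x then Suc a else c)"
          if "Ok a u c" "x = v + q (od ! i) a * (r (od ! i) a - v)" for a u c x
        proof -
          have "?M (Suc a) = max (?M a) x" using that(2) by (simp add: gain_Suc max_def)
          then show ?thesis using that by (auto simp: Ok_def max_def)
        qed
        have s5: "Ok m (rmem s5 ''u'' 0) (nmem s5 ''c'' 0)"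
          unfolding s5_def
        proof (rule den_For[where I = "\<lambda>a (s5 :: state). Ok a (rmem s5 ''u'' 0) (nmem s5 ''c'' 0)"])
          show "nval s4 (nV ''m'') = m" using inp5 by (simp add: inp_def)
          show "Ok 0 (rmem (nset ''a1'' 0 0 s4) ''u'' 0) (nmem (nset ''a1'' 0 0 s4) ''c'' 0)"
            using f4 Ok0 by simp
          fix a and s6 :: state
          assume a: "a < m" and C: "Ok a (rmem s6 ''u'' 0) (nmem s6 ''c'' 0)"
            and aa: "nmem s6 ''a1'' 0 = a"
            and frn6: "\<And>y. y \<noteq> ''a1'' \<Longrightarrow> y \<notin> nw ?d \<Longrightarrow> nmem s6 y = nmem s4 y"
            and frr6: "\<And>y. y \<notin> rw ?d \<Longrightarrow> rmem s6 y = rmem s4 y"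
          have inp6: "inp s6" using inp5 by (subst inp_cong[of s6 s4]) (auto simp: frn6 frr6)
          have f6: "nmem s6 ''o'' 0 = od ! i" "rmem s6 ''f'' 0 = v" using frn6 frr6 f4 by simp_all
          have rq: "rval s6 (RQ ''r'' ''o'' ''a1'') = r (od ! i) a" "rval s6 (RQ ''q'' ''o'' ''a1'') = q (od ! i) a"
            using inp6 e a f6 aa by (auto simp: RQ_def inp_def)
          define x where "x = v + q (od ! i) a * (r (od ! i) a - v)"
          have D: "rmem (nset ''a1'' 0 (Suc a) (den ?d s6)) ''u'' 0 = (if rmem s6 ''u'' 0 < x then x else rmem s6 ''u'' 0)"
            "nmem (nset ''a1'' 0 (Suc a) (den ?d s6)) ''c'' 0 = (if rmem s6 ''u'' 0 < x then Suc a else nmem s6 ''c'' 0)"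
            using rq f6 aa by (simp_all add: x_def)
          show "Ok (Suc a) (rmem (nset ''a1'' 0 (Suc a) (den ?d s6)) ''u'' 0) (nmem (nset ''a1'' 0 (Suc a) (den ?d s6)) ''c'' 0)"
            unfolding D by (rule OkS[OF C x_def])
        qed simp
        have f5: "nmem s5 ''i'' 0 = i" "nmem s5 ''kk'' 0 = k" "rmem s5 ''F'' = rmem s3 ''F''" "nmem s5 ''act'' = nmem s3 ''act''"
          "nmem s5 ''rl'' = nmem s3 ''rl''"
          using f4 by (simp_all add: s5_def nmem_den rmem_den del: den.simps(6)) (simp add: s4_def nmem_nset_other)
        have uV: "rmem s5 ''u'' 0 = V (Suc i) (Suc k)" using s5 VS[OF True] by (simp add: Ok_def v_def)
        have Ac: "A i k (nmem s5 ''c'' 0)" using s5 uV by (auto simp: A_def Ok_def v_def)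
        have d: "den c_cell s3 = den (FR ''F'' (FX (NAdd (nV ''i'') (N 1)) (NAdd (nV ''kk'') (N 1))) (rV ''u'') ;;
     FN ''act'' (FX (NAdd (nV ''i'') (N 1)) (NAdd (nV ''kk'') (N 1))) (nV ''c'')) s5"
          by (simp add: c_cell_def s5_def s4_def)
        have DF: "rmem (den c_cell s3) ''F'' (cellix t' k') = (if t' = Suc i \<and> k' = Suc k then V (Suc i) (Suc k) else rmem s3 ''F'' (cellix t' k'))"
          if "k' \<le> l" for t' k'
          unfolding d using f5 rl3(2)[of "Suc k"] uV cellix_inj[of k' "Suc k" t' "Suc i"] that k by auto
        have DA: "nmem (den c_cell s3) ''act'' (cellix t' k') = (if t' = Suc i \<and> k' = Suc k then nmem s5 ''c'' 0 else nmem s3 ''act'' (cellix t' k'))"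
          if "k' \<le> l" for t' k'
          unfolding d using f5 rl3(2)[of "Suc k"] cellix_inj[of k' "Suc k" t' "Suc i"] that k by auto
        have K1: "?P i (den c_cell s3)"
        proof (intro conjI allI impI)
          fix t' k' assume "t' \<le> i" "k' \<le> l"
          then show "rmem (den c_cell s3) ''F'' (cellix t' k') = V t' k'" using DF[of k' t'] B by auto
        next
          fix t' k' assume "t' < i" "k' < l"
          then show "A t' k' (nmem (den c_cell s3) ''act'' (cellix (Suc t') (Suc k')))" using DA[of "Suc k'" "Suc t'"] B by auto
        qed
        have K2: "rmem (den c_cell s3) ''F'' (cellix (Suc i) k') = V (Suc i) k'" if "k' \<le> Suc k" for k'
          using DF[of k' "Suc i"] B that k by (auto simp: le_Suc_eq)
        have K3: "A i k' (nmem (den c_cell s3) ''act'' (cellix (Suc i) (Suc k')))" if "k' < Suc k" for k'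
          using DA[of "Suc k'" "Suc i"] B that k Ac by (auto simp: less_Suc_eq)
        show "?K (Suc k) (nset ''kk'' 0 (Suc k) (den c_cell s3))"
          using K1 K2 K3 by simp
      qed (simp add: c_cell_def)
      moreover have "den ?b s' = den (FFor ''kk'' (nV ''l'') c_cell) s2"
        using True f2 ii by (simp add: c_row_def s2_def)
      ultimately have K: "?K l (den ?b s')" by simp
      have m: "min (Suc i) (length od) = Suc i" using True by simp
      have "?P (Suc i) (den ?b s')"
        using K by (auto simp: le_Suc_eq less_Suc_eq simp del: den.simps mult_Suc)
      then show ?thesis unfolding m by (simp del: den.simps mult_Suc)
    qed
  qed (simp add: c_row_def c_cell_def)
  then have "?P (length od) (den c_dp s)" using od(2) by (simp add: c_dp_def s1_def min_def)
  then show ?thesis unfolding dp_ok_def Let_def V_def A_def by simp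
qed

lemma c_out:
  assumes inp: "inp s" and ord: "map (nmem s ''ord'') [0..<nmem s ''cnt'' 0] = od"
    and od: "set od \<subseteq> {..<n}" "distinct od" "length od \<le> n" and dp: "dp_ok od s" and ok: "out_ok s"
  shows "out_ok (den c_out s)" "rmem s ''best'' 0 \<le> rmem (den c_out s) ''best'' 0"
    "opt r q m (rev od) l \<le> rmem (den c_out s) ''best'' 0"
proof -
  define V where "V t k = opt r q m (rev (take t od)) k" for t k
  have V0: "V 0 k = 0" "V t 0 = 0" for t k
    by (simp_all add: V_def)
  have cnt: "nmem s ''cnt'' 0 = length od" using ord by (metis length_map length_upt diff_zero)
  have ordt: "nmem s ''ord'' t = od ! t" if "t < length od" for t
    using that ord cnt by (metis add_0 nth_map_upt diff_zero)
  have nml: "nmem s ''n'' 0 = n" "nmem s ''l'' 0 = l" using inp by (simp_all add: inp_def)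
  have Fv: "rval s (RGet ''F'' (FX (nV ''cnt'') (nV ''l''))) = V (length od) l"
    using inp_rl[OF inp od(3), of l] dp cnt nml by (simp add: dp_ok_def V_def)
  show *: "out_ok (den c_out s)" "rmem s ''best'' 0 \<le> rmem (den c_out s) ''best'' 0"
    "opt r q m (rev od) l \<le> rmem (den c_out s) ''best'' 0"
  proof -
    let ?b = "FIf (NLess (nV ''i'') (nV ''cnt'')) c_step FSkip"
    define s1 where "s1 = den (rS ''best'' (RGet ''F'' (FX (nV ''cnt'') (nV ''l''))) ;; nS ''k'' (N 0) ;; nS ''kr'' (nV ''l'')) s"
    define s2 where "s2 = den (FFor ''i'' (nV ''n'') ?b) s1"
    have best: "rmem s2 ''best'' 0 = V (length od) l"
      using Fv by (simp add: s2_def s1_def rmem_den c_step_def del: den.simps(6))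
    have f1: "nmem s1 ''n'' 0 = n" "nmem s1 ''cnt'' 0 = length od" "nmem s1 ''ord'' = nmem s ''ord''" "nmem s1 ''act'' = nmem s ''act''"
      "nmem s1 ''rl'' = nmem s ''rl''" "nmem s1 ''k'' 0 = 0" "nmem s1 ''kr'' 0 = l"
      using nml cnt by (simp_all add: s1_def nmem_nset_other)
    \<comment> \<open>The queries written so far, continued by the table entry for the remaining row
      and budget, are worth the final entry of the table. The loop runs \<open>n\<close> times; the
      \<open>min\<close> accounts for the idle iterations beyond the length of
      \<open>od\<close>.\<close>
    let ?I = "\<lambda>i (s' :: state). let t = length od - min i (length od); es = map (nmem s' ''e'') [0..<nmem s' ''k'' 0];
        as = map (nmem s' ''a'') [0..<nmem s' ''k'' 0] in
       nmem s' ''k'' 0 + nmem s' ''kr'' 0 = l \<and> distinct es \<and> set es \<subseteq> set (drop t od) \<and> set as \<subseteq> {..<m} \<and>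
       V (length od) l = ext_val es as (V t (nmem s' ''kr'' 0))"
    have "?I n s2" unfolding s2_def
    proof (rule den_For[where I = ?I])
      show "nval s1 (nV ''n'') = n" using f1 by simp
      show "?I 0 (nset ''i'' 0 0 s1)" using f1 by (simp add: ext_val_def)
      fix i and s' :: state assume i: "i < n" and A: "?I i s'" and ii: "nmem s' ''i'' 0 = i"
        and frn: "\<And>y. y \<noteq> ''i'' \<Longrightarrow> y \<notin> nw ?b \<Longrightarrow> nmem s' y = nmem s1 y"
      have f: "nmem s' ''cnt'' 0 = length od" "nmem s' ''ord'' = nmem s ''ord''" "nmem s' ''act'' = nmem s ''act''"
        "nmem s' ''rl'' = nmem s ''rl''"
        using frn f1 by (simp_all add: c_step_def)
      show "?I (Suc i) (nset ''i'' 0 (Suc i) (den ?b s'))"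
      proof (cases "i < length od")
        case False
        then have "den ?b s' = s'" "min (Suc i) (length od) = min i (length od)" using f ii by auto
        then show ?thesis using A by (simp add: Let_def nmem_nset_other del: den.simps)
      next
        case True
        define z where "z = length od - Suc i"
        define kr where "kr = nmem s' ''kr'' 0"
        define k where "k = nmem s' ''k'' 0"
        define es where "es = map (nmem s' ''e'') [0..<k]"
        define as where "as = map (nmem s' ''a'') [0..<k]"
        have z: "z < length od" "length od - min i (length od) = Suc z" "length od - min (Suc i) (length od) = z" "length od - (i + 1) = z"
          using True by (auto simp: z_def)
        have AA: "k + kr = l" "distinct es" "set es \<subseteq> set (drop (Suc z) od)" "set as \<subseteq> {..<m}"
          "V (length od) l = ext_val es as (V (Suc z) kr)"
          using A unfolding Let_def z(2) by (auto simp: kr_def k_def es_def as_def)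
        have dz: "drop z od = od ! z # drop (Suc z) od" using z(1) by (simp add: Cons_nth_drop_Suc)
        have nz: "od ! z \<notin> set (drop (Suc z) od)" using od(2) dz by (metis distinct.simps(2) distinct_drop)
        define c where "c = nmem s ''act'' (cellix (Suc z) kr)"
        have db: "den ?b s' = den c_step s'" using True f ii by simp
        have rlz: "nmem s ''rl'' (Suc z) + x = cellix (Suc z) x" for x using inp_rl[OF inp] z(1) od(3) by simp
        have act: "c = 0 \<and> V (Suc z) kr = V z kr \<or>
            0 < c \<and> c \<le> m \<and> V (Suc z) kr = V z k' + q (od ! z) (c - 1) * (r (od ! z) (c - 1) - V z k')"
          if "kr = Suc k'" for k'
          using dp[unfolded dp_ok_def Let_def V_def[symmetric], THEN conjunct2, rule_format, OF z(1), of k'] AA(1) that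
          by (simp add: c_def)
        show ?thesis
        proof (cases "0 < kr \<and> 0 < c")
          case False
          have "V (Suc z) kr = V z kr"
          proof (cases kr)
            case 0
            then show ?thesis by (simp add: V0)
          next
            case (Suc k')
            then show ?thesis using act[OF Suc] False by simp
          qed
          moreover have "nmem (den c_step s') y = nmem s' y" if "y \<in> {''k'', ''kr'', ''e'', ''a''}" for y
            using False f ii z(4) rlz[of kr] that unfolding c_step_def c_def kr_def by (auto simp: nmem_nset_other)
          ultimately show ?thesis unfolding db Let_def z(3) using AA dz
            by (auto simp: kr_def k_def es_def as_def nmem_nset_other)
        next
          case c: True
          then obtain k' where k': "kr = Suc k'" by (cases kr) auto
          have "0 < c \<and> c \<le> m \<and> V (Suc z) kr = V z k' + q (od ! z) (c - 1) * (r (od ! z) (c - 1) - V z k')"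
            using act[OF k'] c by simp
          then have cm: "c - 1 < m" and Vz: "V (Suc z) kr = r (od ! z) (c - 1) * q (od ! z) (c - 1) + (1 - q (od ! z) (c - 1)) * V z k'"
            using c by (auto simp: algebra_simps)
          have D: "nmem (den c_step s') ''k'' 0 = Suc k" "nmem (den c_step s') ''kr'' 0 = k'"
            "nmem (den c_step s') ''e'' = (nmem s' ''e'')(k := od ! z)" "nmem (den c_step s') ''a'' = (nmem s' ''a'')(k := c - 1)"
            using c f ii z(1,4) rlz[of kr] ordt unfolding c_step_def c_def kr_def k_def using k' kr_def
            by (auto simp: nset_def)
          have upd: "map (f(k := v)) [0..<Suc k] = map f [0..<k] @ [v]" for f :: "nat \<Rightarrow> nat" and k v by simp
          have E: "map (nmem (den c_step s') ''e'') [0..<Suc k] = es @ [od ! z]"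
            "map (nmem (den c_step s') ''a'') [0..<Suc k] = as @ [c - 1]"
            unfolding D upd es_def as_def by (rule refl)+
          have "ext_val (es @ [od ! z]) (as @ [c - 1]) (V z k') = V (length od) l"
            using AA(5) Vz by (subst ext_val_snoc) (simp_all add: es_def as_def)
          then show ?thesis unfolding db Let_def z(3) using AA dz nz cm
            by (auto simp: D(1,2) E k' nmem_nset_other simp del: upt_Suc den.simps set_map)
        qed
      qed
    qed (simp add: c_step_def)
    then have fin: "nmem s2 ''k'' 0 + nmem s2 ''kr'' 0 = l" "distinct (map (nmem s2 ''e'') [0..<nmem s2 ''k'' 0])"
      "set (map (nmem s2 ''e'') [0..<nmem s2 ''k'' 0]) \<subseteq> set od" "set (map (nmem s2 ''a'') [0..<nmem s2 ''k'' 0]) \<subseteq> {..<m}"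
      "V (length od) l = ext_val (map (nmem s2 ''e'') [0..<nmem s2 ''k'' 0]) (map (nmem s2 ''a'') [0..<nmem s2 ''k'' 0]) 0"
      using od(3) by (simp_all add: Let_def V0)
    have out2: "out_ok s2"
      unfolding out_ok_def output_policy_def policies_def using fin od(1) best
      by (auto simp: policy_val_ext)
    have Vl: "V (length od) l = opt r q m (rev od) l" by (simp add: V_def)
    have d: "den c_out s = (if rmem s ''best'' 0 < V (length od) l then s2 else s)"
      using Fv by (simp add: c_out_def s2_def s1_def)
    show "out_ok (den c_out s)" "rmem s ''best'' 0 \<le> rmem (den c_out s) ''best'' 0"
      "opt r q m (rev od) l \<le> rmem (den c_out s) ''best'' 0"
      unfolding d using ok out2 best Vl by auto
  qed
qed

end

section \<open>Enumerating the guesses\<close>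

definition c_body :: "nat \<Rightarrow> fcom" where
  "c_body pr = c_share pr ;; c_code pr ;; c_tab pr ;; FFor ''s0'' (N (qsize pr)) (c_cand pr)"

text \<open>Nested loops need different counters: these differ in length, and no other array of the
  program has a name beginning with v.\<close>

definition iv :: "nat \<Rightarrow> string" where
  "iv b = CHR ''v'' # replicate b CHR ''v''"

text \<open>Each loop lets one entry of \<open>Lam\<close> run through \<open>grid\<close>.\<close>

primrec nest :: "nat \<Rightarrow> nat \<Rightarrow> fcom \<Rightarrow> fcom" where
  "nest pr 0 c = c"
| "nest pr (Suc b) c = FR ''Lam'' (N b) (ROfNat (N 0)) ;; FFor (iv b) (nV ''K'') (nest pr b c ;;
     FIf (RLess (ROfNat (N 0)) (RGet ''Lam'' (N b)))
       (FR ''Lam'' (N b) (RMul (RGet ''Lam'' (N b)) (RAdd (ROfNat (N 1)) (RDiv (ROfNat (N 1)) (ROfNat (N pr))))))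
       (FR ''Lam'' (N b) (ROfNat (N 1))))"

definition c_main :: "nat \<Rightarrow> fcom" where
  "c_main pr = mul_table ''rm'' (nV ''m'') ;; mul_table ''rl'' (NAdd (nV ''n'') (N 1)) ;; c_max ;;
     rS ''W'' (ROfNat (N 0)) ;; rS ''best'' (ROfNat (N 0)) ;; nS ''k'' (N 0) ;;
     FFor ''w'' (nV ''n'') (rS ''W'' (RAdd (rV ''W'') (rV ''M'')) ;; c_lev pr ;; nest pr (lvls pr + 1) (c_body pr))"

lemmas code_defs = c_body_def c_share_def c_weight_def c_code_def c_tab_def c_sel_def c_cand_def c_back_def
  c_load_def c_greedy_def c_item_def c_pick_def c_order_def c_dp_def c_row_def c_cell_def c_out_def c_step_def

lemma nw_c_cand: "nw (c_cand pr) = {''cur'', ''i'', ''e1'', ''o'', ''asg'', ''j'', ''cnt'', ''b'', ''ord'', ''kk'', ''c'', ''a1'', ''act'', ''k'', ''kr'', ''z'', ''e'', ''a''}"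
  and rw_c_cand: "rw (c_cand pr) = {''L'', ''R'', ''b'', ''t'', ''F'', ''f'', ''u'', ''best''}"
  by (auto simp: code_defs)

lemma nw_c_body: "nw (c_body pr) \<subseteq> nw (c_cand pr) \<union> {''p'', ''d'', ''inc'', ''s'', ''tab'', ''s0''}"
  and rw_c_body: "rw (c_body pr) \<subseteq> rw (c_cand pr) \<union> {''w'', ''y''}"
  unfolding nw_c_cand rw_c_cand by (auto simp: code_defs nw_fseq rw_fseq)

lemma iv_inj [simp]: "iv b = iv b' \<longleftrightarrow> b = b'"
  unfolding iv_def by (metis length_replicate list.inject)

lemma nw_nest: "nw (nest pr b c) = nw c \<union> iv ` {..<b}"
  by (induction b) (auto simp: lessThan_Suc)

text \<open>The grid in the order in which a loop of \<open>nest\<close> visits it: 0, then 1, then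
  one factor of the ratio per step. The visit to 0 and the power with exponent 0 account for the
  \<open>+ 2\<close> in \<open>K\<close>.\<close>

definition gp :: "nat \<Rightarrow> nat \<Rightarrow> real" where
  "gp pr i = (if i = 0 then 0 else (1 + 1 / real pr) ^ (i - 1))"

lemma grid_gp: "grid pr k \<subseteq> gp pr ` {..<k + 1}"
proof
  fix x assume "x \<in> grid pr k"
  then consider "x = 0" | j where "j < k" "x = (1 + 1 / real pr) ^ j" by (auto simp: grid_def)
  then show "x \<in> gp pr ` {..<k + 1}"
  proof cases
    case 1
    then show ?thesis by (intro image_eqI[of _ _ 0]) (auto simp: gp_def)
  next
    case 2
    then show ?thesis by (intro image_eqI[of _ _ "Suc j"]) (auto simp: gp_def)
  qed
qed

lemma gp_Suc: "gp pr (Suc i) = (if 0 < gp pr i then gp pr i * (1 + 1 / real pr) else 1)"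
proof (cases i)
  case (Suc i')
  have "0 < (1 + 1 / real pr) ^ i'" by (intro zero_less_power add_pos_nonneg) auto
  then show ?thesis using Suc by (simp add: gp_def)
qed (simp add: gp_def)

text \<open>Induction on the number of entries of \<open>Lam\<close> still to be enumerated, the
  others keeping their current values. \<open>good \<Lambda> x\<close> is to mean that
  \<open>x\<close> is at least what the multipliers \<open>\<Lambda>\<close> achieve; as
  \<open>best\<close> never decreases, it remains true after \<open>\<Lambda>\<close> has been
  visited.\<close>

lemma nest:
  fixes pr :: nat and I :: "state \<Rightarrow> bool" and good :: "(nat \<Rightarrow> real) \<Rightarrow> real \<Rightarrow> bool"
  assumes body: "\<And>s. I s \<Longrightarrow> I (den c s) \<and> rmem s ''best'' 0 \<le> rmem (den c s) ''best'' 0 \<and> good (rmem s ''Lam'') (rmem (den c s) ''best'' 0)"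
    and mono: "\<And>\<Lambda> x x'. good \<Lambda> x \<Longrightarrow> x \<le> x' \<Longrightarrow> good \<Lambda> x'"
    and I: "\<And>s b v. b < J \<Longrightarrow> I s \<Longrightarrow> I (rset ''Lam'' b v s)" "\<And>s b v. I s \<Longrightarrow> I (nset (iv b) 0 v s)"
      "\<And>s. I s \<Longrightarrow> nmem s ''K'' 0 = K"
    and w: "\<And>b. iv b \<notin> nw c" "''Lam'' \<notin> rw c"
    and b: "b \<le> J" and s: "I s"
  defines "s' \<equiv> den (nest pr b c) s"
  shows "I s' \<and> rmem s ''best'' 0 \<le> rmem s' ''best'' 0 \<and> (\<forall>j\<ge>b. rmem s' ''Lam'' j = rmem s ''Lam'' j) \<and>
    (\<forall>\<Lambda>. (\<forall>j<b. \<Lambda> j \<in> gp pr ` {..<K}) \<and> (\<forall>j\<ge>b. \<Lambda> j = rmem s ''Lam'' j) \<longrightarrow> good \<Lambda> (rmem s' ''best'' 0))"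
  unfolding s'_def using b s
proof (induction b arbitrary: s)
  case 0
  have "\<Lambda> = rmem s ''Lam''" if "\<forall>j\<ge>0. \<Lambda> j = rmem s ''Lam'' j" for \<Lambda> using that by auto
  then show ?case using body[OF 0(2)] w(2) by (auto simp: rmem_den)
next
  case (Suc b)
  let ?u = "FIf (RLess (ROfNat (N 0)) (RGet ''Lam'' (N b)))
       (FR ''Lam'' (N b) (RMul (RGet ''Lam'' (N b)) (RAdd (ROfNat (N 1)) (RDiv (ROfNat (N 1)) (ROfNat (N pr))))))
       (FR ''Lam'' (N b) (ROfNat (N 1)))"
  let ?b = "nest pr b c ;; ?u"
  define s1 where "s1 = den (FR ''Lam'' (N b) (ROfNat (N 0))) s"
  have I1: "I s1" using Suc.prems I(1)[of b s 0] by (simp add: s1_def)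
  let ?P = "\<lambda>i (s' :: state). I s' \<and> rmem s ''best'' 0 \<le> rmem s' ''best'' 0 \<and> rmem s' ''Lam'' b = gp pr i \<and>
     (\<forall>j\<ge>Suc b. rmem s' ''Lam'' j = rmem s ''Lam'' j) \<and>
     (\<forall>\<Lambda>. (\<forall>j<b. \<Lambda> j \<in> gp pr ` {..<K}) \<and> \<Lambda> b \<in> gp pr ` {..<i} \<and> (\<forall>j\<ge>Suc b. \<Lambda> j = rmem s ''Lam'' j) \<longrightarrow> good \<Lambda> (rmem s' ''best'' 0))"
  have "?P K (den (FFor (iv b) (nV ''K'') ?b) s1)"
  proof (rule den_For[where I = ?P])
    show "iv b \<notin> nw ?b" using w(1) by (auto simp: nw_nest)
    show "nval s1 (nV ''K'') = K" using I(3)[OF I1] by simp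
    have "I (nset (iv b) 0 0 s1)" using I1 by (rule I(2))
    then show "?P 0 (nset (iv b) 0 0 s1)" by (simp add: s1_def gp_def)
    fix i and s2 :: state assume i: "i < K" and A: "?P i s2"
    have IH: "I (den (nest pr b c) s2) \<and> rmem s2 ''best'' 0 \<le> rmem (den (nest pr b c) s2) ''best'' 0 \<and> (\<forall>j\<ge>b. rmem (den (nest pr b c) s2) ''Lam'' j = rmem s2 ''Lam'' j) \<and>
    (\<forall>\<Lambda>. (\<forall>j<b. \<Lambda> j \<in> gp pr ` {..<K}) \<and> (\<forall>j\<ge>b. \<Lambda> j = rmem s2 ''Lam'' j) \<longrightarrow> good \<Lambda> (rmem (den (nest pr b c) s2) ''best'' 0))"
      using Suc.IH[of s2] Suc.prems A by simp
    define s3 where "s3 = den (nest pr b c) s2"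
    have u: "den ?u s3 = rset ''Lam'' b (gp pr (Suc i)) s3"
    proof -
      have "rmem s3 ''Lam'' b = gp pr i" using IH A by (simp add: s3_def)
      then show ?thesis by (simp add: gp_Suc)
    qed
    define s4 where "s4 = nset (iv b) 0 (Suc i) (den ?b s2)"
    have s4: "s4 = nset (iv b) 0 (Suc i) (rset ''Lam'' b (gp pr (Suc i)) s3)"
      by (simp only: s4_def den.simps(4) s3_def[symmetric] u)
    have "I s4" unfolding s4 using IH Suc.prems by (intro I) (auto simp: s3_def)
    moreover have bs: "rmem s4 ''best'' 0 = rmem s3 ''best'' 0" unfolding s4 by simp
    moreover have "rmem s ''best'' 0 \<le> rmem s3 ''best'' 0" "rmem s2 ''best'' 0 \<le> rmem s3 ''best'' 0"
      using IH A by (auto simp: s3_def)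
    moreover have "rmem s4 ''Lam'' b = gp pr (Suc i)" unfolding s4 by simp
    moreover have "rmem s4 ''Lam'' j = rmem s ''Lam'' j" if "Suc b \<le> j" for j
      unfolding s4 using that IH A by (simp add: s3_def)
    moreover have "good \<Lambda> (rmem s3 ''best'' 0)"
      if \<Lambda>: "\<forall>j<b. \<Lambda> j \<in> gp pr ` {..<K}" "\<Lambda> b \<in> gp pr ` {..<Suc i}" "\<forall>j\<ge>Suc b. \<Lambda> j = rmem s ''Lam'' j" for \<Lambda>
    proof (cases "\<Lambda> b = gp pr i")
      case True
      have "\<Lambda> j = rmem s2 ''Lam'' j" if "b \<le> j" for j
        using True \<Lambda>(3) A that by (cases "j = b") auto
      then show ?thesis using IH \<Lambda>(1) unfolding s3_def by blast
    next
      case False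
      then have "\<Lambda> b \<in> gp pr ` {..<i}" using \<Lambda>(2) by (auto simp: lessThan_Suc)
      then have "good \<Lambda> (rmem s2 ''best'' 0)" using A \<Lambda> by blast
      then show ?thesis using \<open>rmem s2 ''best'' 0 \<le> rmem s3 ''best'' 0\<close> by (rule mono)
    qed
    ultimately show "?P (Suc i) (nset (iv b) 0 (Suc i) (den ?b s2))"
      unfolding s4_def[symmetric] by simp
  qed
  then have P: "?P K (den (nest pr (Suc b) c) s)" by (simp add: s1_def)
  have "good \<Lambda> (rmem (den (nest pr (Suc b) c) s) ''best'' 0)"
    if "\<forall>j<Suc b. \<Lambda> j \<in> gp pr ` {..<K}" "\<forall>j\<ge>Suc b. \<Lambda> j = rmem s ''Lam'' j" for \<Lambda>
    using P that by (meson less_SucI lessI)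
  with P show ?case by blast
qed

context star
begin

lemma inp_cong':
  assumes "nmem s' ''n'' = nmem s ''n''" "nmem s' ''m'' = nmem s ''m''" "nmem s' ''l'' = nmem s ''l''"
    "nmem s' ''rm'' = nmem s ''rm''" "nmem s' ''rl'' = nmem s ''rl''"
    "rmem s' ''r'' = rmem s ''r''" "rmem s' ''q'' = rmem s ''q''"
  shows "inp s' \<longleftrightarrow> inp s"
  using assms by (simp add: inp_def)

lemma out_ok_cong:
  assumes "nmem s' ''k'' = nmem s ''k''" "nmem s' ''e'' = nmem s ''e''" "nmem s' ''a'' = nmem s ''a''"
    "rmem s' ''best'' = rmem s ''best''"
  shows "out_ok s' \<longleftrightarrow> out_ok s"
  using assms by (simp add: out_ok_def output_policy_def)

lemma ok_cong:
  "rmem s' ''g'' = rmem s ''g'' \<Longrightarrow> rmem s' ''h'' = rmem s ''h'' \<Longrightarrow> lev_ok W s' \<longleftrightarrow> lev_ok W s"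
  "rmem s' ''y'' = rmem s ''y'' \<Longrightarrow> share_ok W P \<Lambda> s' \<longleftrightarrow> share_ok W P \<Lambda> s"
  "nmem s' ''inc'' = nmem s ''inc'' \<Longrightarrow> code_ok W P \<Lambda> s' \<longleftrightarrow> code_ok W P \<Lambda> s"
  "nmem s' ''tab'' = nmem s ''tab'' \<Longrightarrow> tab_ok W P \<Lambda> s' \<longleftrightarrow> tab_ok W P \<Lambda> s"
  by (simp_all add: lev_ok_def share_ok_def code_ok_def tab_ok_def)

lemma c_cand:
  assumes inp: "inp s" and lev: "lev_ok W s" and y: "share_ok W P \<Lambda> s" and code: "code_ok W P \<Lambda> s"
    and tab: "tab_ok W P \<Lambda> s" and c: "nmem s ''s0'' 0 = c" "c < qsize pr" and ok: "out_ok s"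
  defines "s' \<equiv> den (c_cand pr) s"
  shows "out_ok s' \<and> rmem s ''best'' 0 \<le> rmem s' ''best'' 0 \<and> cand W P \<Lambda> c \<le> rmem s' ''best'' 0"
proof -
  have n: "nmem s ''n'' 0 = n" using inp by (simp add: inp_def)
  define s1 where "s1 = den (c_back pr) s"
  define s2 where "s2 = den (c_load pr) s1"
  define s3 where "s3 = den (c_greedy pr) s2"
  define s4 where "s4 = den (c_order pr) s3"
  define s5 where "s5 = den c_dp s4"
  note nd = nmem_den rmem_den inp_den
  have n1: "nmem s1 ''n'' 0 = n" "lev_ok W s1" "share_ok W P \<Lambda> s1" "inp s1"
    using n lev y inp ok_cong[of s1 s] by (simp_all add: s1_def nd c_back_def del: den.simps)
  have n2: "nmem s2 ''n'' 0 = n" "lev_ok W s2" "share_ok W P \<Lambda> s2" "inp s2" "nmem s2 ''asg'' = nmem s1 ''asg''"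
    using n1 ok_cong[of s2 s1] by (simp_all add: s2_def nd c_load_def del: den.simps)
  have n3: "nmem s3 ''n'' 0 = n" "inp s3"
    using n2 by (simp_all add: s3_def nd c_greedy_def nw_c_item del: den.simps)
  have n4: "inp s4" using n3 by (simp add: s4_def nd c_order_def del: den.simps)
  have n5: "inp s5" "nmem s5 ''cnt'' = nmem s4 ''cnt''" "nmem s5 ''ord'' = nmem s4 ''ord''"
    using n4 by (simp_all add: s5_def nd c_dp_def c_row_def c_cell_def del: den.simps)
  have ok5: "out_ok s5" "rmem s5 ''best'' = rmem s ''best''"
  proof -
    have best: "rmem s5 ''best'' = rmem s ''best''"
      by (simp add: s5_def s4_def s3_def s2_def s1_def nd c_dp_def c_row_def c_cell_def c_order_def c_greedy_def nw_c_item c_load_def c_back_def del: den.simps)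
    moreover have "nmem s5 y = nmem s y" if "y \<in> {''k'', ''e'', ''a''}" for y
      using that by (auto simp add: s5_def s4_def s3_def s2_def s1_def nd c_dp_def c_row_def c_cell_def c_order_def c_greedy_def nw_c_item c_load_def c_back_def simp del: den.simps)
    ultimately show "out_ok s5" using ok out_ok_cong[of s5 s] by simp
    show "rmem s5 ''best'' = rmem s ''best''" by (rule best)
  qed
  define od where "od = bin_order n (2 * lvls pr) (asg W P \<Lambda> c)"
  have a1: "\<forall>e<n. nmem s1 ''asg'' e = lrg W P \<Lambda> c e" unfolding s1_def by (rule c_back[OF n code tab c])
  have l2: "\<forall>j\<le>lvls pr. rmem s2 ''L'' j = load W P \<Lambda> c j" unfolding s2_def by (rule c_load[OF n1(1-3) a1])
  have a3: "\<forall>e<n. nmem s3 ''asg'' e = asg W P \<Lambda> c e" unfolding s3_def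
    by (rule c_greedy[OF n2(1-3) _ l2]) (use a1 n2 in simp)
  have o4: "map (nmem s4 ''ord'') [0..<nmem s4 ''cnt'' 0] = od" unfolding s4_def od_def by (rule c_order[OF n3(1) a3])
  have od: "set od \<subseteq> {..<n}" "distinct od" by (auto simp: od_def set_bin_order distinct_bin_order)
  have len: "length od \<le> n" using card_mono[OF _ od(1)] od(2) by (simp add: distinct_card)
  have d5: "dp_ok od s5" unfolding s5_def by (rule c_dp[OF n4 o4 od(1) len])
  have o5: "map (nmem s5 ''ord'') [0..<nmem s5 ''cnt'' 0] = od" using o4 n5 by simp
  have s': "s' = den c_out s5" by (simp add: s'_def c_cand_def s5_def s4_def s3_def s2_def s1_def)
  show ?thesis unfolding s' using c_out[OF n5(1) o5 od len d5 ok5(1)] ok5(2)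
    by (simp add: cand_def od_def)
qed

definition main_inv :: "real \<Rightarrow> real \<Rightarrow> nat \<Rightarrow> nat \<Rightarrow> state \<Rightarrow> bool" where
  "main_inv M W P K s \<longleftrightarrow> inp s \<and> lev_ok W s \<and> out_ok s \<and> nmem s ''P'' 0 = P \<and> nmem s ''K'' 0 = K \<and>
     rmem s ''M'' 0 = M \<and> rmem s ''W'' 0 = W \<and> (\<forall>j>lvls pr. rmem s ''Lam'' j = 0)"

lemma c_body:
  assumes inv: "main_inv M W P K s"
  defines "s' \<equiv> den (c_body pr) s"
  shows "main_inv M W P K s' \<and> rmem s ''best'' 0 \<le> rmem s' ''best'' 0 \<and>
    (\<forall>c<qsize pr. cand W P (rmem s ''Lam'') c \<le> rmem s' ''best'' 0)"
proof -
  let ?L = "rmem s ''Lam''"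
  have i0: "inp s" "lev_ok W s" "out_ok s" "nmem s ''P'' 0 = P" using inv by (simp_all add: main_inv_def)
  have n: "nmem s ''n'' 0 = n" using i0 by (simp add: inp_def)
  define s1 where "s1 = den (c_share pr) s"
  define s2 where "s2 = den (c_code pr) s1"
  define s3 where "s3 = den (c_tab pr) s2"
  note nd = nmem_den rmem_den inp_den
  have y1: "share_ok W P ?L s1" unfolding s1_def by (rule c_share[OF n i0(4,2) refl])
  have n1: "nmem s1 ''n'' 0 = n" "lev_ok W s1" "inp s1" "out_ok s1" "rmem s1 ''best'' = rmem s ''best''"
    using n i0 ok_cong[of s1 s] out_ok_cong[of s1 s] by (simp_all add: s1_def nd c_share_def c_weight_def del: den.simps)
  have nwc: "nw (c_code pr) \<subseteq> {''i'', ''c'', ''d'', ''inc''}" "rw (c_code pr) = {}"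
    by (auto simp: c_code_def nw_fseq rw_fseq)
  have c2: "code_ok W P ?L s2" unfolding s2_def by (rule c_code[OF n1(1,2) y1])
  have r2: "rmem s2 = rmem s1" unfolding s2_def using nwc(2) rmem_den by auto
  have m2: "nmem s2 x = nmem s1 x" if "x \<notin> {''i'', ''c'', ''d'', ''inc''}" for x
    unfolding s2_def using nwc that by (intro nmem_den) auto
  have n2: "nmem s2 ''n'' 0 = n" "lev_ok W s2" "share_ok W P ?L s2" "inp s2" "out_ok s2" "rmem s2 ''best'' = rmem s ''best''"
    using n1 y1 ok_cong[of s2 s1] out_ok_cong[of s2 s1] inp_cong'[of s2 s1] by (auto simp: r2 m2)
  have t3: "tab_ok W P ?L s3" unfolding s3_def by (rule c_tab[OF n2(1) c2])
  have n3: "lev_ok W s3" "share_ok W P ?L s3" "code_ok W P ?L s3" "inp s3" "out_ok s3" "rmem s3 ''best'' = rmem s ''best''"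
    using n2 c2 ok_cong[of s3 s2] out_ok_cong[of s3 s2] by (simp_all add: s3_def nd c_tab_def c_sel_def del: den.simps)
  let ?I = "\<lambda>i (s4 :: state). lev_ok W s4 \<and> share_ok W P ?L s4 \<and> code_ok W P ?L s4 \<and> tab_ok W P ?L s4 \<and> inp s4 \<and> out_ok s4 \<and>
     rmem s ''best'' 0 \<le> rmem s4 ''best'' 0 \<and> (\<forall>c<i. cand W P ?L c \<le> rmem s4 ''best'' 0)"
  have "?I (qsize pr) (den (FFor ''s0'' (N (qsize pr)) (c_cand pr)) s3)"
  proof (rule den_For[where I = ?I])
    show "''s0'' \<notin> nw (c_cand pr)" by (simp add: nw_c_cand)
    have "?I 0 s3" using n3 t3 by simp
    then show "?I 0 (nset ''s0'' 0 0 s3)"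
      using ok_cong[of "nset ''s0'' 0 0 s3" s3] inp_cong'[of "nset ''s0'' 0 0 s3" s3] out_ok_cong[of "nset ''s0'' 0 0 s3" s3]
      by (simp add: nmem_nset_other)
    fix i and s4 :: state assume i: "i < qsize pr" and A: "?I i s4" and ii: "nmem s4 ''s0'' 0 = i"
    define s5 where "s5 = den (c_cand pr) s4"
    have C: "out_ok s5 \<and> rmem s4 ''best'' 0 \<le> rmem s5 ''best'' 0 \<and> cand W P ?L i \<le> rmem s5 ''best'' 0"
      unfolding s5_def using A by (intro c_cand ii i) auto
    have m5: "nmem s5 y = nmem s4 y" if "y \<notin> nw (c_cand pr)" for y using that by (simp add: s5_def nmem_den)
    have r5: "rmem s5 y = rmem s4 y" if "y \<notin> rw (c_cand pr)" for y using that by (simp add: s5_def rmem_den)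
    have B: "?I (Suc i) s5"
      using A C ok_cong[of s5 s4] inp_cong'[of s5 s4] by (auto simp: m5 r5 nw_c_cand rw_c_cand less_Suc_eq)
    then show "?I (Suc i) (nset ''s0'' 0 (Suc i) (den (c_cand pr) s4))"
      using ok_cong[of "nset ''s0'' 0 (Suc i) s5" s5] inp_cong'[of "nset ''s0'' 0 (Suc i) s5" s5] out_ok_cong[of "nset ''s0'' 0 (Suc i) s5" s5]
      unfolding s5_def[symmetric] by (simp add: nmem_nset_other)
  qed simp
  then have F: "?I (qsize pr) s'" by (simp add: s'_def c_body_def s3_def s2_def s1_def)
  have m: "nmem s' y = nmem s y" if "y \<in> {''P'', ''K''}" for y
    unfolding s'_def using that nw_c_body[of pr] by (intro nmem_den) (auto simp: nw_c_cand)
  have r: "rmem s' y = rmem s y" if "y \<in> {''M'', ''W'', ''Lam''}" for y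
    unfolding s'_def using that rw_c_body[of pr] by (intro rmem_den) (auto simp: rw_c_cand)
  show ?thesis using F inv m r by (simp add: main_inv_def)
qed

lemma c_main_correct:
  defines "s' \<equiv> den (c_main pr) (den (c_log pr) (input_state n m l r q))"
  shows "output_policy s' \<in> policies {..<n} {..<m} l"
    and "(1 - 100 / real pr) * OPT {..<n} {..<m} l r q \<le> policy_val r q (output_policy s')"
proof -
  define s0 where "s0 = input_state n m l r q"
  define s1 where "s1 = den (c_log pr) s0"
  have in0: "nmem s0 ''n'' 0 = n" "nmem s0 ''m'' 0 = m" "nmem s0 ''l'' 0 = l" by (simp_all add: s0_def input_state_def)
  obtain lg where lg: "n + 1 \<le> 2 ^ lg" "nmem s1 ''P'' 0 = pr * (lg_off pr + lg)" "nmem s1 ''K'' 0 = 6 * pr\<^sup>2 * (lg_off pr + lg)\<^sup>2 + 2"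
    using c_log[of s0 pr] in0 unfolding s1_def by auto
  define lgt where "lgt = lg_off pr + lg"
  define P where "P = pr * lgt"
  define K where "K = 6 * pr\<^sup>2 * lgt\<^sup>2 + 2"
  have PK: "nmem s1 ''P'' 0 = P" "nmem s1 ''K'' 0 = K" using lg by (simp_all add: P_def K_def lgt_def)
  have in1: "nmem s1 ''n'' 0 = n" "nmem s1 ''m'' 0 = m" "nmem s1 ''l'' 0 = l" "rmem s1 = rmem s0"
  proof -
    show "nmem s1 ''n'' 0 = n" "nmem s1 ''m'' 0 = m" "nmem s1 ''l'' 0 = l"
      unfolding s1_def using in0 by (simp_all add: nmem_den c_log_def del: den.simps)
    have "rw (c_log pr) = {}" by (simp add: c_log_def)
    then show "rmem s1 = rmem s0" unfolding s1_def using rmem_den by auto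
  qed
  define s2 where "s2 = den (mul_table ''rm'' (nV ''m'')) s1"
  define s3 where "s3 = den (mul_table ''rl'' (NAdd (nV ''n'') (N 1))) s2"
  have rm: "nmem s2 ''rm'' i = i * m" if "i \<le> n" for i
    unfolding s2_def using mul_table[of "''rm''" "nV ''m''" i s1] in1 that by simp
  have in2: "nmem s2 ''n'' 0 = n" "nmem s2 ''m'' 0 = m" "nmem s2 ''l'' 0 = l" "nmem s2 ''P'' 0 = P" "nmem s2 ''K'' 0 = K"
    unfolding s2_def using in1 PK by (simp_all add: nmem_den mul_table_def del: den.simps)
  have rl: "nmem s3 ''rl'' i = i * (n + 1)" if "i \<le> n" for i
    unfolding s3_def using mul_table[of "''rl''" "NAdd (nV ''n'') (N 1)" i s2] in2 that by simp
  have in3: "nmem s3 ''n'' 0 = n" "nmem s3 ''m'' 0 = m" "nmem s3 ''l'' 0 = l" "nmem s3 ''P'' 0 = P" "nmem s3 ''K'' 0 = K"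
     "nmem s3 ''rm'' = nmem s2 ''rm''"
    unfolding s3_def using in2 by (simp_all add: nmem_den mul_table_def del: den.simps)
  have r3: "rmem s3 = rmem s0"
  proof
    fix y
    have "rmem s3 y = rmem s2 y" unfolding s3_def by (rule rmem_den) (simp add: mul_table_def)
    also have "\<dots> = rmem s1 y" unfolding s2_def by (rule rmem_den) (simp add: mul_table_def)
    finally show "rmem s3 y = rmem s0 y" using in1 by simp
  qed
  have rq: "rmem s0 ''r'' (e * m + a) = r e a \<and> rmem s0 ''q'' (e * m + a) = q e a" if "e < n" "a < m" for e a
  proof -
    have "e * m + a < Suc e * m" using that by simp
    also have "\<dots> \<le> n * m" using that by (intro mult_le_mono1) simp
    finally have "e * m + a < n * m" .
    moreover have "(e * m + a) div m = e" "(e * m + a) mod m = a" using that by auto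
    ultimately show ?thesis by (simp add: s0_def input_state_def)
  qed
  have inp3: "inp s3" using in3 rm rl rq by (simp add: inp_def r3)
  define s4 where "s4 = den c_max s3"
  define M where "M = rmem s4 ''M'' 0"
  have M: "\<And>e a. e < n \<Longrightarrow> a < m \<Longrightarrow> r e a * q e a \<le> M" "M = 0 \<or> (\<exists>e<n. \<exists>a<m. M = r e a * q e a)"
    using c_max[OF inp3] by (simp_all add: M_def s4_def)
  have in4: "inp s4" "nmem s4 ''P'' 0 = P" "nmem s4 ''K'' 0 = K" "rmem s4 ''Lam'' = (\<lambda>_. 0)"
    unfolding s4_def using inp3 in3 r3
    by (simp_all add: nmem_den rmem_den inp_den c_max_def s0_def input_state_def fun_eq_iff del: den.simps)
  define s5 where "s5 = den (rS ''W'' (ROfNat (N 0)) ;; rS ''best'' (ROfNat (N 0)) ;; nS ''k'' (N 0)) s4"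
  have in5: "inp s5" unfolding s5_def using in4 by (simp add: inp_den del: den.simps)
  have s5: "nmem s5 ''P'' 0 = P" "nmem s5 ''K'' 0 = K" "rmem s5 ''Lam'' = (\<lambda>_. 0)" "rmem s5 ''M'' 0 = M" "rmem s5 ''W'' 0 = 0" "rmem s5 ''best'' 0 = 0"
    "nmem s5 ''k'' 0 = 0"
    using in4 by (simp_all add: s5_def M_def rmem_rset_other)
  have out5: "out_ok s5" using s5 by (simp add: out_ok_def output_policy_def empty_policy)
  let ?nest = "nest pr (lvls pr + 1) (c_body pr)"
  let ?b = "rS ''W'' (RAdd (rV ''W'') (rV ''M'')) ;; c_lev pr ;; ?nest"
  define good where "good W \<Lambda> x \<longleftrightarrow> (\<forall>c<qsize pr. cand W P \<Lambda> c \<le> x)" for W \<Lambda> x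
  let ?I = "\<lambda>i (s :: state). inp s \<and> out_ok s \<and> nmem s ''P'' 0 = P \<and> nmem s ''K'' 0 = K \<and> rmem s ''M'' 0 = M \<and>
     rmem s ''W'' 0 = real i * M \<and> (\<forall>j>lvls pr. rmem s ''Lam'' j = 0) \<and> 0 \<le> rmem s ''best'' 0 \<and>
     (\<forall>w<i. \<forall>\<Lambda>. (\<forall>j\<le>lvls pr. \<Lambda> j \<in> gp pr ` {..<K}) \<and> (\<forall>j>lvls pr. \<Lambda> j = 0) \<longrightarrow> good (real (Suc w) * M) \<Lambda> (rmem s ''best'' 0))"
  have nwb: "''w'' \<notin> nw ?b" using nw_c_body[of pr] by (auto simp: c_lev_def nw_nest nw_c_cand iv_def)
  have ivb: "iv b \<notin> nw (c_body pr)" for b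
  proof -
    have "hd (iv b) = CHR ''v''" by (simp add: iv_def)
    then show ?thesis using nw_c_body[of pr] by (auto simp: nw_c_cand)
  qed
  have ivx: "iv b \<noteq> x" if "hd x \<noteq> CHR ''v''" for b x using that by (auto simp: iv_def)
  have "?I n (den (FFor ''w'' (nV ''n'') ?b) s5)"
  proof (rule den_For[where I = ?I, OF nwb])
    show "nval s5 (nV ''n'') = n" using in5 by (simp add: inp_def)
    have stable: "?I i (nset ''w'' 0 v s) \<longleftrightarrow> ?I i s" for i v s
      using inp_cong'[of "nset ''w'' 0 v s" s] out_ok_cong[of "nset ''w'' 0 v s" s] by (simp add: nmem_nset_other)
    show "?I 0 (nset ''w'' 0 0 s5)" unfolding stable using in5 out5 s5 by simp
    fix i and s :: state assume i: "i < n" and A: "?I i s"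
    define W where "W = real (Suc i) * M"
    define t1 where "t1 = den (rS ''W'' (RAdd (rV ''W'') (rV ''M''))) s"
    define t2 where "t2 = den (c_lev pr) t1"
    have W1: "rmem t1 ''W'' 0 = W" using A by (simp add: t1_def W_def algebra_simps)
    have inp1: "inp t1" unfolding t1_def using A by (simp add: inp_den del: den.simps)
    have lev2: "lev_ok W t2" unfolding t2_def lev_ok_def by (rule c_lev[OF inp1 W1])
    have m2: "nmem t2 y = nmem s y" if "y \<in> {''P'', ''K'', ''k'', ''e'', ''a''}" for y
      using that by (auto simp: t2_def t1_def nmem_den c_lev_def simp del: den.simps)
    have r2: "rmem t2 y = rmem s y" if "y \<in> {''M'', ''Lam'', ''best''}" for y
      using that by (auto simp: t2_def t1_def rmem_den c_lev_def simp del: den.simps)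
    have W2: "rmem t2 ''W'' 0 = W" using W1 by (simp add: t2_def rmem_den c_lev_def del: den.simps)
    have inp2: "inp t2" unfolding t2_def using inp1 by (simp add: inp_den c_lev_def del: den.simps)
    have inv2: "main_inv M W P K t2" unfolding main_inv_def
      using inp2 lev2 W2 A out_ok_cong[of t2 s] by (simp add: m2 r2)
    have N: "main_inv M W P K (den ?nest t2) \<and> rmem t2 ''best'' 0 \<le> rmem (den ?nest t2) ''best'' 0 \<and>
      (\<forall>j\<ge>lvls pr + 1. rmem (den ?nest t2) ''Lam'' j = rmem t2 ''Lam'' j) \<and>
      (\<forall>\<Lambda>. (\<forall>j<lvls pr + 1. \<Lambda> j \<in> gp pr ` {..<K}) \<and> (\<forall>j\<ge>lvls pr + 1. \<Lambda> j = rmem t2 ''Lam'' j) \<longrightarrow>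
         good W \<Lambda> (rmem (den ?nest t2) ''best'' 0))"
    proof (rule nest[where J = "lvls pr + 1" and I = "main_inv M W P K" and good = "good W"])
      show "main_inv M W P K (den (c_body pr) s) \<and> rmem s ''best'' 0 \<le> rmem (den (c_body pr) s) ''best'' 0 \<and>
          good W (rmem s ''Lam'') (rmem (den (c_body pr) s) ''best'' 0)" if "main_inv M W P K s" for s
        using c_body[OF that] by (simp add: good_def)
      show "good W \<Lambda> x'" if "good W \<Lambda> x" "x \<le> x'" for \<Lambda> x x'
        using that by (auto simp: good_def intro: order_trans)
      show "main_inv M W P K (rset ''Lam'' b v s)" if "b < lvls pr + 1" "main_inv M W P K s" for s b v
        using that inp_cong'[of "rset ''Lam'' b v s" s] out_ok_cong[of "rset ''Lam'' b v s" s] ok_cong(1)[of "rset ''Lam'' b v s" s]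
        by (auto simp: main_inv_def rmem_rset_other)
      show "main_inv M W P K (nset (iv b) 0 v s)" if "main_inv M W P K s" for s b v
        using that inp_cong'[of "nset (iv b) 0 v s" s] out_ok_cong[of "nset (iv b) 0 v s" s] ok_cong(1)[of "nset (iv b) 0 v s" s]
        by (auto simp: main_inv_def nmem_nset_other iv_def)
      show "nmem s ''K'' 0 = K" if "main_inv M W P K s" for s using that by (simp add: main_inv_def)
      show "iv b \<notin> nw (c_body pr)" for b by (rule ivb)
      show "''Lam'' \<notin> rw (c_body pr)" using rw_c_body[of pr] by (auto simp: rw_c_cand)
    qed (use inv2 in simp_all)
    define t3 where "t3 = den ?nest t2"
    have t3: "den ?b s = t3" by (simp add: t3_def t2_def t1_def)
    have inv3: "main_inv M W P K t3" "rmem s ''best'' 0 \<le> rmem t3 ''best'' 0" using N by (auto simp: t3_def r2)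
    have g: "good W \<Lambda> (rmem t3 ''best'' 0)" if "\<forall>j\<le>lvls pr. \<Lambda> j \<in> gp pr ` {..<K}" "\<forall>j>lvls pr. \<Lambda> j = 0" for \<Lambda>
      using N that A by (auto simp: t3_def r2 less_Suc_eq_le Suc_le_eq)
    have "good (real (Suc w) * M) \<Lambda> (rmem t3 ''best'' 0)"
      if "w < Suc i" "\<forall>j\<le>lvls pr. \<Lambda> j \<in> gp pr ` {..<K}" "\<forall>j>lvls pr. \<Lambda> j = 0" for w \<Lambda>
    proof (cases "w = i")
      case True
      then show ?thesis using g[OF that(2,3)] by (simp add: W_def)
    next
      case False
      then have "good (real (Suc w) * M) \<Lambda> (rmem s ''best'' 0)" using A that by auto
      then show ?thesis using inv3(2) by (auto simp: good_def intro: order_trans)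
    qed
    then have "?I (Suc i) t3" using inv3 A by (simp add: main_inv_def W_def)
    then show "?I (Suc i) (nset ''w'' 0 (Suc i) (den ?b s))" unfolding stable t3 .
  qed
  moreover have "den (FFor ''w'' (nV ''n'') ?b) s5 = s'"
    by (simp add: s'_def c_main_def s5_def s4_def s3_def s2_def s1_def s0_def)
  ultimately have F: "?I n s'" by simp
  then have out: "out_ok s'" and b0: "0 \<le> rmem s' ''best'' 0" by simp_all
  then show "output_policy s' \<in> policies {..<n} {..<m} l" by (simp add: out_ok_def)
  have val: "policy_val r q (output_policy s') = rmem s' ''best'' 0" using out by (simp add: out_ok_def)
  define Op where "Op = OPT {..<n} {..<m} l r q"
  have gM: "gain r q m e 0 \<le> M" if "e < n" for e
  proof (rule gain_le)
    show "0 \<le> M" using M(2) r0 q01 by auto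
    show "q e a * (r e a - 0) \<le> M" if "a < m" for a using M(1)[OF \<open>e < n\<close> that] by (simp add: mult.commute)
  qed
  have "(1 - 100 / real pr) * Op \<le> rmem s' ''best'' 0"
  proof (cases "Op \<le> 0")
    case True
    have "Op = 0" using True opt_le_OPT[of "[]" l] by (simp add: Op_def)
    then show ?thesis using b0 by simp
  next
    case False
    obtain es where es: "distinct es" "set es \<subseteq> {..<n}" "length es \<le> l" "comp_val r q m es 0 = Op"
      using OPT_comp_val unfolding Op_def by blast
    have cv: "comp_val r q m xs 0 \<le> real (length xs) * M \<and> 0 \<le> comp_val r q m xs 0" if "set xs \<subseteq> {..<n}" for xs
      using that
    proof (induction xs)
      case Nil
      then show ?case by (simp add: comp_val_def)
    next
      case (Cons e xs)
      define v where "v = comp_val r q m xs 0"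
      have v: "v \<le> real (length xs) * M" "0 \<le> v" using Cons by (auto simp: v_def)
      have "gain r q m e v \<le> gain r q m e 0" using Cons v by (intro gain_antimono) auto
      also have "\<dots> \<le> M" using Cons gM by simp
      finally have "v + gain r q m e v \<le> real (length (e # xs)) * M" using v by (simp add: algebra_simps)
      then show ?case using v by (simp add: comp_val_def v_def)
    qed
    have Ol: "Op \<le> real (length es) * M" using cv[OF es(2)] es(4) by simp
    have l1: "1 \<le> l" using es(3) Ol False by (cases l) auto
    have M0: "0 < M" using Ol False by (metis M(2) mult_nonneg_nonpos not_le of_nat_0_le_iff order_trans le_less_linear)
    then obtain e a where ea: "e < n" "a < m" "M = r e a * q e a" using M(2) by auto
    have "M \<le> gain r q m e 0" using gain_ge[OF ea(2), of q e r 0] ea(3) by (simp add: mult.commute)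
    also have "\<dots> \<le> opt r q m [e] l" using l1 by (cases l) auto
    also have "\<dots> \<le> Op" unfolding Op_def using ea(1) by (intro opt_le_OPT) auto
    finally have MO: "M \<le> Op" .
    have On: "Op \<le> real n * M"
    proof -
      have "real (length es) * M \<le> real n * M" using es(3) l_le M0 by (intro mult_right_mono) auto
      then show ?thesis using Ol by simp
    qed
    \<comment> \<open>Since \<open>Op\<close> lies between \<open>M\<close> and
      \<open>n * M\<close>, rounding the quotient down gives one of the \<open>n\<close> guesses,
      and a number that is at least 1 loses less than half by rounding down.\<close>
    define w where "w = nat \<lfloor>Op / M\<rfloor>"
    have OM: "1 \<le> Op / M" "Op / M \<le> real n" using MO On M0 by (auto simp: field_simps)
    then have rw': "real w = of_int \<lfloor>Op / M\<rfloor>" by (simp add: w_def)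
    have w: "real w \<le> Op / M" "Op / M < real w + 1" unfolding rw' by linarith+
    have w1: "1 \<le> w" using OM by (simp add: w_def le_nat_iff le_floor_iff)
    have wn: "w \<le> n" using w(1) OM(2) by linarith
    define W where "W = real w * M"
    have W: "0 < W" "W \<le> Op" "Op \<le> 2 * W"
    proof -
      show "0 < W" using w1 M0 by (simp add: W_def)
      show "W \<le> Op" using w(1) M0 by (simp add: W_def field_simps)
      have "Op \<le> (real w + 1) * M" using w(2) M0 by (simp add: field_simps)
      also have "\<dots> \<le> (real w + real w) * M" using w1 M0 by (intro mult_right_mono) auto
      finally show "Op \<le> 2 * W" by (simp add: W_def)
    qed
    have gW: "gain r q m e 0 \<le> W" if "e < n" for e
    proof -
      have "1 * M \<le> W" unfolding W_def using w1 M0 by (intro mult_right_mono) auto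
      then show ?thesis using gM[OF that] by simp
    qed
    have off: "2 * pr * (lvls pr + 1) \<le> 2 ^ lg_off pr" "pr ^ 5 \<le> 2 ^ lg_off pr"
    proof -
      have "lg_off pr < 2 ^ lg_off pr" by (rule less_exp)
      then show "2 * pr * (lvls pr + 1) \<le> 2 ^ lg_off pr" "pr ^ 5 \<le> 2 ^ lg_off pr"
        unfolding lg_off_def by linarith+
    qed
    have lg1: "1 \<le> lgt" using N2 by (simp add: lgt_def lg_off_def)
    have "2 * pr * (lvls pr + 1) * (n + 1) \<le> 2 ^ lgt"
      unfolding lgt_def power_add using off(1) lg(1) by (intro mult_le_mono)
    then have "real (2 * pr * (lvls pr + 1) * (n + 1)) \<le> real (2 ^ lgt)" by (rule of_nat_mono)
    then have lg2: "2 * real pr * (real (lvls pr) + 1) * (real n + 1) \<le> 2 ^ lgt" by (simp add: algebra_simps)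
    have "pr ^ 5 \<le> 2 ^ lgt" unfolding lgt_def power_add using off(2) mult_le_mono[OF off(2), of 1 "2 ^ lg"] by simp
    then have "real (pr ^ 5) \<le> real (2 ^ lgt)" by (rule of_nat_mono)
    then have lg3: "real pr ^ 5 \<le> 2 ^ lgt" by simp
    obtain \<Lambda> c where \<Lambda>: "\<forall>j. \<Lambda> j \<in> grid pr (6 * pr\<^sup>2 * lgt\<^sup>2 + 1)" "\<forall>j>lvls pr. \<Lambda> j = 0" "c < qsize pr"
      "(1 - 100 / real pr) * Op \<le> cand W P \<Lambda> c"
      using candidate_good[OF W[unfolded Op_def] gW lg1 lg2 lg3] unfolding Op_def P_def by blast
    have "\<forall>j\<le>lvls pr. \<Lambda> j \<in> gp pr ` {..<K}" using \<Lambda>(1) grid_gp[of pr "6 * pr\<^sup>2 * lgt\<^sup>2 + 1"] by (auto simp: K_def)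
    moreover have "real (Suc (w - 1)) * M = W" "w - 1 < n" using w1 wn by (auto simp: W_def)
    ultimately have "good W \<Lambda> (rmem s' ''best'' 0)" using F \<Lambda>(2) by metis
    then show ?thesis using \<Lambda>(3,4) by (force simp: good_def)
  qed
  then show "(1 - 100 / real pr) * OPT {..<n} {..<m} l r q \<le> policy_val r q (output_policy s')"
    using val by (simp add: Op_def)
qed

end

section \<open>Running time\<close>

primrec depth :: "fcom \<Rightarrow> nat" where
  "depth FSkip = 0"
| "depth (FN x i a) = 0"
| "depth (FR x i a) = 0"
| "depth (c ;; d) = max (depth c) (depth d)"
| "depth (FIf b c d) = max (depth c) (depth d)"
| "depth (FFor x b c) = Suc (depth c)"

abbreviation "sz \<equiv> tb (\<lambda>_. 1)"

text \<open>With all loop bounds set to 1, \<open>tb\<close> measures the text of the program; a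
  piece of text inside at most \<open>k\<close> loops is executed at most \<open>B ^ k\<close>
  times.\<close>

lemma tb_le_sz:
  assumes "\<And>b. b \<in> bnds c \<Longrightarrow> w b \<le> B" "1 \<le> B" "depth c \<le> k"
  shows "tb w c \<le> sz c * B ^ k"
  using assms
proof (induction c arbitrary: k)
  case (FSeq c d)
  then have "tb w c \<le> sz c * B ^ k" "tb w d \<le> sz d * B ^ k" by auto
  then show ?case by (simp add: add_mult_distrib)
next
  case (FIf b c d)
  then have "tb w c \<le> sz c * B ^ k" "tb w d \<le> sz d * B ^ k" by auto
  moreover have "(1 + bcost b) * 1 \<le> (1 + bcost b) * B ^ k" using FIf.prems by (intro mult_le_mono2) simp
  ultimately show ?case by (simp add: add_mult_distrib)
next
  case (FFor x b c)
  then obtain k' where k: "k = Suc k'" "depth c \<le> k'" by (cases k) auto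
  have IH: "tb w c \<le> sz c * B ^ k'" using FFor k by auto
  have B1: "1 \<le> B ^ k'" "1 \<le> B ^ k" using FFor.prems by simp_all
  have "w b * (10 + ncost b + tb w c) \<le> B * ((10 + ncost b) * B ^ k' + sz c * B ^ k')"
    using FFor.prems IH mult_le_mono2[OF B1(1), of "10 + ncost b"] by (intro mult_le_mono add_mono) auto
  also have "\<dots> = (10 + ncost b + sz c) * B ^ k" by (simp add: k algebra_simps)
  finally have "w b * (10 + ncost b + tb w c) \<le> (10 + ncost b + sz c) * B ^ k" .
  moreover have "7 + ncost b \<le> (7 + ncost b) * B ^ k" using mult_le_mono2[OF B1(2), of "7 + ncost b"] by simp
  ultimately show ?case by (simp add: add_mult_distrib)
next
  case FSkip
  then show ?case by simp
next
  case (FN x i a)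
  then have "(1 + ncost i + ncost a) * 1 \<le> (1 + ncost i + ncost a) * B ^ k" by (intro mult_le_mono2) simp
  then show ?case by simp
next
  case (FR x i a)
  then have "(1 + ncost i + rcost a) * 1 \<le> (1 + ncost i + rcost a) * B ^ k" by (intro mult_le_mono2) simp
  then show ?case by simp
qed

section \<open>Loop bounds and text size of the program\<close>

lemma ncost_nmulc [simp]: "ncost (nmulc k a) = 1 + k * (1 + ncost a)"
  by (induction k) auto

lemma rcost_rsum [simp]: "rcost (rsum f k) = 2 + (\<Sum>j<k. 1 + rcost (f j))"
  by (induction k) auto

lemma tb_fseq [simp]: "tb w (fseq f k) = 1 + (\<Sum>j<k. tb w (f j))"
  by (induction k) auto

lemma no_clash_fseq [simp]: "no_clash (fseq f k) \<longleftrightarrow> (\<forall>j<k. no_clash (f j))"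
  by (induction k) (auto simp: less_Suc_eq)

lemma bnds_fseq: "bnds (fseq f k) = (\<Union>j<k. bnds (f j))"
  by (induction k) (auto simp: less_Suc_eq)

lemma depth_fseq: "(\<And>j. j < k \<Longrightarrow> depth (f j) \<le> d) \<Longrightarrow> depth (fseq f k) \<le> d"
  by (induction k) auto

lemmas expr_defs = HX_def IX_def TAU_def RQ_def FX_def

lemma no_clash_body: "no_clash (c_body pr)"
  by (auto simp: code_defs nw_fseq digit_def)

lemma no_clash_nest: "no_clash c \<Longrightarrow> (\<And>b. iv b \<notin> nw c) \<Longrightarrow> no_clash (nest pr b c)"
  by (induction b) (auto simp: nw_nest)

lemma iv_notin_body: "iv b \<notin> nw (c_body pr)"
proof -
  have "hd (iv b) = CHR ''v''" by (simp add: iv_def)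
  then show ?thesis using nw_c_body[of pr] by (auto simp: nw_c_cand)
qed

lemma nw_main: "nw (c_main pr) \<inter> {''n'', ''m'', ''l'', ''P'', ''K''} = {}"
proof -
  show ?thesis using nw_c_body[of pr]
    by (auto simp: c_main_def mul_table_def c_max_def c_lev_def nw_nest nw_c_cand iv_def simp del: nest.simps)
qed

lemma no_clash_main: "no_clash (c_main pr)"
proof -
  have "''w'' \<notin> nw (nest pr b (c_body pr))" for b
    using nw_c_body[of pr] by (auto simp: nw_nest nw_c_cand iv_def)
  then show ?thesis
    using no_clash_nest[OF no_clash_body iv_notin_body]
    by (auto simp: c_main_def mul_table_def c_max_def c_lev_def simp del: nest.simps)
qed

lemma bnds_body: "bnds (c_body pr) \<subseteq> {nV ''n'', nV ''m'', nV ''l'', nV ''P'', N (lvls pr), N (lvls pr + 1), N (2 * lvls pr), N (dres pr), N (qsize pr)}"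
  by (auto simp: code_defs bnds_fseq digit_def)

lemma bnds_nest: "bnds (nest pr b c) \<subseteq> insert (nV ''K'') (bnds c)"
  by (induction b) auto

lemma bnds_main: "bnds (c_main pr) \<subseteq> insert (nV ''K'') {nV ''n'', nV ''m'', nV ''l'', nV ''P'', N (lvls pr), N (lvls pr + 1), N (2 * lvls pr), N (dres pr), N (qsize pr)}"
  using bnds_nest[of pr "lvls pr + 1" "c_body pr"] bnds_body[of pr]
  by (auto simp: c_main_def mul_table_def c_max_def c_lev_def simp del: nest.simps)

lemma depth_body: "depth (c_body pr) \<le> 4"
  by (simp add: code_defs digit_def) (intro conjI depth_fseq order_trans[OF depth_fseq]; simp add: digit_def depth_fseq)

text \<open>Each loop multiplies the time by about \<open>K\<close>. The summand 100 absorbs the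
  overhead of the iterations, and the factor 2 absorbs this summand:
  \<open>K * (X + 60) + 120\<close> is at most \<open>2 * K * (X + 100)\<close>.\<close>

lemma tb_nest:
  assumes "1 \<le> w (nV ''K'')"
  shows "tb w (nest pr b c) + 100 \<le> (2 * w (nV ''K'')) ^ b * (tb w c + 100)"
proof (induction b)
  case (Suc b)
  define K where "K = w (nV ''K'')"
  define X where "X = tb w (nest pr b c)"
  have K: "1 \<le> K" using assms by (simp add: K_def)
  have "tb w (nest pr (Suc b) c) + 100 \<le> K * (X + 60) + 120 * 1"
    by (simp add: K_def X_def algebra_simps)
  also have "\<dots> \<le> K * (X + 60) + 120 * K" using K by (intro add_left_mono mult_le_mono2)
  also have "\<dots> = K * (X + 180)" by (simp add: algebra_simps)
  also have "\<dots> \<le> K * (2 * (X + 100))" by (intro mult_le_mono2) simp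
  also have "\<dots> \<le> K * (2 * ((2 * K) ^ b * (tb w c + 100)))"
    using Suc by (intro mult_le_mono2) (simp add: K_def X_def)
  finally show ?case by (simp add: K_def mult_ac)
qed simp

lemma qsize_ge:
  assumes "2 \<le> pr"
  shows "2 * lvls pr + 1 \<le> qsize pr" "dres pr \<le> qsize pr"
proof -
  have p4: "16 \<le> pr ^ 4" using power_mono[OF assms, of 4] by simp
  have "pr * 16 \<le> pr * pr ^ 4" by (intro mult_le_mono2 p4)
  also have "\<dots> = pr ^ 5" by (simp add: numeral_eq_Suc)
  finally have h: "pr * 16 \<le> pr ^ 5" .
  have u: "1 \<le> ubase pr" by (simp add: ubase_def)
  then have u': "ubase pr ^ 1 \<le> ubase pr ^ (3 * lvls pr + 1)" by (intro power_increasing) auto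
  have "(hmax pr + 1) * 1 \<le> qsize pr" unfolding qsize_def using u by (intro mult_le_mono2) simp
  then show "2 * lvls pr + 1 \<le> qsize pr" using h assms by (simp add: hmax_def lvls_def)
  have "1 * dres pr \<le> hmax pr * (dres pr + dpad pr)" using assms by (intro mult_le_mono) (auto simp: hmax_def)
  then have "dres pr \<le> ubase pr" by (simp add: ubase_def)
  also have "\<dots> \<le> 1 * ubase pr ^ (3 * lvls pr + 1)" using u' by simp
  also have "\<dots> \<le> qsize pr" unfolding qsize_def by (intro mult_le_mono1) simp
  finally show "dres pr \<le> qsize pr" .
qed

text \<open>The text grows with \<open>pr\<close> through the unrolled loops and through
  multiplications by constants such as \<open>qsize pr\<close>; the explicit polynomial is obtained
  by evaluating the cost functions.\<close>

lemma sz_body: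
  assumes "2 \<le> pr"
  shows "sz (c_body pr) \<le> 100000 * qsize pr ^ 3"
proof -
  let ?J = "lvls pr" and ?Q = "qsize pr"
  have Q: "?J \<le> ?Q" "1 \<le> ?Q" using qsize_ge(1)[OF assms] by simp_all
  have Q3: "?Q ^ i \<le> ?Q ^ 3" if "i \<le> 3" for i using Q that by (intro power_increasing) auto
  have J: "?J ^ i \<le> ?Q ^ 3" if "i \<le> 3" for i
    using power_mono[OF Q(1), of i] Q3[OF that] by simp
  have eq: "sz (c_body pr) = 12 * ?Q + 231 * ?J + 1074 + 124 * ?J ^ 2 + 18 * ?J ^ 3"
    by (simp add: code_defs expr_defs digit_def algebra_simps power2_eq_square power3_eq_cube)
  have "?J ^ 3 \<le> ?Q ^ 3" by (rule J) simp
  moreover have "?Q \<le> ?Q ^ 3" "1 \<le> ?Q ^ 3" "?J \<le> ?Q ^ 3" "?J ^ 2 \<le> ?Q ^ 3"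
    using Q3[of 1] Q3[of 0] J[of 1] J[of 2] by simp_all
  ultimately show ?thesis unfolding eq by linarith
qed

lemma sz_pre:
  assumes "2 \<le> pr"
  shows "sz c_max + sz (c_lev pr) + sz (mul_table ''rl'' (NAdd (nV ''n'') (N 1))) + sz (mul_table ''rm'' (nV ''m'')) + sz (c_log pr)
     \<le> 100000 * qsize pr ^ 3"
proof -
  let ?J = "lvls pr" and ?Q = "qsize pr"
  have Q: "?J \<le> ?Q" "1 \<le> ?Q" "pr \<le> ?Q" using qsize_ge(1)[OF assms] by (simp_all add: lvls_def)
  have Q3: "?Q ^ i \<le> ?Q ^ 3" if "i \<le> 3" for i using Q that by (intro power_increasing) auto
  have J: "pr ^ i \<le> ?Q ^ 3" if "i \<le> 3" for i
    using power_mono[OF Q(3), of i] Q3[OF that] by simp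
  have eq: "sz c_max + sz (c_lev pr) + sz (mul_table ''rl'' (NAdd (nV ''n'') (N 1))) + sz (mul_table ''rm'' (nV ''m'')) + sz (c_log pr)
     = 3 * pr + 6 * ?J + 18 * pr ^ 2 + 359"
    by (simp add: c_max_def c_lev_def mul_table_def c_log_def expr_defs algebra_simps power2_eq_square power3_eq_cube)
  show ?thesis unfolding eq using Q3[of 1] Q3[of 0] J[of 1] J[of 2] Q(1) by simp
qed

text \<open>The loops over \<open>K\<close> are kept apart because they are nested
  \<open>lvls pr + 1\<close> deep. All other bounds are at most \<open>B\<close>: four nested loops
  inside the body and one for the guess of \<open>OPT\<close> give the exponent 5.\<close>

lemma tb_main:
  assumes "2 \<le> pr" "\<And>b. b \<in> bnds (c_main pr) \<union> bnds (c_log pr) \<Longrightarrow> b \<noteq> nV ''K'' \<Longrightarrow> w b \<le> B"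
    and "1 \<le> B" "1 \<le> w (nV ''K'')"
  shows "tb w (c_main pr) + tb w (c_log pr) \<le> 10 * (100000 * qsize pr ^ 3) * ((2 * w (nV ''K'')) ^ (lvls pr + 1) * B ^ 5)"
proof -
  define S where "S = 100000 * qsize pr ^ 3"
  define Z where "Z = (2 * w (nV ''K'')) ^ (lvls pr + 1)"
  have "1 \<le> qsize pr" using qsize_ge(1)[OF assms(1)] by simp
  then have S: "100000 \<le> S" by (simp add: S_def)
  have Z: "1 \<le> Z" using assms(4) by (simp add: Z_def)
  have Bp: "B ^ i \<le> B ^ j" if "i \<le> j" for i j using that assms(3) by (intro power_increasing) auto
  have ne: "nV ''K'' \<notin> bnds (c_body pr)" "nV ''K'' \<notin> bnds c" if "c \<in> {c_max, c_lev pr, mul_table ''rl'' (NAdd (nV ''n'') (N 1)), mul_table ''rm'' (nV ''m''), c_log pr}" for c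
    using that bnds_body[of pr] by (auto simp: c_max_def c_lev_def mul_table_def c_log_def)
  have sub: "bnds (c_body pr) \<subseteq> bnds (c_main pr)"
  proof -
    have "bnds c \<subseteq> bnds (nest pr b c)" for b c by (induction b) auto
    then show ?thesis by (auto simp: c_main_def simp del: nest.simps)
  qed
  have pc: "tb w c \<le> sz c * B ^ 4" if "c \<in> {c_max, c_lev pr, mul_table ''rl'' (NAdd (nV ''n'') (N 1)), mul_table ''rm'' (nV ''m''), c_log pr}" for c
  proof (rule tb_le_sz)
    fix b assume b: "b \<in> bnds c"
    have "bnds c \<subseteq> bnds (c_main pr) \<union> bnds (c_log pr)"
      using that by (auto simp: c_main_def simp del: nest.simps)
    then show "w b \<le> B" using b ne(2)[OF that] assms(2) by blast
  next
    show "depth c \<le> 4" using that by (auto simp: c_max_def c_lev_def mul_table_def c_log_def)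
  qed (rule assms(3))
  have body: "tb w (c_body pr) \<le> S * B ^ 4"
  proof -
    have "tb w (c_body pr) \<le> sz (c_body pr) * B ^ 4"
      using sub ne(1)[of c_max] assms(2) by (intro tb_le_sz assms(3) depth_body) auto
    also have "\<dots> \<le> S * B ^ 4" unfolding S_def by (intro mult_le_mono1 sz_body assms(1))
    finally show ?thesis .
  qed
  have "tb w (nest pr (lvls pr + 1) (c_body pr)) + 100 \<le> Z * (S * B ^ 4 + 100)"
    using tb_nest[of w pr "lvls pr + 1" "c_body pr", OF assms(4)] body unfolding Z_def
    by (meson add_mono le_refl mult_le_mono order_trans)
  also have "\<dots> \<le> Z * (S * B ^ 4 + S * B ^ 4)"
  proof -
    have "100 * 1 \<le> S * B ^ 4" using S assms(3) by (intro mult_le_mono) auto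
    then show ?thesis by simp
  qed
  finally have nest: "tb w (nest pr (lvls pr + 1) (c_body pr)) + 100 \<le> 2 * (Z * S * B ^ 4)"
    by (simp add: algebra_simps)
  define p where "p = sz c_max + sz (mul_table ''rl'' (NAdd (nV ''n'') (N 1))) + sz (mul_table ''rm'' (nV ''m'')) + sz (c_log pr)"
  have pre: "tb w c_max + tb w (mul_table ''rl'' (NAdd (nV ''n'') (N 1))) + tb w (mul_table ''rm'' (nV ''m'')) + tb w (c_log pr) \<le> p * B ^ 4"
    using pc[of c_max] pc[of "mul_table ''rl'' (NAdd (nV ''n'') (N 1))"] pc[of "mul_table ''rm'' (nV ''m'')"] pc[of "c_log pr"]
    unfolding p_def add_mult_distrib by simp
  have lev: "tb w (c_lev pr) \<le> sz (c_lev pr) * B ^ 4" by (rule pc) simp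
  have wn: "w (nV ''n'') \<le> B" by (rule assms(2)) (auto simp: c_log_def)
  have S': "p + sz (c_lev pr) \<le> S" using sz_pre[OF assms(1)] by (simp add: S_def p_def)
  have ZB: "S * B ^ 4 \<le> Z * S * B ^ 4" "1 * 1 \<le> S * B ^ 4"
    using Z S assms(3) by (simp_all add: mult_le_mono)
  have lev': "tb w (c_lev pr) \<le> S * B ^ 4" "p * B ^ 4 \<le> S * B ^ 4"
    using lev mult_le_mono1[of "sz (c_lev pr)" S "B ^ 4"] mult_le_mono1[of p S "B ^ 4"] S' by linarith+
  have inner: "tb w (c_lev pr) + tb w (nest pr (lvls pr + 1) (c_body pr)) + 100 \<le> 3 * (Z * S * B ^ 4)"
    using lev' nest ZB by linarith
  have "tb w (c_main pr) + tb w (c_log pr) \<le> (tb w c_max + tb w (mul_table ''rl'' (NAdd (nV ''n'') (N 1))) + tb w (mul_table ''rm'' (nV ''m'')) + tb w (c_log pr))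
     + 100 + w (nV ''n'') * (tb w (c_lev pr) + tb w (nest pr (lvls pr + 1) (c_body pr)) + 100)"
    by (simp add: c_main_def algebra_simps del: nest.simps)
  also have "\<dots> \<le> Z * S * B ^ 4 + 100 * (Z * 1 * B ^ 4) + B * (3 * (Z * S * B ^ 4))"
    using pre lev'(2) ZB wn inner Z assms(3) by (intro add_mono mult_le_mono) (linarith | simp)+
  also have "\<dots> \<le> B * (Z * S * B ^ 4) + B * (Z * S * B ^ 4) + B * (3 * (Z * S * B ^ 4))"
  proof -
    have "1 * (Z * S * B ^ 4) \<le> B * (Z * S * B ^ 4)" using assms(3) by (intro mult_le_mono1)
    moreover have "100 * (Z * 1 * B ^ 4) \<le> Z * S * B ^ 4" using S by simp
    ultimately show ?thesis by linarith
  qed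
  also have "\<dots> \<le> 10 * S * (Z * B ^ 5)" by (simp add: numeral_eq_Suc algebra_simps)
  finally show ?thesis by (simp add: S_def Z_def)
qed

text \<open>Turns the factor \<open>(log n) ^ O(1/\<epsilon>)\<close> for enumerating the multipliers into one depending on \<open>\<epsilon>\<close>
  times \<open>O(n)\<close>.\<close>

lemma power_le_mult_two_power: "(g + 1) ^ q \<le> q ^ q * 2 ^ (g + 1)" if "1 \<le> q" for g q :: nat
proof -
  have "g + 1 \<le> q * ((g + 1) div q + 1)"
    using that dividend_less_times_div[of q "g + 1"] by simp
  also have "\<dots> \<le> q * 2 ^ ((g + 1) div q)"
    by (intro mult_le_mono2) (metis Suc_eq_plus1 Suc_leI less_exp)
  finally have "(g + 1) ^ q \<le> (q * 2 ^ ((g + 1) div q)) ^ q" by (intro power_mono) auto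
  also have "\<dots> = q ^ q * 2 ^ ((g + 1) div q * q)" by (simp add: power_mult_distrib power_mult)
  also have "\<dots> \<le> q ^ q * 2 ^ (g + 1)" by (intro mult_le_mono2 power_increasing) auto
  finally show ?thesis .
qed

section \<open>Bounding everything by powers of the precision\<close>

lemma add_le_power_Suc: "a + b \<le> p ^ Suc k" if "2 \<le> p" "a \<le> p ^ k" "b \<le> p ^ k" for a b p :: nat
proof -
  have "a + b \<le> 2 * p ^ k" using that by simp
  also have "\<dots> \<le> p * p ^ k" using that by (intro mult_le_mono1)
  finally show ?thesis by simp
qed

lemma mult_le_power_add: "a * b \<le> p ^ (j + k)" if "a \<le> p ^ j" "b \<le> p ^ k" for a b p :: nat
  using mult_le_mono[OF that] by (simp add: power_add)

lemma power_le_power_mult: "a ^ k \<le> p ^ (j * k)" if "a \<le> p ^ j" for a p :: nat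
  using power_mono[OF that, of k] by (simp add: power_mult)

lemma le_power_mono: "a \<le> p ^ k" if "a \<le> p ^ j" "j \<le> k" "2 \<le> p" for a p :: nat
  using that power_increasing[of j k p] by linarith

lemma numeral_le_power: "c \<le> p ^ k" if "c \<le> 2 ^ k" "2 \<le> p" for c p :: nat
  using that power_mono[of 2 p k] by linarith

text \<open>All constants are bounded by powers of \<open>pr\<close>, where
  \<open>2 \<le> pr\<close> lets a sum cost one more factor, so that only exponents need be tracked.
  The final exponent is linear in \<open>pr\<close> because a sum of codes has
  \<open>6 * pr + 5\<close> digits, each polynomial in \<open>pr\<close>.\<close>

lemma qsize_le:
  assumes "2 \<le> pr"
  shows "qsize pr \<le> pr ^ (188 * pr)"
proof -
  have p1: "1 \<le> pr ^ k" for k using assms by simp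
  have two: "2 \<le> pr ^ 1" using assms by simp
  have h: "hmax pr \<le> pr ^ (1 + 5)" unfolding hmax_def by (intro mult_le_power_add two order_refl)
  have h1: "hmax pr + 1 \<le> pr ^ Suc 6" using h by (intro add_le_power_Suc assms p1) simp
  have hd: "hmax pr * dres pr \<le> pr ^ (6 + 8)" unfolding dres_def using h by (intro mult_le_power_add) auto
  have dp: "dpad pr \<le> pr ^ Suc 14" unfolding dpad_def using hd by (intro add_le_power_Suc assms p1) simp
  have "dres pr \<le> pr ^ 15" by (rule le_power_mono[of _ _ 8]) (simp_all add: dres_def assms)
  then have dd: "dres pr + dpad pr \<le> pr ^ Suc 15" using dp by (intro add_le_power_Suc assms) simp_all
  have "hmax pr * (dres pr + dpad pr) \<le> pr ^ (6 + 16)" using h dd by (intro mult_le_power_add) simp_all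
  then have "ubase pr \<le> pr ^ Suc 22" unfolding ubase_def by (intro add_le_power_Suc assms p1) simp
  then have "ubase pr ^ (3 * lvls pr + 1) \<le> pr ^ (23 * (3 * lvls pr + 1))" by (intro power_le_power_mult) simp
  then have "qsize pr \<le> pr ^ (7 + 23 * (3 * lvls pr + 1))" unfolding qsize_def using h1 by (intro mult_le_power_add) simp_all
  then show ?thesis by (rule le_power_mono) (use assms in \<open>simp_all add: lvls_def\<close>)
qed

lemma lg_off_le:
  assumes "2 \<le> pr"
  shows "lg_off pr + 1 \<le> pr ^ 7"
proof -
  have "4 \<le> pr ^ 2" by (rule numeral_le_power) (use assms in simp_all)
  then have "4 * pr ^ 1 \<le> pr ^ (2 + 1)" "4 * pr ^ 2 \<le> pr ^ (2 + 2)"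
    by (intro mult_le_power_add order_refl; assumption)+
  then have "4 * pr \<le> pr ^ 4" "4 * pr ^ 2 \<le> pr ^ 4"
    using le_power_mono[of "4 * pr" pr 3 4] assms by simp_all
  then have "4 * pr + 4 * pr ^ 2 \<le> pr ^ Suc 4" by (intro add_le_power_Suc assms)
  then have "(4 * pr + 4 * pr ^ 2) + pr ^ 5 \<le> pr ^ Suc 5" using assms by (intro add_le_power_Suc) simp_all
  then have "((4 * pr + 4 * pr ^ 2) + pr ^ 5) + 1 \<le> pr ^ Suc 6" using assms by (intro add_le_power_Suc) simp_all
  then show ?thesis by (simp add: lg_off_def lvls_def algebra_simps power2_eq_square)
qed

text \<open>\<open>X\<close> will be \<open>n + m + 1\<close>. Five of its six factors come from
  \<open>B ^ 5\<close>; the sixth comes from \<open>power_le_mult_two_power\<close>, as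
  \<open>2 ^ g\<close> is at most \<open>2 * (n + 1)\<close>.\<close>

lemma time_bound:
  fixes pr g n X :: nat
  assumes "2 \<le> pr" "2 ^ g \<le> 2 * (n + 1)" "n + 1 \<le> X"
    and K: "K = 6 * pr\<^sup>2 * (lg_off pr + g)\<^sup>2 + 2" and B: "B = 2 * pr * (lg_off pr + 1) * qsize pr * X"
  shows "10 * (100000 * qsize pr ^ 3) * ((2 * K) ^ (lvls pr + 1) * B ^ 5) \<le> pr ^ (2000 * pr) * X ^ 6"
proof -
  define Q where "Q = qsize pr"
  define L where "L = lg_off pr + 1"
  define q where "q = 4 * pr + 4"
  have L: "L \<le> pr ^ 7" using lg_off_le[OF assms(1)] by (simp add: L_def)
  have Q: "Q \<le> pr ^ (188 * pr)" using qsize_le[OF assms(1)] by (simp add: Q_def)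
  have pL: "1 \<le> pr * L" using assms(1) by (simp add: L_def)
  have "2 * K \<le> (4 * (pr * L) * (g + 1))\<^sup>2"
  proof -
    define x where "x = pr * (L * (g + 1))"
    have "lg_off pr + g \<le> L * (g + 1)" by (simp add: L_def algebra_simps)
    then have "pr * (lg_off pr + g) \<le> x" unfolding x_def by (rule mult_le_mono2)
    then have "(pr * (lg_off pr + g))\<^sup>2 \<le> x\<^sup>2" by (rule power_mono) simp
    moreover have "1 * 1 \<le> x" unfolding x_def mult.assoc[symmetric] by (intro mult_le_mono pL) simp
    then have "1 \<le> x\<^sup>2" by simp
    ultimately have "2 * K \<le> 16 * x\<^sup>2" unfolding K by (simp add: power_mult_distrib)
    also have "\<dots> = (4 * x)\<^sup>2" by (simp add: power_mult_distrib)
    also have "4 * x = 4 * (pr * L) * (g + 1)" by (simp only: x_def mult.assoc)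
    finally show ?thesis .
  qed
  then have "(2 * K) ^ (lvls pr + 1) \<le> ((4 * (pr * L) * (g + 1))\<^sup>2) ^ (lvls pr + 1)" by (rule power_mono) simp
  also have "\<dots> = (4 * (pr * L) * (g + 1)) ^ q"
  proof -
    have "2 * (lvls pr + 1) = q" by (simp add: lvls_def q_def)
    then show ?thesis by (simp only: power_mult[symmetric])
  qed
  also have "\<dots> = (4 * (pr * L)) ^ q * (g + 1) ^ q" by (rule power_mult_distrib)
  also have "\<dots> \<le> (4 * (pr * L)) ^ q * (q ^ q * 2 ^ (g + 1))"
    by (intro mult_le_mono2 power_le_mult_two_power) (simp add: q_def)
  also have "\<dots> \<le> (4 * (pr * L)) ^ q * (q ^ q * (4 * X))" using assms(2,3) by (intro mult_le_mono2) simp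
  finally have KK: "(2 * K) ^ (lvls pr + 1) \<le> (4 * (pr * L) * q) ^ q * (4 * X)" by (simp add: power_mult_distrib mult_ac)
  have "10 * (100000 * Q ^ 3) * ((2 * K) ^ (lvls pr + 1) * B ^ 5)
      \<le> 10 * (100000 * Q ^ 3) * ((4 * (pr * L) * q) ^ q * (4 * X) * B ^ 5)"
    using KK by (intro mult_le_mono2 mult_le_mono1)
  also have "\<dots> = (4000000 * Q ^ 3 * (4 * (pr * L) * q) ^ q * (2 * (pr * L) * Q) ^ 5) * X ^ 6"
  proof -
    have "10 * (100000 * Q ^ 3) * (Y * (4 * X) * (Z * X) ^ 5) = (4000000 * Q ^ 3 * Y * Z ^ 5) * X ^ 6" for Y Z
    proof -
      have "X ^ 6 = X * X ^ 5" by (simp flip: power_Suc)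
      then show ?thesis by (simp add: power_mult_distrib)
    qed
    moreover have "B = 2 * (pr * L) * Q * X" by (simp only: B L_def Q_def mult_ac)
    ultimately show ?thesis by (simp only:)
  qed
  also have "4000000 * Q ^ 3 * (4 * (pr * L) * q) ^ q * (2 * (pr * L) * Q) ^ 5 \<le> pr ^ (2000 * pr)"
  proof -
    have c: "4000000 \<le> pr ^ 22" by (rule numeral_le_power) (use assms in simp_all)
    have Q3: "Q ^ 3 \<le> pr ^ ((188 * pr) * 3)" by (rule power_le_power_mult[OF Q])
    have pL: "pr * L \<le> pr ^ (1 + 7)" using L by (intro mult_le_power_add) simp_all
    have two: "2 \<le> pr ^ 1" "4 \<le> pr ^ 2" "8 \<le> pr ^ 3"
      by (rule numeral_le_power; use assms in simp)+
    have "q \<le> 8 * pr ^ 1" using assms(1) by (simp add: q_def)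
    also have "\<dots> \<le> pr ^ (3 + 1)" by (intro mult_le_power_add two order_refl)
    finally have q: "q \<le> pr ^ (3 + 1)" .
    have "4 * (pr * L) * q \<le> pr ^ ((2 + (1 + 7)) + (3 + 1))" by (intro mult_le_power_add two pL q)
    then have a: "(4 * (pr * L) * q) ^ q \<le> pr ^ (((2 + (1 + 7)) + (3 + 1)) * q)" by (rule power_le_power_mult)
    have "2 * (pr * L) * Q \<le> pr ^ ((1 + (1 + 7)) + 188 * pr)" by (intro mult_le_power_add two pL Q)
    then have b: "(2 * (pr * L) * Q) ^ 5 \<le> pr ^ (((1 + (1 + 7)) + 188 * pr) * 5)" by (rule power_le_power_mult)
    have "4000000 * Q ^ 3 * (4 * (pr * L) * q) ^ q * (2 * (pr * L) * Q) ^ 5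
        \<le> pr ^ (((22 + (188 * pr) * 3) + ((2 + (1 + 7)) + (3 + 1)) * q) + ((1 + (1 + 7)) + 188 * pr) * 5)"
      by (intro mult_le_power_add c Q3 a b)
    then show ?thesis by (rule le_power_mono) (use assms in \<open>simp_all add: q_def\<close>)
  qed
  finally show ?thesis by (simp add: Q_def mult_le_mono1)
qed

context star
begin

lemma exec_main:
  defines "s0 \<equiv> input_state n m l r q"
  shows "\<exists>t. t \<le> pr ^ (2000 * pr) * (n + m + 1) ^ 6 \<and>
    exec (to_com (c_log pr ;; c_main pr)) s0 t (den (c_main pr) (den (c_log pr) s0))"
proof -
  define s where "s = den (c_log pr) s0"
  define X where "X = n + m + 1"
  define B where "B = 2 * pr * (lg_off pr + 1) * qsize pr * X"
  define w where "w = nval s"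
  have in0: "nmem s0 ''n'' 0 = n" "nmem s0 ''m'' 0 = m" "nmem s0 ''l'' 0 = l" by (simp_all add: s0_def input_state_def)
  obtain g where g: "2 ^ g \<le> 2 * (n + 1)" "nmem s ''P'' 0 = pr * (lg_off pr + g)" "nmem s ''K'' 0 = 6 * pr\<^sup>2 * (lg_off pr + g)\<^sup>2 + 2"
    using c_log[of s0 pr] in0 unfolding s_def by auto
  have ins: "nmem s ''n'' 0 = n" "nmem s ''m'' 0 = m" "nmem s ''l'' 0 = l"
    unfolding s_def using in0 by (simp_all add: nmem_den c_log_def del: den.simps)
  have Q1: "1 \<le> qsize pr" "2 * lvls pr + 1 \<le> qsize pr" "dres pr \<le> qsize pr" using qsize_ge[OF N2] by simp_all
  have c1: "1 \<le> 2 * pr * (lg_off pr + 1)" using N2 by simp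
  have "1 * qsize pr * 1 \<le> B" unfolding B_def using c1 by (intro mult_le_mono) (auto simp: X_def)
  then have QB: "qsize pr \<le> B" by simp
  have "1 * 1 * X \<le> B" unfolding B_def using c1 Q1 by (intro mult_le_mono) auto
  then have XB: "X \<le> B" by simp
  have "g < 2 * (n + 1)" using g(1) less_exp[of g] by linarith
  then have "lg_off pr + g \<le> 2 * (lg_off pr + 1) * (n + 1)" by (simp add: algebra_simps)
  also have "\<dots> \<le> 2 * (lg_off pr + 1) * X" by (intro mult_le_mono2) (simp add: X_def)
  finally have "pr * (lg_off pr + g) \<le> pr * (2 * (lg_off pr + 1) * X)" by (rule mult_le_mono2)
  also have "\<dots> = 2 * pr * (lg_off pr + 1) * 1 * X" by (simp only: mult_ac mult_1_right)
  also have "\<dots> \<le> B" unfolding B_def using Q1 by (intro mult_le_mono) auto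
  finally have PB: "pr * (lg_off pr + g) \<le> B" .
  have wB: "w b \<le> B" if "b \<in> bnds (c_main pr) \<union> bnds (c_log pr)" "b \<noteq> nV ''K''" for b
  proof -
    have "bnds (c_log pr) \<subseteq> {nV ''n''}" by (simp add: c_log_def)
    then have "b \<in> {nV ''n'', nV ''m'', nV ''l'', nV ''P'', N (lvls pr), N (lvls pr + 1), N (2 * lvls pr), N (dres pr), N (qsize pr)}"
      using that bnds_main[of pr] by blast
    then show ?thesis using ins g(2) Q1 QB XB PB l_le by (auto simp: w_def X_def lvls_def)
  qed
  have wK: "w (nV ''K'') = 6 * pr\<^sup>2 * (lg_off pr + g)\<^sup>2 + 2" using g(3) by (simp add: w_def)
  have "tb w (c_main pr) + tb w (c_log pr) \<le> 10 * (100000 * qsize pr ^ 3) * ((2 * w (nV ''K'')) ^ (lvls pr + 1) * B ^ 5)"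
    using QB Q1 by (intro tb_main N2 wB) (simp_all add: wK)
  also have "\<dots> \<le> pr ^ (2000 * pr) * X ^ 6"
    by (rule time_bound[OF N2 g(1) _ wK B_def]) (simp add: X_def)
  finally have T: "tb w (c_main pr) + tb w (c_log pr) \<le> pr ^ (2000 * pr) * X ^ 6" .
  have "\<exists>t. t \<le> tb w (c_log pr) \<and> exec (to_com (c_log pr)) s0 t (den (c_log pr) s0)"
    by (rule exec_to_com) (use in0 ins in \<open>auto simp: c_log_def w_def simp del: den.simps\<close>)
  then obtain t1 where t1: "t1 \<le> tb w (c_log pr)" "exec (to_com (c_log pr)) s0 t1 s" by (auto simp: s_def)
  have "nvars b \<inter> nw (c_main pr) = {}" if "b \<in> bnds (c_main pr)" for b
    using that bnds_main[of pr] nw_main[of pr] by auto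
  then have "\<exists>t. t \<le> tb w (c_main pr) \<and> exec (to_com (c_main pr)) s t (den (c_main pr) s)"
    by (intro exec_to_com no_clash_main) (auto simp: w_def)
  then obtain t2 where t2: "t2 \<le> tb w (c_main pr)" "exec (to_com (c_main pr)) s t2 (den (c_main pr) s)" by blast
  have "exec (to_com (c_log pr ;; c_main pr)) s0 (t1 + t2) (den (c_main pr) s)"
    using exec.Seq[OF t1(2) t2(2)] by simp
  moreover have "t1 + t2 \<le> pr ^ (2000 * pr) * (n + m + 1) ^ 6" using t1 t2 T by (simp add: X_def)
  ultimately show ?thesis unfolding s_def by blast
qed

end

lemma OPT_nonneg: "star_instance n m l r q \<Longrightarrow> 0 \<le> OPT {..<n} {..<m} l r q"
proof -
  have "policy_val r q ([], []) \<le> OPT {..<n} {..<m} l r q"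
    unfolding OPT_def by (intro Max_ge finite_imageI finite_policies imageI empty_policy) auto
  then show ?thesis by (simp add: policy_val_def)
qed

text \<open>\<open>ln \<epsilon> \<le> \<epsilon>\<close> bounds the power from below by
  \<open>exp (- 2 * c)\<close>. For \<open>\<epsilon>\<close> above 1 the base is smaller than 1,
  and the time bound must still admit a single step.\<close>

lemma one_le_exp_mult_powr:
  fixes \<epsilon> :: real
  assumes "0 < \<epsilon>" "0 \<le> c"
  shows "1 \<le> exp (2 * c) * (1 / \<epsilon>\<^sup>2) powr (c / \<epsilon>)"
proof -
  have "ln \<epsilon> \<le> \<epsilon>" using ln_le_minus_one[OF assms(1)] by simp
  then have "ln \<epsilon> / \<epsilon> \<le> 1" using assms(1) by (simp add: field_simps)
  then have "2 * c * (ln \<epsilon> / \<epsilon>) \<le> 2 * c * 1" using assms(2) by (intro mult_left_mono) auto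
  moreover have "ln (1 / \<epsilon>\<^sup>2) = - (2 * ln \<epsilon>)" using assms(1) by (simp add: ln_div ln_realpow)
  then have "(1 / \<epsilon>\<^sup>2) powr (c / \<epsilon>) = exp (- (2 * c * (ln \<epsilon> / \<epsilon>)))"
    using assms(1) by (simp add: powr_def mult_ac)
  ultimately show ?thesis by (simp add: exp_add[symmetric])
qed

text \<open>\<open>pr\<close> is \<open>100 / (7 * \<epsilon>)\<close> rounded up and hence at most
  \<open>15 / \<epsilon>\<close>. Below 1/7 this is at most the cube of
  \<open>1 / \<epsilon>\<close>, the power 3/2 of the required base. The exponent is therefore
  \<open>2000 * 15 * 3 / 2 = 45000\<close> over \<open>\<epsilon>\<close>.\<close>

lemma precision_exists:
  fixes \<epsilon> :: real
  assumes "0 < \<epsilon>" "\<epsilon> < 1 / 7"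
  obtains pr :: nat where "2 \<le> pr" "100 / real pr \<le> 7 * \<epsilon>"
    "real (pr ^ (2000 * pr)) \<le> (1 / \<epsilon>\<^sup>2) powr (45000 / \<epsilon>)"
proof
  define x where "x = 100 / (7 * \<epsilon>)"
  define pr where "pr = nat \<lceil>x\<rceil>"
  have x: "100 < x" using assms by (simp add: x_def field_simps)
  have pr: "x \<le> real pr" "real pr \<le> x + 1" using x unfolding pr_def by linarith+
  show p2: "2 \<le> pr" using x pr by linarith
  show "100 / real pr \<le> 7 * \<epsilon>" using pr(1) p2 assms by (simp add: x_def field_simps)
  have "x + 1 \<le> 15 / \<epsilon>" using assms by (simp add: x_def field_simps)
  then have p15: "real pr \<le> 15 / \<epsilon>" using pr by linarith
  have "\<epsilon> * \<epsilon> \<le> (1 / 7) * (1 / 7)" using assms by (intro mult_mono) auto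
  then have "15 / \<epsilon> \<le> (1 / \<epsilon>) ^ 3" using assms by (simp add: field_simps numeral_eq_Suc)
  also have "\<dots> = (1 / \<epsilon>) powr 3" using assms by simp
  also have "\<dots> = ((1 / \<epsilon>) powr 2) powr (3 / 2)" by (simp add: powr_powr)
  also have "(1 / \<epsilon>) powr 2 = 1 / \<epsilon>\<^sup>2" using assms by (simp add: power_divide)
  finally have e3: "15 / \<epsilon> \<le> (1 / \<epsilon>\<^sup>2) powr (3 / 2)" .
  have e1: "1 \<le> 15 / \<epsilon>" using assms by simp
  have "real (pr ^ (2000 * pr)) = real pr powr (2000 * real pr)"
    using p2 powr_realpow[of "real pr" "2000 * pr"] by simp
  also have "\<dots> \<le> (15 / \<epsilon>) powr (2000 * real pr)" using p15 by (intro powr_mono2) auto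
  also have "\<dots> \<le> (15 / \<epsilon>) powr (30000 / \<epsilon>)" using p15 e1 by (intro powr_mono) auto
  also have "\<dots> \<le> ((1 / \<epsilon>\<^sup>2) powr (3 / 2)) powr (30000 / \<epsilon>)" using e3 e1 assms by (intro powr_mono2) auto
  also have "\<dots> = (1 / \<epsilon>\<^sup>2) powr (45000 / \<epsilon>)" by (simp add: powr_powr)
  finally show "real (pr ^ (2000 * pr)) \<le> (1 / \<epsilon>\<^sup>2) powr (45000 / \<epsilon>)" .
qed

theorem mainTheorem11:
  "\<exists>(C::real) (c::real) (d::nat). \<forall>\<epsilon>::real. \<epsilon> > 0 \<longrightarrow>
     (\<exists>P. \<forall>n m l r q. star_instance n m l r q \<longrightarrow>
        (\<exists>t s. exec P (input_state n m l r q) t s \<and>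
           real t \<le> C * (1 / \<epsilon>\<^sup>2) powr (c / \<epsilon>) * real (n + m + 1) ^ d \<and>
           output_policy s \<in> policies {..<n} {..<m} l \<and>
           policy_val r q (output_policy s) \<ge> (1 - 7 * \<epsilon>) * OPT {..<n} {..<m} l r q))"
proof (rule exI[of _ "exp (2 * 45000)"], rule exI[of _ 45000], rule exI[of _ 6], intro allI impI)
  fix \<epsilon> :: real
  assume \<epsilon>: "0 < \<epsilon>"
  show "\<exists>P. \<forall>n m l r q. star_instance n m l r q \<longrightarrow>
      (\<exists>t s. exec P (input_state n m l r q) t s \<and>
         real t \<le> exp (2 * 45000) * (1 / \<epsilon>\<^sup>2) powr (45000 / \<epsilon>) * real (n + m + 1) ^ 6 \<and>
         output_policy s \<in> policies {..<n} {..<m} l \<and>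
         policy_val r q (output_policy s) \<ge> (1 - 7 * \<epsilon>) * OPT {..<n} {..<m} l r q)"
  proof (cases "\<epsilon> < 1 / 7")
    case False
    \<comment> \<open>For \<open>\<epsilon>\<close> at least 1/7 the required value is not positive,
      and the empty policy already present in the initial memory attains it.\<close>
    show ?thesis
    proof (intro exI[of _ Skip] allI impI)
      fix n m l r q
      assume inst: "star_instance n m l r q"
      let ?s = "input_state n m l r q"
      have "output_policy ?s = ([], [])" by (simp add: output_policy_def input_state_def)
      moreover have "(1 - 7 * \<epsilon>) * OPT {..<n} {..<m} l r q \<le> 0"
        using False OPT_nonneg[OF inst] by (intro mult_nonpos_nonneg) auto
      moreover have "1 * 1 \<le> exp (2 * 45000) * (1 / \<epsilon>\<^sup>2) powr (45000 / \<epsilon>) * real (n + m + 1) ^ 6"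
        by (intro mult_mono one_le_exp_mult_powr \<epsilon> one_le_power) auto
      ultimately show "\<exists>t s. exec Skip ?s t s \<and>
         real t \<le> exp (2 * 45000) * (1 / \<epsilon>\<^sup>2) powr (45000 / \<epsilon>) * real (n + m + 1) ^ 6 \<and>
         output_policy s \<in> policies {..<n} {..<m} l \<and>
         policy_val r q (output_policy s) \<ge> (1 - 7 * \<epsilon>) * OPT {..<n} {..<m} l r q"
        using exec.Skip[of ?s] empty_policy[of "{..<n}" "{..<m}" l] by (intro exI[of _ 1] exI[of _ ?s]) (simp add: policy_val_def)
    qed
  next
    case True
    from precision_exists[OF \<epsilon> True] obtain pr :: nat where pr: "2 \<le> pr" "100 / real pr \<le> 7 * \<epsilon>"
      "real (pr ^ (2000 * pr)) \<le> (1 / \<epsilon>\<^sup>2) powr (45000 / \<epsilon>)" by blast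
    show ?thesis
    proof (intro exI[of _ "to_com (c_log pr ;; c_main pr)"] allI impI)
      fix n m l r q
      assume inst: "star_instance n m l r q"
      interpret star n m r q l pr
        using inst pr(1) by unfold_locales (auto simp: star_instance_def)
      let ?s = "input_state n m l r q"
      let ?s' = "den (c_main pr) (den (c_log pr) ?s)"
      obtain t where t: "t \<le> pr ^ (2000 * pr) * (n + m + 1) ^ 6"
        "exec (to_com (c_log pr ;; c_main pr)) ?s t ?s'"
        using exec_main by blast
      have "real t \<le> real (pr ^ (2000 * pr)) * real (n + m + 1) ^ 6"
        using t(1) by (metis of_nat_le_iff of_nat_mult of_nat_power)
      also have "\<dots> \<le> (exp (2 * 45000) * (1 / \<epsilon>\<^sup>2) powr (45000 / \<epsilon>)) * real (n + m + 1) ^ 6"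
      proof (intro mult_right_mono)
        have "1 * (1 / \<epsilon>\<^sup>2) powr (45000 / \<epsilon>) \<le> exp (2 * 45000) * (1 / \<epsilon>\<^sup>2) powr (45000 / \<epsilon>)"
          by (intro mult_right_mono) auto
        then show "real (pr ^ (2000 * pr)) \<le> exp (2 * 45000) * (1 / \<epsilon>\<^sup>2) powr (45000 / \<epsilon>)"
          using pr(3) by linarith
      qed simp
      finally have "real t \<le> exp (2 * 45000) * (1 / \<epsilon>\<^sup>2) powr (45000 / \<epsilon>) * real (n + m + 1) ^ 6" .
      moreover have "(1 - 7 * \<epsilon>) * OPT {..<n} {..<m} l r q \<le> (1 - 100 / real pr) * OPT {..<n} {..<m} l r q"
        using pr(2) OPT_nonneg[OF inst] by (intro mult_right_mono) auto
      ultimately show "\<exists>t s. exec (to_com (c_log pr ;; c_main pr)) ?s t s \<and>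
         real t \<le> exp (2 * 45000) * (1 / \<epsilon>\<^sup>2) powr (45000 / \<epsilon>) * real (n + m + 1) ^ 6 \<and>
         output_policy s \<in> policies {..<n} {..<m} l \<and>
         policy_val r q (output_policy s) \<ge> (1 - 7 * \<epsilon>) * OPT {..<n} {..<m} l r q"
        using t(2) c_main_correct by (intro exI[of _ t] exI[of _ ?s']) linarith
    qed
  qed
qed

end
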